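(* Let $(\mathbf u,\mathbf W)\in\mathcal F(\Omega)$ be a minimizer for the functional $J$ in $\mathcal F(\Omega)$, and let $\{r_k\}$ be a sequence of positive numbers with $\lim_{k\to\infty}r_k=0$. Set $\mathbf u_k(x)=r_k^{-1}\mathbf u(r_kx)$ and $\Omega_k=r_k^{-1}\Omega$. Assume: (1) $\mathbf u(0)=0$, and there is $\rho_0>0$ such that for $1\le i\le N$, $f_i\ge0$ on $B(0,\rho_0)$ and $\|f_i\|_{L^\infty(B(0,\rho_0))}+\|g_i\|_{L^\infty(B(0,\rho_0))}<+\infty$, and $\mathbf u$ is Lipschitz in $B(0,\rho_0)$; (2) for some $R>0$ there is a Lipschitz function $\mathbf u_\infty$ on $B(0,R)$ such that $\mathbf u_\infty(x)=\lim_{k\to\infty}\mathbf u_k(x)$ for $x\in B(0,R)$; (3) there is a measurable set $\Omega_\infty\subset B(0,R)$ such that $\mathbf 1_{\Omega_\infty}=\lim_{k\to\infty}\mathbf 1_{B(0,R)\cap\Omega_k}$ in $L^1(B(0,R))$; for $0<T<R$ there are $r_T>0$ and $c_T>0$ such that $|B(x,r)\setminus\Omega_\infty|\ge c_Tr^n$ for $x\in B(0,T)\cap\partial\Omega_\infty$ and $0<r\le r_T$; and for $0<T<R$, $\lim_{k\to\infty}\delta(k,T)=0$, where $\delta(k,T)=\sup\{\operatorname{dist}(x,B(0,R)\setminus\Omega_\infty): x\in B(0,T)\setminus\Omega_k\}$ (and $\delta(k,T)=0$ when $B(0,T)\setminus\Omega_k=\emptyset$); (4) there are real constants $\lambda_i$,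 $1\le i\le N$, and a function $\varepsilon(r)$, defined for $r>0$ small, with $\lim_{r\to0}\varepsilon(r)=0$, such that $$\Big|F(\mathbf W)-F(\mathbf W')-\sum_{i=1}^N\lambda_i\big[|W_i\cap B(0,r)|-|W_i'\cap B(0,r)|\big]\Big|\le r^n\varepsilon(r)$$ for every $\mathbf W'\in\mathcal W(\Omega)$ such that $W_i\setminus B(0,r)=W_i'\setminus B(0,r)$ for $1\le i\le N$. Then we can find $\mathbf W_\infty$ such that $(\mathbf u_\infty,\mathbf W_\infty)\in\mathcal F(B(0,R),\Omega_\infty)$ and $(\mathbf u_\infty,\mathbf W_\infty)$ is a local minimizer in $B(0,R)$ for the functional $$J_\infty(\mathbf v,\mathbf Z)=\sum_{i=1}^N\int_{B(0,R)}|\nabla v_i|^2+\sum_{i=1}^N\lambda_i|Z_i|.$$ We also have that $\lim_{k\to+\infty}\mathbf u_k=\mathbf u_\infty$ in $W^{1,2}(B(0,R))$.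
   Context: $n\ge2$ and $N\ge1$ are integers; $|A|$ is the Lebesgue measure of $A$; $B(x,r)$ is the open ball; $\Omega\subset\mathbb R^n$ is a Borel set with $|\Omega|<+\infty$. $W^{1,2}(\mathbb R^n)$ denotes the set of functions in $L^2_{loc}(\mathbb R^n)$ whose distributional gradient lies in $L^2(\mathbb R^n)$. $\mathcal W(\Omega)$ is the set of $N$-tuples $\mathbf W=(W_1,\dots,W_N)$ of pairwise disjoint Borel (measurable) subsets of $\Omega$. $\mathcal F(\Omega)$ is the set of pairs $(\mathbf u,\mathbf W)$ with $\mathbf W\in\mathcal W(\Omega)$ and $\mathbf u=(u_1,\dots,u_N)$ an $N$-tuple of real-valued functions $u_i\in W^{1,2}(\mathbb R^n)$ such that $u_i=0$ almost everywhere on $\mathbb R^n\setminus W_i$. Given measurable $f_i,g_i$ on $\Omega$ (such that the integrals below converge) and $F:\mathcal W(\Omega)\to\mathbb R$, $$J(\mathbf u,\mathbf W)=\sum_{i=1}^N\int|\nabla u_i|^2\,dx+\sum_{i=1}^N\int[u_i^2f_i-u_ig_i]\,dx+F(\mathbf W),$$ and a minimizer for $J$ in $\mathcal F(\Omega)$ is a pair in $\mathcal F(\Omega)$ at which $J$ attains its minimum over $\mathcal F(\Omega)$. $\mathcal F(B(0,R),\Omega_\infty)$ is the set of pairs $(\mathbf v,\mathbf Z)$ where $\mathbf Z=(Z_1,\dots,Z_N)$ is an $N$-tuple of disjoint measurable subsets of $\Omega_\infty$ and $\mathbf v=(v_1,\dots,v_N)$ with $v_i\in W^{1,2}_{loc}(B(0,R))$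 and $v_i=0$ almost everywhere on $B(0,R)\setminus Z_i$. That $(\mathbf u_\infty,\mathbf W_\infty)$ is a local minimizer for $J_\infty$ in $B(0,R)$ means that $J_\infty(\mathbf u_\infty,\mathbf W_\infty)\le J_\infty(\mathbf v,\mathbf Z)$ for every $(\mathbf v,\mathbf Z)\in\mathcal F(B(0,R),\Omega_\infty)$ that coincides with $(\mathbf u_\infty,\mathbf W_\infty)$ on $B(0,R)\setminus B(0,r)$ for some $r<R$. *)

theory Defs
  imports "HOL-Analysis.Analysis" "HOL-Probability.Essential_Supremum"
begin

section \<open>Sobolev spaces\<close>

primrec C_k :: "nat \<Rightarrow> ('a::euclidean_space \<Rightarrow> real) \<Rightarrow> bool" where
  "C_k 0 f \<longleftrightarrow> continuous_on UNIV f"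
| "C_k (Suc k) f \<longleftrightarrow> (\<forall>x. f differentiable at x) \<and>
     (\<forall>b\<in>Basis. C_k k (\<lambda>x. frechet_derivative f (at x) b))"

text \<open>\<open>C_c_inf U\<close> is the space of smooth functions with compact support in the open set \<open>U\<close>,
  extended by zero to the whole space.\<close>

definition C_c_inf :: "'a::euclidean_space set \<Rightarrow> ('a \<Rightarrow> real) set" where
  "C_c_inf U = {\<phi>. (\<forall>k. C_k k \<phi>) \<and> compact (closure {x. \<phi> x \<noteq> 0}) \<and> closure {x. \<phi> x \<noteq> 0} \<subseteq> U}"

definition L2 :: "'a::euclidean_space set \<Rightarrow> ('a \<Rightarrow> 'b::euclidean_space) set" where
  "L2 U = {h. h \<in> borel_measurable (lebesgue_on U) \<and> integrable (lebesgue_on U) (\<lambda>x. (norm (h x))\<^sup>2)}"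

definition L2_loc :: "'a::euclidean_space set \<Rightarrow> ('a \<Rightarrow> 'b::euclidean_space) set" where
  "L2_loc U = {h. \<forall>K. compact K \<and> K \<subseteq> U \<longrightarrow> h \<in> L2 K}"

definition L1_loc :: "'a::euclidean_space set \<Rightarrow> ('a \<Rightarrow> 'b::euclidean_space) set" where
  "L1_loc U = {h. \<forall>K. compact K \<and> K \<subseteq> U \<longrightarrow> h absolutely_integrable_on K}"

definition has_weak_gradient ::
    "'a::euclidean_space set \<Rightarrow> ('a \<Rightarrow> real) \<Rightarrow> ('a \<Rightarrow> 'a) \<Rightarrow> bool" where
  "has_weak_gradient U u G \<longleftrightarrow> u \<in> L1_loc U \<and> G \<in> L1_loc U \<and>
     (\<forall>\<phi>\<in>C_c_inf U. \<forall>b\<in>Basis.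
        (LINT x:U|lebesgue. u x * frechet_derivative \<phi> (at x) b) =
        - (LINT x:U|lebesgue. (G x \<bullet> b) * \<phi> x))"

text \<open>The weak gradient is unique up to null sets, so that integrals of it
  do not depend on the choice made here.\<close>

definition weak_gradient :: "'a::euclidean_space set \<Rightarrow> ('a \<Rightarrow> real) \<Rightarrow> 'a \<Rightarrow> 'a" where
  "weak_gradient U u = (SOME G. has_weak_gradient U u G)"

text \<open>Only the gradient is required to be globally square integrable.\<close>

definition W12 :: "'a::euclidean_space set \<Rightarrow> ('a \<Rightarrow> real) set" where
  "W12 U = {u. u \<in> L2_loc U \<and> (\<exists>G. has_weak_gradient U u G \<and> G \<in> L2 U)}"

definition W12_loc :: "'a::euclidean_space set \<Rightarrow> ('a \<Rightarrow> real) set" where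
  "W12_loc U = {u. u \<in> L2_loc U \<and> (\<exists>G. has_weak_gradient U u G \<and> G \<in> L2_loc U)}"

definition W12_norm_sq :: "'a::euclidean_space set \<Rightarrow> ('a \<Rightarrow> real) \<Rightarrow> ennreal" where
  "W12_norm_sq U u = (\<integral>\<^sup>+x\<in>U. ennreal ((u x)\<^sup>2) \<partial>lebesgue)
     + (\<integral>\<^sup>+x\<in>U. ennreal ((norm (weak_gradient U u x))\<^sup>2) \<partial>lebesgue)"

definition tendsto_W12 ::
    "'a::euclidean_space set \<Rightarrow> (nat \<Rightarrow> 'a \<Rightarrow> real) \<Rightarrow> ('a \<Rightarrow> real) \<Rightarrow> bool" where
  "tendsto_W12 U v w \<longleftrightarrow> (\<forall>k. v k \<in> W12 U) \<and> w \<in> W12 U \<and>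
     (\<lambda>k. W12_norm_sq U (\<lambda>x. v k x - w x)) \<longlonglongrightarrow> 0"

section \<open>The functional and its minimizers\<close>

text \<open>The components of an \<open>N\<close>-tuple are indexed by a finite type \<open>'i\<close>, with \<open>N = CARD('i)\<close>.\<close>

definition W_class :: "'a::euclidean_space set \<Rightarrow> ('i::finite \<Rightarrow> 'a set) set" where
  "W_class \<Omega> = {W. (\<forall>i. W i \<in> sets borel \<and> W i \<subseteq> \<Omega>) \<and> disjoint_family W}"

definition F_class ::
    "'a::euclidean_space set \<Rightarrow> (('a \<Rightarrow> real^'i::finite) \<times> ('i \<Rightarrow> 'a set)) set" where
  "F_class \<Omega> = {(u, W). W \<in> W_class \<Omega> \<and>
     (\<forall>i. (\<lambda>x. u x $ i) \<in> W12 UNIV \<and> (AE x in lebesgue. x \<notin> W i \<longrightarrow> u x $ i = 0))}"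

text \<open>The functions \<open>f i\<close> and \<open>g i\<close> are only meaningful on \<open>\<Omega>\<close>, outside of which \<open>u\<close> vanishes
  almost everywhere; hence the second integral is taken over \<open>\<Omega>\<close>.\<close>

definition J :: "('i::finite \<Rightarrow> 'a::euclidean_space \<Rightarrow> real) \<Rightarrow> ('i \<Rightarrow> 'a \<Rightarrow> real) \<Rightarrow>
    (('i \<Rightarrow> 'a set) \<Rightarrow> real) \<Rightarrow> 'a set \<Rightarrow> ('a \<Rightarrow> real^'i) \<Rightarrow> ('i \<Rightarrow> 'a set) \<Rightarrow> real" where
  "J f g F \<Omega> u W =
     (\<Sum>i\<in>UNIV. LINT x|lebesgue. (norm (weak_gradient UNIV (\<lambda>y. u y $ i) x))\<^sup>2)
     + (\<Sum>i\<in>UNIV. LINT x:\<Omega>|lebesgue. ((u x $ i)\<^sup>2 * f i x - u x $ i * g i x))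
     + F W"

definition J_integrals_converge :: "('i::finite \<Rightarrow> 'a::euclidean_space \<Rightarrow> real) \<Rightarrow>
    ('i \<Rightarrow> 'a \<Rightarrow> real) \<Rightarrow> 'a set \<Rightarrow> bool" where
  "J_integrals_converge f g \<Omega> \<longleftrightarrow>
     (\<forall>(u, W) \<in> F_class \<Omega>. \<forall>i.
        set_integrable lebesgue \<Omega> (\<lambda>x. (u x $ i)\<^sup>2 * f i x - u x $ i * g i x))"

definition J_minimizer :: "('i::finite \<Rightarrow> 'a::euclidean_space \<Rightarrow> real) \<Rightarrow> ('i \<Rightarrow> 'a \<Rightarrow> real) \<Rightarrow>
    (('i \<Rightarrow> 'a set) \<Rightarrow> real) \<Rightarrow> 'a set \<Rightarrow> ('a \<Rightarrow> real^'i) \<Rightarrow> ('i \<Rightarrow> 'a set) \<Rightarrow> bool" where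
  "J_minimizer f g F \<Omega> u W \<longleftrightarrow> (u, W) \<in> F_class \<Omega> \<and>
     (\<forall>(v, Z) \<in> F_class \<Omega>. J f g F \<Omega> u W \<le> J f g F \<Omega> v Z)"

definition F_class_ball :: "real \<Rightarrow> 'a::euclidean_space set \<Rightarrow>
    (('a \<Rightarrow> real^'i::finite) \<times> ('i \<Rightarrow> 'a set)) set" where
  "F_class_ball R \<Omega> = {(v, Z). (\<forall>i. Z i \<in> sets lebesgue \<and> Z i \<subseteq> \<Omega>) \<and> disjoint_family Z \<and>
     (\<forall>i. (\<lambda>x. v x $ i) \<in> W12_loc (ball 0 R) \<and>
          (AE x in lebesgue. x \<in> ball 0 R - Z i \<longrightarrow> v x $ i = 0))}"

text \<open>Functions in \<open>W12_loc (ball 0 R)\<close> may have infinite energy on \<open>ball 0 R\<close>, so the limit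
  functional takes values in \<open>(-\<infinity>, \<infinity>]\<close>. The measures are finite since \<open>Z i \<subseteq> ball 0 R\<close>.\<close>

definition J_inf :: "real \<Rightarrow> ('i::finite \<Rightarrow> real) \<Rightarrow>
    ('a::euclidean_space \<Rightarrow> real^'i) \<Rightarrow> ('i \<Rightarrow> 'a set) \<Rightarrow> ereal" where
  "J_inf R lam v Z =
     enn2ereal (\<Sum>i\<in>UNIV. \<integral>\<^sup>+x\<in>ball 0 R.
        ennreal ((norm (weak_gradient (ball 0 R) (\<lambda>y. v y $ i) x))\<^sup>2) \<partial>lebesgue)
     + ereal (\<Sum>i\<in>UNIV. lam i * measure lebesgue (Z i))"

text \<open>Sobolev functions coincide when they agree almost everywhere.\<close>

definition local_minimizer :: "real \<Rightarrow> 'a::euclidean_space set \<Rightarrow> ('i::finite \<Rightarrow> real) \<Rightarrow>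
    ('a \<Rightarrow> real^'i) \<Rightarrow> ('i \<Rightarrow> 'a set) \<Rightarrow> bool" where
  "local_minimizer R \<Omega> lam u W \<longleftrightarrow>
     (\<forall>(v, Z) \<in> F_class_ball R \<Omega>.
        (\<exists>r<R. (AE x in lebesgue. x \<in> ball 0 R - ball 0 r \<longrightarrow> v x = u x) \<and>
               (\<forall>i. Z i - ball 0 r = W i - ball 0 r))
        \<longrightarrow> J_inf R lam u W \<le> J_inf R lam v Z)"

section \<open>Blow-up\<close>

definition blowup_fun :: "real \<Rightarrow> ('a::real_vector \<Rightarrow> 'b::real_vector) \<Rightarrow> 'a \<Rightarrow> 'b" where
  "blowup_fun r u x = inverse r *\<^sub>R u (r *\<^sub>R x)"

definition blowup_set :: "real \<Rightarrow> 'a::real_vector set \<Rightarrow> 'a set" where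
  "blowup_set r A = (\<lambda>x. inverse r *\<^sub>R x) ` A"

definition Linf_norm :: "'a::euclidean_space set \<Rightarrow> ('a \<Rightarrow> real) \<Rightarrow> ereal" where
  "Linf_norm A h = esssup (lebesgue_on A) (\<lambda>x. ereal \<bar>h x\<bar>)"

text \<open>The value in \<open>ennreal\<close> provides the conventions for empty sets:
  the supremum over \<open>{}\<close> is \<open>0\<close>, and the distance to \<open>{}\<close> is \<open>\<infinity>\<close>
  (whereas \<open>infdist x {} = 0\<close>).\<close>

definition excess_dist :: "real \<Rightarrow> 'a::euclidean_space set \<Rightarrow> 'a set \<Rightarrow> real \<Rightarrow> ennreal" where
  "excess_dist R \<Omega>_inf A T = (SUP x\<in>ball 0 T - A. INF y\<in>ball 0 R - \<Omega>_inf. ennreal (dist x y))"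

end

theory Submission
  imports Defs
begin

text \<open>
  On a ball of radius \<open>r\<^sub>k\<close> the functional \<open>J\<close> is, after rescaling, \<open>J_inf\<close> up to an error that tends to \<open>0\<close>: the energy and
  the volume terms both scale like \<open>r\<^sub>k\<^sup>n\<close>, and the terms with \<open>f\<close> and \<open>g\<close> are smaller by a factor \<open>r\<^sub>k\<close> because \<open>u\<close> is
  Lipschitz and vanishes at the origin. So the blow-ups \<open>u\<^sub>k\<close> almost minimize \<open>J_inf\<close>, which is made precise by
  \<open>scaled_minimality\<close>. Two questions remain: why gradients converge strongly, and how a competitor for the limit problem is
  turned into a competitor for \<open>u\<^sub>k\<close>, although \<open>\<Omega>\<^sub>k\<close> is close to \<open>\<Omega>_inf\<close> only in measure and from one side, and the sets
  \<open>W\<^sub>k\<^sub>,\<^sub>i\<close> need not converge.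

  For strong convergence, variations that keep the sets \<open>W\<^sub>k\<^sub>,\<^sub>i\<close> give the first-order condition
  \<open>\<integral> \<nabla>u\<^sub>k \<bullet> \<nabla>h \<ge> - o(1)\<close> for all \<open>h\<close> that vanish where \<open>u\<^sub>k\<close> vanishes (\<open>euler_lagrange_inequality\<close>). The natural
  variation \<open>\<phi> (u\<^sub>l - u\<^sub>k)\<close> is not of this kind. But \<open>u\<^sub>k\<close> and \<open>u\<^sub>l\<close> are uniformly close (\<open>uk_uniform_limit\<close>),
  hence a soft threshold \<open>S\<close> at a small height makes \<open>\<phi> (S (u\<^sub>l) - S (u\<^sub>k))\<close> vanish at the zeros of both
  functions. The conditions for \<open>k\<close> and \<open>l\<close> together show that the gradients form a Cauchy sequence in \<open>L\<^sup>2\<close>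
  on smaller balls (\<open>gradients_cauchy_inside\<close>), and the uniform bound on the gradients extends this to the ball of
  radius \<open>R\<close> (\<open>gk_cauchy\<close>). The limit is the gradient of \<open>u_inf\<close>.

  For minimality, let \<open>(v, Z)\<close> agree with \<open>(u_inf, W_inf)\<close> outside a smaller ball. To become admissible for \<open>\<Omega>\<^sub>k\<close>,
  the function \<open>v\<close> has to vanish outside \<open>\<Omega>\<^sub>k\<close>. Points outside \<open>\<Omega>\<^sub>k\<close> are close to the complement of \<open>\<Omega>_inf\<close>, and
  since this complement has positive density near its boundary, \<open>v\<close> is so small nearby that it can be cut off there at an
  arbitrarily small cost (\<open>cutoff_near_thick_complement\<close>); this is a Hardy-type estimate obtained from increments of Sobolev
  functions. A soft threshold takes care of the transition to \<open>u\<^sub>k\<close>: where \<open>v\<close> agrees with \<open>u_inf\<close>, the thresholded function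
  vanishes at the zeros of \<open>u\<^sub>k\<close>, so that the sets \<open>W\<^sub>k\<^sub>,\<^sub>i\<close> are kept in the transition layer. Passing to the limit
  \<open>k \<rightarrow> \<infinity>\<close> first (\<open>comparison_limit\<close>) and then removing cut-off and threshold (\<open>energy_comparison\<close>) gives the minimality of
  \<open>u_inf\<close> with the volume term \<open>liminf \<Sum>\<^sub>i \<lambda>\<^sub>i |W\<^sub>k\<^sub>,\<^sub>i|\<close>. The sets \<open>W_inf\<close> are chosen such that their volume
  term is at most this limit (\<open>volume_term_lower_semicontinuous\<close>).

  Sobolev functions are represented by pairs of a function and its weak gradient, both square integrable on the
  whole space (\<open>H1\<close>). The chain rule for them is obtained from difference quotients.
\<close>

section \<open>Smooth functions\<close>

definition smooth :: "('a::euclidean_space \<Rightarrow> real) \<Rightarrow> bool" where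
  "smooth f \<longleftrightarrow> (\<forall>k. C_k k f)"

abbreviation pderivative :: "'a::euclidean_space \<Rightarrow> ('a \<Rightarrow> real) \<Rightarrow> 'a \<Rightarrow> real" where
  "pderivative b f x \<equiv> frechet_derivative f (at x) b"

lemma frechet_derivative_eqI:
  "(f has_derivative f') (at x) \<Longrightarrow> frechet_derivative f (at x) = f'"
  using frechet_derivative_at by metis

lemma C_k_SucD: "C_k (Suc k) f \<Longrightarrow> C_k k f"
proof (induction k arbitrary: f)
  case 0
  then show ?case
    by (auto intro!: differentiable_imp_continuous_on simp: differentiable_on_def
        intro: differentiable_at_withinI)
next
  case (Suc k)
  then show ?case by (metis C_k.simps(2))
qed

lemma C_k_SucI:
  assumes "\<And>x. (f has_derivative f' x) (at x)" "\<And>b. b \<in> Basis \<Longrightarrow> C_k k (\<lambda>x. f' x b)"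
  shows "C_k (Suc k) f"
proof -
  have "frechet_derivative f (at x) = f' x" for x by (rule frechet_derivative_eqI[OF assms(1)])
  then show ?thesis using assms by (auto simp: differentiable_def)
qed

lemma C_k_SucE:
  assumes "C_k (Suc k) f"
  shows "(f has_derivative frechet_derivative f (at x)) (at x)"
    and "\<And>b. b \<in> Basis \<Longrightarrow> C_k k (pderivative b f)"
  using assms frechet_derivative_works by auto

lemma C_k_const: "C_k k (\<lambda>x. c)"
proof (induction k arbitrary: c)
  case (Suc k)
  show ?case by (rule C_k_SucI[where f' = "\<lambda>x h. 0"]) (auto intro: Suc)
qed auto

lemma C_k_add: "C_k k f \<Longrightarrow> C_k k g \<Longrightarrow> C_k k (\<lambda>x. f x + g x)"
proof (induction k arbitrary: f g)
  case (Suc k)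
  show ?case
    by (rule C_k_SucI[where f' = "\<lambda>x h. frechet_derivative f (at x) h + frechet_derivative g (at x) h"])
      (auto intro!: has_derivative_add C_k_SucE[OF Suc.prems(1)] C_k_SucE[OF Suc.prems(2)] Suc.IH)
qed (auto intro: continuous_intros)

lemma C_k_mult: "C_k k f \<Longrightarrow> C_k k g \<Longrightarrow> C_k k (\<lambda>x. f x * g x)"
proof (induction k arbitrary: f g)
  case (Suc k)
  show ?case
    by (rule C_k_SucI[where f' = "\<lambda>x h. f x * frechet_derivative g (at x) h + frechet_derivative f (at x) h * g x"])
      (auto intro!: has_derivative_mult C_k_SucE[OF Suc.prems(1)] C_k_SucE[OF Suc.prems(2)]
        C_k_add Suc.IH C_k_SucD[OF Suc.prems(1)] C_k_SucD[OF Suc.prems(2)])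
qed (auto intro: continuous_intros)

lemma C_k_linear: "bounded_linear f \<Longrightarrow> C_k k f"
proof (cases k)
  case (Suc k')
  assume "bounded_linear f"
  then show ?thesis unfolding Suc
    by (intro C_k_SucI[where f' = "\<lambda>x. f"]) (auto intro: bounded_linear_imp_has_derivative C_k_const)
qed (auto intro: linear_continuous_on)

lemma C_k_affine: "C_k k f \<Longrightarrow> C_k k (\<lambda>x. f (c *\<^sub>R x + a))"
proof (induction k arbitrary: f)
  case 0
  then show ?case by (auto intro!: continuous_on_compose2[of UNIV f] continuous_intros)
next
  case (Suc k)
  have D: "((\<lambda>x. f (c *\<^sub>R x + a)) has_derivative
      (\<lambda>h. frechet_derivative f (at (c *\<^sub>R x + a)) (c *\<^sub>R h))) (at x)" for x
    by (rule has_derivative_compose[of "\<lambda>x. c *\<^sub>R x + a" "\<lambda>h. c *\<^sub>R h" x UNIV f, simplified])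
      (auto intro!: derivative_eq_intros C_k_SucE(1)[OF Suc.prems])
  have lin: "frechet_derivative f (at y) (c *\<^sub>R h) = c * frechet_derivative f (at y) h" for y h
    using has_derivative_linear[OF C_k_SucE(1)[OF Suc.prems, of y]] by (simp add: linear_cmul)
  show ?case
    by (rule C_k_SucI[OF D]) (auto simp: lin intro!: C_k_mult C_k_const Suc.IH C_k_SucE[OF Suc.prems])
qed

lemma smooth_const [intro]: "smooth (\<lambda>x. c)"
  and smooth_add [intro]: "smooth f \<Longrightarrow> smooth g \<Longrightarrow> smooth (\<lambda>x. f x + g x)"
  and smooth_mult [intro]: "smooth f \<Longrightarrow> smooth g \<Longrightarrow> smooth (\<lambda>x. f x * g x)"
  and smooth_linear: "bounded_linear f \<Longrightarrow> smooth f"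
  and smooth_affine: "smooth f \<Longrightarrow> smooth (\<lambda>x. f (c *\<^sub>R x + a))"
  by (auto simp: smooth_def C_k_const C_k_add C_k_mult C_k_linear C_k_affine)

lemma smooth_diff [intro]: "smooth f \<Longrightarrow> smooth g \<Longrightarrow> smooth (\<lambda>x. f x - g x)"
  using smooth_add[of f "\<lambda>x. -1 * g x"] smooth_mult[OF smooth_const, of g "-1"] by simp

lemma smooth_sum: "finite I \<Longrightarrow> (\<And>i. i \<in> I \<Longrightarrow> smooth (f i)) \<Longrightarrow> smooth (\<lambda>x. \<Sum>i\<in>I. f i x)"
  by (induction rule: finite_induct) auto

lemma smooth_prod: "finite I \<Longrightarrow> (\<And>i. i \<in> I \<Longrightarrow> smooth (f i)) \<Longrightarrow> smooth (\<lambda>x. \<Prod>i\<in>I. f i x)"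
  by (induction rule: finite_induct) auto

lemma smooth_polynomial: "real_polynomial_function f \<Longrightarrow> smooth f"
  by (induction rule: real_polynomial_function.induct) (auto intro: smooth_linear)

lemma smooth_has_derivative: "smooth f \<Longrightarrow> (f has_derivative frechet_derivative f (at x)) (at x)"
  unfolding smooth_def by (metis C_k_SucE(1))

lemma smooth_pderivative: "smooth f \<Longrightarrow> b \<in> Basis \<Longrightarrow> smooth (pderivative b f)"
  unfolding smooth_def by (metis C_k_SucE(2))

lemma smooth_continuous_on: "smooth f \<Longrightarrow> continuous_on S f"
  unfolding smooth_def by (metis C_k.simps(1) continuous_on_subset subset_UNIV)

lemma pderivative_mult:
  assumes "smooth f" "smooth g"
  shows "frechet_derivative (\<lambda>x. f x * g x) (at x) h
       = f x * frechet_derivative g (at x) h + frechet_derivative f (at x) h * g x"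
  by (subst frechet_derivative_eqI[OF has_derivative_mult[OF smooth_has_derivative[OF assms(1)]
        smooth_has_derivative[OF assms(2)]]]) simp

lemma pderivative_affine:
  assumes "smooth f"
  shows "frechet_derivative (\<lambda>x. f (c *\<^sub>R x + a)) (at x) h
       = c * frechet_derivative f (at (c *\<^sub>R x + a)) h"
proof -
  have D: "((\<lambda>x. f (c *\<^sub>R x + a)) has_derivative
      (\<lambda>h. frechet_derivative f (at (c *\<^sub>R x + a)) (c *\<^sub>R h))) (at x)"
    by (rule has_derivative_compose[of "\<lambda>x. c *\<^sub>R x + a" "\<lambda>h. c *\<^sub>R h" x UNIV f, simplified])
      (auto intro!: derivative_eq_intros smooth_has_derivative[OF assms])
  have "frechet_derivative f (at y) (c *\<^sub>R h) = c * frechet_derivative f (at y) h" for y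
    using has_derivative_linear[OF smooth_has_derivative[OF assms, of y]] by (simp add: linear_cmul)
  then show ?thesis by (simp add: frechet_derivative_eqI[OF D])
qed

lemma pderivative_Basis_sum:
  assumes "smooth f"
  shows "frechet_derivative f (at x) h = (\<Sum>b\<in>Basis. (h \<bullet> b) * pderivative b f x)"
proof -
  have lin: "linear (frechet_derivative f (at x))"
    by (rule has_derivative_linear[OF smooth_has_derivative[OF assms]])
  have "frechet_derivative f (at x) h = frechet_derivative f (at x) (\<Sum>b\<in>Basis. (h \<bullet> b) *\<^sub>R b)"
    by (simp add: euclidean_representation)
  also have "\<dots> = (\<Sum>b\<in>Basis. (h \<bullet> b) * pderivative b f x)"
    by (simp add: linear_sum[OF lin] linear_cmul[OF lin])
  finally show ?thesis .
qed

section \<open>Cut-off functions\<close>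

text \<open>The functions \<open>p (1/y) exp (-1/y)\<close>, extended by \<open>0\<close> to \<open>y \<le> 0\<close>, form a family that is closed
  under differentiation. Proving smoothness for the whole family makes the induction go through.\<close>

definition flat_exp :: "real poly \<Rightarrow> real \<Rightarrow> real" where
  "flat_exp p y = (if y > 0 then poly p (1/y) * exp (-(1/y)) else 0)"

lemma poly_times_exp_tendsto_0: "((\<lambda>t. poly p t * exp (-t)) \<longlongrightarrow> (0::real)) at_top"
proof -
  have "((\<lambda>t. \<Sum>i\<le>degree p. coeff p i * (t ^ i / exp t)) \<longlongrightarrow> (\<Sum>i\<le>degree p. coeff p i * 0)) at_top"
    by (intro tendsto_intros tendsto_power_div_exp_0)
  moreover have "(\<Sum>i\<le>degree p. coeff p i * (t ^ i / exp t)) = poly p t * exp (-t)" for t :: real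
    by (simp add: poly_altdef sum_distrib_right exp_minus divide_inverse mult.assoc)
  ultimately show ?thesis by simp
qed

lemma flat_exp_has_derivative:
  "(flat_exp p has_real_derivative flat_exp (monom 1 2 * (p - pderiv p)) y) (at y)"
proof -
  consider "y > 0" | "y < 0" | "y = 0" by linarith
  then show ?thesis
  proof cases
    case 1
    have "((\<lambda>y. poly p (1/y) * exp (-(1/y))) has_real_derivative
        flat_exp (monom 1 2 * (p - pderiv p)) y) (at y)"
      using 1 unfolding flat_exp_def
      by (auto intro!: derivative_eq_intros DERIV_chain2[of "poly p"] poly_DERIV
          simp: poly_monom field_simps power2_eq_square)
    then show ?thesis
    proof (rule has_field_derivative_transform_within_open[of _ _ _ "{0<..}"])
    qed (use 1 in \<open>auto simp: flat_exp_def\<close>)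
  next
    case 2
    have "((\<lambda>y. 0) has_real_derivative flat_exp (monom 1 2 * (p - pderiv p)) y) (at y)"
      using 2 by (auto simp: flat_exp_def)
    then show ?thesis
      by (rule has_field_derivative_transform_within_open[of _ _ _ "{..<0}"])
        (use 2 in \<open>auto simp: flat_exp_def\<close>)
  next
    case 3
    have lim: "((\<lambda>y. flat_exp p y / y) \<longlongrightarrow> 0) (at 0)"
    proof (rule filterlim_split_at)
      show "((\<lambda>y. flat_exp p y / y) \<longlongrightarrow> 0) (at_left 0)"
        by (rule tendsto_eventually)
          (auto simp: flat_exp_def eventually_at intro!: exI[of _ 1])
      have "((\<lambda>y. poly (pCons 0 p) (inverse y) * exp (- inverse y)) \<longlongrightarrow> (0::real)) (at_right 0)"
        by (rule filterlim_compose[OF poly_times_exp_tendsto_0 filterlim_inverse_at_top_right])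
      then show "((\<lambda>y. flat_exp p y / y) \<longlongrightarrow> 0) (at_right 0)"
        by (rule Lim_transform_eventually)
          (auto simp: flat_exp_def eventually_at field_simps intro!: exI[of _ 1])
    qed
    then show ?thesis unfolding 3 has_field_derivative_iff by (simp add: flat_exp_def)
  qed
qed

lemma smooth_flat_exp:
  assumes "smooth g"
  shows "smooth (\<lambda>x. flat_exp p (g x))"
proof -
  have "C_k k (\<lambda>x. flat_exp p (g x))" for k
  proof (induction k arbitrary: p)
    case 0
    have "continuous_on UNIV (flat_exp p)"
      by (meson DERIV_continuous continuous_at_imp_continuous_on flat_exp_has_derivative)
    then show ?case
      by (auto intro: continuous_on_compose2 smooth_continuous_on[OF assms])
  next
    case (Suc k)
    show ?case
    proof (rule C_k_SucI)
      fix x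
      show "((\<lambda>x. flat_exp p (g x)) has_derivative
          (\<lambda>h. frechet_derivative g (at x) h * flat_exp (monom 1 2 * (p - pderiv p)) (g x))) (at x)"
        by (rule DERIV_compose_FDERIV[OF flat_exp_has_derivative smooth_has_derivative[OF assms]])
    next
      fix b :: 'a assume "b \<in> Basis"
      then show "C_k k (\<lambda>x. pderivative b g x * flat_exp (monom 1 2 * (p - pderiv p)) (g x))"
        using smooth_pderivative[OF assms] by (auto intro!: C_k_mult Suc.IH simp: smooth_def)
    qed
  qed
  then show ?thesis by (simp add: smooth_def)
qed

text \<open>Nesting \<open>e y = exp (-1/y)\<close> in \<open>e (1 - e t / e 1) / e 1\<close> gives a smooth step that equals \<open>1\<close>
  exactly for \<open>t \<le> 0\<close> and \<open>0\<close> exactly for \<open>t \<ge> 1\<close>, without dividing by a function.\<close>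

lemma smooth_cutoff_ball:
  fixes a :: "'a::euclidean_space"
  assumes "0 \<le> r" "r < s"
  obtains \<beta> where "smooth \<beta>" "\<And>x. 0 \<le> \<beta> x \<and> \<beta> x \<le> 1" "\<And>x. x \<in> cball a r \<Longrightarrow> \<beta> x = 1"
    "\<And>x. x \<notin> ball a s \<Longrightarrow> \<beta> x = 0"
proof -
  let ?e = "flat_exp 1" and ?e1 = "flat_exp 1 1"
  define g where "g = (\<lambda>x. (1 / (s\<^sup>2 - r\<^sup>2)) * ((\<Sum>b\<in>Basis. ((x - a) \<bullet> b) * ((x - a) \<bullet> b)) - r\<^sup>2))"
  define \<beta> where "\<beta> = (\<lambda>x. (1 / ?e1) * ?e (1 - (1 / ?e1) * ?e (g x)))"
  have e1: "?e1 > 0" by (simp add: flat_exp_def)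
  have mono: "?e y \<le> ?e1" if "y \<le> 1" for y
    using that by (auto simp: flat_exp_def)
  have nonneg: "?e y \<ge> 0" for y by (auto simp: flat_exp_def)
  have rs: "s\<^sup>2 - r\<^sup>2 > 0" using assms by (simp add: power_strict_mono)
  have g: "g x = ((dist a x)\<^sup>2 - r\<^sup>2) / (s\<^sup>2 - r\<^sup>2)" for x
    by (simp add: g_def dist_norm norm_minus_commute flip: euclidean_inner power2_norm_eq_inner)
  have sm: "smooth (\<lambda>x. (x - a) \<bullet> b)" for b
  proof -
    have "smooth (\<lambda>x. x \<bullet> b - a \<bullet> b)"
      by (intro smooth_diff smooth_linear smooth_const bounded_linear_inner_left)
    then show ?thesis by (simp add: inner_diff_left)
  qed
  have "smooth g" unfolding g_def by (intro smooth_mult smooth_diff smooth_const smooth_sum sm) auto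
  then have "smooth \<beta>" unfolding \<beta>_def by (intro smooth_mult smooth_diff smooth_const smooth_flat_exp)
  moreover have "0 \<le> \<beta> x \<and> \<beta> x \<le> 1" for x
    using nonneg[of "1 - (1 / ?e1) * ?e (g x)"] mono[of "1 - (1 / ?e1) * ?e (g x)"] nonneg[of "g x"] e1
    by (auto simp: \<beta>_def divide_simps)
  moreover have "\<beta> x = 1" if "x \<in> cball a r" for x
  proof -
    have "(dist a x)\<^sup>2 \<le> r\<^sup>2" using that assms by (simp add: power_mono)
    then have "g x \<le> 0" using rs by (simp add: g divide_le_0_iff)
    then have "?e (g x) = 0" by (simp add: flat_exp_def)
    then show ?thesis using e1 by (simp add: \<beta>_def)
  qed
  moreover have "\<beta> x = 0" if "x \<notin> ball a s" for x
  proof -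
    have "s\<^sup>2 \<le> (dist a x)\<^sup>2" using that assms by (simp add: power_mono)
    then have "g x \<ge> 1" using rs by (simp add: g)
    then have "?e (g x) \<ge> ?e1" by (auto simp: flat_exp_def)
    then have "1 - (1 / ?e1) * ?e (g x) \<le> 0" using e1 by (simp add: divide_simps)
    then show ?thesis by (simp add: \<beta>_def flat_exp_def)
  qed
  ultimately show ?thesis using that by blast
qed

lemma C_c_inf_smooth: "\<phi> \<in> C_c_inf U \<Longrightarrow> smooth \<phi>"
  by (simp add: C_c_inf_def smooth_def)

lemma C_c_infI:
  assumes "smooth \<phi>" "compact K" "K \<subseteq> U" "\<And>x. x \<notin> K \<Longrightarrow> \<phi> x = 0"
  shows "\<phi> \<in> C_c_inf U"
proof -
  have "closure {x. \<phi> x \<noteq> 0} \<subseteq> K"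
    using assms by (intro closure_minimal) (auto intro: compact_imp_closed)
  moreover from this have "compact (closure {x. \<phi> x \<noteq> 0})"
    using assms(2) by (metis closed_closure compact_Int_closed inf.absorb_iff2)
  ultimately show ?thesis using assms by (auto simp: C_c_inf_def smooth_def)
qed

lemma C_c_inf_support:
  "\<phi> \<in> C_c_inf U \<Longrightarrow> \<exists>K. compact K \<and> K \<subseteq> U \<and> (\<forall>x. x \<notin> K \<longrightarrow> \<phi> x = 0)"
  using closure_subset[of "{x. \<phi> x \<noteq> 0}"] by (auto simp: C_c_inf_def intro!: exI[of _ "closure {x. \<phi> x \<noteq> 0}"])

lemma pderivative_eq_0_outside:
  assumes "compact K" "\<And>x. x \<notin> K \<Longrightarrow> \<phi> x = 0" "x \<notin> K"
  shows "frechet_derivative \<phi> (at x) = (\<lambda>h. 0)"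
proof (rule frechet_derivative_eqI)
  have "((\<lambda>x. 0) has_derivative (\<lambda>h. 0)) (at x)" by simp
  then show "(\<phi> has_derivative (\<lambda>h. 0)) (at x)"
    by (rule has_derivative_transform_within_open[of _ _ _ UNIV "- K"])
      (use assms compact_imp_closed in auto)
qed

lemma C_c_inf_mono: "U \<subseteq> V \<Longrightarrow> C_c_inf U \<subseteq> C_c_inf V"
  by (auto simp: C_c_inf_def)

lemma C_c_inf_pderivative:
  assumes "\<phi> \<in> C_c_inf U" "b \<in> Basis"
  shows "pderivative b \<phi> \<in> C_c_inf U"
proof -
  obtain K where K: "compact K" "K \<subseteq> U" "\<And>x. x \<notin> K \<Longrightarrow> \<phi> x = 0" using C_c_inf_support[OF assms(1)] by auto
  show ?thesis
    by (rule C_c_infI[OF smooth_pderivative[OF C_c_inf_smooth[OF assms(1)] assms(2)] K(1,2)])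
      (simp add: pderivative_eq_0_outside[OF K(1,3)])
qed

lemma C_c_inf_mult:
  assumes "\<phi> \<in> C_c_inf U" "smooth \<psi>"
  shows "(\<lambda>x. \<psi> x * \<phi> x) \<in> C_c_inf U"
proof -
  obtain K where K: "compact K" "K \<subseteq> U" "\<And>x. x \<notin> K \<Longrightarrow> \<phi> x = 0" using C_c_inf_support[OF assms(1)] by auto
  show ?thesis
    by (rule C_c_infI[OF smooth_mult[OF assms(2) C_c_inf_smooth[OF assms(1)]] K(1,2)]) (simp add: K(3))
qed

lemma C_c_inf_affine:
  assumes "\<phi> \<in> C_c_inf U" "c \<noteq> 0" "\<And>x. c *\<^sub>R x + a \<in> U \<Longrightarrow> x \<in> V"
  shows "(\<lambda>x. \<phi> (c *\<^sub>R x + a)) \<in> C_c_inf V"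
proof -
  obtain K where K: "compact K" "K \<subseteq> U" "\<And>x. x \<notin> K \<Longrightarrow> \<phi> x = 0" using C_c_inf_support[OF assms(1)] by auto
  let ?K = "(\<lambda>y. inverse c *\<^sub>R (y - a)) ` K"
  show ?thesis
  proof (rule C_c_infI[of _ ?K])
    show "compact ?K" by (intro compact_continuous_image continuous_intros K)
    show "?K \<subseteq> V" using K(2) assms(2,3) by auto
    fix x assume "x \<notin> ?K"
    then have "c *\<^sub>R x + a \<notin> K" using assms(2) by (force simp: image_iff)
    then show "\<phi> (c *\<^sub>R x + a) = 0" by (rule K)
  qed (rule smooth_affine[OF C_c_inf_smooth[OF assms(1)]])
qed

lemma C_c_inf_bounded:
  assumes "\<phi> \<in> C_c_inf U"
  obtains B where "B > 0" "\<And>x. \<bar>\<phi> x\<bar> \<le> B"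
proof -
  obtain K where K: "compact K" "K \<subseteq> U" "\<And>x. x \<notin> K \<Longrightarrow> \<phi> x = 0" using C_c_inf_support[OF assms(1)] by auto
  have "compact (\<phi> ` K)"
    by (intro compact_continuous_image smooth_continuous_on C_c_inf_smooth[OF assms] K)
  then obtain B where B: "B > 0" "\<And>y. y \<in> \<phi> ` K \<Longrightarrow> norm y \<le> B"
    by (metis bounded_pos compact_imp_bounded)
  have "\<bar>\<phi> x\<bar> \<le> B" for x using B K(3)[of x] by (cases "x \<in> K") auto
  then show ?thesis using that B by blast
qed

text \<open>Covering \<open>K\<close> by finitely many balls with cut-offs \<open>\<beta>\<^sub>j\<close>, the function \<open>1 - \<Prod>\<^sub>j (1 - \<beta>\<^sub>j)\<close> equals
  \<open>1\<close> wherever one of the \<open>\<beta>\<^sub>j\<close> does.\<close>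

lemma smooth_urysohn:
  fixes K U :: "'a::euclidean_space set"
  assumes "compact K" "open U" "K \<subseteq> U"
  obtains \<beta> where "\<beta> \<in> C_c_inf U" "\<And>x. 0 \<le> \<beta> x \<and> \<beta> x \<le> 1" "\<And>x. x \<in> K \<Longrightarrow> \<beta> x = 1"
proof -
  have "\<exists>r>0. cball x (2*r) \<subseteq> U" if x: "x \<in> K" for x
  proof -
    obtain e where "e > 0" "cball x e \<subseteq> U"
      using open_contains_cball[of U] assms(2,3) x by blast
    then have "e/2 > 0 \<and> cball x (2 * (e/2)) \<subseteq> U" by simp
    then show ?thesis by blast
  qed
  then obtain r where r: "\<And>x. x \<in> K \<Longrightarrow> r x > 0 \<and> cball x (2 * r x) \<subseteq> U" by metis
  have cov: "K \<subseteq> (\<Union>x\<in>K. ball x (r x))"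
  proof
    fix y assume "y \<in> K"
    then show "y \<in> (\<Union>x\<in>K. ball x (r x))" using r by (intro UN_I[of y]) simp_all
  qed
  obtain I where I: "I \<subseteq> K" "finite I" "K \<subseteq> (\<Union>x\<in>I. ball x (r x))"
    by (rule compactE_image[OF assms(1) _ cov]) simp_all
  have "\<exists>\<beta>. smooth \<beta> \<and> (\<forall>y. 0 \<le> \<beta> y \<and> \<beta> y \<le> 1) \<and> (\<forall>y\<in>cball x (r x). \<beta> y = 1)
      \<and> (\<forall>y. y \<notin> ball x (2 * r x) \<longrightarrow> \<beta> y = 0)" if "x \<in> I" for x
    by (rule smooth_cutoff_ball[of "r x" "2 * r x" x]) (use r[of x] I that in auto)
  then obtain \<beta> where \<beta>: "\<And>x. x \<in> I \<Longrightarrow> smooth (\<beta> x)" "\<And>x y. x \<in> I \<Longrightarrow> 0 \<le> \<beta> x y \<and> \<beta> x y \<le> 1"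
      "\<And>x y. x \<in> I \<Longrightarrow> y \<in> cball x (r x) \<Longrightarrow> \<beta> x y = 1"
      "\<And>x y. x \<in> I \<Longrightarrow> y \<notin> ball x (2 * r x) \<Longrightarrow> \<beta> x y = 0" by metis
  define B where "B = (\<lambda>y. 1 - (\<Prod>x\<in>I. 1 - \<beta> x y))"
  have "smooth B" unfolding B_def by (intro smooth_diff smooth_const smooth_prod I \<beta>)
  then have "B \<in> C_c_inf U"
  proof (rule C_c_infI[of _ "\<Union>x\<in>I. cball x (2 * r x)"])
    show "compact (\<Union>x\<in>I. cball x (2 * r x))" using I by auto
    show "(\<Union>x\<in>I. cball x (2 * r x)) \<subseteq> U" using r I by blast
    fix y assume "y \<notin> (\<Union>x\<in>I. cball x (2 * r x))"
    then show "B y = 0" unfolding B_def using \<beta>(4) by (auto intro!: prod.neutral)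
  qed
  moreover have "0 \<le> B y \<and> B y \<le> 1" for y
    unfolding B_def using \<beta>(2) by (auto intro!: prod_nonneg prod_le_1)
  moreover have "B y = 1" if y: "y \<in> K" for y
  proof -
    obtain x where "x \<in> I" "y \<in> ball x (r x)" using I y by blast
    then have "(\<Prod>x\<in>I. 1 - \<beta> x y) = 0" using I \<beta>(3)[of x y] by (intro prod_zero) auto
    then show ?thesis by (simp add: B_def)
  qed
  ultimately show ?thesis using that by blast
qed

lemma C_c_inf_lipschitz:
  assumes "\<phi> \<in> C_c_inf U"
  obtains C where "C > 0" "\<And>x h. \<bar>frechet_derivative \<phi> (at x) h\<bar> \<le> C * norm h"
    "\<And>x y. \<bar>\<phi> x - \<phi> y\<bar> \<le> C * norm (x - y)"
proof -
  have "\<exists>B>0. \<forall>x. \<bar>pderivative b \<phi> x\<bar> \<le> B" if "b \<in> Basis" for b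
    by (rule C_c_inf_bounded[OF C_c_inf_pderivative[OF assms that]]) auto
  then obtain B where B: "\<And>b. b \<in> Basis \<Longrightarrow> B b > 0" "\<And>b x. b \<in> Basis \<Longrightarrow> \<bar>pderivative b \<phi> x\<bar> \<le> B b"
    by metis
  define C where "C = (\<Sum>b\<in>Basis. B b)"
  have C: "C > 0" unfolding C_def using B by (intro sum_pos) auto
  have 1: "\<bar>frechet_derivative \<phi> (at x) h\<bar> \<le> C * norm h" for x h
  proof -
    have "\<bar>frechet_derivative \<phi> (at x) h\<bar> \<le> (\<Sum>b\<in>Basis. \<bar>(h \<bullet> b) * pderivative b \<phi> x\<bar>)"
      by (subst pderivative_Basis_sum[OF C_c_inf_smooth[OF assms]]) (rule sum_abs)
    also have "\<dots> \<le> (\<Sum>b\<in>Basis. norm h * B b)"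
      by (intro sum_mono) (auto simp: abs_mult intro!: mult_mono B Basis_le_norm)
    finally show ?thesis by (simp add: C_def sum_distrib_left mult.commute)
  qed
  have "norm (\<phi> x - \<phi> y) \<le> C * norm (x - y)" for x y
  proof (rule differentiable_bound[of UNIV \<phi> "\<lambda>x. frechet_derivative \<phi> (at x)"])
    show "onorm (frechet_derivative \<phi> (at x)) \<le> C" for x
      by (rule onorm_le) (use 1 in auto)
  qed (auto intro: smooth_has_derivative C_c_inf_smooth[OF assms])
  then show ?thesis using that C 1 by simp
qed

lemma C_c_inf_taylor:
  assumes "\<phi> \<in> C_c_inf U"
  obtains C where "C > 0"
    "\<And>x h. \<bar>\<phi> (x + h) - \<phi> x - frechet_derivative \<phi> (at x) h\<bar> \<le> C * (norm h)\<^sup>2"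
proof -
  have sm: "smooth \<phi>" by (rule C_c_inf_smooth[OF assms])
  have "\<exists>C>0. \<forall>x y. \<bar>pderivative b \<phi> x - pderivative b \<phi> y\<bar> \<le> C * norm (x - y)" if "b \<in> Basis" for b
    by (rule C_c_inf_lipschitz[OF C_c_inf_pderivative[OF assms that]]) auto
  then obtain B where B: "\<And>b. b \<in> Basis \<Longrightarrow> B b > 0"
      "\<And>b x y. b \<in> Basis \<Longrightarrow> \<bar>pderivative b \<phi> x - pderivative b \<phi> y\<bar> \<le> B b * norm (x - y)"
    by metis
  define C where "C = (\<Sum>b\<in>Basis. B b)"
  have C: "C > 0" unfolding C_def using B by (intro sum_pos) auto
  have "\<bar>\<phi> (x + h) - \<phi> x - frechet_derivative \<phi> (at x) h\<bar> \<le> C * (norm h)\<^sup>2" for x h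
  proof -
    define d where "d = (\<lambda>y. \<phi> y - frechet_derivative \<phi> (at x) (y - x))"
    have bl: "bounded_linear (frechet_derivative \<phi> (at x))"
      by (rule has_derivative_bounded_linear[OF smooth_has_derivative[OF sm]])
    have "norm (d (x + h) - d x) \<le> (C * norm h) * norm ((x + h) - x)"
    proof (rule differentiable_bound)
      fix y assume y: "y \<in> cball x (norm h)"
      show "(d has_derivative (\<lambda>k. frechet_derivative \<phi> (at y) k - frechet_derivative \<phi> (at x) (k - 0)))
          (at y within cball x (norm h))"
        unfolding d_def
        by (intro has_derivative_diff has_derivative_at_withinI[OF smooth_has_derivative[OF sm]]
            bounded_linear.has_derivative[OF bl] has_derivative_ident has_derivative_const)
      show "onorm (\<lambda>k. frechet_derivative \<phi> (at y) k - frechet_derivative \<phi> (at x) (k - 0)) \<le> C * norm h"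
      proof (rule onorm_le)
        fix k
        have "frechet_derivative \<phi> (at y) k - frechet_derivative \<phi> (at x) k
            = (\<Sum>b\<in>Basis. (k \<bullet> b) * (pderivative b \<phi> y - pderivative b \<phi> x))"
          by (subst (1 2) pderivative_Basis_sum[OF sm]) (simp add: sum_subtractf algebra_simps)
        also have "norm \<dots> \<le> (\<Sum>b\<in>Basis. norm k * (B b * norm h))"
        proof (rule sum_norm_le)
          fix b :: 'a assume b: "b \<in> Basis"
          have "\<bar>pderivative b \<phi> y - pderivative b \<phi> x\<bar> \<le> B b * norm h"
            using B(2)[OF b, of y x] y B(1)[OF b]
            by (smt (verit) mem_cball dist_norm mult_left_mono norm_minus_commute)
          then show "norm ((k \<bullet> b) * (pderivative b \<phi> y - pderivative b \<phi> x)) \<le> norm k * (B b * norm h)"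
            by (auto simp: abs_mult intro!: mult_mono Basis_le_norm b)
        qed
        also have "\<dots> = C * norm h * norm k"
          by (simp add: C_def sum_distrib_left sum_distrib_right algebra_simps)
        finally show "norm (frechet_derivative \<phi> (at y) k - frechet_derivative \<phi> (at x) (k - 0)) \<le> C * norm h * norm k"
          by simp
      qed
    qed (auto simp: dist_norm)
    then show ?thesis
      using linear_0[OF has_derivative_linear[OF smooth_has_derivative[OF sm, of x]]]
      by (simp add: d_def power2_eq_square algebra_simps)
  qed
  then show ?thesis using that C by blast
qed

section \<open>Square integrable functions\<close>

abbreviation sqn :: "('a::euclidean_space \<Rightarrow> 'b::euclidean_space) \<Rightarrow> real" where
  "sqn f \<equiv> (LINT x|lebesgue. (norm (f x))\<^sup>2)"

lemma L2_UNIV_iff: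
  "f \<in> L2 UNIV \<longleftrightarrow> f \<in> borel_measurable lebesgue \<and> integrable lebesgue (\<lambda>x. (norm (f x))\<^sup>2)"
  by (simp add: L2_def lebesgue_on_UNIV_eq)

lemma L2_UNIV_measurable [measurable_dest]: "f \<in> L2 UNIV \<Longrightarrow> f \<in> borel_measurable lebesgue"
  by (simp add: L2_UNIV_iff)

lemma L2_UNIV_integrable: "f \<in> L2 UNIV \<Longrightarrow> integrable lebesgue (\<lambda>x. (norm (f x))\<^sup>2)"
  by (simp add: L2_UNIV_iff)

lemma L2_UNIV_bound:
  assumes "f \<in> L2 UNIV" "g \<in> borel_measurable lebesgue" "AE x in lebesgue. norm (g x) \<le> norm (f x)"
  shows "g \<in> L2 UNIV"
proof -
  have "integrable lebesgue (\<lambda>x. (norm (g x))\<^sup>2)"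
    by (rule Bochner_Integration.integrable_bound[OF L2_UNIV_integrable[OF assms(1)]])
      (use assms(2,3) in \<open>auto intro: power_mono elim!: eventually_mono\<close>)
  then show ?thesis using assms by (simp add: L2_UNIV_iff)
qed

lemma L2_UNIV_scale:
  assumes "f \<in> L2 UNIV"
  shows "(\<lambda>x. c *\<^sub>R f x) \<in> L2 UNIV"
  using assms by (auto simp: L2_UNIV_iff power_mult_distrib)

lemma integrable_norm_mult_L2:
  assumes [measurable]: "f \<in> L2 UNIV" "g \<in> L2 UNIV"
  shows "integrable lebesgue (\<lambda>x. norm (f x) * norm (g x))"
proof (rule Bochner_Integration.integrable_bound)
  show "integrable lebesgue (\<lambda>x. (norm (f x))\<^sup>2 + (norm (g x))\<^sup>2)"
    using assms by (auto intro: L2_UNIV_integrable)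
  have "2 * (norm (f x) * norm (g x)) \<le> (norm (f x))\<^sup>2 + (norm (g x))\<^sup>2" for x
    using sum_squares_bound[of "norm (f x)" "norm (g x)"] by simp
  then show "AE x in lebesgue. norm (norm (f x) * norm (g x)) \<le> norm ((norm (f x))\<^sup>2 + (norm (g x))\<^sup>2)"
    by (intro AE_I2) (smt (verit) mult_nonneg_nonneg norm_ge_zero real_norm_def)
qed measurable

lemma integrable_inner_L2:
  assumes [measurable]: "f \<in> L2 UNIV" "g \<in> L2 UNIV"
  shows "integrable lebesgue (\<lambda>x. f x \<bullet> g x)"
  by (rule Bochner_Integration.integrable_bound[OF integrable_norm_mult_L2[OF assms]])
    (auto intro: Cauchy_Schwarz_ineq2)

lemma L2_UNIV_add:
  assumes [measurable]: "f \<in> L2 UNIV" "g \<in> L2 UNIV"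
  shows "(\<lambda>x. f x + g x) \<in> L2 UNIV"
  unfolding L2_UNIV_iff
proof
  have "integrable lebesgue (\<lambda>x. (norm (f x))\<^sup>2 + 2 * (f x \<bullet> g x) + (norm (g x))\<^sup>2)"
    by (intro Bochner_Integration.integrable_add integrable_mult_right L2_UNIV_integrable integrable_inner_L2 assms)
  then show "integrable lebesgue (\<lambda>x. (norm (f x + g x))\<^sup>2)"
    by (simp add: power2_norm_eq_inner algebra_simps inner_commute)
qed measurable

lemma L2_UNIV_diff: "f \<in> L2 UNIV \<Longrightarrow> g \<in> L2 UNIV \<Longrightarrow> (\<lambda>x. f x - g x) \<in> L2 UNIV"
  using L2_UNIV_add[of f "\<lambda>x. -1 *\<^sub>R g x"] L2_UNIV_scale[of g "-1"] by simp

lemma L2_UNIV_mult_bounded: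
  assumes f: "f \<in> L2 UNIV" and m [measurable]: "m \<in> borel_measurable lebesgue"
    and B: "AE x in lebesgue. \<bar>m x\<bar> \<le> B"
  shows "(\<lambda>x. m x *\<^sub>R f x) \<in> L2 UNIV"
proof (rule L2_UNIV_bound[OF L2_UNIV_scale[OF f, of "\<bar>B\<bar>"]])
  show "AE x in lebesgue. norm (m x *\<^sub>R f x) \<le> norm (\<bar>B\<bar> *\<^sub>R f x)"
    using B by eventually_elim (auto intro!: mult_right_mono)
qed (use f in measurable)

lemma L2_UNIV_component: "f \<in> L2 UNIV \<Longrightarrow> b \<in> Basis \<Longrightarrow> (\<lambda>x. f x \<bullet> b) \<in> L2 UNIV"
  by (rule L2_UNIV_bound) (auto intro: Basis_le_norm L2_UNIV_measurable)

lemma L2_cauchy_schwarz: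
  assumes [measurable]: "f \<in> L2 UNIV" "g \<in> L2 UNIV"
  shows "(LINT x|lebesgue. norm (f x) * norm (g x)) \<le> sqrt (sqn f) * sqrt (sqn g)"
proof -
  let ?A = "sqn f" and ?C = "sqn g" and ?B = "LINT x|lebesgue. norm (f x) * norm (g x)"
  have q: "0 \<le> ?A - 2 * t * ?B + t\<^sup>2 * ?C" for t
  proof -
    have "0 \<le> (LINT x|lebesgue. (norm (f x) - t * norm (g x))\<^sup>2)" by simp
    also have "\<dots> = (LINT x|lebesgue. (norm (f x))\<^sup>2 - 2 * t * (norm (f x) * norm (g x)) + t\<^sup>2 * (norm (g x))\<^sup>2)"
      by (simp add: power2_diff power_mult_distrib algebra_simps)
    also have "\<dots> = ?A - 2 * t * ?B + t\<^sup>2 * ?C"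
      using assms by (simp add: L2_UNIV_integrable integrable_norm_mult_L2)
    finally show ?thesis .
  qed
  have AC: "?A \<ge> 0" "?C \<ge> 0" "?B \<ge> 0" by (auto intro: integral_nonneg_AE)
  have "?B\<^sup>2 \<le> ?A * ?C"
  proof (cases "?C = 0")
    case True
    have "?B = 0"
    proof (rule ccontr)
      assume "?B \<noteq> 0"
      then show False using q[of "(?A + 1) / (2 * ?B)"] True AC by simp
    qed
    then show ?thesis using AC by simp
  next
    case False
    then have "?C > 0" using AC by linarith
    then show ?thesis using q[of "?B / ?C"]
      by (simp add: power2_eq_square field_simps)
  qed
  then show ?thesis by (simp add: real_le_rsqrt flip: real_sqrt_mult)
qed

lemma L2_cauchy_schwarz_inner:
  assumes [measurable]: "f \<in> L2 UNIV" "g \<in> L2 UNIV"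
  shows "\<bar>LINT x|lebesgue. f x \<bullet> g x\<bar> \<le> sqrt (sqn f) * sqrt (sqn g)"
proof -
  have "\<bar>LINT x|lebesgue. f x \<bullet> g x\<bar> \<le> (LINT x|lebesgue. norm (f x) * norm (g x))"
    using Bochner_Integration.integral_norm_bound_integral[OF integrable_inner_L2[OF assms] integrable_norm_mult_L2[OF assms]]
    by (simp add: Cauchy_Schwarz_ineq2)
  then show ?thesis using L2_cauchy_schwarz[OF assms] by linarith
qed

lemma L2_triangle:
  assumes [measurable]: "f \<in> L2 UNIV" "g \<in> L2 UNIV"
  shows "sqrt (sqn (\<lambda>x. f x + g x)) \<le> sqrt (sqn f) + sqrt (sqn g)"
proof -
  have "sqn (\<lambda>x. f x + g x) = (LINT x|lebesgue. (norm (f x))\<^sup>2 + 2 * (f x \<bullet> g x) + (norm (g x))\<^sup>2)"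
    by (simp add: power2_norm_eq_inner algebra_simps inner_commute)
  also have "\<dots> = sqn f + 2 * (LINT x|lebesgue. f x \<bullet> g x) + sqn g"
    using assms by (simp add: L2_UNIV_integrable integrable_inner_L2)
  also have "\<dots> \<le> sqn f + 2 * (sqrt (sqn f) * sqrt (sqn g)) + sqn g"
    using L2_cauchy_schwarz_inner[OF assms] by linarith
  also have "\<dots> = (sqrt (sqn f) + sqrt (sqn g))\<^sup>2"
    by (simp add: power2_sum)
  finally show ?thesis
    by (intro real_le_lsqrt) (auto intro: add_nonneg_nonneg integral_nonneg_AE)
qed

lemma L2_triangle_diff:
  assumes [measurable]: "f \<in> L2 UNIV" "g \<in> L2 UNIV"
  shows "sqrt (sqn (\<lambda>x. f x - g x)) \<le> sqrt (sqn f) + sqrt (sqn g)"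
  using L2_triangle[OF assms(1) L2_UNIV_scale[OF assms(2), of "-1"]] by simp

lemma sqn_mono:
  assumes "g \<in> L2 UNIV" "AE x in lebesgue. norm (f x) \<le> norm (g x)"
  shows "sqn f \<le> sqn g"
proof (rule integral_mono_AE')
  show "AE x in lebesgue. (norm (f x))\<^sup>2 \<le> (norm (g x))\<^sup>2"
    using assms(2) by eventually_elim (simp add: power_mono)
qed (auto intro: L2_UNIV_integrable assms)

lemma lebesgue_measurable_AE_cong:
  fixes f g :: "'a::euclidean_space \<Rightarrow> 'b::euclidean_space"
  assumes [measurable]: "f \<in> borel_measurable lebesgue" and "AE x in lebesgue. f x = g x"
  shows "g \<in> borel_measurable lebesgue"
proof -
  from assms(2) obtain N where N: "{x. f x \<noteq> g x} \<subseteq> N" "N \<in> null_sets lebesgue"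
    by (auto simp: eventually_ae_filter)
  show ?thesis
  proof (rule measurableI)
    fix A :: "'b set" assume A: "A \<in> sets borel"
    have "f -` A - N \<in> sets lebesgue"
      using measurable_sets[OF assms(1) A] N by (auto simp: null_sets_def)
    moreover have "g -` A \<inter> N \<in> null_sets lebesgue"
      by (rule completion.complete2[OF Int_lower2 N(2)])
    then have "g -` A \<inter> N \<in> sets lebesgue" by auto
    moreover have "g -` A = (f -` A - N) \<union> (g -` A \<inter> N)"
      using N(1) by force
    ultimately show "g -` A \<inter> space lebesgue \<in> sets lebesgue" 
      using sets.Un[of "f -` A - N" lebesgue "g -` A \<inter> N"] by simp
  qed auto
qed

lemma sqn_tendsto_0_dominated:
  fixes F :: "nat \<Rightarrow> 'a::euclidean_space \<Rightarrow> 'b::euclidean_space" and w :: "'a \<Rightarrow> 'c::euclidean_space"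
  assumes "\<And>n. F n \<in> borel_measurable lebesgue" "w \<in> L2 UNIV"
    and lim: "AE x in lebesgue. (\<lambda>n. F n x) \<longlonglongrightarrow> 0"
    and le: "\<And>n. AE x in lebesgue. norm (F n x) \<le> norm (w x)"
  shows "(\<lambda>n. sqn (F n)) \<longlonglongrightarrow> 0"
proof -
  have "(\<lambda>n. sqn (F n)) \<longlonglongrightarrow> (LINT x|(lebesgue :: 'a measure). (0::real))"
  proof (rule integral_dominated_convergence[where w = "\<lambda>x. (norm (w x))\<^sup>2"])
    show "AE x in lebesgue. (\<lambda>n. (norm (F n x))\<^sup>2) \<longlonglongrightarrow> 0"
      using lim
    proof eventually_elim
      case (elim x)
      from tendsto_power[OF tendsto_norm[OF elim], of 2] show ?case by simp
    qed
    show "AE x in lebesgue. norm ((norm (F n x))\<^sup>2) \<le> (norm (w x))\<^sup>2" for n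
      using le[of n] by eventually_elim (simp add: power_mono)
  qed (use assms(1) L2_UNIV_integrable[OF assms(2)] in measurable)
  then show ?thesis by simp
qed

lemma compact_indicator_L2:
  assumes "compact K"
  shows "(\<lambda>x. c * indicator K x :: real) \<in> L2 UNIV"
proof -
  have K: "K \<in> lmeasurable" by (rule lmeasurable_compact[OF assms])
  then have "integrable lebesgue (\<lambda>x. c\<^sup>2 * indicator K x)"
    by (intro integrable_mult_right integrable_real_indicator) (auto simp: fmeasurable_def)
  moreover have "(norm (c * indicator K x :: real))\<^sup>2 = c\<^sup>2 * indicator K x" for x
    by (simp add: indicator_def)
  ultimately show ?thesis using K by (auto simp: L2_UNIV_iff intro!: borel_measurable_times)
qed

section \<open>Affine changes of variables\<close>

lemma
  fixes a :: "'a::euclidean_space" and c :: real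
  assumes "c \<noteq> 0"
  shows measurable_affine: "(\<lambda>x. c *\<^sub>R x + a) \<in> lebesgue \<rightarrow>\<^sub>M lebesgue"
    and lebesgue_affine: "lebesgue = density (distr lebesgue lebesgue (\<lambda>x. c *\<^sub>R x + a)) (\<lambda>_. ennreal (\<bar>c\<bar> ^ DIM('a)))"
proof -
  have eq: "(\<lambda>x. a + (\<Sum>j\<in>Basis. (c * (x \<bullet> j)) *\<^sub>R j)) = (\<lambda>x. c *\<^sub>R x + a)"
    by (simp add: euclidean_representation add.commute flip: scaleR_scaleR scaleR_sum_right)
  show "(\<lambda>x. c *\<^sub>R x + a) \<in> lebesgue \<rightarrow>\<^sub>M lebesgue"
    using lebesgue_affine_measurable[of "\<lambda>_. c" a] assms by (simp add: eq)
  show "lebesgue = density (distr lebesgue lebesgue (\<lambda>x. c *\<^sub>R x + a)) (\<lambda>_. ennreal (\<bar>c\<bar> ^ DIM('a)))"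
    using lebesgue_affine_euclidean[of "\<lambda>_. c" a] assms by (simp add: eq)
qed

lemma measurable_affine_compose:
  fixes c :: real
  assumes "f \<in> lebesgue \<rightarrow>\<^sub>M N" "c \<noteq> 0"
  shows "(\<lambda>x. f (c *\<^sub>R x + a)) \<in> lebesgue \<rightarrow>\<^sub>M N"
  using measurable_compose[OF measurable_affine[OF assms(2)] assms(1)] .

lemma AE_affine:
  fixes a :: "'a::euclidean_space" and c :: real
  assumes "AE x in lebesgue. P x" "c \<noteq> 0"
  shows "AE x in lebesgue. P (c *\<^sub>R x + a)"
proof -
  let ?D = "distr lebesgue lebesgue (\<lambda>x. c *\<^sub>R x + a)"
  have "AE x in density ?D (\<lambda>_. ennreal (\<bar>c\<bar> ^ DIM('a))). P x"
    using assms lebesgue_affine[OF assms(2)] by metis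
  then have "AE x in ?D. P x"
    using assms(2) by (subst (asm) AE_density) auto
  then show ?thesis by (rule AE_distrD[OF measurable_affine[OF assms(2)]])
qed

lemma
  fixes f :: "'a::euclidean_space \<Rightarrow> 'b::euclidean_space" and c :: real
  assumes "f \<in> borel_measurable lebesgue" "c \<noteq> 0"
  shows integrable_affine: "integrable lebesgue (\<lambda>x. f (c *\<^sub>R x + a)) \<longleftrightarrow> integrable lebesgue f"
    and integral_affine: "(LINT x|lebesgue. f x) = \<bar>c\<bar> ^ DIM('a) *\<^sub>R (LINT x|lebesgue. f (c *\<^sub>R x + a))"
proof -
  let ?D = "distr lebesgue lebesgue (\<lambda>x. c *\<^sub>R x + a)" and ?C = "\<bar>c\<bar> ^ DIM('a)"
  have mD: "f \<in> borel_measurable ?D" using assms by simp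
  have "integrable lebesgue f \<longleftrightarrow> integrable (density ?D (\<lambda>_. ennreal ?C)) f"
    using lebesgue_affine[OF assms(2)] by metis
  also have "\<dots> \<longleftrightarrow> integrable ?D (\<lambda>x. ?C *\<^sub>R f x)"
    by (rule integrable_density[OF mD]) auto
  also have "\<dots> \<longleftrightarrow> integrable ?D f"
    using integrable_scaleR_right[of ?C ?D f] integrable_scaleR_right[of "inverse ?C" ?D "\<lambda>x. ?C *\<^sub>R f x"] assms(2)
    by auto
  also have "\<dots> \<longleftrightarrow> integrable lebesgue (\<lambda>x. f (c *\<^sub>R x + a))"
    by (rule integrable_distr_eq[OF measurable_affine[OF assms(2)] assms(1)])
  finally show "integrable lebesgue (\<lambda>x. f (c *\<^sub>R x + a)) \<longleftrightarrow> integrable lebesgue f" by simp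
  have "(LINT x|lebesgue. f x) = (LINT x|density ?D (\<lambda>_. ennreal ?C). f x)"
    using lebesgue_affine[OF assms(2)] by metis
  also have "\<dots> = (LINT x|?D. ?C *\<^sub>R f x)"
    by (rule integral_density[OF mD]) auto
  also have "\<dots> = (LINT x|lebesgue. ?C *\<^sub>R f (c *\<^sub>R x + a))"
    by (rule integral_distr[OF measurable_affine[OF assms(2)]]) (use assms in simp)
  finally show "(LINT x|lebesgue. f x) = ?C *\<^sub>R (LINT x|lebesgue. f (c *\<^sub>R x + a))" by simp
qed

lemma L2_UNIV_affine:
  assumes "f \<in> L2 UNIV" "c \<noteq> 0"
  shows "(\<lambda>x. f (c *\<^sub>R x + a)) \<in> L2 UNIV"
  using integrable_affine[of "\<lambda>x. (norm (f x))\<^sup>2" c a] assms measurable_affine_compose[of f borel c a]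
  by (auto simp: L2_UNIV_iff)

lemma L2_UNIV_translate: "f \<in> L2 UNIV \<Longrightarrow> (\<lambda>x. f (x + a)) \<in> L2 UNIV"
  using L2_UNIV_affine[of f 1 a] by simp

lemma sqn_translate: "f \<in> L2 UNIV \<Longrightarrow> sqn (\<lambda>x. f (x + a)) = sqn f"
  using integral_affine[of "\<lambda>x. (norm (f x))\<^sup>2" 1 a] borel_measurable_integrable[OF L2_UNIV_integrable, of f]
  by simp

section \<open>Density of test functions\<close>

lemma C_c_inf_measurable: "\<phi> \<in> C_c_inf U \<Longrightarrow> \<phi> \<in> borel_measurable lebesgue"
  using measurable_completion[of \<phi> lborel borel]
    borel_measurable_continuous_onI[OF smooth_continuous_on[OF C_c_inf_smooth[of \<phi> U]]] by simp

lemma compact_integrable_indicator: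
  "compact K \<Longrightarrow> integrable lebesgue (\<lambda>x. c * indicator K x :: real)"
  using lmeasurable_compact[of K]
  by (intro integrable_mult_right integrable_real_indicator) (auto simp: fmeasurable_def)

lemma C_c_inf_L2: 
  assumes "\<phi> \<in> C_c_inf U"
  shows "\<phi> \<in> L2 UNIV"
proof -
  obtain K where K: "compact K" "\<And>x. x \<notin> K \<Longrightarrow> \<phi> x = 0" using C_c_inf_support[OF assms] by auto
  obtain B where B: "B > 0" "\<And>x. \<bar>\<phi> x\<bar> \<le> B" by (rule C_c_inf_bounded[OF assms]) auto
  have "integrable lebesgue (\<lambda>x. (norm (\<phi> x))\<^sup>2)"
  proof (rule Bochner_Integration.integrable_bound[OF compact_integrable_indicator[OF K(1), of "B\<^sup>2"]])
    show "(\<lambda>x. (norm (\<phi> x))\<^sup>2) \<in> borel_measurable lebesgue"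
      using C_c_inf_measurable[OF assms] by measurable
    have "(norm (\<phi> x))\<^sup>2 \<le> B\<^sup>2 * indicator K x" for x
      using B K(2)[of x] by (cases "x \<in> K") (auto simp: abs_le_square_iff[symmetric])
    then show "AE x in lebesgue. norm ((norm (\<phi> x))\<^sup>2) \<le> norm (B\<^sup>2 * indicator K x)" by (intro AE_I2) simp
  qed
  then show ?thesis by (simp add: L2_UNIV_iff C_c_inf_measurable[OF assms])
qed

text \<open>A measurable function is an almost everywhere limit of continuous functions; on a compact set the
  latter are uniformly close to polynomials, which a smooth cut-off makes into test functions.\<close>

lemma bounded_approx_test_functions:
  fixes f :: "'a::euclidean_space \<Rightarrow> real"
  assumes f: "f \<in> borel_measurable lebesgue" "\<And>x. \<bar>f x\<bar> \<le> M"
    and K: "compact K" "open U" "K \<subseteq> U" "\<And>x. x \<notin> K \<Longrightarrow> f x = 0"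
  obtains \<phi> L where "\<And>n::nat. \<phi> n \<in> C_c_inf U" "\<And>n x. \<bar>\<phi> n x\<bar> \<le> M + 1" "compact L" "L \<subseteq> U"
    "\<And>n x. x \<notin> L \<Longrightarrow> \<phi> n x = 0" "AE x in lebesgue. (\<lambda>n. \<phi> n x) \<longlonglongrightarrow> f x"
proof -
  obtain \<beta> where \<beta>: "\<beta> \<in> C_c_inf U" "\<And>x. 0 \<le> \<beta> x \<and> \<beta> x \<le> 1" "\<And>x. x \<in> K \<Longrightarrow> \<beta> x = 1"
    using smooth_urysohn[OF K(1-3)] by metis
  obtain L where L: "compact L" "L \<subseteq> U" "\<And>x. x \<notin> L \<Longrightarrow> \<beta> x = 0"
    using C_c_inf_support[OF \<beta>(1)] by auto
  have M: "M \<ge> 0" using f(2)[of undefined] by linarith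
  have "f measurable_on UNIV" by (rule lebesgue_measurable_imp_measurable_on[OF f(1)]) simp
  then obtain N g where N: "negligible N" and g: "\<And>n. continuous_on UNIV (g n)"
      "\<And>x. x \<notin> N \<Longrightarrow> (\<lambda>n::nat. g n x) \<longlonglongrightarrow> f x"
    by (auto simp: measurable_on_def)
  define h where "h = (\<lambda>n x. max (-M) (min M (g n x)))"
  have "\<exists>p. real_polynomial_function p \<and> (\<forall>x\<in>L. \<bar>h n x - p x\<bar> < inverse (real (Suc n)))" for n
  proof -
    have "continuous_on L (h n)" unfolding h_def
      by (intro continuous_intros continuous_on_subset[OF g(1)]) auto
    then show ?thesis
      by (rule Stone_Weierstrass_real_polynomial_function[OF L(1), of "h n" "inverse (real (Suc n))"]) auto
  qed
  then obtain p where p: "\<And>n. real_polynomial_function (p n)"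
      "\<And>n x. x \<in> L \<Longrightarrow> \<bar>h n x - p n x\<bar> < inverse (real (Suc n))" by metis
  define \<phi> where "\<phi> = (\<lambda>n x. p n x * \<beta> x)"
  have \<phi>1: "\<phi> n \<in> C_c_inf U" for n
    unfolding \<phi>_def by (intro C_c_inf_mult \<beta> smooth_polynomial p)
  have \<phi>2: "\<bar>\<phi> n x\<bar> \<le> M + 1" for n x
  proof (cases "x \<in> L")
    case True
    have "\<bar>p n x\<bar> \<le> M + 1"
      using p(2)[OF True, of n] M inverse_le_1_iff[of "real (Suc n)"] by (auto simp: h_def)
    then have "\<bar>p n x\<bar> * \<bar>\<beta> x\<bar> \<le> (M + 1) * 1"
      using \<beta>(2)[of x] M by (intro mult_mono) auto
    then show ?thesis by (simp add: \<phi>_def abs_mult)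
  qed (use L M in \<open>auto simp: \<phi>_def\<close>)
  have \<phi>3: "(\<lambda>n. \<phi> n x) \<longlonglongrightarrow> f x" if x: "x \<notin> N" for x
  proof (cases "x \<in> L")
    case True
    have "(\<lambda>n. h n x) \<longlonglongrightarrow> max (-M) (min M (f x))"
      unfolding h_def by (intro tendsto_intros g x)
    then have h: "(\<lambda>n. h n x) \<longlonglongrightarrow> f x" using f(2)[of x] by (simp add: abs_le_iff max_def min_def split: if_splits)
    have "(\<lambda>n. h n x - p n x) \<longlonglongrightarrow> 0"
      by (rule Lim_null_comparison[OF _ LIMSEQ_inverse_real_of_nat]) (use p(2)[OF True] in \<open>simp add: less_imp_le\<close>)
    from tendsto_mult[OF tendsto_diff[OF h this] tendsto_const[of "\<beta> x"]]
    have "(\<lambda>n. \<phi> n x) \<longlonglongrightarrow> f x * \<beta> x" by (simp add: \<phi>_def)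
    moreover have "f x * \<beta> x = f x" using \<beta>(3) K(4) by (cases "x \<in> K") auto
    ultimately show ?thesis by simp
  next
    case False
    then have "x \<notin> K" using L(3) \<beta>(3)[of x] by auto
    then show ?thesis using False L(3) K(4)[of x] by (simp add: \<phi>_def)
  qed
  have "N \<in> null_sets lebesgue" using N by (simp add: negligible_iff_null_sets)
  then have "AE x in lebesgue. (\<lambda>n. \<phi> n x) \<longlonglongrightarrow> f x"
    by (rule AE_I') (use \<phi>3 in auto)
  with \<phi>1 \<phi>2 L that[of \<phi> L] show ?thesis by (auto simp: \<phi>_def)
qed

lemma C_c_inf_dense_L2:
  fixes f :: "'a::euclidean_space \<Rightarrow> real"
  assumes f: "f \<in> L2 UNIV" and e: "e > 0"
  obtains \<phi> where "\<phi> \<in> C_c_inf UNIV" "sqn (\<lambda>x. f x - \<phi> x) < e"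
proof -
  note [measurable] = L2_UNIV_measurable[OF f]
  define t where "t = (\<lambda>(m::nat) x. indicator (cball 0 (real m)) x * max (- real m) (min (real m) (f x)))"
  have tm [measurable]: "t m \<in> borel_measurable lebesgue" for m unfolding t_def
    by (intro borel_measurable_times borel_measurable_indicator borel_measurable_max borel_measurable_min) auto
  have tf: "\<bar>f x - t m x\<bar> \<le> \<bar>f x\<bar>" for m x by (auto simp: t_def indicator_def)
  have "(\<lambda>m. sqn (\<lambda>x. f x - t m x)) \<longlonglongrightarrow> 0"
  proof (rule sqn_tendsto_0_dominated[OF _ f])
    show "AE x in lebesgue. (\<lambda>m. f x - t m x) \<longlonglongrightarrow> 0"
    proof (rule AE_I2)
      fix x
      obtain m0 :: nat where m0: "real m0 \<ge> norm x" "real m0 \<ge> \<bar>f x\<bar>"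
        using real_arch_simple[of "max (norm x) \<bar>f x\<bar>"] by auto
      have "f x - t m x = 0" if "m \<ge> m0" for m
        using m0 that by (auto simp: t_def)
      then show "(\<lambda>m. f x - t m x) \<longlonglongrightarrow> 0"
        by (intro tendsto_eventually) (auto simp: eventually_sequentially intro!: exI[of _ m0])
    qed
  qed (use tf in auto)
  then obtain m where m: "sqn (\<lambda>x. f x - t m x) < e/4"
    using order_tendstoD(2)[of _ 0 sequentially "e/4"] e eventually_sequentially by (metis (no_types, lifting) divide_pos_pos order_refl zero_less_numeral)
  have tL2: "t m \<in> L2 UNIV"
  proof (rule L2_UNIV_bound[OF f])
    show "AE x in lebesgue. norm (t m x) \<le> norm (f x)" by (auto simp: t_def indicator_def)
  qed simp
  have "\<bar>t m x\<bar> \<le> real m" for x by (auto simp: t_def indicator_def)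
  then obtain \<phi> L where \<phi>: "\<And>n::nat. \<phi> n \<in> C_c_inf UNIV" "\<And>n x. \<bar>\<phi> n x\<bar> \<le> real m + 1" "compact L"
      "\<And>n x. x \<notin> L \<Longrightarrow> \<phi> n x = 0" "AE x in lebesgue. (\<lambda>n. \<phi> n x) \<longlonglongrightarrow> t m x"
    by (rule bounded_approx_test_functions[OF tm, of m "real m" "cball 0 (real m)" UNIV]) (auto simp: t_def)
  let ?K = "L \<union> cball 0 (real m)"
  have "(\<lambda>n. sqn (\<lambda>x. t m x - \<phi> n x)) \<longlonglongrightarrow> 0"
  proof (rule sqn_tendsto_0_dominated[OF _ compact_indicator_L2, of _ ?K "2 * real m + 1"])
    show "AE x in lebesgue. (\<lambda>n. t m x - \<phi> n x) \<longlonglongrightarrow> 0"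
      using \<phi>(5)
    proof eventually_elim
      case (elim x)
      from tendsto_diff[OF tendsto_const[of "t m x"] elim] show ?case by simp
    qed
    show "AE x in lebesgue. norm (t m x - \<phi> n x) \<le> norm ((2 * real m + 1) * indicator ?K x :: real)" for n
    proof (rule AE_I2)
      fix x
      show "norm (t m x - \<phi> n x) \<le> norm ((2 * real m + 1) * indicator ?K x :: real)"
      proof (cases "x \<in> ?K")
        case True
        have "\<bar>t m x - \<phi> n x\<bar> \<le> 2 * real m + 1"
          using \<open>\<And>x. \<bar>t m x\<bar> \<le> real m\<close>[of x] \<phi>(2)[of n x] by linarith
        then show ?thesis using True by simp
      qed (use \<phi>(4)[of x n] in \<open>auto simp: t_def\<close>)
    qed
    show "compact ?K" using \<phi>(3) by auto
    show "(\<lambda>x. t m x - \<phi> n x) \<in> borel_measurable lebesgue" for n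
      using C_c_inf_measurable[OF \<phi>(1), of n] by measurable
  qed
  then obtain n where n: "sqn (\<lambda>x. t m x - \<phi> n x) < e/4"
    using order_tendstoD(2)[of _ 0 sequentially "e/4"] e eventually_sequentially by (metis (no_types, lifting) divide_pos_pos order_refl zero_less_numeral)
  have "sqrt (sqn (\<lambda>x. f x - \<phi> n x)) \<le> sqrt (sqn (\<lambda>x. f x - t m x)) + sqrt (sqn (\<lambda>x. t m x - \<phi> n x))"
    using L2_triangle[OF L2_UNIV_diff[OF f tL2] L2_UNIV_diff[OF tL2 C_c_inf_L2[OF \<phi>(1)]]] by simp
  also have "\<dots> < sqrt (e/4) + sqrt (e/4)"
    using m n by (intro add_strict_mono) (auto intro: real_sqrt_less_mono)
  also have "\<dots> = sqrt e" by (simp add: real_sqrt_divide)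
  finally have "sqn (\<lambda>x. f x - \<phi> n x) < e" by simp
  then show ?thesis using that \<phi>(1) by blast
qed

text \<open>By the density of the test functions in \<open>L\<^sup>2\<close>, bounds of integrals against test functions, such as the
  definition of a weak gradient provides, become bounds in \<open>L\<^sup>2\<close>.\<close>

lemma L2_norm_le_by_duality:
  fixes f :: "'a::euclidean_space \<Rightarrow> real"
  assumes f: "f \<in> L2 UNIV" and "C \<ge> 0"
    and le: "\<And>\<phi>. \<phi> \<in> C_c_inf UNIV \<Longrightarrow> (LINT x|lebesgue. f x * \<phi> x) \<le> C * sqrt (sqn \<phi>)"
  shows "sqrt (sqn f) \<le> C"
proof -
  have "sqn f \<le> C * sqrt (sqn f) + e" if e: "e > 0" for e
  proof -
    define d where "d = e / (sqrt (sqn f) + C + 1)"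
    have s: "sqrt (sqn f) \<ge> 0" by (auto intro: integral_nonneg_AE)
    have sp: "sqrt (sqn f) + C + 1 > 0" using s \<open>C \<ge> 0\<close> by linarith
    then have d: "d > 0" unfolding d_def using e by (rule divide_pos_pos[rotated])
    obtain \<phi> where \<phi>: "\<phi> \<in> C_c_inf UNIV" "sqn (\<lambda>x. f x - \<phi> x) < d\<^sup>2"
      using C_c_inf_dense_L2[OF f, of "d\<^sup>2"] d by auto
    note \<phi>L = C_c_inf_L2[OF \<phi>(1)]
    have sd: "sqrt (sqn (\<lambda>x. f x - \<phi> x)) \<le> d" using \<phi>(2) d by (intro real_le_lsqrt) auto
    have i: "integrable lebesgue (\<lambda>x. f x * (f x - \<phi> x))" "integrable lebesgue (\<lambda>x. f x * \<phi> x)"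
      using integrable_inner_L2[OF f L2_UNIV_diff[OF f \<phi>L]] integrable_inner_L2[OF f \<phi>L] by auto
    have "sqn f = (LINT x|lebesgue. f x * (f x - \<phi> x) + f x * \<phi> x)"
      by (simp add: power2_eq_square algebra_simps)
    also have "\<dots> = (LINT x|lebesgue. f x * (f x - \<phi> x)) + (LINT x|lebesgue. f x * \<phi> x)"
      by (rule Bochner_Integration.integral_add[OF i])
    also have "\<dots> \<le> sqrt (sqn f) * d + C * (sqrt (sqn f) + d)"
    proof (rule add_mono)
      have "(LINT x|lebesgue. f x * (f x - \<phi> x)) \<le> sqrt (sqn f) * sqrt (sqn (\<lambda>x. f x - \<phi> x))"
        using L2_cauchy_schwarz_inner[OF f L2_UNIV_diff[OF f \<phi>L]] by (simp add: abs_le_iff)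
      also have "\<dots> \<le> sqrt (sqn f) * d" by (intro mult_left_mono sd s)
      finally show "(LINT x|lebesgue. f x * (f x - \<phi> x)) \<le> sqrt (sqn f) * d" .
      have "sqrt (sqn \<phi>) \<le> sqrt (sqn f) + sqrt (sqn (\<lambda>x. f x - \<phi> x))"
        using L2_triangle_diff[OF f L2_UNIV_diff[OF f \<phi>L]] by simp
      then have "C * sqrt (sqn \<phi>) \<le> C * (sqrt (sqn f) + d)" using sd \<open>C \<ge> 0\<close> by (intro mult_left_mono) auto
      then show "(LINT x|lebesgue. f x * \<phi> x) \<le> C * (sqrt (sqn f) + d)" using le[OF \<phi>(1)] by linarith
    qed
    also have "\<dots> = C * sqrt (sqn f) + d * (sqrt (sqn f) + C)" by (simp add: algebra_simps)
    also have "\<dots> \<le> C * sqrt (sqn f) + e"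
    proof -
      have "d * (sqrt (sqn f) + C) \<le> d * (sqrt (sqn f) + C + 1)" using d by (intro mult_left_mono) auto
      also have "\<dots> = e" using sp by (simp add: d_def)
      finally show ?thesis by simp
    qed
    finally show ?thesis .
  qed
  then have "sqn f \<le> C * sqrt (sqn f)" by (rule field_le_epsilon)
  moreover have "sqn f = sqrt (sqn f) * sqrt (sqn f)" by simp
  ultimately show ?thesis
    by (smt (verit, best) \<open>C \<ge> 0\<close> mult_le_cancel_right real_sqrt_ge_zero)
qed

lemma L2_translation_continuous_real:
  fixes f :: "'a::euclidean_space \<Rightarrow> real"
  assumes f: "f \<in> L2 UNIV" and e: "e > 0"
  obtains d where "d > 0" "\<And>h. norm h < d \<Longrightarrow> sqrt (sqn (\<lambda>x. f (x + h) - f x)) \<le> e"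
proof -
  obtain \<phi> where \<phi>: "\<phi> \<in> C_c_inf UNIV" "sqn (\<lambda>x. f x - \<phi> x) < (e/3)\<^sup>2"
    using C_c_inf_dense_L2[OF f, of "(e/3)\<^sup>2"] e by auto
  note \<phi>L = C_c_inf_L2[OF \<phi>(1)]
  obtain C where C: "C > 0" "\<And>x y. \<bar>\<phi> x - \<phi> y\<bar> \<le> C * norm (x - y)"
    by (rule C_c_inf_lipschitz[OF \<phi>(1)]) auto
  obtain K where K: "compact K" "\<And>x. x \<notin> K \<Longrightarrow> \<phi> x = 0" using C_c_inf_support[OF \<phi>(1)] by auto
  obtain r where r: "r > 0" "K \<subseteq> cball 0 r" 
    using bounded_subset_ballD[OF compact_imp_bounded[OF K(1)], of 0] ball_subset_cball by blast
  define m where "m = measure lebesgue (cball (0::'a) (r + 1))"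
  define d where "d = min 1 (e / (3 * (C * sqrt m + 1)))"
  have pos: "C * sqrt m + 1 > 0" using C by (auto simp: m_def intro!: add_nonneg_pos)
  have d: "d > 0" using e pos by (auto simp: d_def)
  have sd: "sqrt (sqn (\<lambda>x. f x - \<phi> x)) \<le> e/3" using \<phi>(2) e by (intro real_le_lsqrt) auto
  have "sqrt (sqn (\<lambda>x. f (x + h) - f x)) \<le> e" if h: "norm h < d" for h
  proof -
    have "sqn (\<lambda>x. \<phi> (x + h) - \<phi> x) \<le> sqn (\<lambda>x. C * norm h * indicator (cball (0::'a) (r+1)) x :: real)"
    proof (rule sqn_mono[OF compact_indicator_L2[OF compact_cball] AE_I2])
      fix x
      show "norm (\<phi> (x + h) - \<phi> x) \<le> norm (C * norm h * indicator (cball 0 (r+1)) x :: real)"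
      proof (cases "x \<in> cball 0 (r + 1)")
        case True
        then show ?thesis using C(2)[of "x + h" x] C(1) by simp
      next
        case False
        have "norm x \<le> norm (x + h) + norm h" using norm_triangle_ineq4[of "x + h" h] by simp
        then have "x \<notin> K" "x + h \<notin> K" using False r h by (auto simp: d_def)
        then show ?thesis by (simp add: K(2))
      qed
    qed
    also have "\<dots> = (LINT x|lebesgue. (C * norm h)\<^sup>2 * indicator (cball (0::'a) (r+1)) x)"
      by (intro Bochner_Integration.integral_cong) (auto simp: indicator_def)
    also have "\<dots> = (C * norm h)\<^sup>2 * m" by (simp add: m_def)
    finally have "sqrt (sqn (\<lambda>x. \<phi> (x + h) - \<phi> x)) \<le> sqrt ((C * norm h)\<^sup>2 * m)" by simp
    also have "\<dots> = norm h * (C * sqrt m)" using C by (simp add: real_sqrt_mult)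
    also have "\<dots> \<le> e / (3 * (C * sqrt m + 1)) * (C * sqrt m + 1)"
    proof (rule mult_mono)
      show "norm h \<le> e / (3 * (C * sqrt m + 1))" using h by (simp add: d_def)
      then show "0 \<le> e / (3 * (C * sqrt m + 1))" using norm_ge_zero order_trans by blast
    qed (use C in \<open>auto simp: m_def\<close>)
    also have "\<dots> = e / 3"
      using pos by (metis less_irrefl nonzero_mult_div_cancel_right times_divide_eq_left mult_divide_mult_cancel_right)
    finally have 1: "sqrt (sqn (\<lambda>x. \<phi> (x + h) - \<phi> x)) \<le> e / 3" .
    have L: "(\<lambda>x. f x - \<phi> x) \<in> L2 UNIV" by (rule L2_UNIV_diff[OF f \<phi>L])
    have "sqrt (sqn (\<lambda>x. f (x + h) - f x))
        = sqrt (sqn (\<lambda>x. ((f (x + h) - \<phi> (x + h)) + (\<phi> (x + h) - \<phi> x)) - (f x - \<phi> x)))"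
      by simp
    also have "\<dots> \<le> sqrt (sqn (\<lambda>x. (f (x + h) - \<phi> (x + h)) + (\<phi> (x + h) - \<phi> x))) + e/3"
      using L2_triangle_diff[OF L2_UNIV_add[OF L2_UNIV_translate[OF L, of h] L2_UNIV_diff[OF L2_UNIV_translate[OF \<phi>L, of h] \<phi>L]] L] sd
      by linarith
    also have "\<dots> \<le> (sqrt (sqn (\<lambda>x. f (x + h) - \<phi> (x + h))) + e/3) + e/3"
      using L2_triangle[OF L2_UNIV_translate[OF L, of h] L2_UNIV_diff[OF L2_UNIV_translate[OF \<phi>L, of h] \<phi>L]] 1
      by linarith
    also have "\<dots> \<le> e" using sd sqn_translate[OF L, of h] by simp
    finally show ?thesis .
  qed
  then show ?thesis using that d by blast
qed

lemma L2_translation_continuous: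
  fixes f :: "'a::euclidean_space \<Rightarrow> 'b::euclidean_space"
  assumes f: "f \<in> L2 UNIV" and e: "e > 0"
  obtains d where "d > 0" "\<And>h. norm h < d \<Longrightarrow> sqrt (sqn (\<lambda>x. f (x + h) - f x)) \<le> e"
proof -
  define k where "k = e / sqrt (DIM('b))"
  have k: "k > 0" using e by (simp add: k_def)
  have "\<exists>d>0. \<forall>h. norm h < d \<longrightarrow> sqrt (sqn (\<lambda>x. f (x + h) \<bullet> b - f x \<bullet> b)) \<le> k" if b: "b \<in> Basis" for b
    by (rule L2_translation_continuous_real[OF L2_UNIV_component[OF f b] k]) auto
  then have "\<exists>d. \<forall>b\<in>Basis. d b > 0 \<and> (\<forall>h. norm h < d b \<longrightarrow> sqrt (sqn (\<lambda>x. f (x + h) \<bullet> b - f x \<bullet> b)) \<le> k)"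
    by (intro bchoice) auto
  then obtain d where d: "\<And>b. b \<in> Basis \<Longrightarrow> d b > 0"
      "\<And>b h. b \<in> Basis \<Longrightarrow> norm h < d b \<Longrightarrow> sqrt (sqn (\<lambda>x. f (x + h) \<bullet> b - f x \<bullet> b)) \<le> k"
    by auto
  define D where "D = Min (d ` Basis)"
  have D: "D > 0" unfolding D_def using d(1) by (subst Min_gr_iff) auto
  have "sqrt (sqn (\<lambda>x. f (x + h) - f x)) \<le> e" if h: "norm h < D" for h
  proof -
    have L: "(\<lambda>x. f (x + h) - f x) \<in> L2 UNIV" by (rule L2_UNIV_diff[OF L2_UNIV_translate[OF f] f])
    have sq: "(norm v)\<^sup>2 = (\<Sum>b\<in>Basis. (norm (v \<bullet> b))\<^sup>2)" for v :: 'b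
      unfolding power2_norm_eq_inner by (subst euclidean_inner) (simp add: power2_eq_square)
    have "sqn (\<lambda>x. f (x + h) - f x) = (\<Sum>b\<in>Basis. sqn (\<lambda>x. (f (x + h) - f x) \<bullet> b))"
      by (subst sq) (intro Bochner_Integration.integral_sum L2_UNIV_integrable L2_UNIV_component[OF L])
    also have "\<dots> \<le> (\<Sum>b\<in>(Basis::'b set). k\<^sup>2)"
    proof (rule sum_mono)
      fix b :: 'b assume b: "b \<in> Basis"
      have "norm h < d b" using h b by (auto simp: D_def)
      from d(2)[OF b this] show "sqn (\<lambda>x. (f (x + h) - f x) \<bullet> b) \<le> k\<^sup>2"
        by (simp add: sqrt_le_D inner_diff_left)
    qed
    also have "\<dots> = e\<^sup>2" by (simp add: k_def power_divide)
    finally show ?thesis using e by (simp add: real_le_lsqrt)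
  qed
  then show ?thesis using that D by blast
qed

section \<open>Weak gradients\<close>

lemma L1_loc_mult_integrable:
  fixes v :: "'a::euclidean_space \<Rightarrow> 'b::euclidean_space"
  assumes v: "v \<in> L1_loc U" and K: "compact K" "K \<subseteq> U"
    and \<phi>: "\<phi> \<in> borel_measurable lebesgue" "\<And>x. \<bar>\<phi> x\<bar> \<le> B" "\<And>x. x \<notin> K \<Longrightarrow> \<phi> x = 0"
  shows "integrable lebesgue (\<lambda>x. \<phi> x *\<^sub>R v x)"
proof -
  have i: "integrable lebesgue (\<lambda>x. indicator K x *\<^sub>R v x)"
    using v K by (auto simp: L1_loc_def set_integrable_def)
  have "integrable lebesgue (\<lambda>x. \<phi> x *\<^sub>R (indicator K x *\<^sub>R v x))"
  proof (rule Bochner_Integration.integrable_bound[OF integrable_scaleR_right[OF i, of B]])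
    show "(\<lambda>x. \<phi> x *\<^sub>R indicat_real K x *\<^sub>R v x) \<in> borel_measurable lebesgue"
      using \<phi>(1) borel_measurable_integrable[OF i] by measurable
    show "AE x in lebesgue. norm (\<phi> x *\<^sub>R indicat_real K x *\<^sub>R v x) \<le> norm (B *\<^sub>R indicat_real K x *\<^sub>R v x)"
    proof (rule AE_I2)
      fix x
      have "\<bar>\<phi> x\<bar> \<le> \<bar>B\<bar>" using \<phi>(2)[of x] by linarith
      then have "norm (\<phi> x *\<^sub>R w) \<le> norm (B *\<^sub>R w)" for w :: 'b by (simp add: mult_right_mono)
      then show "norm (\<phi> x *\<^sub>R indicat_real K x *\<^sub>R v x) \<le> norm (B *\<^sub>R indicat_real K x *\<^sub>R v x)" .
    qed
  qed
  moreover have "\<phi> x *\<^sub>R (indicator K x *\<^sub>R v x) = \<phi> x *\<^sub>R v x" for x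
    using \<phi>(3)[of x] by (cases "x \<in> K") auto
  ultimately show ?thesis by (simp only:)
qed

lemma L1_loc_test_integrable:
  fixes v :: "'a::euclidean_space \<Rightarrow> 'b::euclidean_space"
  assumes "v \<in> L1_loc U" "\<phi> \<in> C_c_inf U"
  shows "integrable lebesgue (\<lambda>x. \<phi> x *\<^sub>R v x)"
proof -
  obtain K where K: "compact K" "K \<subseteq> U" "\<And>x. x \<notin> K \<Longrightarrow> \<phi> x = 0" using C_c_inf_support[OF assms(2)] by auto
  obtain B where "\<And>x. \<bar>\<phi> x\<bar> \<le> B" by (rule C_c_inf_bounded[OF assms(2)]) auto
  then show ?thesis
    using L1_loc_mult_integrable[OF assms(1) K(1,2) C_c_inf_measurable[OF assms(2)] _ K(3)] by auto
qed

lemma L1_loc_mono: "v \<in> L1_loc U \<Longrightarrow> V \<subseteq> U \<Longrightarrow> v \<in> L1_loc V"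
  by (auto simp: L1_loc_def)

lemma L2_indicator:
  fixes h :: "'a::euclidean_space \<Rightarrow> 'b::euclidean_space"
  assumes "K \<in> sets lebesgue"
  shows "h \<in> L2 K \<longleftrightarrow> (\<lambda>x. indicator K x *\<^sub>R h x) \<in> L2 UNIV"
proof -
  have K: "K \<inter> space lebesgue \<in> sets lebesgue" using assms by simp
  have "(norm (indicat_real K x *\<^sub>R h x))\<^sup>2 = indicat_real K x *\<^sub>R (norm (h x))\<^sup>2" for x
    by (auto simp: indicator_def)
  then show ?thesis
    unfolding L2_def mem_Collect_eq lebesgue_on_UNIV_eq
    using borel_measurable_restrict_space_iff[OF K, of h]
      integrable_restrict_space[OF K, of "\<lambda>x. (norm (h x))\<^sup>2"] by simp
qed

lemma L2_mono_set:
  assumes "h \<in> L2 K" "M \<subseteq> K" "K \<in> sets lebesgue" "M \<in> sets lebesgue"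
  shows "h \<in> L2 M"
proof -
  have "(\<lambda>x. indicat_real M x *\<^sub>R (indicat_real K x *\<^sub>R h x)) \<in> L2 UNIV"
    by (rule L2_UNIV_mult_bounded[of _ _ 1])
      (use assms L2_indicator in \<open>auto simp: indicator_def\<close>)
  moreover have "indicat_real M x *\<^sub>R (indicat_real K x *\<^sub>R h x) = indicat_real M x *\<^sub>R h x" for x
    using assms(2) by (auto simp: indicator_def)
  ultimately have "(\<lambda>x. indicat_real M x *\<^sub>R h x) \<in> L2 UNIV" by (simp only:)
  then show ?thesis using L2_indicator[OF assms(4)] by blast
qed

lemma L2_imp_L2_loc: "h \<in> L2 U \<Longrightarrow> U \<in> sets lebesgue \<Longrightarrow> h \<in> L2_loc U"
  using L2_mono_set[of h U] lmeasurable_compact by (auto simp: L2_loc_def fmeasurable_def)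

lemma L2_loc_imp_L1_loc:
  fixes h :: "'a::euclidean_space \<Rightarrow> 'b::euclidean_space"
  assumes "h \<in> L2_loc U"
  shows "h \<in> L1_loc U"
  unfolding L1_loc_def
proof (safe)
  fix K assume K: "compact K" "K \<subseteq> U"
  have hK: "(\<lambda>x. indicator K x *\<^sub>R h x) \<in> L2 UNIV"
    using assms K lmeasurable_compact[OF K(1)] L2_indicator[of K h] by (auto simp: L2_loc_def fmeasurable_def)
  have "integrable lebesgue (\<lambda>x. norm (indicator K x *\<^sub>R h x) * norm (1 * indicator K x :: real))"
    by (rule integrable_norm_mult_L2[OF hK compact_indicator_L2[OF K(1)]])
  moreover have "norm (indicator K x *\<^sub>R h x) * norm (1 * indicator K x :: real) = norm (indicat_real K x *\<^sub>R h x)" for x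
    by (simp add: indicator_def)
  ultimately have "integrable lebesgue (\<lambda>x. norm (indicat_real K x *\<^sub>R h x))" by (simp only:)
  then show "h absolutely_integrable_on K"
    unfolding set_integrable_def by (rule integrable_norm_cancel) (use hK L2_UNIV_measurable in auto)
qed

lemma L2_UNIV_imp_L1_loc: "h \<in> L2 UNIV \<Longrightarrow> h \<in> L1_loc U"
  by (intro L1_loc_mono[OF L2_loc_imp_L1_loc[OF L2_imp_L2_loc]]) auto

lemma has_weak_gradient_iff:
  "has_weak_gradient U u G \<longleftrightarrow> u \<in> L1_loc U \<and> G \<in> L1_loc U \<and>
     (\<forall>\<phi>\<in>C_c_inf U. \<forall>b\<in>Basis. (LINT x|lebesgue. u x * pderivative b \<phi> x) = - (LINT x|lebesgue. (G x \<bullet> b) * \<phi> x))"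
proof -
  have "(LINT x:U|lebesgue. u x * pderivative b \<phi> x) = (LINT x|lebesgue. u x * pderivative b \<phi> x)"
       "(LINT x:U|lebesgue. (G x \<bullet> b) * \<phi> x) = (LINT x|lebesgue. (G x \<bullet> b) * \<phi> x)"
    if \<phi>: "\<phi> \<in> C_c_inf U" and b: "b \<in> Basis" for \<phi> b
  proof -
    have "\<exists>K\<subseteq>U. \<forall>x. x \<notin> K \<longrightarrow> \<psi> x = 0" if "\<psi> \<in> C_c_inf U" for \<psi> using C_c_inf_support[OF that] by auto
    note this[OF \<phi>] this[OF C_c_inf_pderivative[OF \<phi> b]]
    then have "\<phi> x = 0" "pderivative b \<phi> x = 0" if "x \<notin> U" for x using that by auto
    then show "(LINT x:U|lebesgue. u x * pderivative b \<phi> x) = (LINT x|lebesgue. u x * pderivative b \<phi> x)"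
       "(LINT x:U|lebesgue. (G x \<bullet> b) * \<phi> x) = (LINT x|lebesgue. (G x \<bullet> b) * \<phi> x)"
      unfolding set_lebesgue_integral_def
      by (auto intro!: Bochner_Integration.integral_cong simp: indicator_def)
  qed
  then show ?thesis unfolding has_weak_gradient_def by auto
qed

lemma has_weak_gradientD:
  assumes "has_weak_gradient U u G" "\<phi> \<in> C_c_inf U" "b \<in> Basis"
  shows "(LINT x|lebesgue. u x * pderivative b \<phi> x) = - (LINT x|lebesgue. (G x \<bullet> b) * \<phi> x)"
  using assms by (simp add: has_weak_gradient_iff)

lemma has_weak_gradient_subset: "has_weak_gradient U u G \<Longrightarrow> V \<subseteq> U \<Longrightarrow> has_weak_gradient V u G"
  using C_c_inf_mono[of V U] by (auto simp: has_weak_gradient_iff intro: L1_loc_mono)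

lemma L1_loc_AE_cong:
  fixes u v :: "'a::euclidean_space \<Rightarrow> 'b::euclidean_space"
  assumes "u \<in> L1_loc U" "AE x in lebesgue. x \<in> U \<longrightarrow> u x = v x"
  shows "v \<in> L1_loc U"
  unfolding L1_loc_def set_integrable_def
proof safe
  fix K assume K: "compact K" "K \<subseteq> U"
  have i: "integrable lebesgue (\<lambda>x. indicator K x *\<^sub>R u x)"
    using assms(1) K by (auto simp: L1_loc_def set_integrable_def)
  have e: "AE x in lebesgue. indicat_real K x *\<^sub>R u x = indicat_real K x *\<^sub>R v x"
    using assms(2) by eventually_elim (use K in \<open>auto simp: indicator_def\<close>)
  have m: "(\<lambda>x. indicat_real K x *\<^sub>R v x) \<in> borel_measurable lebesgue"
    by (rule lebesgue_measurable_AE_cong[OF borel_measurable_integrable[OF i] e])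
  show "integrable lebesgue (\<lambda>x. indicat_real K x *\<^sub>R v x)"
    using integrable_cong_AE[OF borel_measurable_integrable[OF i] m e] i by simp
qed

lemma L1_loc_linear:
  fixes u v :: "'a::euclidean_space \<Rightarrow> 'b::euclidean_space"
  assumes "u \<in> L1_loc U" "v \<in> L1_loc U"
  shows "(\<lambda>x. c *\<^sub>R u x + d *\<^sub>R v x) \<in> L1_loc U"
  using assms by (auto simp: L1_loc_def intro!: set_integral_add set_integrable_scaleR_right)

lemma integral_test_AE_cong:
  fixes u v :: "'a::euclidean_space \<Rightarrow> real"
  assumes "u \<in> L1_loc U" "AE x in lebesgue. x \<in> U \<longrightarrow> u x = v x" "\<phi> \<in> C_c_inf U"
  shows "(LINT x|lebesgue. u x * \<phi> x) = (LINT x|lebesgue. v x * \<phi> x)"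
proof (rule integral_cong_AE)
  show "AE x in lebesgue. u x * \<phi> x = v x * \<phi> x"
    using assms(2) C_c_inf_support[OF assms(3)] by (auto elim!: eventually_mono)
qed (use L1_loc_test_integrable[OF assms(1,3)] L1_loc_test_integrable[OF L1_loc_AE_cong[OF assms(1,2)] assms(3)]
    in \<open>auto simp: mult.commute dest: borel_measurable_integrable\<close>)

lemma L1_loc_component:
  fixes G :: "'a::euclidean_space \<Rightarrow> 'b::euclidean_space"
  assumes "G \<in> L1_loc U"
  shows "(\<lambda>x. G x \<bullet> b) \<in> L1_loc U"
  unfolding L1_loc_def set_integrable_def
proof safe
  fix K assume K: "compact K" "K \<subseteq> U"
  have "integrable lebesgue (\<lambda>x. (indicat_real K x *\<^sub>R G x) \<bullet> b)"
    using assms K by (intro integrable_inner_left) (auto simp: L1_loc_def set_integrable_def)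
  then show "integrable lebesgue (\<lambda>x. indicat_real K x *\<^sub>R (G x \<bullet> b))" by simp
qed

lemma has_weak_gradient_AE_cong:
  assumes w: "has_weak_gradient U u G"
    and u: "AE x in lebesgue. x \<in> U \<longrightarrow> u x = v x" and G: "AE x in lebesgue. x \<in> U \<longrightarrow> G x = H x"
  shows "has_weak_gradient U v H"
proof -
  have L: "u \<in> L1_loc U" "G \<in> L1_loc U" using w by (auto simp: has_weak_gradient_iff)
  show ?thesis unfolding has_weak_gradient_iff
  proof (intro conjI ballI)
    fix \<phi> b assume \<phi>: "\<phi> \<in> C_c_inf U" and b: "(b::'a) \<in> Basis"
    have Gb: "AE x in lebesgue. x \<in> U \<longrightarrow> G x \<bullet> b = H x \<bullet> b" using G by eventually_elim simp
    show "(LINT x|lebesgue. v x * pderivative b \<phi> x) = - (LINT x|lebesgue. (H x \<bullet> b) * \<phi> x)"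
      using integral_test_AE_cong[OF L(1) u C_c_inf_pderivative[OF \<phi> b]]
        integral_test_AE_cong[OF L1_loc_component[OF L(2)] Gb \<phi>] has_weak_gradientD[OF w \<phi> b] by simp
  qed (use L1_loc_AE_cong[OF L(1) u] L1_loc_AE_cong[OF L(2) G] in auto)
qed

lemma has_weak_gradient_linear:
  assumes u: "has_weak_gradient U u G" and v: "has_weak_gradient U v H"
  shows "has_weak_gradient U (\<lambda>x. c * u x + d * v x) (\<lambda>x. c *\<^sub>R G x + d *\<^sub>R H x)"
proof -
  have L: "u \<in> L1_loc U" "G \<in> L1_loc U" "v \<in> L1_loc U" "H \<in> L1_loc U"
    using u v by (auto simp: has_weak_gradient_iff)
  show ?thesis unfolding has_weak_gradient_iff
  proof (intro conjI ballI)
    fix \<phi> b assume \<phi>: "\<phi> \<in> C_c_inf U" and b: "(b::'a) \<in> Basis"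
    note i = L1_loc_test_integrable[OF L(1) C_c_inf_pderivative[OF \<phi> b]]
      L1_loc_test_integrable[OF L(3) C_c_inf_pderivative[OF \<phi> b]]
      L1_loc_test_integrable[OF L1_loc_component[OF L(2)] \<phi>] L1_loc_test_integrable[OF L1_loc_component[OF L(4)] \<phi>]
    have "(LINT x|lebesgue. (c * u x + d * v x) * pderivative b \<phi> x)
        = (LINT x|lebesgue. c * (pderivative b \<phi> x *\<^sub>R u x) + d * (pderivative b \<phi> x *\<^sub>R v x))"
      by (simp add: algebra_simps)
    also have "\<dots> = c * (LINT x|lebesgue. u x * pderivative b \<phi> x) + d * (LINT x|lebesgue. v x * pderivative b \<phi> x)"
      using i(1,2) by (simp add: mult.commute)
    also have "\<dots> = - (c * (LINT x|lebesgue. (G x \<bullet> b) * \<phi> x) + d * (LINT x|lebesgue. (H x \<bullet> b) * \<phi> x))"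
      by (simp add: has_weak_gradientD[OF u \<phi> b] has_weak_gradientD[OF v \<phi> b])
    also have "\<dots> = - (LINT x|lebesgue. c * (\<phi> x *\<^sub>R (G x \<bullet> b)) + d * (\<phi> x *\<^sub>R (H x \<bullet> b)))"
      using i(3,4) by (simp add: mult.commute)
    also have "\<dots> = - (LINT x|lebesgue. ((c *\<^sub>R G x + d *\<^sub>R H x) \<bullet> b) * \<phi> x)"
      by (simp add: algebra_simps)
    finally show "(LINT x|lebesgue. (c * u x + d * v x) * pderivative b \<phi> x)
        = - (LINT x|lebesgue. ((c *\<^sub>R G x + d *\<^sub>R H x) \<bullet> b) * \<phi> x)" .
  qed (use L1_loc_linear[OF L(1,3), of c d] L1_loc_linear[OF L(2,4), of c d] in auto)
qed

lemma L1_loc_const: "(\<lambda>x::'a::euclidean_space. c::'b::euclidean_space) \<in> L1_loc U"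
  unfolding L1_loc_def set_integrable_def
proof safe
  fix K :: "'a set" assume "compact K"
  then have "K \<in> sets lebesgue" "emeasure lebesgue K < \<infinity>"
    using lmeasurable_compact[of K] unfolding fmeasurable_def by blast+
  then show "integrable lebesgue (\<lambda>x. indicat_real K x *\<^sub>R c)"
    by (intro integrable_scaleR_left integrable_real_indicator)
qed

lemma has_weak_gradient_zero: "has_weak_gradient U (\<lambda>x. 0) (\<lambda>x. 0)"
  by (auto simp: has_weak_gradient_iff L1_loc_const)

text \<open>The fundamental lemma of the calculus of variations, in an inequality form that yields both the
  uniqueness of weak gradients and the bound of the gradient of a Lipschitz function. The inequality is
  tested with approximations of the indicator function of a part of \<open>{v > L}\<close>.\<close>

lemma AE_le_if_test_le:
  fixes v :: "'a::euclidean_space \<Rightarrow> real"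
  assumes v: "v \<in> L1_loc U" and U: "open U"
    and le: "\<And>\<phi>. \<phi> \<in> C_c_inf U \<Longrightarrow> (LINT x|lebesgue. v x * \<phi> x) \<le> L * (LINT x|lebesgue. \<bar>\<phi> x\<bar>)"
  shows "AE x in lebesgue. x \<in> U \<longrightarrow> v x \<le> L"
proof -
  have K: "AE x in lebesgue. x \<in> K \<longrightarrow> v x \<le> L" if K: "compact K" "K \<subseteq> U" for K
  proof -
    have Km: "K \<in> sets lebesgue" using lmeasurable_compact[OF K(1)] by auto
    define P where "P = {x \<in> K. v x > L}"
    have iK: "integrable lebesgue (\<lambda>x. indicator K x *\<^sub>R v x)"
      using v K by (auto simp: L1_loc_def set_integrable_def)
    note [measurable] = borel_measurable_integrable[OF this] Km
    have "P = {x \<in> space lebesgue. indicat_real K x *\<^sub>R v x > L} \<inter> K" by (auto simp: P_def)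
    also have "\<dots> \<in> sets lebesgue" by measurable
    finally have P [measurable]: "P \<in> sets lebesgue" .
    obtain \<phi> M where \<phi>: "\<And>n::nat. \<phi> n \<in> C_c_inf U" "\<And>n x. \<bar>\<phi> n x\<bar> \<le> 1 + 1" "compact M" "M \<subseteq> U"
        "\<And>n x. x \<notin> M \<Longrightarrow> \<phi> n x = 0" "AE x in lebesgue. (\<lambda>n. \<phi> n x) \<longlonglongrightarrow> indicat_real P x"
      by (rule bounded_approx_test_functions[of "indicat_real P" 1 K U]) (use K U P in \<open>auto simp: P_def\<close>)
    have Mm: "M \<in> sets lebesgue" using lmeasurable_compact[OF \<phi>(3)] by auto
    have iM: "integrable lebesgue (\<lambda>x. indicator M x *\<^sub>R v x)"
      using v \<phi>(3,4) by (auto simp: L1_loc_def set_integrable_def)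
    have mv: "(\<lambda>x. v x * \<phi> n x) \<in> borel_measurable lebesgue" for n
      using L1_loc_test_integrable[OF v \<phi>(1)[of n]] by (auto simp: mult.commute dest: borel_measurable_integrable)
    have vP: "v x * indicat_real P x = (indicat_real K x *\<^sub>R v x) * indicat_real P x" for x
      by (auto simp: indicator_def P_def)
    have l1: "(\<lambda>n. LINT x|lebesgue. v x * \<phi> n x) \<longlonglongrightarrow> (LINT x|lebesgue. v x * indicat_real P x)"
    proof (rule integral_dominated_convergence[where w = "\<lambda>x. 2 * norm (indicator M x *\<^sub>R v x)"])
      show "(\<lambda>x. v x * indicat_real P x) \<in> borel_measurable lebesgue" unfolding vP by measurable
      show "AE x in lebesgue. (\<lambda>n. v x * \<phi> n x) \<longlonglongrightarrow> v x * indicat_real P x"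
        using \<phi>(6) by eventually_elim (intro tendsto_intros)
      show "AE x in lebesgue. norm (v x * \<phi> n x) \<le> 2 * norm (indicat_real M x *\<^sub>R v x)" for n
      proof (rule AE_I2)
        fix x show "norm (v x * \<phi> n x) \<le> 2 * norm (indicat_real M x *\<^sub>R v x)"
          using \<phi>(2)[of n x] \<phi>(5)[of x n] mult_left_mono[of "\<bar>\<phi> n x\<bar>" 2 "\<bar>v x\<bar>"]
          by (cases "x \<in> M") (auto simp: abs_mult)
      qed
    qed (use iM mv in auto)
    have l2: "(\<lambda>n. LINT x|lebesgue. \<bar>\<phi> n x\<bar>) \<longlonglongrightarrow> (LINT x|lebesgue. \<bar>indicat_real P x\<bar>)"
    proof (rule integral_dominated_convergence[where w = "\<lambda>x. 2 * indicat_real M x"])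
      show "AE x in lebesgue. (\<lambda>n. \<bar>\<phi> n x\<bar>) \<longlonglongrightarrow> \<bar>indicat_real P x\<bar>"
        using \<phi>(6) by eventually_elim (intro tendsto_intros)
      show "AE x in lebesgue. norm \<bar>\<phi> n x\<bar> \<le> 2 * indicat_real M x" for n
      proof (rule AE_I2)
        fix x show "norm \<bar>\<phi> n x\<bar> \<le> 2 * indicat_real M x"
          using \<phi>(2)[of n x] \<phi>(5)[of x n] by (cases "x \<in> M") auto
      qed
      show "integrable lebesgue (\<lambda>x. 2 * indicat_real M x)" by (rule compact_integrable_indicator[OF \<phi>(3)])
    qed (use C_c_inf_measurable[OF \<phi>(1)] in measurable)
    have "(LINT x|lebesgue. v x * indicat_real P x) \<le> L * (LINT x|lebesgue. \<bar>indicat_real P x\<bar>)"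
      by (rule LIMSEQ_le[OF l1 tendsto_mult_left[OF l2]]) (use le[OF \<phi>(1)] in auto)
    moreover have iP: "integrable lebesgue (\<lambda>x. v x * indicat_real P x)"
      unfolding vP by (rule integrable_real_mult_indicator) (use iK P in auto)
    moreover have iP2: "integrable lebesgue (\<lambda>x. indicat_real P x)"
    proof (rule integrable_real_indicator[OF P])
      have "emeasure lebesgue P \<le> emeasure lebesgue K" by (intro emeasure_mono Km) (auto simp: P_def)
      also have "\<dots> < \<infinity>" using lmeasurable_compact[OF K(1)] by (simp add: fmeasurable_def)
      finally show "emeasure lebesgue P < \<infinity>" .
    qed
    ultimately have "(LINT x|lebesgue. v x * indicat_real P x - L * indicat_real P x) \<le> 0" by simp
    moreover have nn: "v x * indicat_real P x - L * indicat_real P x \<ge> 0" for x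
      by (auto simp: P_def indicator_def)
    ultimately have z: "(LINT x|lebesgue. v x * indicat_real P x - L * indicat_real P x) = 0"
      by (intro antisym integral_nonneg_AE) auto
    have "AE x in lebesgue. v x * indicat_real P x - L * indicat_real P x = 0"
      using z by (subst (asm) integral_nonneg_eq_0_iff_AE) (use nn iP iP2 in auto)
    then show ?thesis by eventually_elim (auto simp: P_def indicator_def split: if_splits)
  qed
  obtain C where C: "\<And>n::nat. compact (C n)" "\<And>n. C n \<subseteq> U" "\<Union>(range C) = U"
    using open_Union_compact_subsets[OF U] by metis
  have "AE x in lebesgue. \<forall>n. x \<in> C n \<longrightarrow> v x \<le> L"
    unfolding AE_all_countable using K C by auto
  then show ?thesis by eventually_elim (use C(3) in auto)
qed

lemma AE_eq_0_if_test_eq_0: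
  fixes v :: "'a::euclidean_space \<Rightarrow> real"
  assumes v: "v \<in> L1_loc U" and U: "open U"
    and eq: "\<And>\<phi>. \<phi> \<in> C_c_inf U \<Longrightarrow> (LINT x|lebesgue. v x * \<phi> x) = 0"
  shows "AE x in lebesgue. x \<in> U \<longrightarrow> v x = 0"
proof -
  have "AE x in lebesgue. x \<in> U \<longrightarrow> v x \<le> 0"
    by (rule AE_le_if_test_le[OF v U]) (simp add: eq)
  moreover have "(\<lambda>x. - v x) \<in> L1_loc U"
    using L1_loc_linear[OF v v, of "-1" 0] by simp
  then have "AE x in lebesgue. x \<in> U \<longrightarrow> - v x \<le> 0"
    by (rule AE_le_if_test_le[OF _ U]) (simp add: eq)
  ultimately show ?thesis by eventually_elim auto
qed

lemma AE_Basis_eqI: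
  fixes f g :: "'a \<Rightarrow> 'b::euclidean_space"
  assumes "\<And>b. b \<in> Basis \<Longrightarrow> AE x in M. Q x \<longrightarrow> f x \<bullet> b = g x \<bullet> b"
  shows "AE x in M. Q x \<longrightarrow> f x = g x"
proof -
  have "AE x in M. \<forall>b\<in>Basis. Q x \<longrightarrow> f x \<bullet> b = g x \<bullet> b"
    using assms by (intro AE_finite_allI) auto
  then show ?thesis by eventually_elim (auto intro: euclidean_eqI)
qed

lemma weak_gradient_unique:
  assumes G: "has_weak_gradient U u G" and H: "has_weak_gradient U u H" and U: "open U"
  shows "AE x in lebesgue. x \<in> U \<longrightarrow> G x = H x"
proof (rule AE_Basis_eqI)
  fix b :: 'a assume b: "b \<in> Basis"
  have L: "G \<in> L1_loc U" "H \<in> L1_loc U" using G H by (auto simp: has_weak_gradient_iff)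
  have Lb: "(\<lambda>x. G x \<bullet> b - H x \<bullet> b) \<in> L1_loc U"
    using L1_loc_linear[OF L1_loc_component[OF L(1), of b] L1_loc_component[OF L(2), of b], of 1 "-1"] by simp
  have "AE x in lebesgue. x \<in> U \<longrightarrow> G x \<bullet> b - H x \<bullet> b = 0"
  proof (rule AE_eq_0_if_test_eq_0[OF Lb U])
    fix \<phi> assume \<phi>: "\<phi> \<in> C_c_inf U"
    have "(LINT x|lebesgue. (G x \<bullet> b - H x \<bullet> b) * \<phi> x)
        = (LINT x|lebesgue. \<phi> x *\<^sub>R (G x \<bullet> b)) - (LINT x|lebesgue. \<phi> x *\<^sub>R (H x \<bullet> b))"
      using L1_loc_test_integrable[OF L1_loc_component[OF L(1), of b] \<phi>] L1_loc_test_integrable[OF L1_loc_component[OF L(2), of b] \<phi>]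
      by (subst Bochner_Integration.integral_diff[symmetric]) (auto simp: algebra_simps)
    also have "\<dots> = 0"
      using has_weak_gradientD[OF G \<phi> b] has_weak_gradientD[OF H \<phi> b] by (simp add: mult.commute)
    finally show "(LINT x|lebesgue. (G x \<bullet> b - H x \<bullet> b) * \<phi> x) = 0" .
  qed
  then show "AE x in lebesgue. x \<in> U \<longrightarrow> G x \<bullet> b = H x \<bullet> b" by eventually_elim simp
qed

lemma weak_gradient_works: "has_weak_gradient U u G \<Longrightarrow> has_weak_gradient U u (weak_gradient U u)"
  unfolding weak_gradient_def by (rule someI[of "has_weak_gradient U u"])

lemma has_weak_gradient_scale:
  fixes u :: "'a::euclidean_space \<Rightarrow> real"
  assumes w: "has_weak_gradient UNIV u G" and r: "r > 0"
  shows "has_weak_gradient UNIV (\<lambda>x. inverse r * u (r *\<^sub>R x)) (\<lambda>x. G (r *\<^sub>R x))"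
proof -
  have L: "u \<in> L1_loc UNIV" "G \<in> L1_loc UNIV" using w by (auto simp: has_weak_gradient_iff)
  have scale: "(\<lambda>x. c *\<^sub>R h (r *\<^sub>R x)) \<in> L1_loc UNIV" if h: "h \<in> L1_loc UNIV" for h :: "'a \<Rightarrow> 'c::euclidean_space" and c
    unfolding L1_loc_def set_integrable_def
  proof safe
    fix K :: "'a set" assume K: "compact K"
    let ?M = "(\<lambda>x. r *\<^sub>R x) ` K"
    have "compact ?M" using K by (intro compact_continuous_image continuous_intros)
    then have i: "integrable lebesgue (\<lambda>x. indicator ?M x *\<^sub>R h x)"
      using h by (auto simp: L1_loc_def set_integrable_def)
    have "integrable lebesgue (\<lambda>x. indicator ?M (r *\<^sub>R x) *\<^sub>R h (r *\<^sub>R x))"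
      using integrable_affine[OF borel_measurable_integrable[OF i], of r 0] i r by simp
    moreover have "indicat_real ?M (r *\<^sub>R x) = indicat_real K x" for x
      using r by (auto simp: indicator_def)
    ultimately show "integrable lebesgue (\<lambda>x. indicat_real K x *\<^sub>R c *\<^sub>R h (r *\<^sub>R x))"
      using integrable_scaleR_right[of c lebesgue "\<lambda>x. indicat_real K x *\<^sub>R h (r *\<^sub>R x)"]
      by (simp add: mult.commute)
  qed
  show ?thesis unfolding has_weak_gradient_iff
  proof (intro conjI ballI)
    show "(\<lambda>x. inverse r * u (r *\<^sub>R x)) \<in> L1_loc UNIV" using scale[OF L(1), of "inverse r"] by simp
    show "(\<lambda>x. G (r *\<^sub>R x)) \<in> L1_loc UNIV" using scale[OF L(2), of 1] by simp
    fix \<phi> :: "'a \<Rightarrow> real" and b :: 'a assume \<phi>: "\<phi> \<in> C_c_inf UNIV" and b: "b \<in> Basis"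
    define \<psi> where "\<psi> = (\<lambda>y::'a. \<phi> (inverse r *\<^sub>R y + 0))"
    have \<psi>: "\<psi> \<in> C_c_inf UNIV" unfolding \<psi>_def by (rule C_c_inf_affine[OF \<phi>]) (use r in auto)
    have \<psi>r: "\<psi> (r *\<^sub>R x) = \<phi> x" "pderivative b \<psi> (r *\<^sub>R x) = inverse r * pderivative b \<phi> x" for x
      using r by (simp_all add: \<psi>_def pderivative_affine[OF C_c_inf_smooth[OF \<phi>], of "inverse r" 0, simplified])
    have 1: "(LINT x|lebesgue. u x * pderivative b \<psi> x)
        = \<bar>r\<bar> ^ DIM('a) *\<^sub>R (LINT x|lebesgue. u (r *\<^sub>R x + 0) * pderivative b \<psi> (r *\<^sub>R x + 0))"
      by (rule integral_affine)
        (use r borel_measurable_integrable[OF L1_loc_test_integrable[OF L(1) C_c_inf_pderivative[OF \<psi> b]]]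
          in \<open>auto simp: mult.commute\<close>)
    have 2: "(LINT x|lebesgue. (G x \<bullet> b) * \<psi> x)
        = \<bar>r\<bar> ^ DIM('a) *\<^sub>R (LINT x|lebesgue. (G (r *\<^sub>R x + 0) \<bullet> b) * \<psi> (r *\<^sub>R x + 0))"
      by (rule integral_affine)
        (use r borel_measurable_integrable[OF L1_loc_test_integrable[OF L1_loc_component[OF L(2)] \<psi>]]
          in \<open>auto simp: mult.commute\<close>)
    have "\<bar>r\<bar> ^ DIM('a) * (LINT x|lebesgue. u (r *\<^sub>R x) * (inverse r * pderivative b \<phi> x))
        = - (\<bar>r\<bar> ^ DIM('a) * (LINT x|lebesgue. (G (r *\<^sub>R x) \<bullet> b) * \<phi> x))"
      using has_weak_gradientD[OF w \<psi> b] by (simp add: 1 2 \<psi>r)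
    then have "\<bar>r\<bar> ^ DIM('a) * (LINT x|lebesgue. u (r *\<^sub>R x) * (inverse r * pderivative b \<phi> x))
        = \<bar>r\<bar> ^ DIM('a) * (- (LINT x|lebesgue. (G (r *\<^sub>R x) \<bullet> b) * \<phi> x))"
      by (simp only: mult_minus_right)
    then have "(LINT x|lebesgue. u (r *\<^sub>R x) * (inverse r * pderivative b \<phi> x))
        = - (LINT x|lebesgue. (G (r *\<^sub>R x) \<bullet> b) * \<phi> x)"
      unfolding mult_cancel_left using r by auto
    then show "(LINT x|lebesgue. inverse r * u (r *\<^sub>R x) * pderivative b \<phi> x)
        = - (LINT x|lebesgue. (G (r *\<^sub>R x) \<bullet> b) * \<phi> x)"
      by (simp add: mult.assoc mult.left_commute)
  qed
qed

section \<open>Convolution with a test function\<close>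

text \<open>Differentiation under the integral sign; by the Taylor bound for \<open>\<phi>\<close> the error is quadratic in the
  increment, uniformly in the integration variable.\<close>

lemma test_integral_has_derivative:
  fixes v :: "'a::euclidean_space \<Rightarrow> real"
  assumes v: "v \<in> L1_loc UNIV" and \<phi>: "\<phi> \<in> C_c_inf UNIV"
  shows "((\<lambda>z. LINT y|lebesgue. v y * \<phi> (y - z)) has_derivative
    (\<lambda>h. - (LINT y|lebesgue. v y * frechet_derivative \<phi> (at (y - z)) h))) (at z)"
proof -
  have tr: "(\<lambda>y. \<psi> (y - z)) \<in> C_c_inf UNIV" if "\<psi> \<in> C_c_inf UNIV" for \<psi> and z :: 'a
    using C_c_inf_affine[OF that, of 1 "-z" UNIV] by simp
  have i: "integrable lebesgue (\<lambda>y. v y * \<psi> (y - z))" if "\<psi> \<in> C_c_inf UNIV" for \<psi> z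
    using L1_loc_test_integrable[OF v tr[OF that]] by (simp add: mult.commute)
  have sm: "smooth \<phi>" by (rule C_c_inf_smooth[OF \<phi>])
  have fd: "(\<lambda>y. v y * frechet_derivative \<phi> (at (y - z)) h)
      = (\<lambda>y. \<Sum>b\<in>Basis. (h \<bullet> b) * (v y * pderivative b \<phi> (y - z)))" for z h
    by (rule ext) (simp only: pderivative_Basis_sum[OF sm, of _ h] sum_distrib_left mult.left_commute)
  have id: "integrable lebesgue (\<lambda>y. v y * frechet_derivative \<phi> (at (y - z)) h)" for z h
    by (subst fd) (intro Bochner_Integration.integrable_sum integrable_mult_right i C_c_inf_pderivative[OF \<phi>])
  have eq: "(LINT y|lebesgue. v y * frechet_derivative \<phi> (at (y - z)) h)
      = (\<Sum>b\<in>Basis. (h \<bullet> b) * (LINT y|lebesgue. v y * pderivative b \<phi> (y - z)))" for h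
    using i[OF C_c_inf_pderivative[OF \<phi>]] by (subst fd, subst Bochner_Integration.integral_sum) auto
  have eqf: "(\<lambda>h. - (LINT y|lebesgue. v y * frechet_derivative \<phi> (at (y - z)) h))
      = (\<lambda>h. - (\<Sum>b\<in>Basis. (h \<bullet> b) * (LINT y|lebesgue. v y * pderivative b \<phi> (y - z))))"
    by (rule ext) (subst eq, rule refl)
  obtain C where C: "C > 0" "\<And>x h. \<bar>\<phi> (x + h) - \<phi> x - frechet_derivative \<phi> (at x) h\<bar> \<le> C * (norm h)\<^sup>2"
    by (rule C_c_inf_taylor[OF \<phi>]) auto
  obtain K where K: "compact K" "\<And>x. x \<notin> K \<Longrightarrow> \<phi> x = 0" using C_c_inf_support[OF \<phi>] by auto
  obtain s where s: "s > 0" "K \<subseteq> ball 0 s"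
    using bounded_subset_ballD[OF compact_imp_bounded[OF K(1)], of 0] by blast
  define M where "M = cball z (s + 1)"
  have iM: "integrable lebesgue (\<lambda>y. norm (indicator M y *\<^sub>R v y))"
    using v by (intro integrable_norm) (auto simp: L1_loc_def set_integrable_def M_def)
  define B where "B = (LINT y|lebesgue. norm (indicator M y *\<^sub>R v y))"
  have le: "\<bar>(LINT y|lebesgue. v y * \<phi> (y - (z + h))) - (LINT y|lebesgue. v y * \<phi> (y - z))
      + (LINT y|lebesgue. v y * frechet_derivative \<phi> (at (y - z)) h)\<bar> \<le> C * (norm h)\<^sup>2 * B" if h: "norm h < 1" for h
  proof -
    have "(LINT y|lebesgue. v y * \<phi> (y - (z + h))) - (LINT y|lebesgue. v y * \<phi> (y - z))
      + (LINT y|lebesgue. v y * frechet_derivative \<phi> (at (y - z)) h)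
      = (LINT y|lebesgue. v y * \<phi> (y - (z + h)) - v y * \<phi> (y - z) + v y * frechet_derivative \<phi> (at (y - z)) h)"
      using i[OF \<phi>] id by simp
    also have "norm \<dots> \<le> (LINT y|lebesgue. C * (norm h)\<^sup>2 * norm (indicator M y *\<^sub>R v y))"
    proof (rule Bochner_Integration.integral_norm_bound_integral)
      fix y
      have e: "v y * \<phi> (y - (z + h)) - v y * \<phi> (y - z) + v y * frechet_derivative \<phi> (at (y - z)) h
          = v y * (\<phi> ((y - z) + (- h)) - \<phi> (y - z) - frechet_derivative \<phi> (at (y - z)) (- h))"
        using linear_neg[OF has_derivative_linear[OF smooth_has_derivative[OF sm]], of "y - z" h]
        by (simp add: algebra_simps)
      show "norm (v y * \<phi> (y - (z + h)) - v y * \<phi> (y - z) + v y * frechet_derivative \<phi> (at (y - z)) h)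
          \<le> C * (norm h)\<^sup>2 * norm (indicator M y *\<^sub>R v y)"
      proof (cases "y \<in> M")
        case True
        have "\<bar>v y\<bar> * \<bar>\<phi> ((y - z) + (- h)) - \<phi> (y - z) - frechet_derivative \<phi> (at (y - z)) (- h)\<bar> \<le> \<bar>v y\<bar> * (C * (norm h)\<^sup>2)"
          using C(2)[of "y - z" "- h"] by (intro mult_left_mono) auto
        then show ?thesis unfolding e using True by (simp add: abs_mult mult.commute)
      next
        case False
        have "norm (y - z) > s + 1" using False by (simp add: M_def dist_norm norm_minus_commute)
        moreover have "norm (y - z) \<le> norm (y - z - h) + norm h" using norm_triangle_ineq[of "y - z - h" h] by simp
        ultimately have "y - z \<notin> K" "y - z + (- h) \<notin> K" using s h by auto
        then show ?thesis unfolding e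
          using K(2) pderivative_eq_0_outside[of K \<phi> "y - z", OF K] C(1) by simp
      qed
    qed (use i[OF \<phi>] id iM in auto)
    also have "\<dots> = C * (norm h)\<^sup>2 * B" by (simp add: B_def)
    finally show ?thesis by simp
  qed
  show ?thesis
  proof (rule has_derivativeI_sandwich[where e = 1 and H = "\<lambda>y. C * B * norm (y - z)"])
    show "bounded_linear (\<lambda>h. - (LINT y|lebesgue. v y * frechet_derivative \<phi> (at (y - z)) h))"
      by (subst eqf) (intro bounded_linear_minus bounded_linear_sum bounded_linear_mult_const bounded_linear_inner_left)
    show "((\<lambda>y. C * B * norm (y - z)) \<longlongrightarrow> 0) (at z)" by (auto intro!: tendsto_eq_intros)
    fix y assume y: "y \<noteq> z" "dist y z < 1"
    then show "norm ((LINT x|lebesgue. v x * \<phi> (x - y)) - (LINT x|lebesgue. v x * \<phi> (x - z))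
        - - (LINT x|lebesgue. v x * frechet_derivative \<phi> (at (x - z)) (y - z))) / norm (y - z) \<le> C * B * norm (y - z)"
      using le[of "y - z"] by (simp add: dist_norm divide_le_eq power2_eq_square mult.commute mult.left_commute)
  qed simp
qed

lemma test_integral_smooth:
  fixes v :: "'a::euclidean_space \<Rightarrow> real"
  assumes v: "v \<in> L1_loc UNIV" and \<phi>: "\<phi> \<in> C_c_inf UNIV"
  shows "smooth (\<lambda>z. LINT y|lebesgue. v y * \<phi> (y - z))"
proof -
  have "C_k k (\<lambda>z. LINT y|lebesgue. v y * \<phi> (y - z))" for k
    using \<phi>
  proof (induction k arbitrary: \<phi>)
    case 0
    show ?case
      using test_integral_has_derivative[OF v 0] by (auto intro!: continuous_at_imp_continuous_on has_derivative_continuous)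
  next
    case (Suc k)
    show ?case
    proof (rule C_k_SucI[OF test_integral_has_derivative[OF v Suc.prems]])
      fix b :: 'a assume b: "b \<in> Basis"
      have "(\<lambda>x. -1 * pderivative b \<phi> x) \<in> C_c_inf UNIV"
        by (intro C_c_inf_mult C_c_inf_pderivative Suc.prems b smooth_const)
      from Suc.IH[OF this] show "C_k k (\<lambda>x. - (LINT y|lebesgue. v y * frechet_derivative \<phi> (at (y - x)) b))" by simp
    qed
  qed
  then show ?thesis by (simp add: smooth_def)
qed

section \<open>Lipschitz functions\<close>

text \<open>The derivative of \<open>t \<mapsto> \<integral> u x \<phi> (x - t b)\<close> at \<open>0\<close> is an integral of \<open>G \<bullet> b\<close> against \<open>\<phi>\<close>; by a change of
  variables its difference quotients are at most \<open>L \<integral> |\<phi>|\<close>.\<close>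

lemma weak_gradient_component_lipschitz:
  fixes u :: "'a::euclidean_space \<Rightarrow> real"
  assumes w: "has_weak_gradient U u G" and U: "open U" and lip: "L-lipschitz_on U u" and b: "b \<in> Basis"
  shows "AE x in lebesgue. x \<in> U \<longrightarrow> G x \<bullet> b \<le> L" "AE x in lebesgue. x \<in> U \<longrightarrow> - (G x \<bullet> b) \<le> L"
proof -
  have L: "u \<in> L1_loc U" "G \<in> L1_loc U" using w by (auto simp: has_weak_gradient_iff)
  have L0: "L \<ge> 0" using lip lipschitz_on_nonneg by blast
  have key: "\<bar>LINT x|lebesgue. (G x \<bullet> b) * \<phi> x\<bar> \<le> L * (LINT x|lebesgue. \<bar>\<phi> x\<bar>)" if \<phi>: "\<phi> \<in> C_c_inf U" for \<phi>
  proof -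
    have \<phi>': "\<phi> \<in> C_c_inf UNIV" using \<phi> C_c_inf_mono by blast
    obtain K where K: "compact K" "K \<subseteq> U" "\<And>x. x \<notin> K \<Longrightarrow> \<phi> x = 0" using C_c_inf_support[OF \<phi>] by auto
    obtain d where d: "d > 0" "(\<Union>x\<in>K. cball x d) \<subseteq> U"
      using compact_subset_open_imp_cball_epsilon_subset[OF K(1) U K(2)] by blast
    define M where "M = (\<Union>x\<in>K. cball x d)"
    have M: "compact M" unfolding M_def
      by (rule compact_minkowski_sum_cball[OF K(1)])
    define u' where "u' = (\<lambda>x. indicator M x * u x)"
    have iM: "integrable lebesgue u'"
      using L(1) M d by (auto simp: L1_loc_def set_integrable_def u'_def M_def)
    have u'L: "u' \<in> L1_loc UNIV"
      unfolding L1_loc_def set_integrable_def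
      using integrable_mult_indicator[OF _ iM] fmeasurableD[OF lmeasurable_compact] by blast
    have KM: "K \<subseteq> M" using d by (force simp: M_def)
    define \<theta> where "\<theta> = (\<lambda>t. LINT y|lebesgue. u' y * \<phi> (y - t *\<^sub>R b))"
    define D where "D = - (LINT y|lebesgue. u' y * pderivative b \<phi> y)"
    have "(\<theta> has_derivative (\<lambda>t. - (LINT y|lebesgue. u' y * frechet_derivative \<phi> (at (y - 0 *\<^sub>R b)) (t *\<^sub>R b)))) (at 0)"
      unfolding \<theta>_def
      by (rule has_derivative_compose[of "\<lambda>t. t *\<^sub>R b" "\<lambda>t. t *\<^sub>R b" 0 UNIV "\<lambda>z. LINT y|lebesgue. u' y * \<phi> (y - z)", simplified])
        (auto intro!: derivative_eq_intros test_integral_has_derivative[OF u'L \<phi>', of 0, simplified])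
    moreover have "frechet_derivative \<phi> (at y) (t *\<^sub>R b) = t * pderivative b \<phi> y" for t y
      using has_derivative_linear[OF smooth_has_derivative[OF C_c_inf_smooth[OF \<phi>], of y]] by (simp add: linear_cmul)
    then have "(\<lambda>t. - (LINT y|lebesgue. u' y * frechet_derivative \<phi> (at (y - 0 *\<^sub>R b)) (t *\<^sub>R b))) = (*) D"
      by (intro ext) (simp add: D_def mult.left_commute)
    ultimately have "(\<theta> has_real_derivative D) (at 0)"
      by (simp only: has_field_derivative_def)
    then have lim: "((\<lambda>t. (\<theta> t - \<theta> 0) / t) \<longlongrightarrow> D) (at 0)"
      by (simp add: has_field_derivative_iff)
    have D: "D = (LINT x|lebesgue. (G x \<bullet> b) * \<phi> x)"
    proof -
      have "u' y * pderivative b \<phi> y = u y * pderivative b \<phi> y" for y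
      proof (cases "y \<in> M")
        case False
        then have "y \<notin> K" using KM by blast
        then show ?thesis by (simp add: pderivative_eq_0_outside[of K \<phi> y, OF K(1,3)])
      qed (simp add: u'_def)
      then show ?thesis using has_weak_gradientD[OF w \<phi> b] unfolding D_def by (simp only: minus_minus)
    qed
    have bd: "\<bar>(\<theta> t - \<theta> 0) / t\<bar> \<le> L * (LINT x|lebesgue. \<bar>\<phi> x\<bar>)" if t: "t \<noteq> 0" "\<bar>t\<bar> < d" for t
    proof -
      have i1: "integrable lebesgue (\<lambda>y. u' y * \<phi> (y - s *\<^sub>R b))" for s
        using L1_loc_test_integrable[OF u'L C_c_inf_affine[OF \<phi>', of 1 "- s *\<^sub>R b" UNIV]] by (simp add: mult.commute)
      have i2: "integrable lebesgue (\<lambda>y. u' (y + t *\<^sub>R b) * \<phi> y)"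
        using integrable_affine[OF borel_measurable_integrable[OF i1[of t]], of 1 "t *\<^sub>R b"] i1[of t] by simp
      have \<theta>t: "\<theta> t = (LINT y|lebesgue. u' (y + t *\<^sub>R b) * \<phi> y)"
        using integral_affine[OF borel_measurable_integrable[OF i1[of t]], of 1 "t *\<^sub>R b"] by (simp add: \<theta>_def)
      have "\<theta> t - \<theta> 0 = (LINT y|lebesgue. u' (y + t *\<^sub>R b) * \<phi> y - u' y * \<phi> y)"
        using i2 i1[of 0] by (subst \<theta>t) (simp add: \<theta>_def)
      also have "norm \<dots> \<le> (LINT y|lebesgue. L * \<bar>t\<bar> * \<bar>\<phi> y\<bar>)"
      proof (rule Bochner_Integration.integral_norm_bound_integral)
        fix y
        show "norm (u' (y + t *\<^sub>R b) * \<phi> y - u' y * \<phi> y) \<le> L * \<bar>t\<bar> * \<bar>\<phi> y\<bar>"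
        proof (cases "y \<in> K")
          case True
          have "y + t *\<^sub>R b \<in> cball y d" using t b by (simp add: dist_norm)
          then have y: "y + t *\<^sub>R b \<in> M" "y \<in> M" using True KM unfolding M_def by blast+
          have "dist (u (y + t *\<^sub>R b)) (u y) \<le> L * dist (y + t *\<^sub>R b) y"
            by (rule lipschitz_onD[OF lip]) (use y d in \<open>unfold M_def, blast+\<close>)
          then have "\<bar>u (y + t *\<^sub>R b) - u y\<bar> * \<bar>\<phi> y\<bar> \<le> L * \<bar>t\<bar> * \<bar>\<phi> y\<bar>"
            using b by (intro mult_right_mono) (auto simp: dist_norm)
          then show ?thesis using y by (simp add: u'_def abs_mult left_diff_distrib[symmetric])
        qed (simp add: K)
      qed (use i2 i1[of 0] integrable_abs[OF L1_loc_test_integrable[OF L1_loc_const[of 1 UNIV] \<phi>']] in auto)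
      also have "\<dots> = L * \<bar>t\<bar> * (LINT x|lebesgue. \<bar>\<phi> x\<bar>)" by simp
      finally show ?thesis using t by (simp add: divide_le_eq mult.commute mult.left_commute)
    qed
    have "\<bar>D\<bar> \<le> L * (LINT x|lebesgue. \<bar>\<phi> x\<bar>)"
      by (rule tendsto_upperbound[OF tendsto_rabs[OF lim]])
        (use bd d in \<open>auto simp: eventually_at intro!: exI[of _ d]\<close>)
    then show ?thesis by (simp add: D)
  qed
  show "AE x in lebesgue. x \<in> U \<longrightarrow> G x \<bullet> b \<le> L"
    by (rule AE_le_if_test_le[OF L1_loc_component[OF L(2)] U]) (use key in \<open>force simp: abs_le_iff\<close>)
  have "(\<lambda>x. - (G x \<bullet> b)) \<in> L1_loc U"
    using L1_loc_component[OF L(2), of "-b"] by simp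
  then show "AE x in lebesgue. x \<in> U \<longrightarrow> - (G x \<bullet> b) \<le> L"
    by (rule AE_le_if_test_le[OF _ U]) (use key in \<open>force simp: abs_le_iff\<close>)
qed

lemma weak_gradient_lipschitz:
  fixes u :: "'a::euclidean_space \<Rightarrow> real" and L :: real
  assumes w: "has_weak_gradient U u G" and U: "open U" and lip: "L-lipschitz_on U u"
  shows "AE x in lebesgue. x \<in> U \<longrightarrow> norm (G x) \<le> real DIM('a) * L"
proof -
  have "AE x in lebesgue. \<forall>b\<in>Basis. x \<in> U \<longrightarrow> \<bar>G x \<bullet> b\<bar> \<le> L"
  proof (rule AE_finite_allI)
    fix b :: 'a assume b: "b \<in> Basis"
    show "AE x in lebesgue. x \<in> U \<longrightarrow> \<bar>G x \<bullet> b\<bar> \<le> L"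
      using weak_gradient_component_lipschitz[OF w U lip b] by eventually_elim auto
  qed simp
  then show ?thesis
  proof eventually_elim
    case (elim x)
    show ?case
    proof
      assume x: "x \<in> U"
      have "norm (G x) \<le> (\<Sum>b\<in>Basis. \<bar>G x \<bullet> b\<bar>)" by (rule norm_le_l1)
      also have "\<dots> \<le> (\<Sum>b\<in>(Basis::'a set). L)" using elim x by (intro sum_mono) auto
      finally show "norm (G x) \<le> real DIM('a) * L" by simp
    qed
  qed
qed

section \<open>Sobolev functions on the whole space\<close>

definition H1 :: "('a::euclidean_space \<Rightarrow> real) \<Rightarrow> ('a \<Rightarrow> 'a) \<Rightarrow> bool" where
  "H1 v G \<longleftrightarrow> v \<in> L2 UNIV \<and> G \<in> L2 UNIV \<and> has_weak_gradient UNIV v G"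

lemma H1_D: "H1 v G \<Longrightarrow> v \<in> L2 UNIV" "H1 v G \<Longrightarrow> G \<in> L2 UNIV" "H1 v G \<Longrightarrow> has_weak_gradient UNIV v G"
  by (auto simp: H1_def)

lemma H1_linear:
  assumes "H1 u G" "H1 v H"
  shows "H1 (\<lambda>x. c * u x + d * v x) (\<lambda>x. c *\<^sub>R G x + d *\<^sub>R H x)"
  using assms has_weak_gradient_linear[of UNIV u G v H c d]
    L2_UNIV_add[OF L2_UNIV_scale[of u c] L2_UNIV_scale[of v d]]
    L2_UNIV_add[OF L2_UNIV_scale[of G c] L2_UNIV_scale[of H d]]
  by (simp add: H1_def)

lemma H1_diff: "H1 u G \<Longrightarrow> H1 v H \<Longrightarrow> H1 (\<lambda>x. u x - v x) (\<lambda>x. G x - H x)"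
  using H1_linear[of u G v H 1 "-1"] by simp

lemma H1_scale: "H1 u G \<Longrightarrow> H1 (\<lambda>x. c * u x) (\<lambda>x. c *\<^sub>R G x)"
  using H1_linear[of u G u G c 0] by simp

definition grad :: "('a::euclidean_space \<Rightarrow> real) \<Rightarrow> 'a \<Rightarrow> 'a" where
  "grad \<phi> x = (\<Sum>b\<in>Basis. pderivative b \<phi> x *\<^sub>R b)"

lemma grad_inner_Basis: "b \<in> Basis \<Longrightarrow> grad \<phi> x \<bullet> b = pderivative b \<phi> x"
  by (simp add: grad_def inner_sum_left inner_Basis if_distrib sum.delta cong: if_cong)

lemma grad_bounded:
  assumes "\<phi> \<in> C_c_inf U"
  obtains B where "B > 0" "\<And>x. norm (grad \<phi> x) \<le> B"
proof -
  obtain C where C: "C > 0" "\<And>x h. \<bar>frechet_derivative \<phi> (at x) h\<bar> \<le> C * norm h"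
    by (rule C_c_inf_lipschitz[OF assms]) auto
  have "norm (grad \<phi> x) \<le> DIM('a) * C" for x
  proof -
    have "norm (grad \<phi> x) \<le> (\<Sum>b\<in>Basis. norm (pderivative b \<phi> x *\<^sub>R b))" unfolding grad_def by (rule norm_sum)
    also have "\<dots> \<le> (\<Sum>b\<in>(Basis::'a set). C)" using C(2)[of x] by (intro sum_mono) (metis mult.right_neutral norm_Basis norm_scaleR real_norm_def)
    finally show ?thesis by simp
  qed
  then show ?thesis using that[of "DIM('a) * C"] C by simp
qed

lemma grad_measurable:
  assumes "\<phi> \<in> C_c_inf U"
  shows "grad \<phi> \<in> borel_measurable lebesgue"
  unfolding grad_def[abs_def]
  by (intro borel_measurable_sum borel_measurable_scaleR borel_measurable_const C_c_inf_measurable[OF C_c_inf_pderivative[OF assms]])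

lemma grad_eq_0_outside: "compact K \<Longrightarrow> (\<And>x. x \<notin> K \<Longrightarrow> \<phi> x = 0) \<Longrightarrow> x \<notin> K \<Longrightarrow> grad \<phi> x = 0"
  using pderivative_eq_0_outside[of K \<phi> x] by (simp add: grad_def)

text \<open>The step from local Sobolev functions on \<open>U\<close> to functions on the whole space, where translations are available.\<close>

lemma H1_mult_test:
  fixes v :: "'a::euclidean_space \<Rightarrow> real"
  assumes w: "has_weak_gradient U v G" and v: "v \<in> L2_loc U" and G: "G \<in> L2_loc U" and \<psi>: "\<psi> \<in> C_c_inf U"
  shows "H1 (\<lambda>x. \<psi> x * v x) (\<lambda>x. \<psi> x *\<^sub>R G x + v x *\<^sub>R grad \<psi> x)"
proof -
  obtain K where K: "compact K" "K \<subseteq> U" "\<And>x. x \<notin> K \<Longrightarrow> \<psi> x = 0" using C_c_inf_support[OF \<psi>] by auto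
  have Km: "K \<in> sets lebesgue" using lmeasurable_compact[OF K(1)] by (simp add: fmeasurable_def)
  obtain B where B: "\<And>x. \<bar>\<psi> x\<bar> \<le> B" by (rule C_c_inf_bounded[OF \<psi>]) auto
  obtain C where C: "\<And>x. norm (grad \<psi> x) \<le> C" by (rule grad_bounded[OF \<psi>]) auto
  have C0: "C \<ge> 0" using C[of 0] norm_ge_zero[of "grad \<psi> 0"] by linarith
  have vK: "(\<lambda>x. indicator K x *\<^sub>R v x) \<in> L2 UNIV" using v K L2_indicator[OF Km, of v] by (auto simp: L2_loc_def)
  have GK: "(\<lambda>x. indicator K x *\<^sub>R G x) \<in> L2 UNIV" using G K L2_indicator[OF Km, of G] by (auto simp: L2_loc_def)
  have "(\<lambda>x. \<psi> x *\<^sub>R (indicator K x *\<^sub>R v x)) \<in> L2 UNIV"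
    by (rule L2_UNIV_mult_bounded[OF vK C_c_inf_measurable[OF \<psi>], of B]) (use B in auto)
  moreover have "(\<lambda>x. \<psi> x *\<^sub>R (indicator K x *\<^sub>R v x)) = (\<lambda>x. \<psi> x * v x)"
    using K(3) by (fastforce simp: indicator_def fun_eq_iff)
  ultimately have 1: "(\<lambda>x. \<psi> x * v x) \<in> L2 UNIV" by metis
  have "(\<lambda>x. \<psi> x *\<^sub>R (indicator K x *\<^sub>R G x)) \<in> L2 UNIV"
    by (rule L2_UNIV_mult_bounded[OF GK C_c_inf_measurable[OF \<psi>], of B]) (use B in auto)
  moreover have "(\<lambda>x. \<psi> x *\<^sub>R (indicator K x *\<^sub>R G x)) = (\<lambda>x. \<psi> x *\<^sub>R G x)"
    using K(3) by (fastforce simp: indicator_def fun_eq_iff)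
  ultimately have 2: "(\<lambda>x. \<psi> x *\<^sub>R G x) \<in> L2 UNIV" by metis
  have "(\<lambda>x. (indicator K x *\<^sub>R v x) *\<^sub>R grad \<psi> x) \<in> L2 UNIV"
  proof (rule L2_UNIV_bound[OF L2_UNIV_scale[OF vK, of C]])
    show "(\<lambda>x. (indicator K x *\<^sub>R v x) *\<^sub>R grad \<psi> x) \<in> borel_measurable lebesgue"
      by (intro borel_measurable_scaleR L2_UNIV_measurable[OF vK] grad_measurable[OF \<psi>])
    show "AE x in lebesgue. norm ((indicator K x *\<^sub>R v x) *\<^sub>R grad \<psi> x) \<le> norm (C *\<^sub>R indicator K x *\<^sub>R v x)"
    proof (rule AE_I2)
      fix x
      have "norm (a *\<^sub>R grad \<psi> x) \<le> norm (C *\<^sub>R a)" for a :: real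
        using mult_left_mono[OF C[of x], of "\<bar>a\<bar>"] C0 by (simp add: abs_mult mult.commute)
      then show "norm ((indicator K x *\<^sub>R v x) *\<^sub>R grad \<psi> x) \<le> norm (C *\<^sub>R indicator K x *\<^sub>R v x)" .
    qed
  qed
  moreover have "(\<lambda>x. (indicator K x *\<^sub>R v x) *\<^sub>R grad \<psi> x) = (\<lambda>x. v x *\<^sub>R grad \<psi> x)"
    using grad_eq_0_outside[of K \<psi>, OF K(1,3)] by (fastforce simp: indicator_def fun_eq_iff)
  ultimately have 3: "(\<lambda>x. v x *\<^sub>R grad \<psi> x) \<in> L2 UNIV" by metis
  have vL: "v \<in> L1_loc U" "G \<in> L1_loc U" using w by (auto simp: has_weak_gradient_iff)
  have "has_weak_gradient UNIV (\<lambda>x. \<psi> x * v x) (\<lambda>x. \<psi> x *\<^sub>R G x + v x *\<^sub>R grad \<psi> x)"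
    unfolding has_weak_gradient_iff
  proof (intro conjI ballI)
    fix \<phi> :: "'a \<Rightarrow> real" and b :: 'a assume \<phi>: "\<phi> \<in> C_c_inf UNIV" and b: "b \<in> Basis"
    have \<psi>\<phi>: "(\<lambda>x. \<phi> x * \<psi> x) \<in> C_c_inf U" by (rule C_c_inf_mult[OF \<psi> C_c_inf_smooth[OF \<phi>]])
    have i1: "integrable lebesgue (\<lambda>x. (\<psi> x * v x) * pderivative b \<phi> x)"
      using L1_loc_test_integrable[OF L2_UNIV_imp_L1_loc[OF 1] C_c_inf_pderivative[OF \<phi> b]] by (simp add: mult.commute)
    have i2: "integrable lebesgue (\<lambda>x. (v x *\<^sub>R grad \<psi> x \<bullet> b) * \<phi> x)"
      using L1_loc_test_integrable[OF L1_loc_component[OF L2_UNIV_imp_L1_loc[OF 3]] \<phi>] by (simp add: mult.commute)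
    have i3: "integrable lebesgue (\<lambda>x. (\<psi> x *\<^sub>R G x \<bullet> b) * \<phi> x)"
      using L1_loc_test_integrable[OF L1_loc_component[OF L2_UNIV_imp_L1_loc[OF 2]] \<phi>] by (simp add: mult.commute)
    have "(LINT x|lebesgue. (\<psi> x * v x) * pderivative b \<phi> x) + (LINT x|lebesgue. (v x *\<^sub>R grad \<psi> x \<bullet> b) * \<phi> x)
        = (LINT x|lebesgue. v x * pderivative b (\<lambda>x. \<phi> x * \<psi> x) x)"
      by (subst Bochner_Integration.integral_add[OF i1 i2, symmetric])
        (simp add: pderivative_mult[OF C_c_inf_smooth[OF \<phi>] C_c_inf_smooth[OF \<psi>]] grad_inner_Basis[OF b] algebra_simps)
    also have "\<dots> = - (LINT x|lebesgue. (\<psi> x *\<^sub>R G x \<bullet> b) * \<phi> x)"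
      using has_weak_gradientD[OF w \<psi>\<phi> b] by (simp add: mult.assoc mult.left_commute mult.commute)
    finally show "(LINT x|lebesgue. (\<psi> x * v x) * pderivative b \<phi> x)
        = - (LINT x|lebesgue. ((\<psi> x *\<^sub>R G x + v x *\<^sub>R grad \<psi> x) \<bullet> b) * \<phi> x)"
      unfolding inner_add_left distrib_right by (subst Bochner_Integration.integral_add[OF i3 i2]) linarith
  qed (use L2_UNIV_imp_L1_loc[OF 1] L2_UNIV_imp_L1_loc[OF L2_UNIV_add[OF 2 3]] in auto)
  then show ?thesis using 1 L2_UNIV_add[OF 2 3] by (simp add: H1_def)
qed

lemma H1_mult_test_UNIV:
  assumes "H1 v G" "\<psi> \<in> C_c_inf UNIV"
  shows "H1 (\<lambda>x. \<psi> x * v x) (\<lambda>x. \<psi> x *\<^sub>R G x + v x *\<^sub>R grad \<psi> x)"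
  using H1_mult_test[OF H1_D(3)[OF assms(1)] _ _ assms(2)] H1_D[OF assms(1)] by (simp add: L2_imp_L2_loc)

lemma inner_test_mult_le:
  fixes G :: "'a::euclidean_space \<Rightarrow> 'a" and \<phi> :: "'a \<Rightarrow> real"
  assumes G: "G \<in> L2 UNIV" and \<phi>: "\<phi> \<in> L2 UNIV"
  shows "\<bar>LINT x|lebesgue. (G x \<bullet> h) * \<phi> x\<bar> \<le> norm h * sqrt (sqn G) * sqrt (sqn \<phi>)"
proof -
  have \<phi>h: "(\<lambda>x. \<phi> x *\<^sub>R h) \<in> L2 UNIV"
    by (rule L2_UNIV_bound[OF L2_UNIV_scale[OF \<phi>, of "norm h"]]) (use L2_UNIV_measurable[OF \<phi>] in \<open>auto simp: abs_mult mult.commute\<close>)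
  have "(LINT x|lebesgue. (G x \<bullet> h) * \<phi> x) = (LINT x|lebesgue. G x \<bullet> (\<phi> x *\<^sub>R h))" by (simp add: mult.commute)
  then have "\<bar>LINT x|lebesgue. (G x \<bullet> h) * \<phi> x\<bar> \<le> sqrt (sqn G) * sqrt (sqn (\<lambda>x. \<phi> x *\<^sub>R h))"
    using L2_cauchy_schwarz_inner[OF G \<phi>h] by simp
  also have "sqrt (sqn (\<lambda>x. \<phi> x *\<^sub>R h)) = norm h * sqrt (sqn \<phi>)"
    by (simp add: power_mult_distrib real_sqrt_mult)
  finally show ?thesis by (simp add: mult.commute mult.left_commute)
qed

text \<open>Tested against \<open>\<phi>\<close>, the increment \<open>v (x + h) - v x\<close> is the increment of
  \<open>t \<mapsto> \<integral> v y \<phi> (y - t h)\<close>, whose derivative is \<open>\<integral> (G (y + t h) \<bullet> h) \<phi> y\<close>; the mean value theorem and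
  duality then bound the first-order remainder by the \<open>L\<^sup>2\<close> modulus of continuity of \<open>G\<close>.\<close>

lemma H1_increment_bound:
  fixes v :: "'a::euclidean_space \<Rightarrow> real"
  assumes H: "H1 v G"
    and e: "\<And>s. 0 \<le> s \<Longrightarrow> s \<le> 1 \<Longrightarrow> sqrt (sqn (\<lambda>x. G (x + s *\<^sub>R h) - G x)) \<le> e"
  shows "sqrt (sqn (\<lambda>x. v (x + h) - v x - G x \<bullet> h)) \<le> norm h * e"
proof -
  note v = H1_D(1)[OF H] and G = H1_D(2)[OF H]
  have Gh: "(\<lambda>x. G x \<bullet> h) \<in> L2 UNIV"
  proof (rule L2_UNIV_bound[OF L2_UNIV_scale[OF G, of "norm h"]])
    show "AE x in lebesgue. norm (G x \<bullet> h) \<le> norm (norm h *\<^sub>R G x)"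
      using Cauchy_Schwarz_ineq2[of "G _" h] by (auto simp: mult.commute)
  qed (use L2_UNIV_measurable[OF G] in measurable)
  have e0: "e \<ge> 0" using e[of 0] by simp
  have L: "(\<lambda>x. v (x + h) - v x - G x \<bullet> h) \<in> L2 UNIV"
    by (intro L2_UNIV_diff L2_UNIV_translate v Gh)
  show ?thesis
  proof (rule L2_norm_le_by_duality[OF L])
    fix \<phi> :: "'a \<Rightarrow> real" assume \<phi>: "\<phi> \<in> C_c_inf UNIV"
    note \<phi>L = C_c_inf_L2[OF \<phi>]
    have tr: "(\<lambda>y. \<psi> (y - z)) \<in> C_c_inf UNIV" if "\<psi> \<in> C_c_inf UNIV" for \<psi> and z :: 'a
      using C_c_inf_affine[OF that, of 1 "-z" UNIV] by simp
    define \<theta> where "\<theta> = (\<lambda>t. LINT y|lebesgue. v y * \<phi> (y - t *\<^sub>R h))"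
    define \<theta>' where "\<theta>' = (\<lambda>t. LINT y|lebesgue. (G (y + t *\<^sub>R h) \<bullet> h) * \<phi> y)"
    have iG: "integrable lebesgue (\<lambda>y. (G (y + a) \<bullet> b) * \<psi> (y + c))" if "\<psi> \<in> C_c_inf UNIV" for a b c \<psi>
    proof -
      have "(\<lambda>y. \<psi> (y + c) *\<^sub>R b) \<in> L2 UNIV"
        by (rule L2_UNIV_bound[OF L2_UNIV_scale[OF L2_UNIV_translate[OF C_c_inf_L2[OF that], of c], of "norm b"]])
          (use L2_UNIV_measurable[OF L2_UNIV_translate[OF C_c_inf_L2[OF that], of c]] in \<open>auto simp: abs_mult mult.commute\<close>)
      from integrable_inner_L2[OF L2_UNIV_translate[OF G, of a] this] show ?thesis by (simp add: mult.commute)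
    qed
    have der: "(\<theta> has_real_derivative \<theta>' t) (at t)" for t
    proof -
      have "(\<theta> has_derivative (\<lambda>s. - (LINT y|lebesgue. v y * frechet_derivative \<phi> (at (y - t *\<^sub>R h)) (s *\<^sub>R h)))) (at t)"
        unfolding \<theta>_def
        by (rule has_derivative_compose[of "\<lambda>t. t *\<^sub>R h" "\<lambda>t. t *\<^sub>R h" t UNIV "\<lambda>z. LINT y|lebesgue. v y * \<phi> (y - z)", simplified])
          (auto intro!: derivative_eq_intros test_integral_has_derivative[OF L2_UNIV_imp_L1_loc[OF v] \<phi>])
      moreover have "- (LINT y|lebesgue. v y * frechet_derivative \<phi> (at (y - t *\<^sub>R h)) (s *\<^sub>R h)) = \<theta>' t * s" for s
      proof -
        define \<psi> where "\<psi> = (\<lambda>y. \<phi> (y - t *\<^sub>R h))"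
        have \<psi>: "\<psi> \<in> C_c_inf UNIV" unfolding \<psi>_def by (rule tr[OF \<phi>])
        have pd: "frechet_derivative \<phi> (at (y - t *\<^sub>R h)) k = frechet_derivative \<psi> (at y) k" for y k
          using pderivative_affine[OF C_c_inf_smooth[OF \<phi>], of 1 "- t *\<^sub>R h" y k] by (simp add: \<psi>_def)
        have iv: "integrable lebesgue (\<lambda>y. v y * pderivative b \<psi> y)" if "b \<in> Basis" for b
          using L1_loc_test_integrable[OF L2_UNIV_imp_L1_loc[OF v] C_c_inf_pderivative[OF \<psi> that]] by (simp add: mult.commute)
        have "- (LINT y|lebesgue. v y * frechet_derivative \<phi> (at (y - t *\<^sub>R h)) (s *\<^sub>R h))
            = - (LINT y|lebesgue. (\<Sum>b\<in>Basis. (s * (h \<bullet> b)) * (v y * pderivative b \<psi> y)))"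
          unfolding pd by (simp only: pderivative_Basis_sum[OF C_c_inf_smooth[OF \<psi>], of _ "s *\<^sub>R h"] sum_distrib_left mult.left_commute[of "v _"] inner_scaleR_left)
        also have "\<dots> = (\<Sum>b\<in>Basis. (s * (h \<bullet> b)) * (LINT y|lebesgue. (G y \<bullet> b) * \<psi> y))"
          using iv by (subst Bochner_Integration.integral_sum)
            (auto simp: has_weak_gradientD[OF H1_D(3)[OF H] \<psi>] sum_negf)
        also have "\<dots> = (LINT y|lebesgue. (\<Sum>b\<in>Basis. (s * (h \<bullet> b)) * ((G y \<bullet> b) * \<psi> y)))"
          using iG[OF \<psi>, of 0 _ 0] by (subst Bochner_Integration.integral_sum) auto
        also have "\<dots> = (LINT y|lebesgue. s * ((G y \<bullet> h) * \<psi> y))"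
          by (subst euclidean_inner[of "G _" h]) (simp add: sum_distrib_left sum_distrib_right mult_ac)
        also have "\<dots> = s * (LINT y|lebesgue. (G y \<bullet> h) * \<phi> (y - t *\<^sub>R h))" by (simp add: \<psi>_def)
        also have "(LINT y|lebesgue. (G y \<bullet> h) * \<phi> (y - t *\<^sub>R h)) = \<theta>' t"
          using integral_affine[OF borel_measurable_integrable[OF iG[OF \<phi>, of 0 h "- t *\<^sub>R h"]], of 1 "t *\<^sub>R h"]
          by (simp add: \<theta>'_def)
        finally show ?thesis by (simp add: mult.commute)
      qed
      then have "(\<lambda>s. - (LINT y|lebesgue. v y * frechet_derivative \<phi> (at (y - t *\<^sub>R h)) (s *\<^sub>R h))) = (*) (\<theta>' t)"
        by (rule ext)
      ultimately show ?thesis by (simp only: has_field_derivative_def)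
    qed
    obtain z where z: "0 < z" "z < 1" "\<theta> 1 - \<theta> 0 = (1 - 0) * \<theta>' z"
      using MVT2[of 0 1 \<theta> \<theta>'] der by auto
    have iv: "integrable lebesgue (\<lambda>y. v y * \<phi> (y + a))" for a
      using integrable_inner_L2[OF v L2_UNIV_translate[OF \<phi>L, of a]] by simp
    have "\<theta> 1 = (LINT y|lebesgue. v (y + h) * \<phi> y)"
      using integral_affine[OF borel_measurable_integrable[OF iv[of "-h"]], of 1 h] by (simp add: \<theta>_def)
    moreover have iv2: "integrable lebesgue (\<lambda>y. v (y + h) * \<phi> y)"
      using integrable_inner_L2[OF L2_UNIV_translate[OF v, of h] \<phi>L] by simp
    ultimately have "(LINT x|lebesgue. (v (x + h) - v x - G x \<bullet> h) * \<phi> x) = \<theta> 1 - \<theta> 0 - \<theta>' 0"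
      using iv[of 0] iG[OF \<phi>, of 0 h 0] by (simp add: \<theta>_def \<theta>'_def left_diff_distrib)
    also have "\<dots> = \<theta>' z - \<theta>' 0" using z by simp
    also have "\<dots> = (LINT y|lebesgue. ((G (y + z *\<^sub>R h) - G y) \<bullet> h) * \<phi> y)"
      using iG[OF \<phi>, of "z *\<^sub>R h" h 0] iG[OF \<phi>, of 0 h 0] by (simp add: \<theta>'_def inner_diff_left left_diff_distrib)
    also have "\<dots> \<le> norm h * sqrt (sqn (\<lambda>y. G (y + z *\<^sub>R h) - G y)) * sqrt (sqn \<phi>)"
      using inner_test_mult_le[OF L2_UNIV_diff[OF L2_UNIV_translate[OF G, of "z *\<^sub>R h"] G] \<phi>L, of h] by (simp add: abs_le_iff)
    also have "\<dots> \<le> norm h * e * sqrt (sqn \<phi>)"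
      using e[of z] z by (intro mult_right_mono mult_left_mono) (auto intro: integral_nonneg_AE)
    finally show "(LINT x|lebesgue. (v (x + h) - v x - G x \<bullet> h) * \<phi> x) \<le> norm h * e * sqrt (sqn \<phi>)" .
  qed (use e0 in simp)
qed

lemma H1_increment:
  fixes v :: "'a::euclidean_space \<Rightarrow> real"
  assumes H: "H1 v G" and e: "e > 0"
  obtains d where "d > 0" "\<And>h. norm h < d \<Longrightarrow> sqrt (sqn (\<lambda>x. v (x + h) - v x - G x \<bullet> h)) \<le> norm h * e"
proof -
  obtain d where d: "d > 0" "\<And>h. norm h < d \<Longrightarrow> sqrt (sqn (\<lambda>x. G (x + h) - G x)) \<le> e"
    by (rule L2_translation_continuous[OF H1_D(2)[OF H] e]) auto
  have "sqrt (sqn (\<lambda>x. v (x + h) - v x - G x \<bullet> h)) \<le> norm h * e" if h: "norm h < d" for h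
  proof (rule H1_increment_bound[OF H])
    fix s :: real assume s: "0 \<le> s" "s \<le> 1"
    have "norm (s *\<^sub>R h) \<le> 1 * norm h" unfolding norm_scaleR using s by (intro mult_right_mono) auto
    then show "sqrt (sqn (\<lambda>x. G (x + s *\<^sub>R h) - G x)) \<le> e" using h by (intro d(2)) linarith
  qed
  then show ?thesis using that d(1) by blast
qed

text \<open>Translation moves the difference quotient of \<open>w\<close> to the test function, where it converges to a derivative.\<close>

lemma H1I_difference_quotients:
  fixes w :: "'a::euclidean_space \<Rightarrow> real"
  assumes w: "w \<in> L2 UNIV" and G: "G \<in> L2 UNIV"
    and t: "\<And>b. b \<in> Basis \<Longrightarrow> \<exists>t::nat \<Rightarrow> real. (\<forall>j. t j \<noteq> 0) \<and> t \<longlonglongrightarrow> 0 \<and>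
      (\<lambda>j. sqrt (sqn (\<lambda>x. (w (x + t j *\<^sub>R b) - w x) / t j - G x \<bullet> b))) \<longlonglongrightarrow> 0"
  shows "H1 w G"
proof -
  have "has_weak_gradient UNIV w G" unfolding has_weak_gradient_iff
  proof (intro conjI ballI)
    fix \<phi> :: "'a \<Rightarrow> real" and b :: 'a assume \<phi>: "\<phi> \<in> C_c_inf UNIV" and b: "b \<in> Basis"
    note \<phi>L = C_c_inf_L2[OF \<phi>] and Gb = L2_UNIV_component[OF G b]
    obtain t :: "nat \<Rightarrow> real" where t: "\<And>j. t j \<noteq> 0" "t \<longlonglongrightarrow> 0"
        "(\<lambda>j. sqrt (sqn (\<lambda>x. (w (x + t j *\<^sub>R b) - w x) / t j - G x \<bullet> b))) \<longlonglongrightarrow> 0"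
      using t[OF b] by auto
    define \<theta> where "\<theta> = (\<lambda>t. LINT y|lebesgue. w y * \<phi> (y - t *\<^sub>R b))"
    have "(\<theta> has_derivative (\<lambda>s. - (LINT y|lebesgue. w y * frechet_derivative \<phi> (at (y - 0 *\<^sub>R b)) (s *\<^sub>R b)))) (at 0)"
      unfolding \<theta>_def
      by (rule has_derivative_compose[of "\<lambda>t. t *\<^sub>R b" "\<lambda>t. t *\<^sub>R b" 0 UNIV "\<lambda>z. LINT y|lebesgue. w y * \<phi> (y - z)", simplified])
        (auto intro!: derivative_eq_intros test_integral_has_derivative[OF L2_UNIV_imp_L1_loc[OF w] \<phi>, of 0, simplified])
    moreover have "frechet_derivative \<phi> (at y) (s *\<^sub>R b) = s * pderivative b \<phi> y" for s y
      using has_derivative_linear[OF smooth_has_derivative[OF C_c_inf_smooth[OF \<phi>], of y]] by (simp add: linear_cmul)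
    then have "(\<lambda>s. - (LINT y|lebesgue. w y * frechet_derivative \<phi> (at (y - 0 *\<^sub>R b)) (s *\<^sub>R b)))
        = (*) (- (LINT y|lebesgue. w y * pderivative b \<phi> y))"
      by (intro ext) (simp add: mult.left_commute)
    ultimately have "(\<theta> has_real_derivative - (LINT y|lebesgue. w y * pderivative b \<phi> y)) (at 0)"
      by (simp only: has_field_derivative_def)
    then have "((\<lambda>s. (\<theta> s - \<theta> 0) / s) \<longlongrightarrow> - (LINT y|lebesgue. w y * pderivative b \<phi> y)) (at 0)"
      by (simp add: has_field_derivative_iff)
    moreover have "filterlim t (at 0) sequentially" using t(1,2) by (simp add: filterlim_at)
    ultimately have l1: "(\<lambda>j. (\<theta> (t j) - \<theta> 0) / t j) \<longlonglongrightarrow> - (LINT y|lebesgue. w y * pderivative b \<phi> y)"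
      by (rule filterlim_compose)
    have l2: "(\<lambda>j. (\<theta> (t j) - \<theta> 0) / t j - (LINT x|lebesgue. (G x \<bullet> b) * \<phi> x)) \<longlonglongrightarrow> 0"
    proof (rule Lim_null_comparison[OF always_eventually tendsto_mult_left_zero[OF t(3), of "sqrt (sqn \<phi>)"]], rule allI)
      fix j
      have iv: "integrable lebesgue (\<lambda>y. w y * \<phi> (y + a))" for a
        using integrable_inner_L2[OF w L2_UNIV_translate[OF \<phi>L, of a]] by simp
      have iv2: "integrable lebesgue (\<lambda>y. w (y + t j *\<^sub>R b) * \<phi> y)"
        using integrable_inner_L2[OF L2_UNIV_translate[OF w, of "t j *\<^sub>R b"] \<phi>L] by simp
      have \<theta>t: "\<theta> (t j) = (LINT y|lebesgue. w (y + t j *\<^sub>R b) * \<phi> y)"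
        using integral_affine[OF borel_measurable_integrable[OF iv[of "- t j *\<^sub>R b"]], of 1 "t j *\<^sub>R b"] by (simp add: \<theta>_def)
      have Dj: "(\<lambda>x. (w (x + t j *\<^sub>R b) - w x) / t j - G x \<bullet> b) \<in> L2 UNIV"
        using L2_UNIV_diff[OF L2_UNIV_scale[OF L2_UNIV_diff[OF L2_UNIV_translate[OF w, of "t j *\<^sub>R b"] w], of "inverse (t j)"] Gb]
        by (simp add: divide_inverse mult.commute)
      have iGb: "integrable lebesgue (\<lambda>x. (G x \<bullet> b) * \<phi> x)" using integrable_inner_L2[OF Gb \<phi>L] by simp
      have "(\<theta> (t j) - \<theta> 0) / t j - (LINT x|lebesgue. (G x \<bullet> b) * \<phi> x)
          = (LINT x|lebesgue. (w (x + t j *\<^sub>R b) * \<phi> x - w x * \<phi> x) / t j - (G x \<bullet> b) * \<phi> x)"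
        using iv[of 0] iv2 iGb by (subst \<theta>t) (simp add: \<theta>_def)
      also have "\<dots> = (LINT x|lebesgue. ((w (x + t j *\<^sub>R b) - w x) / t j - G x \<bullet> b) \<bullet> \<phi> x)"
        by (simp add: left_diff_distrib)
      finally show "norm ((\<theta> (t j) - \<theta> 0) / t j - (LINT x|lebesgue. (G x \<bullet> b) * \<phi> x))
          \<le> sqrt (sqn (\<lambda>x. (w (x + t j *\<^sub>R b) - w x) / t j - G x \<bullet> b)) * sqrt (sqn \<phi>)"
        using L2_cauchy_schwarz_inner[OF Dj \<phi>L] by simp
    qed
    from tendsto_diff[OF l1 l2] have "(\<lambda>j. (LINT x|lebesgue. (G x \<bullet> b) * \<phi> x)) \<longlonglongrightarrow> - (LINT y|lebesgue. w y * pderivative b \<phi> y)"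
      by simp
    then have "(LINT x|lebesgue. (G x \<bullet> b) * \<phi> x) = - (LINT y|lebesgue. w y * pderivative b \<phi> y)"
      by (simp add: LIMSEQ_const_iff)
    then show "(LINT x|lebesgue. w x * pderivative b \<phi> x) = - (LINT x|lebesgue. (G x \<bullet> b) * \<phi> x)" by simp
  qed (use L2_UNIV_imp_L1_loc w G in auto)
  then show ?thesis using w G by (simp add: H1_def)
qed

text \<open>The difference quotients of \<open>S \<circ> v\<close> are those of \<open>v\<close> times difference quotients of \<open>S\<close>, which are
  bounded and converge almost everywhere along a subsequence of steps.\<close>

lemma H1_chain_rule:
  fixes v :: "'a::euclidean_space \<Rightarrow> real"
  assumes H: "H1 v G" and S: "\<And>a. (S has_real_derivative S' a) (at a)" "S 0 = 0"
    and S': "continuous_on UNIV S'" "\<And>a. \<bar>S' a\<bar> \<le> 1"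
  shows "H1 (\<lambda>x. S (v x)) (\<lambda>x. S' (v x) *\<^sub>R G x)"
proof (rule H1I_difference_quotients)
  note v = H1_D(1)[OF H] and G = H1_D(2)[OF H]
  have lip: "\<bar>S a - S c\<bar> \<le> \<bar>a - c\<bar>" for a c
  proof -
    have "norm (S a - S c) \<le> 1 * norm (a - c)"
    proof (rule differentiable_bound[of UNIV S "\<lambda>a. (*) (S' a)"])
      show "onorm ((*) (S' x)) \<le> 1" for x
        by (rule onorm_le) (use S'(2)[of x] in \<open>auto simp: abs_mult mult_right_le_one_le mult_left_le_one_le\<close>)
    qed (use S(1) in \<open>auto simp: has_field_derivative_def\<close>)
    then show ?thesis by simp
  qed
  have contS: "continuous_on UNIV S" using S(1) by (meson DERIV_continuous continuous_at_imp_continuous_on)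
  have mS: "(\<lambda>x. S (h x)) \<in> borel_measurable lebesgue" and mS': "(\<lambda>x. S' (h x)) \<in> borel_measurable lebesgue"
    if "h \<in> borel_measurable lebesgue" for h :: "'a \<Rightarrow> real"
    using measurable_compose[OF that borel_measurable_continuous_onI[OF contS]]
      measurable_compose[OF that borel_measurable_continuous_onI[OF S'(1)]] by auto
  show SvL: "(\<lambda>x. S (v x)) \<in> L2 UNIV"
    by (rule L2_UNIV_bound[OF v mS[OF L2_UNIV_measurable[OF v]]]) (use lip[of "v _" 0] S(2) in auto)
  show "(\<lambda>x. S' (v x) *\<^sub>R G x) \<in> L2 UNIV"
    by (rule L2_UNIV_mult_bounded[OF G mS'[OF L2_UNIV_measurable[OF v]], of 1]) (use S'(2) in auto)
  fix b :: 'a assume b: "b \<in> Basis"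
  note Gb = L2_UNIV_component[OF G b]
  define t where "t = (\<lambda>j. inverse (real (Suc j)))"
  have t: "t j \<noteq> 0" "t j > 0" for j by (auto simp: t_def)
  have t0: "t \<longlonglongrightarrow> 0" unfolding t_def by (rule LIMSEQ_inverse_real_of_nat)
  have ev: "\<forall>\<^sub>F j in sequentially. norm (t j *\<^sub>R b) < d" if "d > 0" for d
    using order_tendstoD(2)[OF tendsto_norm_zero[OF t0] that] b by simp
  have "(\<lambda>j. sqn (\<lambda>x. v (x + t j *\<^sub>R b) - v x)) \<longlonglongrightarrow> 0"
  proof (rule order_tendstoI)
    fix e :: real assume "e > 0"
    obtain d where "d > 0" "\<And>h. norm h < d \<Longrightarrow> sqrt (sqn (\<lambda>x. v (x + h) - v x)) \<le> sqrt (e/2)"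
      by (rule L2_translation_continuous_real[OF v, of "sqrt (e/2)"]) (use \<open>e > 0\<close> in auto)
    then have le2: "sqn (\<lambda>x. v (x + h) - v x) \<le> e/2" if "norm h < d" for h
      using that by simp
    have le: "sqn (\<lambda>x. v (x + h) - v x) < e" if "norm h < d" for h
      using le2[OF that] \<open>e > 0\<close> by linarith
    show "\<forall>\<^sub>F j in sequentially. sqn (\<lambda>x. v (x + t j *\<^sub>R b) - v x) < e"
      using ev[OF \<open>d > 0\<close>] by eventually_elim (rule le)
  qed (auto intro!: always_eventually order.strict_trans2[OF _ integral_nonneg_AE])
  then obtain r where r: "strict_mono r" and rv: "AE x in lebesgue. (\<lambda>j. (norm (v (x + t (r j) *\<^sub>R b) - v x))\<^sup>2) \<longlonglongrightarrow> 0"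
    using tendsto_L1_AE_subseq[of lebesgue "\<lambda>j x. (norm (v (x + t j *\<^sub>R b) - v x))\<^sup>2"]
      L2_UNIV_integrable[OF L2_UNIV_diff[OF L2_UNIV_translate[OF v] v]] by auto
  define s where "s = t \<circ> r"
  have s: "s j \<noteq> 0" for j using t by (simp add: s_def)
  have s0: "s \<longlonglongrightarrow> 0" unfolding s_def by (rule LIMSEQ_subseq_LIMSEQ[OF t0 r])
  define D where "D = (\<lambda>j x. (v (x + s j *\<^sub>R b) - v x) / s j)"
  define \<rho> where "\<rho> = (\<lambda>j x. if v (x + s j *\<^sub>R b) = v x then 0
    else (S (v (x + s j *\<^sub>R b)) - S (v x)) / (v (x + s j *\<^sub>R b) - v x) - S' (v x))"
  have mv: "v \<in> borel_measurable lebesgue" "(\<lambda>x. v (x + a)) \<in> borel_measurable lebesgue" for a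
    using L2_UNIV_measurable v L2_UNIV_translate[OF v] by auto
  have m\<rho>: "\<rho> j \<in> borel_measurable lebesgue" for j
    unfolding \<rho>_def using mv mS[OF mv(1)] mS[OF mv(2)] mS'[OF mv(1)] by measurable
  have b\<rho>: "\<bar>\<rho> j x\<bar> \<le> 2" for j x
  proof (cases "v (x + s j *\<^sub>R b) = v x")
    case False
    then have "\<bar>(S (v (x + s j *\<^sub>R b)) - S (v x)) / (v (x + s j *\<^sub>R b) - v x)\<bar> \<le> 1"
      using lip[of "v (x + s j *\<^sub>R b)" "v x"] by (simp add: divide_le_eq)
    moreover have "\<rho> j x = (S (v (x + s j *\<^sub>R b)) - S (v x)) / (v (x + s j *\<^sub>R b) - v x) - S' (v x)"
      using False by (simp add: \<rho>_def)
    ultimately show ?thesis using S'(2)[of "v x"] by linarith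
  qed (simp add: \<rho>_def)
  have \<rho>0: "AE x in lebesgue. (\<lambda>j. \<rho> j x) \<longlonglongrightarrow> 0"
    using rv
  proof eventually_elim
    case (elim x)
    have "(\<lambda>j. v (x + s j *\<^sub>R b) - v x) \<longlonglongrightarrow> 0"
      using tendsto_real_sqrt[OF elim] by (simp add: s_def tendsto_rabs_zero_iff)
    from tendsto_add[OF this tendsto_const[of "v x"]] have lim: "(\<lambda>j. v (x + s j *\<^sub>R b)) \<longlonglongrightarrow> v x" by simp
    define Q where "Q = (\<lambda>a. if a = v x then 0 else (S a - S (v x)) / (a - v x) - S' (v x))"
    have "((\<lambda>a. (S a - S (v x)) / (a - v x) - S' (v x)) \<longlongrightarrow> S' (v x) - S' (v x)) (at (v x))"
      using S(1)[of "v x"] by (intro tendsto_diff tendsto_const) (simp add: has_field_derivative_iff)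
    then have "((\<lambda>a. (S a - S (v x)) / (a - v x) - S' (v x)) \<longlongrightarrow> Q (v x)) (at (v x))" by (simp add: Q_def)
    then have "(Q \<longlongrightarrow> Q (v x)) (at (v x))"
      by (rule Lim_transform_eventually) (auto simp: Q_def eventually_at intro!: exI[of _ 1])
    then have "isCont Q (v x)" by (simp add: isCont_def)
    from isCont_tendsto_compose[OF this lim] show ?case by (simp add: Q_def \<rho>_def)
  qed
  have DL: "(\<lambda>x. D j x - G x \<bullet> b) \<in> L2 UNIV" for j
    using L2_UNIV_diff[OF L2_UNIV_scale[OF L2_UNIV_diff[OF L2_UNIV_translate[OF v, of "s j *\<^sub>R b"] v], of "inverse (s j)"] Gb]
    by (simp add: D_def divide_inverse mult.commute)
  have D0: "(\<lambda>j. sqrt (sqn (\<lambda>x. D j x - G x \<bullet> b))) \<longlonglongrightarrow> 0"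
  proof (rule order_tendstoI)
    fix e :: real assume "e > 0"
    obtain d where d: "d > 0" "\<And>h. norm h < d \<Longrightarrow> sqrt (sqn (\<lambda>x. v (x + h) - v x - G x \<bullet> h)) \<le> norm h * (e/2)"
      by (rule H1_increment[OF H, of "e/2"]) (use \<open>e > 0\<close> in auto)
    have "\<forall>\<^sub>F j in sequentially. norm (s j *\<^sub>R b) < d"
      using order_tendstoD(2)[OF tendsto_norm_zero[OF s0] d(1)] b by simp
    then show "\<forall>\<^sub>F j in sequentially. sqrt (sqn (\<lambda>x. D j x - G x \<bullet> b)) < e"
    proof eventually_elim
      case (elim j)
      have "D j x - G x \<bullet> b = inverse (s j) * (v (x + s j *\<^sub>R b) - v x - G x \<bullet> (s j *\<^sub>R b))" for x
        using s[of j] by (simp add: D_def field_simps)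
      then have "sqrt (sqn (\<lambda>x. D j x - G x \<bullet> b))
          = \<bar>inverse (s j)\<bar> * sqrt (sqn (\<lambda>x. v (x + s j *\<^sub>R b) - v x - G x \<bullet> (s j *\<^sub>R b)))"
        by (simp add: power_mult_distrib real_sqrt_mult)
      also have "\<dots> \<le> \<bar>inverse (s j)\<bar> * (norm (s j *\<^sub>R b) * (e/2))"
        using d(2)[OF elim] by (intro mult_left_mono) auto
      also have "\<dots> < e" using s[of j] b \<open>e > 0\<close> by simp
      finally show ?case .
    qed
  qed (auto intro!: always_eventually order.strict_trans2[OF _ real_sqrt_ge_zero[OF integral_nonneg_AE]])
  have \<rho>L: "(\<lambda>x. \<rho> j x * (G x \<bullet> b)) \<in> L2 UNIV" for j
    using L2_UNIV_mult_bounded[OF Gb m\<rho>[of j], of 2] b\<rho> by simp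
  have "(\<lambda>j. sqn (\<lambda>x. \<rho> j x * (G x \<bullet> b))) \<longlonglongrightarrow> 0"
  proof (rule sqn_tendsto_0_dominated[OF _ L2_UNIV_scale[OF Gb, of 2]])
    show "AE x in lebesgue. (\<lambda>j. \<rho> j x * (G x \<bullet> b)) \<longlonglongrightarrow> 0"
      using \<rho>0 by eventually_elim (rule tendsto_mult_left_zero)
    show "AE x in lebesgue. norm (\<rho> j x * (G x \<bullet> b)) \<le> norm (2 *\<^sub>R (G x \<bullet> b))" for j
      using b\<rho>[of j] by (auto simp: abs_mult intro!: mult_right_mono)
  qed (use \<rho>L L2_UNIV_measurable in auto)
  then have \<rho>G: "(\<lambda>j. sqrt (sqn (\<lambda>x. \<rho> j x * (G x \<bullet> b)))) \<longlonglongrightarrow> 0"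
    using tendsto_real_sqrt by fastforce
  have "(\<lambda>j. sqrt (sqn (\<lambda>x. (S (v (x + s j *\<^sub>R b)) - S (v x)) / s j - S' (v x) *\<^sub>R G x \<bullet> b))) \<longlonglongrightarrow> 0"
  proof (rule Lim_null_comparison[OF always_eventually])
    show "(\<lambda>j. sqrt (sqn (\<lambda>x. \<rho> j x * (G x \<bullet> b))) + 3 * sqrt (sqn (\<lambda>x. D j x - G x \<bullet> b))) \<longlonglongrightarrow> 0"
      using tendsto_add[OF \<rho>G tendsto_mult_left[OF D0, of 3]] by simp
    show "\<forall>j. norm (sqrt (sqn (\<lambda>x. (S (v (x + s j *\<^sub>R b)) - S (v x)) / s j - S' (v x) *\<^sub>R G x \<bullet> b)))
        \<le> sqrt (sqn (\<lambda>x. \<rho> j x * (G x \<bullet> b))) + 3 * sqrt (sqn (\<lambda>x. D j x - G x \<bullet> b))"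
    proof
      fix j
      have eq: "(S (v (x + s j *\<^sub>R b)) - S (v x)) / s j - S' (v x) *\<^sub>R G x \<bullet> b
          = \<rho> j x * (G x \<bullet> b) + (\<rho> j x + S' (v x)) *\<^sub>R (D j x - G x \<bullet> b)" for x
        using s[of j] by (auto simp: \<rho>_def D_def field_simps)
      have mm: "(\<lambda>x. \<rho> j x + S' (v x)) \<in> borel_measurable lebesgue" using m\<rho>[of j] mS'[OF mv(1)] by measurable
      have bb: "\<bar>\<rho> j x + S' (v x)\<bar> \<le> 3" for x using b\<rho>[of j x] S'(2)[of "v x"] by linarith
      have L3: "(\<lambda>x. (\<rho> j x + S' (v x)) *\<^sub>R (D j x - G x \<bullet> b)) \<in> L2 UNIV"
        by (rule L2_UNIV_mult_bounded[OF DL mm, of 3]) (use bb in auto)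
      have "sqrt (sqn (\<lambda>x. (S (v (x + s j *\<^sub>R b)) - S (v x)) / s j - S' (v x) *\<^sub>R G x \<bullet> b))
          \<le> sqrt (sqn (\<lambda>x. \<rho> j x * (G x \<bullet> b))) + sqrt (sqn (\<lambda>x. (\<rho> j x + S' (v x)) *\<^sub>R (D j x - G x \<bullet> b)))"
        unfolding eq by (rule L2_triangle[OF \<rho>L L3])
      moreover have "sqrt (sqn (\<lambda>x. (\<rho> j x + S' (v x)) *\<^sub>R (D j x - G x \<bullet> b))) \<le> 3 * sqrt (sqn (\<lambda>x. D j x - G x \<bullet> b))"
      proof -
        have "sqn (\<lambda>x. (\<rho> j x + S' (v x)) *\<^sub>R (D j x - G x \<bullet> b)) \<le> sqn (\<lambda>x. 3 *\<^sub>R (D j x - G x \<bullet> b))"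
        proof (rule sqn_mono[OF L2_UNIV_scale[OF DL] AE_I2])
          fix x
          have "norm ((\<rho> j x + S' (v x)) *\<^sub>R a) \<le> norm (3 *\<^sub>R a)" for a :: real
            using mult_right_mono[OF bb[of x], of "\<bar>a\<bar>"] by (simp add: abs_mult)
          then show "norm ((\<rho> j x + S' (v x)) *\<^sub>R (D j x - G x \<bullet> b)) \<le> norm (3 *\<^sub>R (D j x - G x \<bullet> b))" .
        qed
        also have "\<dots> = 3\<^sup>2 * sqn (\<lambda>x. D j x - G x \<bullet> b)"
          by (simp only: norm_scaleR power_mult_distrib integral_mult_right_zero)
        finally have "sqrt (sqn (\<lambda>x. (\<rho> j x + S' (v x)) *\<^sub>R (D j x - G x \<bullet> b)))
            \<le> sqrt (3\<^sup>2 * sqn (\<lambda>x. D j x - G x \<bullet> b))" by (rule real_sqrt_le_mono)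
        also have "\<dots> = 3 * sqrt (sqn (\<lambda>x. D j x - G x \<bullet> b))" unfolding real_sqrt_mult by simp
        finally show ?thesis .
      qed
      ultimately show "norm (sqrt (sqn (\<lambda>x. (S (v (x + s j *\<^sub>R b)) - S (v x)) / s j - S' (v x) *\<^sub>R G x \<bullet> b)))
        \<le> sqrt (sqn (\<lambda>x. \<rho> j x * (G x \<bullet> b))) + 3 * sqrt (sqn (\<lambda>x. D j x - G x \<bullet> b))"
        by (simp add: integral_nonneg_AE)
    qed
  qed
  then show "\<exists>t::nat \<Rightarrow> real. (\<forall>j. t j \<noteq> 0) \<and> t \<longlonglongrightarrow> 0 \<and>
      (\<lambda>j. sqrt (sqn (\<lambda>x. (S (v (x + t j *\<^sub>R b)) - S (v x)) / t j - S' (v x) *\<^sub>R G x \<bullet> b))) \<longlonglongrightarrow> 0"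
    using s s0 by blast
qed

section \<open>A smooth soft threshold\<close>

lemma pos_part_square_has_derivative:
  "((\<lambda>a::real. (max 0 a)\<^sup>2) has_real_derivative 2 * max 0 a) (at a)"
proof -
  consider "a > 0" | "a < 0" | "a = 0" by linarith
  then show ?thesis
  proof cases
    case 1
    have "((\<lambda>a::real. a\<^sup>2) has_real_derivative 2 * max 0 a) (at a)"
      using 1 by (auto intro!: derivative_eq_intros)
    then show ?thesis
      by (rule has_field_derivative_transform_within_open[of _ _ _ "{0<..}"]) (use 1 in auto)
  next
    case 2
    have "((\<lambda>a::real. 0) has_real_derivative 2 * max 0 a) (at a)"
      using 2 by auto
    then show ?thesis
      by (rule has_field_derivative_transform_within_open[of _ _ _ "{..<0}"]) (use 2 in auto)
  next
    case 3
    have "((\<lambda>h::real. (max 0 h)\<^sup>2 / h) \<longlongrightarrow> 0) (at 0)"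
    proof (rule Lim_null_comparison[OF always_eventually tendsto_rabs_zero[OF tendsto_ident_at]], rule allI)
      fix h :: real
      show "norm ((max 0 h)\<^sup>2 / h) \<le> \<bar>h\<bar>" by (cases "h > 0") (auto simp: max_def power2_eq_square)
    qed
    then show ?thesis unfolding 3 has_field_derivative_iff by simp
  qed
qed

text \<open>If \<open>v\<close> is uniformly \<open>\<eta>\<close>-close to \<open>w\<close>, then \<open>S \<circ> v\<close> vanishes at the zeros of \<open>w\<close>. The function is
  a difference of two squared positive parts on each side of \<open>0\<close>, which makes it continuously differentiable.\<close>

lemma soft_threshold:
  fixes \<eta> :: real
  assumes \<eta>: "\<eta> > 0"
  obtains S S' where "\<And>a. (S has_real_derivative S' a) (at a)" "continuous_on UNIV S'"
    "\<And>a. 0 \<le> S' a \<and> S' a \<le> 1" "\<And>a. \<bar>a\<bar> \<le> \<eta> \<Longrightarrow> S a = 0" "\<And>a. \<bar>S a - a\<bar> \<le> 2 * \<eta>"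
proof -
  define S where "S = (\<lambda>a. ((max 0 (a - \<eta>))\<^sup>2 - (max 0 (a - 2*\<eta>))\<^sup>2 - (max 0 (- a - \<eta>))\<^sup>2 + (max 0 (- a - 2*\<eta>))\<^sup>2) / (2*\<eta>))"
  define S' where "S' = (\<lambda>a. (max 0 (a - \<eta>) - max 0 (a - 2*\<eta>) + max 0 (- a - \<eta>) - max 0 (- a - 2*\<eta>)) / \<eta>)"
  have der: "(S has_real_derivative S' a) (at a)" for a
  proof -
    have 1: "((\<lambda>a. (max 0 (a - t))\<^sup>2) has_real_derivative 2 * max 0 (a - t)) (at a)" for t
    proof -
      have "((\<lambda>a. a - t) has_real_derivative 1) (at a)" by (auto intro!: derivative_eq_intros)
      from DERIV_chain2[OF pos_part_square_has_derivative this] show ?thesis by simp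
    qed
    have 2: "((\<lambda>a. (max 0 (- a - t))\<^sup>2) has_real_derivative - (2 * max 0 (- a - t))) (at a)" for t
    proof -
      have "((\<lambda>a. - a - t) has_real_derivative - 1) (at a)" by (auto intro!: derivative_eq_intros)
      from DERIV_chain2[OF pos_part_square_has_derivative this] show ?thesis by simp
    qed
    show ?thesis unfolding S_def S'_def
      by (rule DERIV_cong[OF DERIV_cdivide[OF DERIV_add[OF DERIV_diff[OF DERIV_diff[OF 1 1] 2] 2]]])
        (use \<eta> in \<open>simp add: field_simps\<close>)
  qed
  have cont: "continuous_on UNIV S'" unfolding S'_def using \<eta> by (intro continuous_intros) auto
  have bnd: "0 \<le> S' a \<and> S' a \<le> 1" for a unfolding S'_def using \<eta> by (auto simp: max_def divide_simps)
  have zero: "S a = 0" if "\<bar>a\<bar> \<le> \<eta>" for a unfolding S_def using that \<eta> by (auto simp: max_def)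
  have close: "\<bar>S a - a\<bar> \<le> 2 * \<eta>" for a
  proof -
    have S_pos: "\<bar>S a - a\<bar> \<le> 2 * \<eta>" if a: "a \<ge> 0" for a
    proof (cases "a \<le> 2 * \<eta>")
      case True
      have "S a = (max 0 (a - \<eta>))\<^sup>2 / (2 * \<eta>)" unfolding S_def using True a \<eta> by (simp add: max_def)
      moreover have "(max 0 (a - \<eta>))\<^sup>2 / (2 * \<eta>) \<le> a"
      proof -
        have "(max 0 (a - \<eta>))\<^sup>2 \<le> a * (2 * \<eta>)"
          unfolding power2_eq_square using True a \<eta> by (intro mult_mono) auto
        then show ?thesis using \<eta> by (simp add: divide_le_eq)
      qed
      moreover have "(max 0 (a - \<eta>))\<^sup>2 / (2 * \<eta>) \<ge> 0" using \<eta> by simp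
      ultimately show ?thesis using True by linarith
    next
      case False
      have "S a = ((a - \<eta>)\<^sup>2 - (a - 2*\<eta>)\<^sup>2) / (2 * \<eta>)" unfolding S_def using False \<eta> by (simp add: max_def)
      also have "\<dots> = a - 3 / 2 * \<eta>" using \<eta> by (simp add: power2_eq_square field_simps)
      finally show ?thesis using \<eta> by simp
    qed
    have odd: "S (- a) = - S a"
      unfolding S_def minus_divide_left by (rule arg_cong[where f = "\<lambda>t. t / (2 * \<eta>)"]) simp
    show ?thesis using S_pos[of a] S_pos[of "-a"] odd by (cases "a \<ge> 0") auto
  qed
  show ?thesis by (rule that[OF der cont bnd zero close])
qed

section \<open>Cut-off near a set\<close>

lemma sqn_scale: "sqn (\<lambda>x. c *\<^sub>R f x) = c\<^sup>2 * sqn f"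
  by (simp add: power_mult_distrib)

lemma lebesgue_measure_cball: "r \<ge> 0 \<Longrightarrow> measure lebesgue (cball (c::'a::euclidean_space) r) = unit_ball_vol (real DIM('a)) * r ^ DIM('a)"
  and lebesgue_measure_ball: "r \<ge> 0 \<Longrightarrow> measure lebesgue (ball (c::'a::euclidean_space) r) = unit_ball_vol (real DIM('a)) * r ^ DIM('a)"
  by (simp_all add: content_cball content_ball)

text \<open>Convolution of the indicator function of a neighbourhood of \<open>A\<close> with a bump of size \<open>\<delta>\<close> gives
  cut-offs with gradient at most \<open>C / \<delta>\<close>, where \<open>C\<close> depends only on the dimension.\<close>

lemma cutoff_neighbourhood:
  obtains C where "C > 0" "\<And>(A::'a::euclidean_space set) \<delta>. bounded A \<Longrightarrow> \<delta> > 0 \<Longrightarrow>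
    \<exists>m\<in>C_c_inf UNIV. (\<forall>x. 0 \<le> m x \<and> m x \<le> 1) \<and> (\<forall>x. (\<exists>a\<in>A. dist x a < \<delta>) \<longrightarrow> m x = 1) \<and>
      (\<forall>x. (m x \<noteq> 0 \<or> grad m x \<noteq> 0) \<longrightarrow> (\<exists>a\<in>A. dist x a < 4 * \<delta>)) \<and> (\<forall>x. norm (grad m x) \<le> C / \<delta>)"
proof -
  obtain \<beta> where \<beta>: "smooth \<beta>" "\<And>x::'a. 0 \<le> \<beta> x \<and> \<beta> x \<le> 1" "\<And>x. x \<in> cball 0 (1/2) \<Longrightarrow> \<beta> x = 1"
      "\<And>x. x \<notin> ball 0 1 \<Longrightarrow> \<beta> x = 0"
    by (rule smooth_cutoff_ball[of "1/2" 1 0]) auto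
  have \<beta>C: "\<beta> \<in> C_c_inf UNIV"
    by (rule C_c_infI[OF \<beta>(1), of "cball 0 1"]) (use \<beta>(4) in auto)
  obtain B where B: "B > 0" "\<And>x h. \<bar>frechet_derivative \<beta> (at x) h\<bar> \<le> B * norm h"
    by (rule C_c_inf_lipschitz[OF \<beta>C]) auto
  define n where "n = DIM('a)"
  define C where "C = real n * (2 ^ n * B)"
  define vol where "vol = unit_ball_vol (real n)"
  have vol: "vol > 0" unfolding vol_def by simp
  have "C > 0" using B by (simp add: C_def n_def)
  moreover have "\<exists>m\<in>C_c_inf UNIV. (\<forall>x. 0 \<le> m x \<and> m x \<le> 1) \<and> (\<forall>x. (\<exists>a\<in>A. dist x a < \<delta>) \<longrightarrow> m x = 1) \<and>
      (\<forall>x. (m x \<noteq> 0 \<or> grad m x \<noteq> 0) \<longrightarrow> (\<exists>a\<in>A. dist x a < 4 * \<delta>)) \<and> (\<forall>x. norm (grad m x) \<le> C / \<delta>)"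
    if A: "bounded A" and \<delta>: "\<delta> > 0" for A :: "'a set" and \<delta>
  proof -
    define E where "E = (\<Union>a\<in>A. ball a (2 * \<delta>))"
    have E: "open E" by (auto simp: E_def)
    then have Em: "E \<in> sets lebesgue" by (simp add: borel_open)
    obtain s where s: "\<And>a. a \<in> A \<Longrightarrow> norm a \<le> s" using A by (auto simp: bounded_iff)
    define v where "v = indicat_real E"
    have vL: "v \<in> L1_loc UNIV"
      unfolding L1_loc_def set_integrable_def v_def
    proof safe
      fix K :: "'a set" assume K: "compact K"
      then show "integrable lebesgue (\<lambda>x. indicat_real K x *\<^sub>R indicat_real E x)"
        using integrable_real_mult_indicator[OF Em compact_integrable_indicator[OF K, of 1]] by simp
    qed
    define \<phi> where "\<phi> = (\<lambda>x. \<beta> ((1/\<delta>) *\<^sub>R x + 0))"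
    have \<phi>: "\<phi> \<in> C_c_inf UNIV" unfolding \<phi>_def by (rule C_c_inf_affine[OF \<beta>C]) (use \<delta> in auto)
    have \<phi>0: "\<phi> x = 0" if "x \<notin> ball 0 \<delta>" for x
      unfolding \<phi>_def by (rule \<beta>(4)) (use that \<delta> in \<open>simp add: divide_simps\<close>)
    have \<phi>1: "\<phi> x = 1" if "x \<in> cball 0 (\<delta>/2)" for x
      unfolding \<phi>_def by (rule \<beta>(3)) (use that \<delta> in \<open>simp add: divide_simps\<close>)
    have \<phi>b: "0 \<le> \<phi> x \<and> \<phi> x \<le> 1" for x unfolding \<phi>_def by (rule \<beta>(2))
    have d\<phi>: "\<bar>pderivative b \<phi> x\<bar> \<le> B / \<delta> * indicat_real (cball 0 \<delta>) x" if b: "b \<in> Basis" for b x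
    proof (cases "x \<in> cball 0 \<delta>")
      case True
      have "pderivative b \<phi> x = (1/\<delta>) * pderivative b \<beta> ((1/\<delta>) *\<^sub>R x + 0)"
        unfolding \<phi>_def by (rule pderivative_affine[OF \<beta>(1)])
      then show ?thesis using B(2)[of "(1/\<delta>) *\<^sub>R x + 0" b] True \<delta> b by (simp add: abs_mult divide_right_mono)
    next
      case False
      then have "frechet_derivative \<phi> (at x) = (\<lambda>h. 0)"
        by (intro pderivative_eq_0_outside[of "cball 0 \<delta>" \<phi>]) (use \<phi>0 in auto)
      then show ?thesis using B \<delta> by simp
    qed
    have i\<phi>: "integrable lebesgue \<phi>" using L1_loc_test_integrable[OF L1_loc_const[of "1::real" UNIV] \<phi>] by simp
    define c where "c = (LINT y|lebesgue. \<phi> y)"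
    have c: "c \<ge> vol * (\<delta>/2) ^ n"
    proof -
      have "vol * (\<delta>/2) ^ n = (LINT y|lebesgue. 1 * indicat_real (cball (0::'a) (\<delta>/2)) y)"
        using lebesgue_measure_cball[of "\<delta>/2" "0::'a"] \<delta> by (simp add: vol_def n_def)
      also have "\<dots> \<le> c" unfolding c_def
        by (rule integral_mono[OF compact_integrable_indicator[OF compact_cball] i\<phi>])
          (use \<phi>1 \<phi>b in \<open>auto simp: indicator_def\<close>)
      finally show ?thesis .
    qed
    have c0: "c > 0" using c vol \<delta> by (meson half_gt_zero less_le_trans mult_pos_pos zero_less_power)
    have tr: "(\<lambda>y. \<psi> (y - z)) \<in> C_c_inf UNIV" if "\<psi> \<in> C_c_inf UNIV" for \<psi> and z :: 'a
      using C_c_inf_affine[OF that, of 1 "-z" UNIV] by simp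
    have iv: "integrable lebesgue (\<lambda>y. v y * \<psi> (y - z))" if "\<psi> \<in> C_c_inf UNIV" for \<psi> z
      using L1_loc_test_integrable[OF vL tr[OF that]] by (simp add: mult.commute)
    define m where "m = (\<lambda>z. (1/c) * (LINT y|lebesgue. v y * \<phi> (y - z)))"
    have i\<phi>z: "integrable lebesgue (\<lambda>y. \<phi> (y - z))" for z
      using L1_loc_test_integrable[OF L1_loc_const[of "1::real" UNIV] tr[OF \<phi>]] by simp
    have cz: "(LINT y|lebesgue. \<phi> (y - z)) = c" for z
      using integral_affine[of \<phi> 1 "-z"] borel_measurable_integrable[OF i\<phi>] by (simp add: c_def)
    have dm: "pderivative b m z = (1/c) * - (LINT y|lebesgue. v y * pderivative b \<phi> (y - z))" for b z
    proof -
      have "(m has_derivative (\<lambda>h. (1/c) * - (LINT y|lebesgue. v y * frechet_derivative \<phi> (at (y - z)) h))) (at z)"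
        unfolding m_def by (intro has_derivative_mult_right test_integral_has_derivative[OF vL \<phi>])
      from frechet_derivative_eqI[OF this] show ?thesis by simp
    qed
    have far: "m z = 0 \<and> grad m z = 0" if z: "\<not> (\<exists>a\<in>A. dist z a < 4 * \<delta>)" for z
    proof -
      have out: "y - z \<notin> cball 0 \<delta>" if "y \<in> E" for y
      proof
        assume "y - z \<in> cball 0 \<delta>"
        moreover obtain a where "a \<in> A" "dist a y < 2 * \<delta>" using \<open>y \<in> E\<close> by (auto simp: E_def)
        moreover have "dist z a \<le> dist a y + norm (y - z)"
          using dist_triangle[of z a y] by (simp add: dist_norm norm_minus_commute)
        ultimately have "dist z a < 4 * \<delta>" "a \<in> A" using \<delta> by simp_all
        then show False using z by blast
      qed
      have v0: "v y * \<phi> (y - z) = 0" for y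
      proof (cases "y \<in> E")
        case True
        then have "y - z \<notin> ball 0 \<delta>" using out[OF True] by simp
        then show ?thesis by (simp add: \<phi>0)
      qed (simp add: v_def)
      have v1: "v y * pderivative b \<phi> (y - z) = 0" if "b \<in> Basis" for y b
      proof (cases "y \<in> E")
        case True
        then show ?thesis using out[OF True] d\<phi>[OF that, of "y - z"] by simp
      qed (simp add: v_def)
      have "pderivative b m z = 0" if "b \<in> Basis" for b unfolding dm by (simp add: v1[OF that])
      then show ?thesis by (simp add: m_def v0 grad_def)
    qed
    have "smooth m" unfolding m_def by (intro smooth_mult smooth_const test_integral_smooth[OF vL \<phi>])
    then have "m \<in> C_c_inf UNIV"
    proof (rule C_c_infI[of _ "cball 0 (s + 4 * \<delta>)"])
      fix z :: 'a assume z: "z \<notin> cball 0 (s + 4 * \<delta>)"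
      have "\<not> (\<exists>a\<in>A. dist z a < 4 * \<delta>)"
      proof
        assume "\<exists>a\<in>A. dist z a < 4 * \<delta>"
        then obtain a where "a \<in> A" "dist z a < 4 * \<delta>" by blast
        then show False using s[of a] z norm_triangle_ineq2[of z a] by (simp add: dist_norm)
      qed
      then show "m z = 0" using far by blast
    qed auto
    moreover have "0 \<le> m z \<and> m z \<le> 1" for z
    proof
      show "0 \<le> m z" unfolding m_def using c0 \<phi>b by (auto intro!: mult_nonneg_nonneg integral_nonneg_AE simp: v_def)
      have "(LINT y|lebesgue. v y * \<phi> (y - z)) \<le> (LINT y|lebesgue. \<phi> (y - z))"
        by (rule integral_mono[OF iv[OF \<phi>] i\<phi>z]) (use \<phi>b in \<open>auto simp: v_def indicator_def\<close>)
      then show "m z \<le> 1" using c0 by (simp add: m_def cz divide_simps)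
    qed
    moreover have "m z = 1" if z: "\<exists>a\<in>A. dist z a < \<delta>" for z
    proof -
      obtain a where a: "a \<in> A" "dist z a < \<delta>" using z by blast
      have "v y * \<phi> (y - z) = \<phi> (y - z)" for y
      proof (cases "y - z \<in> ball 0 \<delta>")
        case True
        have "dist a y \<le> dist z a + norm (y - z)" using dist_triangle[of a y z] by (simp add: dist_norm norm_minus_commute)
        then have "y \<in> E" using True a by (force simp: E_def)
        then show ?thesis by (simp add: v_def)
      qed (simp add: \<phi>0)
      then have "(LINT y|lebesgue. v y * \<phi> (y - z)) = c" by (simp only: cz)
      then show ?thesis using c0 by (simp add: m_def)
    qed
    moreover have "norm (grad m z) \<le> C / \<delta>" for z
    proof -
      have "\<bar>pderivative b m z\<bar> \<le> 2 ^ n * B / \<delta>" if b: "b \<in> Basis" for b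
      proof -
        have "norm (LINT y|lebesgue. v y * pderivative b \<phi> (y - z)) \<le> (LINT y|lebesgue. B / \<delta> * indicat_real (cball z \<delta>) y)"
        proof (rule Bochner_Integration.integral_norm_bound_integral)
          fix y
          have "\<bar>v y\<bar> * \<bar>pderivative b \<phi> (y - z)\<bar> \<le> 1 * (B / \<delta> * indicat_real (cball 0 \<delta>) (y - z))"
            by (intro mult_mono d\<phi> b) (auto simp: v_def)
          moreover have "indicat_real (cball 0 \<delta>) (y - z) = indicat_real (cball z \<delta>) y"
            by (simp add: indicator_def dist_norm norm_minus_commute)
          ultimately show "norm (v y * pderivative b \<phi> (y - z)) \<le> B / \<delta> * indicat_real (cball z \<delta>) y"
            by (simp add: abs_mult)
        qed (rule iv[OF C_c_inf_pderivative[OF \<phi> b]], rule compact_integrable_indicator[OF compact_cball])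
        also have "\<dots> = B / \<delta> * (vol * \<delta> ^ n)"
          using lebesgue_measure_cball[of \<delta> z] \<delta> by (simp add: vol_def n_def)
        also have "\<dots> = (2 ^ n * B / \<delta>) * (vol * (\<delta>/2) ^ n)" by (simp add: power_divide)
        also have "\<dots> \<le> (2 ^ n * B / \<delta>) * c" using c B \<delta> by (intro mult_left_mono) auto
        finally have "\<bar>LINT y|lebesgue. v y * pderivative b \<phi> (y - z)\<bar> \<le> (2 ^ n * B / \<delta>) * c" by simp
        then show ?thesis using c0 by (simp add: dm abs_mult divide_le_eq)
      qed
      then have "(\<Sum>b\<in>Basis. norm (pderivative b m z *\<^sub>R b)) \<le> (\<Sum>b\<in>(Basis::'a set). 2 ^ n * B / \<delta>)"
        by (intro sum_mono) simp
      moreover have "norm (grad m z) \<le> (\<Sum>b\<in>Basis. norm (pderivative b m z *\<^sub>R b))" unfolding grad_def by (rule norm_sum)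
      ultimately show ?thesis by (simp add: C_def n_def)
    qed
    ultimately show ?thesis using far by blast
  qed
  ultimately show ?thesis using that by blast
qed

section \<open>Sobolev functions vanishing on a thick set\<close>

lemma lebesgue_ex_borel:
  fixes v :: "'a::euclidean_space \<Rightarrow> real"
  assumes "v \<in> borel_measurable lebesgue"
  obtains v0 where "v0 \<in> borel_measurable borel" "AE x in lborel. v x = v0 x"
  using completion_ex_borel_measurable_real[OF assms] by auto

lemma lebesgue_ex_borel_set:
  fixes A :: "'a::euclidean_space set"
  assumes "A \<in> sets lebesgue"
  obtains A0 where "A0 \<in> sets borel" "AE x in lborel. x \<in> A \<longleftrightarrow> x \<in> A0"
proof -
  obtain g where g: "g \<in> borel_measurable borel" "AE x in lborel. indicat_real A x = g x"
    by (rule lebesgue_ex_borel[of "indicat_real A"]) (use assms in auto)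
  have "{x. g x = 1} \<in> sets borel" using g(1) by measurable
  moreover have "AE x in lborel. x \<in> A \<longleftrightarrow> x \<in> {x. g x = 1}"
    using g(2) by eventually_elim (auto simp: indicator_def split: if_splits)
  ultimately show ?thesis using that by blast
qed

text \<open>If every point of \<open>N\<close> sees a definite amount of the zero set \<open>A\<close> of \<open>v\<close> at scale \<open>s\<close>, then on \<open>N\<close> the
  function itself is controlled by its increments: integrate \<open>(v y - v x)\<^sup>2 = (v x)\<^sup>2\<close> over \<open>x \<in> N\<close> and
  \<open>y \<in> A \<inter> ball x s\<close>, and exchange the integrals after the substitution \<open>y = x + h\<close>.\<close>

lemma zero_set_increment_bound:
  fixes v :: "'a::euclidean_space \<Rightarrow> real"
  assumes v: "v \<in> L2 UNIV" and A: "A \<in> sets lebesgue" and N: "N \<in> sets lebesgue"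
    and v0: "AE x in lebesgue. x \<in> A \<longrightarrow> v x = 0"
    and c: "c \<ge> 0" "\<And>x. x \<in> N \<Longrightarrow> c \<le> measure lebesgue (ball x s \<inter> A)"
    and K: "K \<ge> 0" "\<And>h. norm h < s \<Longrightarrow> sqn (\<lambda>x. indicator N x * (v (x + h) - v x)) \<le> K"
  shows "c * sqn (\<lambda>x. indicator N x * v x) \<le> measure lebesgue (ball (0::'a) s) * K"
proof -
  obtain w where w [measurable]: "w \<in> borel_measurable borel" and vw: "AE x in lborel. v x = w x"
    by (rule lebesgue_ex_borel[OF L2_UNIV_measurable[OF v]])
  obtain N0 where N0 [measurable]: "N0 \<in> sets borel" and NN0: "AE x in lborel. x \<in> N \<longleftrightarrow> x \<in> N0"
    by (rule lebesgue_ex_borel_set[OF N])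
  obtain A0 where A0 [measurable]: "A0 \<in> sets borel" and AA0: "AE x in lborel. x \<in> A \<longleftrightarrow> x \<in> A0"
    by (rule lebesgue_ex_borel_set[OF A])
  define A1 where "A1 = A0 \<inter> {x. w x = 0}"
  have A1 [measurable]: "A1 \<in> sets borel" unfolding A1_def by measurable
  have AA1: "AE x in lborel. x \<in> A \<longleftrightarrow> x \<in> A1"
    using AA0 vw v0[unfolded AE_completion_iff] by eventually_elim (auto simp: A1_def)
  have [measurable]: "ball z t \<in> sets borel" for z :: 'a and t by simp
  define Q where "Q = (\<lambda>x y. indicator N0 x * (indicator (ball x s) y * indicator A1 y * ennreal ((w y - w x)\<^sup>2)))"
  have vN: "(\<lambda>x. indicat_real N x * v x) \<in> L2 UNIV"
    using L2_UNIV_mult_bounded[OF v, of "indicat_real N" 1] N by simp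
  have "ennreal (c * sqn (\<lambda>x. indicator N x * v x)) = ennreal c * (\<integral>\<^sup>+x. ennreal ((norm (indicat_real N x * v x))\<^sup>2) \<partial>lebesgue)"
    using L2_UNIV_integrable[OF vN] c(1) by (simp add: ennreal_mult nn_integral_eq_integral)
  also have "\<dots> = (\<integral>\<^sup>+x. ennreal c * ennreal ((norm (indicat_real N x * v x))\<^sup>2) \<partial>lebesgue)"
    using L2_UNIV_measurable[OF vN] by (subst nn_integral_cmult) auto
  also have "\<dots> = (\<integral>\<^sup>+x. ennreal c * ennreal ((norm (indicat_real N x * v x))\<^sup>2) \<partial>lborel)"
    by (rule nn_integral_completion)
  also have "\<dots> \<le> (\<integral>\<^sup>+x. (\<integral>\<^sup>+y. Q x y \<partial>lborel) \<partial>lborel)"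
  proof (rule nn_integral_mono_AE)
    show "AE x in lborel. ennreal c * ennreal ((norm (indicat_real N x * v x))\<^sup>2) \<le> (\<integral>\<^sup>+y. Q x y \<partial>lborel)"
      using NN0 vw
    proof eventually_elim
      case (elim x)
      show ?case
      proof (cases "x \<in> N")
        case True
        have "(\<integral>\<^sup>+y. Q x y \<partial>lborel) = (\<integral>\<^sup>+y. ennreal ((w x)\<^sup>2) * indicator (ball x s \<inter> A1) y \<partial>lborel)"
          using True elim by (intro nn_integral_cong) (auto simp: Q_def A1_def indicator_def)
        also have "\<dots> = ennreal ((w x)\<^sup>2) * emeasure lborel (ball x s \<inter> A1)"
          by (subst nn_integral_cmult_indicator) auto
        also have "emeasure lborel (ball x s \<inter> A1) = emeasure lebesgue (ball x s \<inter> A1)" by simp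
        also have "\<dots> = emeasure lebesgue (ball x s \<inter> A)"
        proof (rule emeasure_eq_AE)
          show "AE y in lebesgue. y \<in> ball x s \<inter> A1 \<longleftrightarrow> y \<in> ball x s \<inter> A"
            unfolding AE_completion_iff using AA1 by eventually_elim auto
        qed (use A A1 in auto)
        also have "\<dots> = ennreal (measure lebesgue (ball x s \<inter> A))"
        proof (rule emeasure_eq_ennreal_measure)
          have "ball x s \<inter> A \<in> lmeasurable" using A by (simp add: fmeasurable_Int_fmeasurable)
          then show "emeasure lebesgue (ball x s \<inter> A) \<noteq> top" by (rule fmeasurableD2)
        qed
        also have "ennreal ((w x)\<^sup>2) * ennreal (measure lebesgue (ball x s \<inter> A)) \<ge> ennreal ((w x)\<^sup>2) * ennreal c"
          using c True by (intro mult_left_mono) (auto intro: ennreal_leI)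
        finally show ?thesis using True elim by (simp add: mult.commute)
      qed simp
    qed
  qed
  also have "\<dots> = (\<integral>\<^sup>+x. (\<integral>\<^sup>+h. Q x (x + h) \<partial>lborel) \<partial>lborel)"
  proof (rule nn_integral_cong)
    fix x
    have [measurable]: "(\<lambda>y. Q x y) \<in> borel_measurable borel" unfolding Q_def by measurable
    have "(\<integral>\<^sup>+y. Q x y \<partial>lborel) = (\<integral>\<^sup>+y. Q x y \<partial>distr lborel borel ((+) x))" by (simp add: lborel_distr_plus)
    also have "\<dots> = (\<integral>\<^sup>+h. Q x (x + h) \<partial>lborel)" by (subst nn_integral_distr) auto
    finally show "(\<integral>\<^sup>+y. Q x y \<partial>lborel) = (\<integral>\<^sup>+h. Q x (x + h) \<partial>lborel)" .
  qed
  also have "\<dots> \<le> (\<integral>\<^sup>+x. (\<integral>\<^sup>+h. indicator N0 x * (indicator (ball 0 s) h * ennreal ((w (x + h) - w x)\<^sup>2)) \<partial>lborel) \<partial>lborel)"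
    by (intro nn_integral_mono) (auto simp: Q_def indicator_def dist_norm)
  also have "\<dots> = (\<integral>\<^sup>+h. (\<integral>\<^sup>+x. indicator N0 x * (indicator (ball 0 s) h * ennreal ((w (x + h) - w x)\<^sup>2)) \<partial>lborel) \<partial>lborel)"
    by (rule lborel_pair.Fubini') measurable
  also have "\<dots> \<le> (\<integral>\<^sup>+h. ennreal K * indicator (ball (0::'a) s) h \<partial>lborel)"
  proof (rule nn_integral_mono)
    fix h :: 'a
    show "(\<integral>\<^sup>+x. indicator N0 x * (indicator (ball 0 s) h * ennreal ((w (x + h) - w x)\<^sup>2)) \<partial>lborel) \<le> ennreal K * indicator (ball 0 s) h"
    proof (cases "h \<in> ball 0 s")
      case True
      have "AE x in lebesgue. v (x + h) = w (x + h)"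
        using AE_affine[of "\<lambda>x. v x = w x" 1 h] vw by (simp add: AE_completion_iff)
      then have vwh: "AE x in lborel. v (x + h) = w (x + h)" by (simp add: AE_completion_iff)
      have L: "(\<lambda>x. indicat_real N x * (v (x + h) - v x)) \<in> L2 UNIV"
        using L2_UNIV_mult_bounded[OF L2_UNIV_diff[OF L2_UNIV_translate[OF v, of h] v], of "indicat_real N" 1] N by simp
      have "(\<integral>\<^sup>+x. indicator N0 x * (indicator (ball 0 s) h * ennreal ((w (x + h) - w x)\<^sup>2)) \<partial>lborel)
          = (\<integral>\<^sup>+x. ennreal ((norm (indicat_real N x * (v (x + h) - v x)))\<^sup>2) \<partial>lborel)"
      proof (rule nn_integral_cong_AE)
        show "AE x in lborel. indicator N0 x * (indicator (ball 0 s) h * ennreal ((w (x + h) - w x)\<^sup>2))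
            = ennreal ((norm (indicat_real N x * (v (x + h) - v x)))\<^sup>2)"
          using NN0 vw vwh by eventually_elim (use True in \<open>auto simp: indicator_def\<close>)
      qed
      also have "\<dots> = (\<integral>\<^sup>+x. ennreal ((norm (indicat_real N x * (v (x + h) - v x)))\<^sup>2) \<partial>lebesgue)"
        by (rule nn_integral_completion[symmetric])
      also have "\<dots> = ennreal (sqn (\<lambda>x. indicator N x * (v (x + h) - v x)))"
        using L2_UNIV_integrable[OF L] by (simp add: nn_integral_eq_integral)
      also have "\<dots> \<le> ennreal K" using K(2)[of h] True by (intro ennreal_leI) auto
      finally show ?thesis using True by simp
    qed simp
  qed
  also have "\<dots> = ennreal K * emeasure lborel (ball (0::'a) s)" by (subst nn_integral_cmult_indicator) auto
  also have "emeasure lborel (ball (0::'a) s) = emeasure lebesgue (ball (0::'a) s)" by simp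
  also have "\<dots> = ennreal (measure lebesgue (ball (0::'a) s))"
    by (rule emeasure_eq_ennreal_measure) (rule fmeasurableD2, simp)
  also have "ennreal K * ennreal (measure lebesgue (ball (0::'a) s)) = ennreal (measure lebesgue (ball (0::'a) s) * K)"
    using K(1) by (simp add: ennreal_mult mult.commute)
  finally show ?thesis
    by (rule ennreal_le_iff[THEN iffD1, rotated]) (use K(1) in simp)
qed

text \<open>At every point of \<open>Om\<close> close to \<open>A\<close> the complement of \<open>Om\<close> has positive density. Applied to the
  indicator function of \<open>Om\<close>, the previous bound shows that the points of \<open>Om\<close> in the closure of \<open>A\<close> form
  a null set; applied to \<open>V\<close>, it then bounds \<open>\<integral> V\<^sup>2\<close> over the part of \<open>Om\<close> within \<open>\<delta>\<close> of \<open>A\<close> by \<open>o (\<delta>\<^sup>2)\<close>, which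
  beats the gradient \<open>C / \<delta>\<close> of the cut-off.\<close>

lemma cutoff_near_thick_complement:
  fixes V :: "'a::euclidean_space \<Rightarrow> real"
  assumes H: "H1 V G" and Om: "Om \<in> sets lebesgue" "bounded Om" and V0: "AE x in lebesgue. x \<notin> Om \<longrightarrow> V x = 0"
    and A: "bounded A"
    and c: "c > 0" and \<delta>0: "\<delta>0 > 0"
    and dens: "\<And>\<delta> x. 0 < \<delta> \<Longrightarrow> \<delta> \<le> \<delta>0 \<Longrightarrow> x \<in> Om \<Longrightarrow> \<exists>a\<in>A. dist x a < \<delta> \<Longrightarrow>
      c * \<delta> ^ DIM('a) \<le> measure lebesgue (ball x (2 * \<delta>) - Om)"
    and e: "e > 0"
  obtains m d where "m \<in> C_c_inf UNIV" "\<And>x. 0 \<le> m x \<and> m x \<le> 1" "d > 0"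
    "\<And>x. \<exists>a\<in>A. dist x a < d \<Longrightarrow> m x = 1"
    "sqn (\<lambda>x. m x * V x) \<le> e" "sqn (\<lambda>x. V x *\<^sub>R grad m x) \<le> e"
proof -
  define n where "n = DIM('a)"
  define vol where "vol = unit_ball_vol (real n)"
  have vol: "vol > 0" unfolding vol_def by simp
  note VL = H1_D(1)[OF H] and GL = H1_D(2)[OF H]
  define P where "P = (\<lambda>\<delta>. Om \<inter> (\<Union>a\<in>A. ball a \<delta>))"
  have Pm: "P \<delta> \<in> sets lebesgue" for \<delta>
  proof -
    have "open (\<Union>a\<in>A. ball a \<delta>)" by auto
    then show ?thesis unfolding P_def using Om by (intro sets.Int) (simp_all add: borel_open)
  qed
  have P_iff: "x \<in> P \<delta> \<longleftrightarrow> x \<in> Om \<and> (\<exists>a\<in>A. dist x a < \<delta>)" for x \<delta> by (auto simp: P_def dist_commute)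
  have Pmono: "P \<delta> \<subseteq> P \<delta>'" if "\<delta> \<le> \<delta>'" for \<delta> \<delta>' using that by (auto simp: P_def)
  have Omc: "- Om \<in> sets lebesgue" using Om(1) by (metis Compl_in_sets_lebesgue)
  have bound: "c * sqn (\<lambda>x. indicator N x * v x) \<le> vol * 2 ^ n * K"
    if v: "v \<in> L2 UNIV" and v0: "AE x in lebesgue. x \<notin> Om \<longrightarrow> v x = 0" and \<delta>: "0 < \<delta>" "\<delta> \<le> \<delta>0"
      and N: "N \<in> sets lebesgue" "N \<subseteq> P \<delta>"
      and K: "\<And>h. norm h < 2 * \<delta> \<Longrightarrow> sqn (\<lambda>x. indicator N x * (v (x + h) - v x)) \<le> K" for v :: "'a \<Rightarrow> real" and \<delta> K N
  proof -
    have K0: "K \<ge> 0" using K[of 0] \<delta> by simp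
    have "c * \<delta> ^ n * sqn (\<lambda>x. indicator N x * v x) \<le> measure lebesgue (ball (0::'a) (2 * \<delta>)) * K"
    proof (rule zero_set_increment_bound[OF v Omc N(1)])
      fix x assume "x \<in> N"
      then have "x \<in> P \<delta>" using N by blast
      then show "c * \<delta> ^ n \<le> measure lebesgue (ball x (2 * \<delta>) \<inter> - Om)"
        using dens[OF \<delta>, of x] by (simp add: P_iff n_def Diff_eq)
    qed (use v0 c \<delta> K K0 in auto)
    also have "measure lebesgue (ball (0::'a) (2 * \<delta>)) * K = \<delta> ^ n * (vol * 2 ^ n * K)"
      using \<delta> by (subst lebesgue_measure_ball) (auto simp: vol_def n_def power_mult_distrib)
    finally have "\<delta> ^ n * (c * sqn (\<lambda>x. indicator N x * v x)) \<le> \<delta> ^ n * (vol * 2 ^ n * K)"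
      by (simp only: mult_ac)
    then show ?thesis using \<delta> by (simp only: mult_le_cancel_left_pos zero_less_power)
  qed
  define t where "t = (\<lambda>j. inverse (real (Suc j)))"
  have t: "t j > 0" for j by (simp add: t_def)
  have t0: "t \<longlonglongrightarrow> 0" unfolding t_def by (rule LIMSEQ_inverse_real_of_nat)
  define N0 where "N0 = (\<Inter>j. P (t j))"
  have N0m: "N0 \<in> sets lebesgue" unfolding N0_def using Pm by (intro sets.countable_INT'') auto
  have N0_null: "AE x in lebesgue. x \<notin> N0"
  proof -
    define v where "v = indicat_real Om"
    have "Om \<in> lmeasurable" using Om by (simp add: bounded_set_imp_lmeasurable)
    then have "integrable lebesgue (indicat_real Om)"
      unfolding fmeasurable_def by (intro integrable_real_indicator) auto
    moreover have "(norm (indicat_real Om x))\<^sup>2 = indicat_real Om x" for x by (simp add: indicator_def)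
    ultimately have v: "v \<in> L2 UNIV" using Om(1) by (simp add: v_def L2_UNIV_iff)
    have le: "c * sqn (\<lambda>x. indicator N0 x * v x) \<le> vol * 2 ^ n * \<kappa>" if \<kappa>: "\<kappa> > 0" for \<kappa>
    proof -
      obtain d where d: "d > 0" "\<And>h. norm h < d \<Longrightarrow> sqrt (sqn (\<lambda>x. v (x + h) - v x)) \<le> sqrt \<kappa>"
        by (rule L2_translation_continuous_real[OF v, of "sqrt \<kappa>"]) (use \<kappa> in auto)
      have "\<forall>\<^sub>F j in sequentially. t j < min (d/2) \<delta>0"
        using order_tendstoD(2)[OF t0, of "min (d/2) \<delta>0"] d \<delta>0 by simp
      then obtain j where j: "t j < min (d/2) \<delta>0" using eventually_happens'[OF sequentially_bot] by blast
      show ?thesis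
      proof (rule bound[OF v _ t[of j]])
        fix h :: 'a assume h: "norm h < 2 * t j"
        have "sqn (\<lambda>x. indicator N0 x * (v (x + h) - v x)) \<le> sqn (\<lambda>x. v (x + h) - v x)"
          by (rule sqn_mono[OF L2_UNIV_diff[OF L2_UNIV_translate[OF v] v]]) (auto simp: indicator_def)
        also have "\<dots> \<le> \<kappa>" using d(2)[of h] h j by simp
        finally show "sqn (\<lambda>x. indicator N0 x * (v (x + h) - v x)) \<le> \<kappa>" .
      qed (use j N0m in \<open>auto simp: v_def N0_def\<close>)
    qed
    have "c * sqn (\<lambda>x. indicator N0 x * v x) \<le> 0"
    proof (rule field_le_epsilon)
      fix \<kappa> :: real assume "\<kappa> > 0"
      then show "c * sqn (\<lambda>x. indicator N0 x * v x) \<le> 0 + \<kappa>"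
        using le[of "\<kappa> / (vol * 2 ^ n)"] vol by simp
    qed
    then have "sqn (\<lambda>x. indicator N0 x * v x) \<le> 0" using c by (simp add: mult_le_0_iff)
    then have "sqn (\<lambda>x. indicator N0 x * v x) = 0" by (intro antisym integral_nonneg_AE) auto
    moreover have "(\<lambda>x. indicat_real N0 x * v x) \<in> L2 UNIV"
      using L2_UNIV_mult_bounded[OF v, of "indicat_real N0" 1] N0m by simp
    ultimately have "AE x in lebesgue. (norm (indicat_real N0 x * v x))\<^sup>2 = 0"
      by (subst (asm) integral_nonneg_eq_0_iff_AE) (auto dest: L2_UNIV_integrable)
    then show ?thesis by eventually_elim (auto simp: v_def N0_def P_def indicator_def split: if_splits)
  qed
  have gP: "(\<lambda>j. sqn (\<lambda>x. indicator (P (t j)) x *\<^sub>R G x)) \<longlonglongrightarrow> 0"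
  proof (rule sqn_tendsto_0_dominated[OF _ GL])
    show "(\<lambda>x. indicat_real (P (t j)) x *\<^sub>R G x) \<in> borel_measurable lebesgue" for j
      using Pm[of j] L2_UNIV_measurable[OF GL] Pm by (intro borel_measurable_scaleR) auto
    show "AE x in lebesgue. (\<lambda>j. indicat_real (P (t j)) x *\<^sub>R G x) \<longlonglongrightarrow> 0"
      using N0_null
    proof eventually_elim
      case (elim x)
      then obtain j0 where j0: "x \<notin> P (t j0)" by (auto simp: N0_def)
      have "x \<notin> P (t j)" if "j \<ge> j0" for j
        using Pmono[of "t j" "t j0"] j0 that by (auto simp: t_def)
      then show ?case by (intro tendsto_eventually) (auto simp: eventually_sequentially intro!: exI[of _ j0])
    qed
  qed (auto simp: indicator_def)
  obtain C where C: "C > 0" "\<And>(A::'a set) \<delta>. bounded A \<Longrightarrow> \<delta> > 0 \<Longrightarrow>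
    \<exists>m\<in>C_c_inf UNIV. (\<forall>x. 0 \<le> m x \<and> m x \<le> 1) \<and> (\<forall>x. (\<exists>a\<in>A. dist x a < \<delta>) \<longrightarrow> m x = 1) \<and>
      (\<forall>x. (m x \<noteq> 0 \<or> grad m x \<noteq> 0) \<longrightarrow> (\<exists>a\<in>A. dist x a < 4 * \<delta>)) \<and> (\<forall>x. norm (grad m x) \<le> C / \<delta>)"
    by (rule cutoff_neighbourhood) blast
  define M where "M = 16 * vol * 2 ^ n / c"
  have M: "M > 0" using vol c by (simp add: M_def)
  define \<kappa> where "\<kappa> = sqrt (e / (M * (16 * C\<^sup>2 + 1)))"
  have den: "M * (16 * C\<^sup>2 + 1) > 0" using M by (intro mult_pos_pos add_nonneg_pos) auto
  have \<kappa>: "\<kappa> > 0" unfolding \<kappa>_def using e den by simp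
  have \<kappa>2: "M * \<kappa>\<^sup>2 * (16 * C\<^sup>2 + 1) = e" unfolding \<kappa>_def using e den by (simp add: field_simps)
  obtain d where d: "d > 0" "\<And>h. norm h < d \<Longrightarrow> sqrt (sqn (\<lambda>x. V (x + h) - V x - G x \<bullet> h)) \<le> norm h * \<kappa>"
    by (rule H1_increment[OF H \<kappa>]) auto
  have "\<forall>\<^sub>F j in sequentially. t j < min (min (d/2) 1) \<delta>0 \<and> sqn (\<lambda>x. indicator (P (t j)) x *\<^sub>R G x) < \<kappa>\<^sup>2"
    by (intro eventually_conj order_tendstoD(2)[OF t0] order_tendstoD(2)[OF gP]) (use d \<delta>0 \<kappa> in auto)
  then obtain j where j: "t j < min (min (d/2) 1) \<delta>0" "sqn (\<lambda>x. indicator (P (t j)) x *\<^sub>R G x) < \<kappa>\<^sup>2"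
    using eventually_happens'[OF sequentially_bot] by blast
  define \<delta> where "\<delta> = t j"
  have \<delta>: "0 < \<delta>" "\<delta> < d/2" "\<delta> < 1" "\<delta> < \<delta>0" using j t[of j] by (auto simp: \<delta>_def)
  have g: "sqrt (sqn (\<lambda>x. indicator (P \<delta>) x *\<^sub>R G x)) \<le> \<kappa>"
    using j(2) \<kappa> by (intro real_le_lsqrt) (auto simp: \<delta>_def)
  have iPL: "(\<lambda>x. indicat_real (P \<delta>) x *\<^sub>R f x) \<in> L2 UNIV" if "f \<in> L2 UNIV" for f :: "'a \<Rightarrow> 'b::euclidean_space"
    by (rule L2_UNIV_mult_bounded[OF that, of _ 1]) (use Pm in auto)
  have main: "sqn (\<lambda>x. indicator (P \<delta>) x * V x) \<le> M * \<delta>\<^sup>2 * \<kappa>\<^sup>2"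
  proof -
    have "c * sqn (\<lambda>x. indicator (P \<delta>) x * V x) \<le> vol * 2 ^ n * (4 * \<delta> * \<kappa>)\<^sup>2"
    proof (rule bound[OF VL V0 \<delta>(1)])
      fix h :: 'a assume h: "norm h < 2 * \<delta>"
      have Gh: "(\<lambda>x. G x \<bullet> h) \<in> L2 UNIV"
      proof (rule L2_UNIV_bound[OF L2_UNIV_scale[OF GL, of "norm h"]])
        show "AE x in lebesgue. norm (G x \<bullet> h) \<le> norm (norm h *\<^sub>R G x)"
          using Cauchy_Schwarz_ineq2[of "G _" h] by (auto simp: mult.commute)
      qed (use L2_UNIV_measurable[OF GL] in measurable)
      have L: "(\<lambda>x. V (x + h) - V x - G x \<bullet> h) \<in> L2 UNIV"
        by (intro L2_UNIV_diff L2_UNIV_translate VL Gh)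
      have "sqrt (sqn (\<lambda>x. indicator (P \<delta>) x * (V (x + h) - V x)))
          = sqrt (sqn (\<lambda>x. indicat_real (P \<delta>) x *\<^sub>R (V (x + h) - V x - G x \<bullet> h) + indicat_real (P \<delta>) x *\<^sub>R (G x \<bullet> h)))"
        by (simp add: algebra_simps)
      also have "\<dots> \<le> sqrt (sqn (\<lambda>x. indicat_real (P \<delta>) x *\<^sub>R (V (x + h) - V x - G x \<bullet> h))) + sqrt (sqn (\<lambda>x. indicat_real (P \<delta>) x *\<^sub>R (G x \<bullet> h)))"
        by (rule L2_triangle[OF iPL[OF L] iPL[OF Gh]])
      also have "\<dots> \<le> norm h * \<kappa> + norm h * \<kappa>"
      proof (rule add_mono)
        have "sqn (\<lambda>x. indicat_real (P \<delta>) x *\<^sub>R (V (x + h) - V x - G x \<bullet> h)) \<le> sqn (\<lambda>x. V (x + h) - V x - G x \<bullet> h)"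
          by (rule sqn_mono[OF L]) (auto simp: indicator_def)
        then have "sqrt (sqn (\<lambda>x. indicat_real (P \<delta>) x *\<^sub>R (V (x + h) - V x - G x \<bullet> h))) \<le> sqrt (sqn (\<lambda>x. V (x + h) - V x - G x \<bullet> h))"
          by (rule real_sqrt_le_mono)
        also have "\<dots> \<le> norm h * \<kappa>" by (rule d(2)) (use h \<delta> in simp)
        finally show "sqrt (sqn (\<lambda>x. indicat_real (P \<delta>) x *\<^sub>R (V (x + h) - V x - G x \<bullet> h))) \<le> norm h * \<kappa>" .
        have "sqn (\<lambda>x. indicat_real (P \<delta>) x *\<^sub>R (G x \<bullet> h)) \<le> sqn (\<lambda>x. norm h *\<^sub>R (indicat_real (P \<delta>) x *\<^sub>R G x))"
        proof (rule sqn_mono[OF L2_UNIV_scale[OF iPL[OF GL]] AE_I2])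
          fix x
          show "norm (indicat_real (P \<delta>) x *\<^sub>R (G x \<bullet> h)) \<le> norm (norm h *\<^sub>R indicat_real (P \<delta>) x *\<^sub>R G x)"
            using Cauchy_Schwarz_ineq2[of "G x" h] by (auto simp: indicator_def mult.commute)
        qed
        also have "\<dots> = (norm h)\<^sup>2 * sqn (\<lambda>x. indicat_real (P \<delta>) x *\<^sub>R G x)" by (rule sqn_scale)
        finally have "sqrt (sqn (\<lambda>x. indicat_real (P \<delta>) x *\<^sub>R (G x \<bullet> h))) \<le> sqrt ((norm h)\<^sup>2 * sqn (\<lambda>x. indicat_real (P \<delta>) x *\<^sub>R G x))"
          by (rule real_sqrt_le_mono)
        also have "\<dots> = norm h * sqrt (sqn (\<lambda>x. indicat_real (P \<delta>) x *\<^sub>R G x))" unfolding real_sqrt_mult by simp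
        also have "\<dots> \<le> norm h * \<kappa>" using g by (intro mult_left_mono) auto
        finally show "sqrt (sqn (\<lambda>x. indicat_real (P \<delta>) x *\<^sub>R (G x \<bullet> h))) \<le> norm h * \<kappa>" .
      qed
      also have "\<dots> \<le> 4 * \<delta> * \<kappa>" using mult_right_mono[of "norm h" "2 * \<delta>" \<kappa>] h \<kappa> by simp
      finally show "sqn (\<lambda>x. indicator (P \<delta>) x * (V (x + h) - V x)) \<le> (4 * \<delta> * \<kappa>)\<^sup>2" by (rule sqrt_le_D)
    qed (use \<delta> Pm in auto)
    then show ?thesis using c by (simp add: M_def power_mult_distrib field_simps)
  qed
  obtain m where m: "m \<in> C_c_inf UNIV" "\<And>x. 0 \<le> m x \<and> m x \<le> 1" "\<And>x. \<exists>a\<in>A. dist x a < \<delta>/4 \<Longrightarrow> m x = 1"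
      "\<And>x. m x \<noteq> 0 \<or> grad m x \<noteq> 0 \<Longrightarrow> \<exists>a\<in>A. dist x a < 4 * (\<delta>/4)" "\<And>x. norm (grad m x) \<le> C / (\<delta>/4)"
    using C(2)[OF A, of "\<delta>/4"] \<delta>(1) by auto
  have iPV: "(\<lambda>x. indicat_real (P \<delta>) x * V x) \<in> L2 UNIV" using iPL[OF VL] by simp
  have "sqn (\<lambda>x. m x * V x) \<le> sqn (\<lambda>x. indicat_real (P \<delta>) x * V x)"
  proof (rule sqn_mono[OF iPV])
    show "AE x in lebesgue. norm (m x * V x) \<le> norm (indicat_real (P \<delta>) x * V x)"
      using V0
    proof eventually_elim
      case (elim x)
      show ?case
      proof (cases "x \<in> P \<delta>")
        case True
        then show ?thesis using m(2)[of x] by (simp add: abs_mult mult_left_le_one_le)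
      next
        case False
        then show ?thesis using elim m(4)[of x] by (auto simp: P_iff)
      qed
    qed
  qed
  also have "\<dots> \<le> M * \<delta>\<^sup>2 * \<kappa>\<^sup>2" by (rule main)
  also have "\<dots> \<le> M * \<kappa>\<^sup>2 * (16 * C\<^sup>2 + 1)"
  proof -
    have "\<delta>\<^sup>2 \<le> 16 * C\<^sup>2 + 1" using \<delta> by (smt (verit) power_le_one zero_le_power2 mult_nonneg_nonneg)
    then have "(M * \<kappa>\<^sup>2) * \<delta>\<^sup>2 \<le> (M * \<kappa>\<^sup>2) * (16 * C\<^sup>2 + 1)" using M by (intro mult_left_mono) auto
    then show ?thesis by (simp only: mult_ac)
  qed
  also have "\<dots> = e" by (rule \<kappa>2)
  finally have 1: "sqn (\<lambda>x. m x * V x) \<le> e" .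
  have "sqn (\<lambda>x. V x *\<^sub>R grad m x) \<le> sqn (\<lambda>x. (4 * C / \<delta>) *\<^sub>R (indicat_real (P \<delta>) x * V x))"
  proof (rule sqn_mono[OF L2_UNIV_scale[OF iPV]])
    show "AE x in lebesgue. norm (V x *\<^sub>R grad m x) \<le> norm ((4 * C / \<delta>) *\<^sub>R (indicat_real (P \<delta>) x * V x))"
      using V0
    proof eventually_elim
      case (elim x)
      show ?case
      proof (cases "x \<in> P \<delta>")
        case True
        have "\<bar>V x\<bar> * norm (grad m x) \<le> \<bar>V x\<bar> * (4 * C / \<delta>)" using m(5)[of x] by (intro mult_left_mono) (auto simp: mult.commute)
        then show ?thesis using True C \<delta> by (simp add: abs_mult mult.commute)
      next
        case False
        then show ?thesis using elim m(4)[of x] by (cases "grad m x = 0") (auto simp: P_iff)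
      qed
    qed
  qed
  also have "\<dots> = (4 * C / \<delta>)\<^sup>2 * sqn (\<lambda>x. indicat_real (P \<delta>) x * V x)"
    by (rule sqn_scale)
  also have "\<dots> \<le> (4 * C / \<delta>)\<^sup>2 * (M * \<delta>\<^sup>2 * \<kappa>\<^sup>2)" by (intro mult_left_mono main) auto
  also have "\<dots> = M * \<kappa>\<^sup>2 * (16 * C\<^sup>2)" using \<delta> by (simp add: power_divide power_mult_distrib)
  also have "\<dots> \<le> M * \<kappa>\<^sup>2 * (16 * C\<^sup>2 + 1)" using M by (intro mult_left_mono) auto
  also have "\<dots> = e" by (rule \<kappa>2)
  finally have 2: "sqn (\<lambda>x. V x *\<^sub>R grad m x) \<le> e" .
  show ?thesis by (rule that[of m "\<delta>/4", OF m(1,2) _ m(3) 1 2]) (use \<delta> in auto)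
qed

section \<open>Rescaled minimality\<close>

lemma H1_rescale:
  assumes "H1 v G" "t > 0"
  shows "H1 (\<lambda>y. t * v ((1/t) *\<^sub>R y)) (\<lambda>y. G ((1/t) *\<^sub>R y))"
  using has_weak_gradient_scale[OF H1_D(3)[OF assms(1)], of "1/t"] assms(2)
    L2_UNIV_scale[OF L2_UNIV_affine[OF H1_D(1)[OF assms(1)], of "1/t" 0], of t]
    L2_UNIV_affine[OF H1_D(2)[OF assms(1)], of "1/t" 0]
  by (simp add: H1_def)

lemma H1_zero: "H1 (\<lambda>x. 0) (\<lambda>x. 0)"
  by (simp add: H1_def has_weak_gradient_zero L2_UNIV_iff)

lemma L2_loc_add:
  assumes "u \<in> L2_loc U" "v \<in> L2_loc U"
  shows "(\<lambda>x. u x + v x) \<in> L2_loc U"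
  unfolding L2_loc_def
proof safe
  fix K assume K: "compact K" "K \<subseteq> U"
  have Km: "K \<in> sets lebesgue" by (rule fmeasurableD[OF lmeasurable_compact[OF K(1)]])
  have "(\<lambda>x. indicator K x *\<^sub>R u x + indicator K x *\<^sub>R v x) \<in> L2 UNIV"
    using assms K L2_indicator[OF Km, of u] L2_indicator[OF Km, of v] by (intro L2_UNIV_add) (auto simp: L2_loc_def)
  then show "(\<lambda>x. u x + v x) \<in> L2 K" using L2_indicator[OF Km, of "\<lambda>x. u x + v x"] by (simp add: scaleR_add_right)
qed

lemma L2_UNIV_AE_cong:
  assumes "f \<in> L2 UNIV" "AE x in lebesgue. f x = g x"
  shows "g \<in> L2 UNIV"
  by (rule L2_UNIV_bound[OF assms(1) lebesgue_measurable_AE_cong[OF L2_UNIV_measurable[OF assms(1)] assms(2)]])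
    (use assms(2) in \<open>eventually_elim, simp\<close>)

lemma weak_gradient_UNIV_AE:
  assumes "has_weak_gradient UNIV u G"
  shows "AE x in lebesgue. weak_gradient UNIV u x = G x"
  using weak_gradient_unique[OF weak_gradient_works[OF assms] assms open_UNIV] by simp

lemma W12_UNIV_weak_gradient:
  assumes "u \<in> W12 UNIV"
  shows "has_weak_gradient UNIV u (weak_gradient UNIV u)" "weak_gradient UNIV u \<in> L2 UNIV"
proof -
  obtain G where G: "has_weak_gradient UNIV u G" "G \<in> L2 UNIV" using assms by (auto simp: W12_def)
  show "has_weak_gradient UNIV u (weak_gradient UNIV u)" by (rule weak_gradient_works[OF G(1)])
  show "weak_gradient UNIV u \<in> L2 UNIV"
    by (rule L2_UNIV_AE_cong[OF G(2)]) (use weak_gradient_UNIV_AE[OF G(1)] in \<open>eventually_elim, simp\<close>)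
qed

lemma measure_scale: "measure lebesgue ((\<lambda>x. t *\<^sub>R x) ` S) = \<bar>t\<bar> ^ DIM('a) * measure lebesgue (S :: 'a::euclidean_space set)"
  using measure_lebesgue_affine[of t 0 S] by simp

lemma borel_scale_image:
  assumes "S \<in> sets borel" "t \<noteq> 0"
  shows "(\<lambda>x::'a::euclidean_space. t *\<^sub>R x) ` S \<in> sets borel"
proof -
  have "(\<lambda>x. t *\<^sub>R x) ` S = (\<lambda>x. inverse t *\<^sub>R x) -` S \<inter> space borel"
    using assms(2) by (force simp: image_iff)
  also have "\<dots> \<in> sets borel" by (rule measurable_sets[OF _ assms(1)]) measurable
  finally show ?thesis .
qed

text \<open>The hypotheses on the minimizer that concern a fixed ball, normalized so that every blow-up is
  controlled on the ball of radius \<open>2 R\<close>; this only discards finitely many terms of the sequence.\<close>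

locale blowup =
  fixes \<Omega> :: "'a::euclidean_space set"
    and f g :: "'i::finite \<Rightarrow> 'a \<Rightarrow> real"
    and F :: "('i \<Rightarrow> 'a set) \<Rightarrow> real"
    and u :: "'a \<Rightarrow> real^'i"
    and W :: "'i \<Rightarrow> 'a set"
    and r :: "nat \<Rightarrow> real"
    and R s0 M0 L :: real
    and lam :: "'i \<Rightarrow> real"
    and \<epsilon> :: "real \<Rightarrow> real"
  assumes fg_converge: "J_integrals_converge f g \<Omega>"
    and minimizer: "J_minimizer f g F \<Omega> u W"
    and r_pos: "\<And>k. r k > 0" and r_le: "\<And>k. r k \<le> 1" and r_lim: "r \<longlonglongrightarrow> 0"
    and R_pos: "R > 0" and scale: "\<And>k. 2 * R * r k < s0"
    and fg_bound: "\<And>i. AE x in lebesgue. x \<in> ball 0 s0 \<inter> \<Omega> \<longrightarrow> \<bar>f i x\<bar> \<le> M0 \<and> \<bar>g i x\<bar> \<le> M0" and M0: "M0 \<ge> 0"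
    and u_lip: "L-lipschitz_on (ball 0 s0) u" and u_0: "u 0 = 0"
    and \<epsilon>_lim: "(\<epsilon> \<longlongrightarrow> 0) (at_right 0)"
    and F_diff: "\<And>s W'. 0 < s \<Longrightarrow> s < s0 \<Longrightarrow> W' \<in> W_class \<Omega> \<Longrightarrow> (\<And>i. W i - ball 0 s = W' i - ball 0 s) \<Longrightarrow>
        \<bar>F W - F W' - (\<Sum>i\<in>UNIV. lam i * (measure lebesgue (W i \<inter> ball 0 s)
            - measure lebesgue (W' i \<inter> ball 0 s)))\<bar> \<le> s ^ DIM('a) * \<epsilon> s"
begin

definition G :: "'i \<Rightarrow> 'a \<Rightarrow> 'a" where
  "G i = weak_gradient UNIV (\<lambda>y. u y $ i)"

definition uk :: "nat \<Rightarrow> 'i \<Rightarrow> 'a \<Rightarrow> real" where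
  "uk k i x = inverse (r k) * u (r k *\<^sub>R x) $ i"

definition Gk :: "nat \<Rightarrow> 'i \<Rightarrow> 'a \<Rightarrow> 'a" where
  "Gk k i x = G i (r k *\<^sub>R x)"

definition \<Omega>k :: "nat \<Rightarrow> 'a set" where
  "\<Omega>k k = blowup_set (r k) \<Omega>"

definition Wk :: "nat \<Rightarrow> 'i \<Rightarrow> 'a set" where
  "Wk k i = blowup_set (r k) (W i)"

lemma L_nonneg: "L \<ge> 0"
  using u_lip lipschitz_on_nonneg by blast

lemma uW: "(u, W) \<in> F_class \<Omega>"
  using minimizer by (simp add: J_minimizer_def)

lemma u_W12: "(\<lambda>x. u x $ i) \<in> W12 UNIV"
  using uW by (auto simp: F_class_def)

lemma W_props: "W i \<in> sets borel" "W i \<subseteq> \<Omega>" "disjoint_family W"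
  using uW by (auto simp: F_class_def W_class_def)

lemma G_props: "has_weak_gradient UNIV (\<lambda>x. u x $ i) (G i)" "G i \<in> L2 UNIV"
  unfolding G_def by (rule W12_UNIV_weak_gradient[OF u_W12])+

lemma Gk_gradient: "has_weak_gradient UNIV (uk k i) (Gk k i)"
  using has_weak_gradient_scale[OF G_props(1)[of i] r_pos[of k]] by (simp add: uk_def[abs_def] Gk_def[abs_def])

lemma Gk_L2: "Gk k i \<in> L2 UNIV"
  using L2_UNIV_affine[OF G_props(2), of "r k" i 0] r_pos[of k] by (simp add: Gk_def[abs_def])

lemma mem_blowup_set: "x \<in> blowup_set (r k) S \<longleftrightarrow> r k *\<^sub>R x \<in> S"
  using r_pos[of k] by (force simp: blowup_set_def image_iff)

lemma Wk_props: "Wk k i \<in> sets borel" "Wk k i \<subseteq> \<Omega>k k" "disjoint_family (Wk k)"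
proof -
  show "Wk k i \<in> sets borel"
    unfolding Wk_def blowup_set_def by (rule borel_scale_image) (use W_props(1) r_pos[of k] in auto)
  show "Wk k i \<subseteq> \<Omega>k k" using W_props(2)[of i] by (auto simp: Wk_def \<Omega>k_def mem_blowup_set)
  show "disjoint_family (Wk k)"
    using W_props(3) by (fastforce simp: disjoint_family_on_def Wk_def mem_blowup_set)
qed

lemma uk_zero: "AE x in lebesgue. x \<notin> Wk k i \<longrightarrow> uk k i x = 0"
proof -
  have "AE x in lebesgue. x \<notin> W i \<longrightarrow> u x $ i = 0" using uW by (auto simp: F_class_def)
  from AE_affine[OF this, of "r k" 0] r_pos[of k] have "AE x in lebesgue. r k *\<^sub>R x \<notin> W i \<longrightarrow> u (r k *\<^sub>R x) $ i = 0" by simp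
  then show ?thesis by eventually_elim (simp add: Wk_def mem_blowup_set uk_def)
qed

lemma scaled_mem_ball:
  assumes "x \<in> ball 0 (2 * R)"
  shows "norm (r k *\<^sub>R x) < s0"
proof -
  have "norm (r k *\<^sub>R x) \<le> r k * (2 * R)"
    using assms r_pos[of k] by (auto intro!: mult_left_mono)
  also have "\<dots> = 2 * R * r k" by simp
  finally show ?thesis using scale[of k] by linarith
qed

lemma uk_lipschitz: "L-lipschitz_on (ball 0 (2 * R)) (uk k i)"
proof (rule lipschitz_onI[OF _ L_nonneg])
  fix x y :: 'a assume "x \<in> ball 0 (2 * R)" "y \<in> ball 0 (2 * R)"
  then have "norm (r k *\<^sub>R x) < s0" "norm (r k *\<^sub>R y) < s0"
    by (auto intro!: scaled_mem_ball simp del: norm_scaleR)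
  then have "dist (u (r k *\<^sub>R x)) (u (r k *\<^sub>R y)) \<le> L * dist (r k *\<^sub>R x) (r k *\<^sub>R y)"
    by (intro lipschitz_onD[OF u_lip]) auto
  moreover have "\<bar>u (r k *\<^sub>R x) $ i - u (r k *\<^sub>R y) $ i\<bar> \<le> dist (u (r k *\<^sub>R x)) (u (r k *\<^sub>R y))"
    using component_le_norm_cart[of "u (r k *\<^sub>R x) - u (r k *\<^sub>R y)" i] by (simp add: dist_norm)
  moreover have "dist (r k *\<^sub>R x) (r k *\<^sub>R y) = r k * dist x y"
    using r_pos[of k] by (simp add: dist_norm flip: scaleR_diff_right)
  ultimately have "\<bar>u (r k *\<^sub>R x) $ i - u (r k *\<^sub>R y) $ i\<bar> \<le> r k * (L * dist x y)" by (simp add: mult.left_commute)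
  moreover have "dist (uk k i x) (uk k i y) = inverse (r k) * \<bar>u (r k *\<^sub>R x) $ i - u (r k *\<^sub>R y) $ i\<bar>"
    using r_pos[of k] by (simp add: uk_def dist_norm abs_mult flip: right_diff_distrib)
  ultimately show "dist (uk k i x) (uk k i y) \<le> L * dist x y"
    using r_pos[of k] by (simp add: inverse_eq_divide divide_le_eq mult.commute)
qed

lemma uk_bound: "x \<in> ball 0 (2 * R) \<Longrightarrow> \<bar>uk k i x\<bar> \<le> L * norm x"
  using lipschitz_onD[OF uk_lipschitz, of x 0 k i] R_pos u_0 by (simp add: uk_def[of k i 0] dist_norm)

lemma Gk_bound: "AE x in lebesgue. x \<in> ball 0 (2 * R) \<longrightarrow> norm (Gk k i x) \<le> real DIM('a) * L"
  by (rule weak_gradient_lipschitz[OF has_weak_gradient_subset[OF Gk_gradient] open_ball uk_lipschitz]) simp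

text \<open>Minimality in the variables of the blow-up, divided by \<open>r\<^sub>k\<^sup>n\<close>. On the ball of radius \<open>r\<^sub>k \<rho>\<close> the functions have
  size \<open>r\<^sub>k\<close>, because \<open>u\<close> is Lipschitz with \<open>u 0 = 0\<close>; this gives the factor \<open>r\<^sub>k\<close> in front of the contribution of \<open>f\<close>
  and \<open>g\<close>.\<close>

lemma scaled_minimality:
  assumes \<rho>: "0 < \<rho>" "\<rho> \<le> 2 * R"
    and H: "\<And>i. H1 (h i) (Q i)" and supp: "\<And>i. AE x in lebesgue. x \<notin> ball 0 \<rho> \<longrightarrow> h i x = 0"
    and Z: "\<And>i. Z i \<in> sets borel" "\<And>i. Z i \<subseteq> \<Omega>k k" "disjoint_family Z"
      "\<And>i. Z i - ball 0 \<rho> = Wk k i - ball 0 \<rho>" "\<And>i. AE x in lebesgue. x \<notin> Z i \<longrightarrow> uk k i x + h i x = 0"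
  shows "0 \<le> (\<Sum>i\<in>UNIV. LINT x|lebesgue. 2 * (Gk k i x \<bullet> Q i x) + (norm (Q i x))\<^sup>2)
    + (\<Sum>i\<in>UNIV. lam i * (measure lebesgue (Z i \<inter> ball 0 \<rho>) - measure lebesgue (Wk k i \<inter> ball 0 \<rho>)))
    + \<rho> ^ DIM('a) * \<epsilon> (r k * \<rho>)
    + r k * M0 * (\<Sum>i\<in>UNIV. (L\<^sup>2 * \<rho>\<^sup>2 + 1) * measure lebesgue (ball (0::'a) \<rho>) + 3 * sqn (h i))"
proof -
  define t where "t = r k"
  define n where "n = DIM('a)"
  have t: "t > 0" "t \<le> 1" using r_pos r_le by (auto simp: t_def)
  have t\<rho>: "t * \<rho> > 0" "t * \<rho> < s0"
  proof -
    have "t * \<rho> \<le> t * (2 * R)" using \<rho> t by (intro mult_left_mono) auto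
    also have "\<dots> = 2 * R * r k" by (simp add: t_def)
    finally show "t * \<rho> < s0" using scale[of k] by linarith
  qed (use t \<rho> in simp)
  define h' where "h' = (\<lambda>i y. t * h i ((1/t) *\<^sub>R y))"
  define Q' where "Q' = (\<lambda>i y. Q i ((1/t) *\<^sub>R y))"
  define w where "w = (\<lambda>y. \<chi> i. u y $ i + h' i y)"
  define W' where "W' = (\<lambda>i. (\<lambda>x. t *\<^sub>R x) ` Z i)"
  have mem_W': "y \<in> W' i \<longleftrightarrow> (1/t) *\<^sub>R y \<in> Z i" for y i using t by (force simp: W'_def image_iff)
  have H': "H1 (h' i) (Q' i)" for i unfolding h'_def Q'_def by (rule H1_rescale[OF H t(1)])
  have wi: "(\<lambda>y. w y $ i) = (\<lambda>y. u y $ i + h' i y)" for i by (simp add: w_def)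
  have wG: "has_weak_gradient UNIV (\<lambda>y. w y $ i) (\<lambda>y. G i y + Q' i y)" for i
    using has_weak_gradient_linear[OF G_props(1)[of i] H1_D(3)[OF H'[of i]], of 1 1] by (simp add: wi)
  have wGL: "(\<lambda>y. G i y + Q' i y) \<in> L2 UNIV" for i
    by (intro L2_UNIV_add G_props(2) H1_D(2)[OF H'])
  have wW: "(\<lambda>y. w y $ i) \<in> W12 UNIV" for i
    unfolding W12_def mem_Collect_eq
  proof (intro conjI exI)
    show "(\<lambda>y. w y $ i) \<in> L2_loc UNIV"
      unfolding wi using u_W12[of i] H1_D(1)[OF H'[of i]]
      by (intro L2_loc_add) (auto simp: W12_def intro: L2_imp_L2_loc)
  qed (rule wG wGL)+
  have W'W: "W' \<in> W_class \<Omega>"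
    unfolding W_class_def mem_Collect_eq
  proof (intro conjI allI)
    fix i
    show "W' i \<in> sets borel" unfolding W'_def by (rule borel_scale_image) (use Z t in auto)
    show "W' i \<subseteq> \<Omega>"
    proof
      fix y assume "y \<in> W' i"
      then have "(1/t) *\<^sub>R y \<in> \<Omega>k k" using Z(2) mem_W' by blast
      then show "y \<in> \<Omega>" using t by (simp add: \<Omega>k_def mem_blowup_set t_def)
    qed
    show "disjoint_family W'" using Z(3) by (fastforce simp: disjoint_family_on_def mem_W')
  qed
  have "AE y in lebesgue. y \<notin> W' i \<longrightarrow> w y $ i = 0" for i
  proof -
    have "AE y in lebesgue. (1/t) *\<^sub>R y + 0 \<notin> Z i \<longrightarrow> uk k i ((1/t) *\<^sub>R y + 0) + h i ((1/t) *\<^sub>R y + 0) = 0"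
      by (rule AE_affine[OF Z(5)]) (use t in simp)
    then show ?thesis
    proof eventually_elim
      case (elim y)
      have "w y $ i = t * (uk k i ((1/t) *\<^sub>R y) + h i ((1/t) *\<^sub>R y))"
        using t by (simp add: w_def h'_def uk_def t_def[symmetric] distrib_left)
      then show ?case using elim by (simp add: mem_W')
    qed
  qed
  then have wF: "(w, W') \<in> F_class \<Omega>" using W'W wW by (auto simp: F_class_def)
  then have J: "J f g F \<Omega> u W \<le> J f g F \<Omega> w W'" using minimizer by (auto simp: J_minimizer_def)
  define EQ where "EQ = (\<lambda>i. LINT x|lebesgue. 2 * (Gk k i x \<bullet> Q i x) + (norm (Q i x))\<^sup>2)"
  have E: "(LINT x|lebesgue. (norm (weak_gradient UNIV (\<lambda>y. w y $ i) x))\<^sup>2)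
      = (LINT x|lebesgue. (norm (weak_gradient UNIV (\<lambda>y. u y $ i) x))\<^sup>2) + t ^ n * EQ i" for i
  proof -
    have "(LINT x|lebesgue. (norm (weak_gradient UNIV (\<lambda>y. w y $ i) x))\<^sup>2) = (LINT x|lebesgue. (norm (G i x + Q' i x))\<^sup>2)"
    proof (rule integral_cong_AE)
      show "AE x in lebesgue. (norm (weak_gradient UNIV (\<lambda>y. w y $ i) x))\<^sup>2 = (norm (G i x + Q' i x))\<^sup>2"
        using weak_gradient_UNIV_AE[OF wG[of i]] by eventually_elim simp
    qed (use L2_UNIV_measurable[OF W12_UNIV_weak_gradient(2)[OF wW[of i]]] L2_UNIV_measurable[OF wGL[of i]] in measurable)
    also have "\<dots> = (LINT x|lebesgue. (norm (G i x))\<^sup>2 + (2 * (G i x \<bullet> Q' i x) + (norm (Q' i x))\<^sup>2))"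
      by (simp add: power2_norm_eq_inner algebra_simps inner_commute)
    also have "\<dots> = (LINT x|lebesgue. (norm (G i x))\<^sup>2) + (LINT x|lebesgue. 2 * (G i x \<bullet> Q' i x) + (norm (Q' i x))\<^sup>2)"
      by (intro Bochner_Integration.integral_add Bochner_Integration.integrable_add integrable_mult_right
          L2_UNIV_integrable integrable_inner_L2 G_props(2) H1_D(2)[OF H'])
    also have "(LINT x|lebesgue. 2 * (G i x \<bullet> Q' i x) + (norm (Q' i x))\<^sup>2)
        = \<bar>t\<bar> ^ DIM('a) *\<^sub>R (LINT x|lebesgue. 2 * (G i (t *\<^sub>R x + 0) \<bullet> Q' i (t *\<^sub>R x + 0)) + (norm (Q' i (t *\<^sub>R x + 0)))\<^sup>2)"
      by (rule integral_affine) (use t L2_UNIV_measurable[OF G_props(2)[of i]] L2_UNIV_measurable[OF H1_D(2)[OF H'[of i]]] in auto)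
    also have "\<dots> = t ^ n * EQ i" using t by (simp add: n_def EQ_def Gk_def Q'_def t_def[symmetric])
    finally show ?thesis by (simp add: G_def)
  qed
  define B where "B = (\<lambda>i x. t * M0 * ((L\<^sup>2 * \<rho>\<^sup>2 + 1) * indicat_real (ball 0 \<rho>) x + 3 * (norm (h i x))\<^sup>2))"
  have iball: "integrable lebesgue (indicat_real (ball (0::'a) \<rho>))"
    by (intro integrable_real_indicator) (use lmeasurable_ball[of "0::'a" \<rho>] in \<open>unfold fmeasurable_def, blast+\<close>)
  have iB: "integrable lebesgue (B i)" for i unfolding B_def
    by (intro integrable_mult_right Bochner_Integration.integrable_add iball L2_UNIV_integrable H1_D(1)[OF H])
  have IB: "(LINT x|lebesgue. B i x) = t * M0 * ((L\<^sup>2 * \<rho>\<^sup>2 + 1) * measure lebesgue (ball (0::'a) \<rho>) + 3 * sqn (h i))" for i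
    unfolding B_def using iball L2_UNIV_integrable[OF H1_D(1)[OF H[of i]]] by simp
  have Low: "(LINT x:\<Omega>|lebesgue. ((w x $ i)\<^sup>2 * f i x - w x $ i * g i x))
      \<le> (LINT x:\<Omega>|lebesgue. ((u x $ i)\<^sup>2 * f i x - u x $ i * g i x)) + t ^ n * (LINT x|lebesgue. B i x)" for i
  proof -
    have iw: "set_integrable lebesgue \<Omega> (\<lambda>x. (w x $ i)\<^sup>2 * f i x - w x $ i * g i x)"
      and iu: "set_integrable lebesgue \<Omega> (\<lambda>x. (u x $ i)\<^sup>2 * f i x - u x $ i * g i x)"
      using fg_converge wF uW by (auto simp: J_integrals_converge_def)
    have iBt: "integrable lebesgue (\<lambda>y. B i ((1/t) *\<^sub>R y + 0))"
      using integrable_affine[OF borel_measurable_integrable[OF iB[of i]], of "1/t" 0] iB[of i] t by simp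
    have "(LINT x:\<Omega>|lebesgue. ((w x $ i)\<^sup>2 * f i x - w x $ i * g i x)) - (LINT x:\<Omega>|lebesgue. ((u x $ i)\<^sup>2 * f i x - u x $ i * g i x))
        = (LINT x:\<Omega>|lebesgue. ((w x $ i)\<^sup>2 * f i x - w x $ i * g i x) - ((u x $ i)\<^sup>2 * f i x - u x $ i * g i x))"
      using set_integral_diff(2)[OF iw iu] by simp
    also have "\<dots> \<le> (LINT y|lebesgue. B i ((1/t) *\<^sub>R y + 0))"
      unfolding set_lebesgue_integral_def
    proof (rule integral_mono_AE)
      show "integrable lebesgue (\<lambda>x. indicat_real \<Omega> x *\<^sub>R ((w x $ i)\<^sup>2 * f i x - w x $ i * g i x - ((u x $ i)\<^sup>2 * f i x - u x $ i * g i x)))"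
        using set_integral_diff(1)[OF iw iu] by (simp add: set_integrable_def)
      have "AE y in lebesgue. (1/t) *\<^sub>R y + 0 \<notin> ball 0 \<rho> \<longrightarrow> h i ((1/t) *\<^sub>R y + 0) = 0"
        by (rule AE_affine[OF supp]) (use t in simp)
      then show "AE y in lebesgue. indicat_real \<Omega> y *\<^sub>R ((w y $ i)\<^sup>2 * f i y - w y $ i * g i y - ((u y $ i)\<^sup>2 * f i y - u y $ i * g i y))
          \<le> B i ((1/t) *\<^sub>R y + 0)"
        using fg_bound[of i]
      proof eventually_elim
        case (elim y)
        define x where "x = (1/t) *\<^sub>R y"
        have B0: "B i x \<ge> 0" unfolding B_def using t M0 by simp
        have hx: "h' i y = t * h i x" by (simp add: h'_def x_def)
        have prod_diff: "a * b - c * d \<le> \<bar>a\<bar> * \<bar>b\<bar> + \<bar>c\<bar> * \<bar>d\<bar>" for a b c d :: real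
          using abs_ge_self[of "a * b"] abs_ge_minus_self[of "c * d"] by (simp add: abs_mult)
        show ?case
        proof (cases "y \<in> \<Omega> \<and> h i x \<noteq> 0")
          case True
          have xb: "x \<in> ball 0 \<rho>" using True elim(1) by (auto simp: x_def)
          have yx: "y = t *\<^sub>R x" using t by (simp add: x_def)
          have ny: "norm y \<le> t * \<rho>" using xb t by (simp add: yx)
          then have yb: "y \<in> ball 0 s0" using t\<rho> by simp
          have fg: "\<bar>f i y\<bar> \<le> M0" "\<bar>g i y\<bar> \<le> M0" using elim(2) yb True by auto
          have "dist (u y) (u 0) \<le> L * dist y 0" by (rule lipschitz_onD[OF u_lip yb]) (use t\<rho> in simp)
          then have "norm (u y) \<le> L * (t * \<rho>)"
            using mult_left_mono[OF ny L_nonneg] by (simp add: u_0 dist_norm)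
          then have uy: "\<bar>u y $ i\<bar> \<le> t * (L * \<rho>)" using component_le_norm_cart[of "u y" i] by (simp add: mult_ac)
          let ?a = "u y $ i" and ?b = "h i x"
          have "(w y $ i)\<^sup>2 * f i y - w y $ i * g i y - (?a\<^sup>2 * f i y - ?a * g i y)
              = (2 * ?a * (t * ?b) + (t * ?b)\<^sup>2) * f i y - (t * ?b) * g i y"
            by (simp add: w_def hx power2_eq_square algebra_simps)
          also have "\<dots> \<le> \<bar>2 * ?a * (t * ?b) + (t * ?b)\<^sup>2\<bar> * \<bar>f i y\<bar> + \<bar>t * ?b\<bar> * \<bar>g i y\<bar>"
            by (rule prod_diff)
          also have "\<dots> \<le> (2 * (t * (L * \<rho>)) * (t * \<bar>?b\<bar>) + (t * ?b)\<^sup>2) * M0 + (t * \<bar>?b\<bar>) * M0"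
          proof (intro add_mono mult_mono fg)
            have "\<bar>2 * ?a * (t * ?b)\<bar> \<le> 2 * (t * (L * \<rho>)) * (t * \<bar>?b\<bar>)"
              unfolding abs_mult using uy t by (intro mult_mono) auto
            then show "\<bar>2 * ?a * (t * ?b) + (t * ?b)\<^sup>2\<bar> \<le> 2 * (t * (L * \<rho>)) * (t * \<bar>?b\<bar>) + (t * ?b)\<^sup>2"
              by (smt (verit) zero_le_power2 abs_triangle_ineq)
          qed (use t L_nonneg \<rho> M0 in \<open>auto simp: abs_mult\<close>)
          also have "\<dots> = t * M0 * (t * (2 * (L * \<rho>) * \<bar>?b\<bar> + ?b\<^sup>2) + \<bar>?b\<bar>)"
            by (simp add: power2_eq_square algebra_simps)
          also have "\<dots> \<le> t * M0 * (1 * (2 * (L * \<rho>) * \<bar>?b\<bar> + ?b\<^sup>2) + \<bar>?b\<bar>)"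
            using t M0 L_nonneg \<rho> by (intro mult_left_mono add_mono mult_right_mono) auto
          also have "\<dots> \<le> t * M0 * ((L\<^sup>2 * \<rho>\<^sup>2 + 1) + 3 * ?b\<^sup>2)"
          proof (rule mult_left_mono)
            have "2 * (L * \<rho>) * \<bar>?b\<bar> \<le> (L * \<rho>)\<^sup>2 + \<bar>?b\<bar>\<^sup>2" by (rule sum_squares_bound)
            moreover have "2 * 1 * \<bar>?b\<bar> \<le> 1\<^sup>2 + \<bar>?b\<bar>\<^sup>2" by (rule sum_squares_bound)
            ultimately show "1 * (2 * (L * \<rho>) * \<bar>?b\<bar> + ?b\<^sup>2) + \<bar>?b\<bar> \<le> (L\<^sup>2 * \<rho>\<^sup>2 + 1) + 3 * ?b\<^sup>2"
              by (simp add: power_mult_distrib)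
          qed (use t M0 in auto)
          also have "\<dots> = B i x" using xb by (simp add: B_def)
          finally show ?thesis using True by (simp add: x_def)
        next
          case False
          then have "indicat_real \<Omega> y *\<^sub>R ((w y $ i)\<^sup>2 * f i y - w y $ i * g i y - ((u y $ i)\<^sup>2 * f i y - u y $ i * g i y)) = 0"
            by (auto simp: w_def hx indicator_def)
          then show ?thesis using B0 unfolding x_def by (simp only: add_0_right)
        qed
      qed
    qed (rule iBt)
    also have "\<dots> = t ^ n * (LINT x|lebesgue. B i x)"
      using integral_affine[OF borel_measurable_integrable[OF iBt], of t 0] t by (simp add: n_def)
    finally show ?thesis by simp
  qed
  define \<Lambda> where "\<Lambda> = (\<Sum>i\<in>UNIV. lam i * (measure lebesgue (Z i \<inter> ball 0 \<rho>) - measure lebesgue (Wk k i \<inter> ball 0 \<rho>)))"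
  have F: "F W' - F W \<le> t ^ n * \<Lambda> + t ^ n * (\<rho> ^ n * \<epsilon> (t * \<rho>))"
  proof -
    have ball: "y \<in> ball 0 (t * \<rho>) \<longleftrightarrow> (1/t) *\<^sub>R y \<in> ball 0 \<rho>" for y :: 'a
      using t by (simp add: divide_less_eq mult.commute)
    have out: "W i - ball 0 (t * \<rho>) = W' i - ball 0 (t * \<rho>)" for i
    proof -
      have "y \<in> W i \<longleftrightarrow> (1/t) *\<^sub>R y \<in> Wk k i" for y using t by (simp add: Wk_def mem_blowup_set t_def)
      then have "y \<in> W i - ball 0 (t * \<rho>) \<longleftrightarrow> (1/t) *\<^sub>R y \<in> Wk k i - ball 0 \<rho>"
          "y \<in> W' i - ball 0 (t * \<rho>) \<longleftrightarrow> (1/t) *\<^sub>R y \<in> Z i - ball 0 \<rho>" for y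
        by (simp_all only: Diff_iff ball mem_W')
      then show ?thesis by (simp only: set_eq_iff Z(4) simp_thms)
    qed
    have m1: "measure lebesgue (W' i \<inter> ball 0 (t * \<rho>)) = t ^ n * measure lebesgue (Z i \<inter> ball 0 \<rho>)" for i
    proof -
      have "W' i \<inter> ball 0 (t * \<rho>) = (\<lambda>x. t *\<^sub>R x) ` (Z i \<inter> ball 0 \<rho>)" using t by (auto simp: W'_def)
      then show ?thesis using measure_scale[of t "Z i \<inter> ball 0 \<rho>"] t by (simp add: n_def)
    qed
    have m2: "measure lebesgue (W i \<inter> ball 0 (t * \<rho>)) = t ^ n * measure lebesgue (Wk k i \<inter> ball 0 \<rho>)" for i
    proof -
      have "y \<in> W i \<longleftrightarrow> (1/t) *\<^sub>R y \<in> Wk k i" for y using t by (simp add: Wk_def mem_blowup_set t_def)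
      then have "W i \<inter> ball 0 (t * \<rho>) = {y. (1/t) *\<^sub>R y \<in> Wk k i \<inter> ball 0 \<rho>}" using ball by auto
      also have "\<dots> = (\<lambda>x. t *\<^sub>R x) ` (Wk k i \<inter> ball 0 \<rho>)" using t by (force simp: image_iff)
      finally show ?thesis using measure_scale[of t "Wk k i \<inter> ball 0 \<rho>"] t by (simp add: n_def)
    qed
    have "\<bar>F W - F W' - (\<Sum>i\<in>UNIV. lam i * (measure lebesgue (W i \<inter> ball 0 (t * \<rho>))
            - measure lebesgue (W' i \<inter> ball 0 (t * \<rho>))))\<bar> \<le> (t * \<rho>) ^ DIM('a) * \<epsilon> (t * \<rho>)"
      by (rule F_diff[OF t\<rho> W'W out])
    moreover have "(\<Sum>i\<in>UNIV. lam i * (measure lebesgue (W i \<inter> ball 0 (t * \<rho>)) - measure lebesgue (W' i \<inter> ball 0 (t * \<rho>))))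
        = - (t ^ n * \<Lambda>)"
      unfolding m1 m2 \<Lambda>_def sum_distrib_left sum_negf[symmetric] by (intro sum.cong) (auto simp: algebra_simps)
    ultimately show ?thesis by (simp add: n_def power_mult_distrib mult.assoc abs_le_iff)
  qed
  have "0 \<le> (\<Sum>i\<in>UNIV. t ^ n * EQ i) + (\<Sum>i\<in>UNIV. t ^ n * (LINT x|lebesgue. B i x)) + (F W' - F W)"
    using J sum_mono[of UNIV "\<lambda>i. LINT x:\<Omega>|lebesgue. ((w x $ i)\<^sup>2 * f i x - w x $ i * g i x)"
        "\<lambda>i. (LINT x:\<Omega>|lebesgue. ((u x $ i)\<^sup>2 * f i x - u x $ i * g i x)) + t ^ n * (LINT x|lebesgue. B i x)", OF Low]
    unfolding J_def by (simp add: E sum.distrib)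
  also have "\<dots> \<le> (\<Sum>i\<in>UNIV. t ^ n * EQ i) + (\<Sum>i\<in>UNIV. t ^ n * (LINT x|lebesgue. B i x)) + (t ^ n * \<Lambda> + t ^ n * (\<rho> ^ n * \<epsilon> (t * \<rho>)))"
    using F by simp
  also have "\<dots> = t ^ n * ((\<Sum>i\<in>UNIV. EQ i) + \<Lambda> + \<rho> ^ n * \<epsilon> (t * \<rho>) + (\<Sum>i\<in>UNIV. LINT x|lebesgue. B i x))"
    by (simp add: sum_distrib_left distrib_left)
  finally have "0 \<le> (\<Sum>i\<in>UNIV. EQ i) + \<Lambda> + \<rho> ^ n * \<epsilon> (t * \<rho>) + (\<Sum>i\<in>UNIV. LINT x|lebesgue. B i x)"
    by (metis mult_le_cancel_left_pos mult_zero_right t(1) zero_less_power)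
  also have "(\<Sum>i\<in>UNIV. LINT x|lebesgue. B i x) = t * M0 * (\<Sum>i\<in>UNIV. (L\<^sup>2 * \<rho>\<^sup>2 + 1) * measure lebesgue (ball (0::'a) \<rho>) + 3 * sqn (h i))"
    unfolding IB sum_distrib_left ..
  finally show ?thesis by (simp only: EQ_def \<Lambda>_def n_def t_def)
qed

lemma \<epsilon>_scaled_lim: "\<rho> > 0 \<Longrightarrow> (\<lambda>k. \<epsilon> (r k * \<rho>)) \<longlonglongrightarrow> 0"
proof (rule filterlim_compose[OF \<epsilon>_lim])
  assume "\<rho> > 0"
  then show "filterlim (\<lambda>k. r k * \<rho>) (at_right 0) sequentially"
    unfolding filterlim_at using tendsto_mult_left_zero[OF r_lim, of \<rho>] r_pos
    by (auto intro!: always_eventually simp: less_imp_neq[symmetric] order_less_imp_not_eq2)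
qed

text \<open>Variations that keep the sets \<open>W\<^sub>i\<close> give the first-order condition; the step \<open>t\<close> of the variation
  is fixed before \<open>k\<close>, so that the lower order terms of the comparison can be absorbed.\<close>

lemma euler_lagrange_inequality:
  assumes \<rho>: "0 < \<rho>" "\<rho> \<le> 2 * R" and K: "K \<ge> 0" and \<gamma>: "\<gamma> > 0"
  obtains k0 where "\<And>k i h Q. k \<ge> k0 \<Longrightarrow> H1 h Q \<Longrightarrow>
    AE x in lebesgue. h x \<noteq> 0 \<longrightarrow> x \<in> ball 0 \<rho> \<and> uk k i x \<noteq> 0 \<Longrightarrow> sqn h \<le> K \<Longrightarrow> sqn Q \<le> K \<Longrightarrow>
    - \<gamma> \<le> (LINT x|lebesgue. Gk k i x \<bullet> Q x)"
proof -
  define t where "t = min 1 (\<gamma> / (K + 1))"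
  have t: "0 < t" "t \<le> 1" unfolding t_def using K \<gamma> by auto
  have tK: "t * K \<le> \<gamma>"
  proof -
    have "t * K \<le> \<gamma> / (K + 1) * (K + 1)" using K \<gamma> by (intro mult_mono) (auto simp: t_def)
    then show ?thesis using K by simp
  qed
  define C where "C = M0 * (real CARD('i) * ((L\<^sup>2 * \<rho>\<^sup>2 + 1) * measure lebesgue (ball (0::'a) \<rho>)) + 3 * K)"
  have "(\<lambda>k. \<rho> ^ DIM('a) * \<epsilon> (r k * \<rho>) + r k * C) \<longlonglongrightarrow> \<rho> ^ DIM('a) * 0 + 0 * C"
    by (intro tendsto_intros \<epsilon>_scaled_lim \<rho> r_lim)
  then have "\<forall>\<^sub>F k in sequentially. \<rho> ^ DIM('a) * \<epsilon> (r k * \<rho>) + r k * C < t * \<gamma>"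
    by (rule order_tendstoD(2)) (use t \<gamma> in simp)
  then obtain k0 where k0: "\<And>k. k \<ge> k0 \<Longrightarrow> \<rho> ^ DIM('a) * \<epsilon> (r k * \<rho>) + r k * C < t * \<gamma>"
    by (auto simp: eventually_sequentially)
  show ?thesis
  proof (rule that)
    fix k i h Q
    assume k: "k \<ge> k0" and H: "H1 h Q" and supp: "AE x in lebesgue. h x \<noteq> 0 \<longrightarrow> x \<in> ball 0 \<rho> \<and> uk k i x \<noteq> 0"
      and hK: "sqn h \<le> K" and QK: "sqn Q \<le> K"
    define h' where "h' = (\<lambda>j x. if j = i then t * h x else 0)"
    define Q' where "Q' = (\<lambda>j x. if j = i then t *\<^sub>R Q x else 0)"
    have h'i: "h' i = (\<lambda>x. t * h x)" "Q' i = (\<lambda>x. t *\<^sub>R Q x)" and h'j: "j \<noteq> i \<Longrightarrow> h' j = (\<lambda>x. 0)" "j \<noteq> i \<Longrightarrow> Q' j = (\<lambda>x. 0)" for j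
      by (auto simp: h'_def Q'_def)
    have H': "H1 (h' j) (Q' j)" for j
      using H1_scale[OF H, of t] H1_zero by (cases "j = i") (auto simp: h'i h'j)
    have "0 \<le> (\<Sum>j\<in>UNIV. LINT x|lebesgue. 2 * (Gk k j x \<bullet> Q' j x) + (norm (Q' j x))\<^sup>2)
      + (\<Sum>j\<in>UNIV. lam j * (measure lebesgue (Wk k j \<inter> ball 0 \<rho>) - measure lebesgue (Wk k j \<inter> ball 0 \<rho>)))
      + \<rho> ^ DIM('a) * \<epsilon> (r k * \<rho>)
      + r k * M0 * (\<Sum>j\<in>UNIV. (L\<^sup>2 * \<rho>\<^sup>2 + 1) * measure lebesgue (ball (0::'a) \<rho>) + 3 * sqn (h' j))"
    proof (rule scaled_minimality[OF \<rho> H' _ Wk_props refl])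
      fix j
      show "AE x in lebesgue. x \<notin> ball 0 \<rho> \<longrightarrow> h' j x = 0"
        using supp by eventually_elim (auto simp: h'_def)
      show "AE x in lebesgue. x \<notin> Wk k j \<longrightarrow> uk k j x + h' j x = 0"
        using supp uk_zero[of k j] by eventually_elim (auto simp: h'_def)
    qed
    also have "(\<Sum>j\<in>UNIV. LINT x|lebesgue. 2 * (Gk k j x \<bullet> Q' j x) + (norm (Q' j x))\<^sup>2)
        = (LINT x|lebesgue. 2 * (Gk k i x \<bullet> Q' i x) + (norm (Q' i x))\<^sup>2)"
      by (rule sum.mono_neutral_cong_right[of UNIV "{i}", simplified]) (auto simp: h'j)
    also have "\<dots> = 2 * t * (LINT x|lebesgue. Gk k i x \<bullet> Q x) + t\<^sup>2 * sqn Q"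
    proof -
      have "(LINT x|lebesgue. 2 * (Gk k i x \<bullet> Q' i x) + (norm (Q' i x))\<^sup>2)
          = (LINT x|lebesgue. (2 * t) * (Gk k i x \<bullet> Q x) + t\<^sup>2 * (norm (Q x))\<^sup>2)"
        by (simp add: h'i power_mult_distrib mult.assoc)
      also have "\<dots> = (2 * t) * (LINT x|lebesgue. Gk k i x \<bullet> Q x) + t\<^sup>2 * sqn Q"
        using integrable_inner_L2[OF Gk_L2[of k i] H1_D(2)[OF H]] L2_UNIV_integrable[OF H1_D(2)[OF H]] by simp
      finally show ?thesis .
    qed
    also have "(\<Sum>j\<in>UNIV. (L\<^sup>2 * \<rho>\<^sup>2 + 1) * measure lebesgue (ball (0::'a) \<rho>) + 3 * sqn (h' j))
        = real CARD('i) * ((L\<^sup>2 * \<rho>\<^sup>2 + 1) * measure lebesgue (ball (0::'a) \<rho>)) + 3 * (t\<^sup>2 * sqn h)"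
    proof -
      have "(\<Sum>j\<in>UNIV. 3 * sqn (h' j)) = 3 * sqn (h' i)"
        by (rule sum.mono_neutral_cong_right[of UNIV "{i}", simplified]) (auto simp: h'j)
      also have "sqn (h' i) = t\<^sup>2 * sqn h" using sqn_scale[of t h] by (simp add: h'i)
      finally show ?thesis by (simp add: sum.distrib)
    qed
    finally have main: "0 \<le> 2 * t * (LINT x|lebesgue. Gk k i x \<bullet> Q x) + t\<^sup>2 * sqn Q + \<rho> ^ DIM('a) * \<epsilon> (r k * \<rho>)
      + r k * M0 * (real CARD('i) * ((L\<^sup>2 * \<rho>\<^sup>2 + 1) * measure lebesgue (ball (0::'a) \<rho>)) + 3 * (t\<^sup>2 * sqn h))"
      by simp
    have t2: "t\<^sup>2 \<le> 1" using t by (simp add: power_le_one)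
    have sh: "sqn h \<ge> 0" by (auto intro: integral_nonneg_AE)
    have "t\<^sup>2 * sqn h \<le> 1 * K" using t2 hK sh by (intro mult_mono) auto
    then have "r k * M0 * (real CARD('i) * ((L\<^sup>2 * \<rho>\<^sup>2 + 1) * measure lebesgue (ball (0::'a) \<rho>)) + 3 * (t\<^sup>2 * sqn h)) \<le> r k * C"
      unfolding C_def mult.assoc using r_pos[of k] M0 by (intro mult_left_mono add_left_mono) auto
    moreover have "t\<^sup>2 * sqn Q \<le> t * \<gamma>"
    proof -
      have "t\<^sup>2 * sqn Q \<le> t\<^sup>2 * K" using QK by (intro mult_left_mono) auto
      also have "\<dots> = t * (t * K)" by (simp add: power2_eq_square)
      also have "\<dots> \<le> t * \<gamma>" using tK t by (intro mult_left_mono) auto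
      finally show ?thesis .
    qed
    ultimately have "0 \<le> t * (2 * (LINT x|lebesgue. Gk k i x \<bullet> Q x) + 2 * \<gamma>)"
      using main k0[OF k] by (simp add: distrib_left mult_ac)
    then show "- \<gamma> \<le> (LINT x|lebesgue. Gk k i x \<bullet> Q x)" using t by (simp add: zero_le_mult_iff)
  qed
qed

end

section \<open>Strong convergence of the gradients\<close>

lemma test_cutoff_ball:
  assumes "0 \<le> T" "T < \<rho>"
  obtains \<phi> :: "'a::euclidean_space \<Rightarrow> real" where "\<phi> \<in> C_c_inf (ball 0 \<rho>)" "\<And>x. 0 \<le> \<phi> x \<and> \<phi> x \<le> 1"
    "\<And>x. x \<in> cball 0 T \<Longrightarrow> \<phi> x = 1" "\<And>x. x \<notin> ball 0 \<rho> \<Longrightarrow> \<phi> x = 0" "\<And>x. x \<notin> ball 0 \<rho> \<Longrightarrow> grad \<phi> x = 0"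
proof -
  define s where "s = (T + \<rho>) / 2"
  have s: "T < s" "s < \<rho>" using assms by (auto simp: s_def)
  obtain \<phi> :: "'a \<Rightarrow> real" where \<phi>: "smooth \<phi>" "\<And>x. 0 \<le> \<phi> x \<and> \<phi> x \<le> 1" "\<And>x. x \<in> cball 0 T \<Longrightarrow> \<phi> x = 1"
    "\<And>x. x \<notin> ball 0 s \<Longrightarrow> \<phi> x = 0"
    by (rule smooth_cutoff_ball[of T s 0]) (use assms s in auto)
  have out: "\<phi> x = 0" if "x \<notin> cball 0 s" for x using \<phi>(4)[of x] that by auto
  have "\<phi> \<in> C_c_inf (ball 0 \<rho>)"
    by (rule C_c_infI[OF \<phi>(1), of "cball 0 s"]) (use out s in auto)
  moreover have "\<phi> x = 0 \<and> grad \<phi> x = 0" if "x \<notin> ball 0 \<rho>" for x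
    using that s grad_eq_0_outside[of "cball 0 s" \<phi> x] out by auto
  ultimately show ?thesis using that \<phi> by blast
qed

lemma grad_eq_0_const:
  assumes "open V" "x \<in> V" "\<And>y. y \<in> V \<Longrightarrow> \<phi> y = c"
  shows "grad \<phi> x = 0"
proof -
  have "((\<lambda>y. c) has_derivative (\<lambda>h. 0)) (at x)" by simp
  then have "(\<phi> has_derivative (\<lambda>h. 0)) (at x)"
    by (rule has_derivative_transform_within_open[of _ _ _ UNIV V]) (use assms in auto)
  from frechet_derivative_eqI[OF this] show ?thesis by (simp add: grad_def)
qed

lemma L2_loc_scale:
  fixes u :: "'a::euclidean_space \<Rightarrow> real"
  assumes u: "u \<in> L2_loc UNIV" and t: "t > 0"
  shows "(\<lambda>x. c * u (t *\<^sub>R x)) \<in> L2_loc UNIV"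
  unfolding L2_loc_def
proof safe
  fix K :: "'a set" assume K: "compact K"
  have Km: "K \<in> sets lebesgue" by (rule fmeasurableD[OF lmeasurable_compact[OF K]])
  let ?M = "(\<lambda>x. t *\<^sub>R x) ` K"
  have M: "compact ?M" using K by (intro compact_continuous_image continuous_intros)
  have "(\<lambda>x. indicator ?M x *\<^sub>R u x) \<in> L2 UNIV"
    using u M L2_indicator[OF fmeasurableD[OF lmeasurable_compact[OF M]], of u] by (auto simp: L2_loc_def)
  from L2_UNIV_scale[OF L2_UNIV_affine[OF this, of t 0], of c] t
  have "(\<lambda>x. c *\<^sub>R (indicator ?M (t *\<^sub>R x) *\<^sub>R u (t *\<^sub>R x))) \<in> L2 UNIV" by simp
  moreover have "c *\<^sub>R (indicat_real ?M (t *\<^sub>R x) *\<^sub>R u (t *\<^sub>R x)) = indicator K x *\<^sub>R (c * u (t *\<^sub>R x))" for x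
    using t by (auto simp: indicator_def)
  ultimately have "(\<lambda>x. indicator K x *\<^sub>R (c * u (t *\<^sub>R x))) \<in> L2 UNIV" by (simp only:)
  then show "(\<lambda>x. c * u (t *\<^sub>R x)) \<in> L2 K" using L2_indicator[OF Km, of "\<lambda>x. c * u (t *\<^sub>R x)"] by simp
qed

lemma ball_indicator_L2: "(\<lambda>x. C * indicat_real (ball (0::'a::euclidean_space) R) x) \<in> L2 UNIV"
proof (rule L2_UNIV_bound[OF compact_indicator_L2[OF compact_cball[of 0 R], of C]])
  show "(\<lambda>x. C * indicat_real (ball (0::'a) R) x) \<in> borel_measurable lebesgue"
    by (intro borel_measurable_times borel_measurable_const borel_measurable_indicator) auto
qed (auto simp: indicator_def)

lemma ball_indicator_integrable: "integrable lebesgue (\<lambda>x. C * indicat_real (ball (0::'a::euclidean_space) R) x)"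
  by (intro integrable_mult_right integrable_real_indicator)
    (use lmeasurable_ball[of "0::'a" R] in \<open>unfold fmeasurable_def, blast+\<close>)

lemma
  fixes f :: "'a::euclidean_space \<Rightarrow> 'b::euclidean_space"
  assumes "f \<in> borel_measurable lebesgue" "AE x in lebesgue. norm (f x) \<le> C * indicat_real (ball 0 R) x"
  shows bounded_ball_L2: "f \<in> L2 UNIV" and bounded_ball_sqn: "sqn f \<le> C\<^sup>2 * measure lebesgue (ball (0::'a) R)"
    and bounded_ball_integrable: "integrable lebesgue f"
proof -
  have le: "AE x in lebesgue. norm (f x) \<le> norm (C * indicat_real (ball 0 R) x)"
    using assms(2) by eventually_elim simp
  show "f \<in> L2 UNIV" by (rule L2_UNIV_bound[OF ball_indicator_L2 assms(1) le])
  have "sqn f \<le> sqn (\<lambda>x. C * indicat_real (ball (0::'a) R) x)" by (rule sqn_mono[OF ball_indicator_L2 le])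
  also have "\<dots> = (LINT x|lebesgue. C\<^sup>2 * indicat_real (ball (0::'a) R) x)"
    by (intro Bochner_Integration.integral_cong) (auto simp: indicator_def)
  finally show "sqn f \<le> C\<^sup>2 * measure lebesgue (ball (0::'a) R)" by simp
  show "integrable lebesgue f"
    by (rule Bochner_Integration.integrable_bound[OF ball_indicator_integrable[of C R] assms(1)]) (use assms(2) in \<open>eventually_elim, simp\<close>)
qed

lemma small_factor: "a \<ge> 0 \<Longrightarrow> b > 0 \<Longrightarrow> \<exists>x>0. x \<le> 1 \<and> a * x \<le> (b::real)"
proof -
  assume a: "a \<ge> 0" "b > 0"
  have "a * min 1 (b / (a + 1)) \<le> (a + 1) * (b / (a + 1))" using a by (intro mult_mono) auto
  then show ?thesis using a by (intro exI[of _ "min 1 (b / (a + 1))"]) auto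
qed

text \<open>On a bounded set, a Cauchy sequence in \<open>L\<^sup>2\<close> is Cauchy in \<open>L\<^sup>1\<close> and has a subsequence that converges almost
  everywhere; the common bound allows dominated convergence and passes to the limit.\<close>

lemma L2_complete_bounded:
  fixes F :: "nat \<Rightarrow> 'a::euclidean_space \<Rightarrow> 'b::euclidean_space"
  assumes F: "\<And>n. F n \<in> borel_measurable lebesgue" "\<And>n. AE x in lebesgue. norm (F n x) \<le> C * indicat_real (ball 0 R) x"
    and Cauchy: "\<And>e. e > 0 \<Longrightarrow> \<exists>N. \<forall>k\<ge>N. \<forall>l\<ge>N. sqn (\<lambda>x. F k x - F l x) \<le> e"
  obtains g where "g \<in> borel_measurable lebesgue" "AE x in lebesgue. norm (g x) \<le> C * indicat_real (ball 0 R) x"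
    "(\<lambda>k. sqn (\<lambda>x. F k x - g x)) \<longlonglongrightarrow> 0"
proof -
  define m where "m = measure lebesgue (ball (0::'a) R)"
  have m: "m \<ge> 0" by (simp add: m_def)
  note FL = bounded_ball_L2[OF F] and Fi = bounded_ball_integrable[OF F]
  note DL = L2_UNIV_diff[OF FL FL]
  have all: "AE x in lebesgue. \<forall>n. norm (F n x) \<le> C * indicat_real (ball 0 R) x"
    unfolding AE_all_countable using F(2) by auto
  have L1: "(LINT x|lebesgue. norm (F k x - F l x)) \<le> sqrt (sqn (\<lambda>x. F k x - F l x)) * sqrt m" for k l
  proof -
    have "(LINT x|lebesgue. norm (F k x - F l x)) = (LINT x|lebesgue. norm (F k x - F l x) * norm (1 * indicat_real (ball (0::'a) R) x))"
    proof (rule integral_cong_AE)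
      show "AE x in lebesgue. norm (F k x - F l x) = norm (F k x - F l x) * norm (1 * indicat_real (ball (0::'a) R) x)"
        using all
      proof eventually_elim
        case (elim x)
        then show ?case using elim[rule_format, of k] elim[rule_format, of l] by (cases "x \<in> ball 0 R") auto
      qed
    qed (use F(1) L2_UNIV_measurable[OF ball_indicator_L2[of 1 R]] in measurable)
    also have "\<dots> \<le> sqrt (sqn (\<lambda>x. F k x - F l x)) * sqrt (sqn (\<lambda>x. 1 * indicat_real (ball (0::'a) R) x))"
      by (rule L2_cauchy_schwarz[OF DL ball_indicator_L2])
    also have "sqn (\<lambda>x. 1 * indicat_real (ball (0::'a) R) x) = (LINT x|lebesgue. 1 * indicat_real (ball (0::'a) R) x)"
      by (intro Bochner_Integration.integral_cong) (auto simp: indicator_def)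
    finally show ?thesis by (simp add: m_def)
  qed
  obtain q where q: "strict_mono q" "AE x in lebesgue. Cauchy (\<lambda>n. F (q n) x)"
  proof (rule cauchy_L1_AE_cauchy_subseq[OF Fi])
    fix e :: real assume e: "e > 0"
    define d where "d = (e / (sqrt m + 1))\<^sup>2"
    have sm: "sqrt m + 1 > 0" using m by (simp add: add_nonneg_pos)
    have d: "d > 0" using e sm by (simp add: d_def)
    obtain N where N: "\<forall>k\<ge>N. \<forall>l\<ge>N. sqn (\<lambda>x. F k x - F l x) \<le> d" using Cauchy[OF d] by blast
    have "(LINT x|lebesgue. norm (F k x - F l x)) < e" if "k \<ge> N" "l \<ge> N" for k l
    proof -
      have "sqrt (sqn (\<lambda>x. F k x - F l x)) \<le> sqrt d" using N that by (intro real_sqrt_le_mono) blast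
      also have "\<dots> = e / (sqrt m + 1)" using e sm by (simp add: d_def)
      finally have "sqrt (sqn (\<lambda>x. F k x - F l x)) * sqrt m \<le> e / (sqrt m + 1) * sqrt m"
        using m by (intro mult_right_mono) auto
      also have "\<dots> < e / (sqrt m + 1) * (sqrt m + 1)" using e sm by (intro mult_strict_left_mono) auto
      also have "\<dots> = e" using sm by simp
      finally show ?thesis using L1[of k l] by linarith
    qed
    then show "\<exists>N. \<forall>i\<ge>N. \<forall>j\<ge>N. (LINT x|lebesgue. norm (F i x - F j x)) < e" by blast
  qed blast
  define g where "g = (\<lambda>x. lim (\<lambda>n. F (q n) x))"
  have gm: "g \<in> borel_measurable lebesgue" unfolding g_def by (rule borel_measurable_lim_metric) (rule F(1))
  have lim: "AE x in lebesgue. (\<lambda>n. F (q n) x) \<longlonglongrightarrow> g x"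
    using q(2) by eventually_elim (simp add: g_def Cauchy_convergent_iff convergent_LIMSEQ_iff)
  have gb: "AE x in lebesgue. norm (g x) \<le> C * indicat_real (ball 0 R) x"
    using lim all
  proof eventually_elim
    case (elim x)
    show ?case by (rule LIMSEQ_le_const2[OF tendsto_norm[OF elim(1)]]) (use elim(2) in auto)
  qed
  note gL = bounded_ball_L2[OF gm gb]
  have sub: "(\<lambda>n. sqn (\<lambda>x. F (q n) x - g x)) \<longlonglongrightarrow> 0"
  proof (rule sqn_tendsto_0_dominated[OF _ ball_indicator_L2[of "2 * C" R]])
    show "AE x in lebesgue. (\<lambda>n. F (q n) x - g x) \<longlonglongrightarrow> 0"
      using lim by eventually_elim (simp add: LIM_zero)
    show "AE x in lebesgue. norm (F (q n) x - g x) \<le> norm (2 * C * indicat_real (ball 0 R) x)" for n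
      using all gb
    proof eventually_elim
      case (elim x)
      have "norm (F (q n) x - g x) \<le> norm (F (q n) x) + norm (g x)" by (rule norm_triangle_ineq4)
      then show ?case using elim(1)[rule_format, of "q n"] elim(2) by simp
    qed
  qed (use F(1) gm in measurable)
  have "(\<lambda>k. sqn (\<lambda>x. F k x - g x)) \<longlonglongrightarrow> 0"
  proof (rule order_tendstoI)
    fix e :: real assume e: "e > 0"
    obtain N where N: "\<forall>k\<ge>N. \<forall>l\<ge>N. sqn (\<lambda>x. F k x - F l x) \<le> e/16" using Cauchy[of "e/16"] e by auto
    obtain N' where N': "\<And>n. n \<ge> N' \<Longrightarrow> sqn (\<lambda>x. F (q n) x - g x) < e/16"
      using order_tendstoD(2)[OF sub, of "e/16"] e by (auto simp: eventually_sequentially)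
    define n where "n = max N N'"
    have qn: "q n \<ge> N" using seq_suble[OF q(1), of n] by (simp add: n_def)
    have "sqn (\<lambda>x. F k x - g x) < e" if "k \<ge> N" for k
    proof -
      have "sqrt (sqn (\<lambda>x. F k x - g x)) = sqrt (sqn (\<lambda>x. (F k x - F (q n) x) + (F (q n) x - g x)))" by simp
      also have "\<dots> \<le> sqrt (sqn (\<lambda>x. F k x - F (q n) x)) + sqrt (sqn (\<lambda>x. F (q n) x - g x))"
        by (rule L2_triangle[OF DL L2_UNIV_diff[OF FL gL]])
      also have "\<dots> \<le> sqrt (e/16) + sqrt (e/16)"
        using N that qn N'[of n] by (intro add_mono real_sqrt_le_mono) (auto simp: n_def less_imp_le)
      also have "\<dots> = sqrt (e/4)" by (simp add: real_sqrt_divide)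
      finally show ?thesis using e by simp
    qed
    then show "\<forall>\<^sub>F k in sequentially. sqn (\<lambda>x. F k x - g x) < e" by (auto simp: eventually_sequentially)
  qed (auto intro!: always_eventually order.strict_trans2[OF _ integral_nonneg_AE])
  then show ?thesis using that gm gb by blast
qed

locale blowup_limit = blowup \<Omega> f g F u W r R s0 M0 L lam \<epsilon>
  for \<Omega> :: "'a::euclidean_space set"
    and f g :: "'i::finite \<Rightarrow> 'a \<Rightarrow> real"
    and F :: "('i \<Rightarrow> 'a set) \<Rightarrow> real"
    and u :: "'a \<Rightarrow> real^'i"
    and W :: "'i \<Rightarrow> 'a set"
    and r :: "nat \<Rightarrow> real"
    and R s0 M0 L :: real
    and lam :: "'i \<Rightarrow> real"
    and \<epsilon> :: "real \<Rightarrow> real" +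
  fixes u_inf :: "'a \<Rightarrow> real^'i"
  assumes u_inf_lim: "\<And>x. x \<in> ball 0 R \<Longrightarrow> (\<lambda>k. blowup_fun (r k) u x) \<longlonglongrightarrow> u_inf x"
begin

lemma uk_lim: "x \<in> ball 0 R \<Longrightarrow> (\<lambda>k. uk k i x) \<longlonglongrightarrow> u_inf x $ i"
  using tendsto_vec_nth[OF u_inf_lim, of x i] by (simp add: blowup_fun_def uk_def)

text \<open>The blow-ups are Lipschitz with a common constant, so that convergence on a finite net is enough.\<close>

lemma uk_uniform_limit:
  assumes e: "e > 0"
  shows "\<exists>k0. \<forall>k\<ge>k0. \<forall>i. \<forall>x\<in>ball 0 R. \<bar>uk k i x - u_inf x $ i\<bar> < e"
proof -
  define d where "d = e / (3 * (L + 1))"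
  have d: "d > 0" and Ld: "L * d \<le> e / 3"
  proof -
    show "d > 0" unfolding d_def using e L_nonneg by (intro divide_pos_pos) auto
    have "L * d \<le> (L + 1) * d" using \<open>d > 0\<close> by (intro mult_right_mono) auto
    also have "\<dots> = e / 3" unfolding d_def using L_nonneg by (simp add: field_simps)
    finally show "L * d \<le> e / 3" .
  qed
  have lip: "\<bar>uk k i x - uk k i y\<bar> \<le> L * dist x y" if "x \<in> ball 0 R" "y \<in> ball 0 R" for k i x y
    using lipschitz_onD[OF uk_lipschitz, of x y k i] that R_pos by (auto simp: dist_real_def)
  have liplim: "\<bar>u_inf x $ i - u_inf y $ i\<bar> \<le> L * dist x y" if "x \<in> ball 0 R" "y \<in> ball 0 R" for i x y
    by (rule LIMSEQ_le_const2[OF tendsto_rabs[OF tendsto_diff[OF uk_lim[OF that(1), of i] uk_lim[OF that(2), of i]]]])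
      (use lip[OF that] in auto)
  have cov: "cball (0::'a) R \<subseteq> (\<Union>y\<in>ball 0 R. ball y d)"
  proof
    fix z :: 'a assume "z \<in> cball 0 R"
    then have "z \<in> closure (ball 0 R)" using R_pos by simp
    then obtain y where "y \<in> ball 0 R" "dist y z < d" using closure_approachable[of z "ball 0 R"] d by blast
    then show "z \<in> (\<Union>y\<in>ball 0 R. ball y d)" by auto
  qed
  obtain Y where Y: "Y \<subseteq> ball 0 R" "finite Y" "cball (0::'a) R \<subseteq> (\<Union>y\<in>Y. ball y d)"
    by (rule compactE_image[OF compact_cball _ cov]) simp_all
  have "\<forall>\<^sub>F k in sequentially. \<forall>y\<in>Y. \<forall>i\<in>UNIV. \<bar>uk k i y - u_inf y $ i\<bar> < e/3"
  proof (intro eventually_ball_finite Y(2) finite ballI)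
    fix y i assume "y \<in> Y"
    then have "(\<lambda>k. \<bar>uk k i y - u_inf y $ i\<bar>) \<longlonglongrightarrow> 0"
      using uk_lim[of y i] Y(1) by (intro tendsto_rabs_zero LIM_zero) auto
    then show "\<forall>\<^sub>F k in sequentially. \<bar>uk k i y - u_inf y $ i\<bar> < e/3" by (rule order_tendstoD(2)) (use e in simp)
  qed
  then obtain k0 where k0: "\<And>k y i. k \<ge> k0 \<Longrightarrow> y \<in> Y \<Longrightarrow> \<bar>uk k i y - u_inf y $ i\<bar> < e/3"
    by (auto simp: eventually_sequentially)
  have "\<bar>uk k i x - u_inf x $ i\<bar> < e" if k: "k \<ge> k0" and x: "x \<in> ball 0 R" for k i x
  proof -
    obtain y where y: "y \<in> Y" "dist y x < d" using Y(3) x by (force simp: subset_eq)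
    have yb: "y \<in> ball 0 R" using y Y by auto
    have "L * dist x y \<le> e / 3" using mult_left_mono[of "dist x y" d L] y L_nonneg Ld by (simp add: dist_commute)
    then show ?thesis using lip[OF x yb, of k i] liplim[OF x yb, of i] k0[OF k y(1), of i] by linarith
  qed
  then show ?thesis by blast
qed

definition cut :: "'a \<Rightarrow> real" where
  "cut = (SOME \<zeta>. \<zeta> \<in> C_c_inf (ball 0 (2 * R)) \<and> (\<forall>x\<in>cball 0 R. \<zeta> x = 1))"

lemma cut: "cut \<in> C_c_inf (ball 0 (2 * R))" "x \<in> cball 0 R \<Longrightarrow> cut x = 1"
proof -
  have "\<exists>\<zeta>. \<zeta> \<in> C_c_inf (ball 0 (2 * R)) \<and> (\<forall>x\<in>cball (0::'a) R. \<zeta> x = 1)"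
    by (rule test_cutoff_ball[of R "2 * R"]) (use R_pos in auto)
  from someI_ex[OF this] show "cut \<in> C_c_inf (ball 0 (2 * R))" "x \<in> cball 0 R \<Longrightarrow> cut x = 1" unfolding cut_def by auto
qed

text \<open>The blow-ups are only locally square integrable; the cut-off makes them functions to which the chain rule on
  the whole space applies, and does not change them on the ball of radius \<open>R\<close>.\<close>

definition U :: "nat \<Rightarrow> 'i \<Rightarrow> 'a \<Rightarrow> real" where
  "U k i x = cut x * uk k i x"

definition P :: "nat \<Rightarrow> 'i \<Rightarrow> 'a \<Rightarrow> 'a" where
  "P k i x = cut x *\<^sub>R Gk k i x + uk k i x *\<^sub>R grad cut x"

lemma uk_L2_loc: "uk k i \<in> L2_loc UNIV"
  using L2_loc_scale[of "\<lambda>x. u x $ i" "r k" "inverse (r k)"] u_W12[of i] r_pos[of k] by (simp add: W12_def uk_def[abs_def])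

lemma U_H1: "H1 (U k i) (P k i)"
  unfolding U_def[abs_def] P_def[abs_def]
  by (rule H1_mult_test[OF Gk_gradient uk_L2_loc L2_imp_L2_loc[OF Gk_L2]])
    (use subsetD[OF C_c_inf_mono[OF subset_UNIV] cut(1)] in simp_all)

lemma U_eq: "x \<in> ball 0 R \<Longrightarrow> U k i x = uk k i x"
  using cut(2)[of x] by (simp add: U_def)

lemma P_eq: "x \<in> ball 0 R \<Longrightarrow> P k i x = Gk k i x"
  using cut(2)[of x] grad_eq_0_const[of "ball 0 R" x cut 1] cut(2) by (simp add: P_def)

lemma Gk_bound_R: "AE x in lebesgue. x \<in> ball 0 R \<longrightarrow> norm (Gk k i x) \<le> real DIM('a) * L"
  using Gk_bound[of k i] by eventually_elim (use R_pos in auto)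

lemma uk_bound_R: "x \<in> ball 0 R \<Longrightarrow> \<bar>uk k i x\<bar> \<le> L * R"
  using uk_bound[of x k i] R_pos mult_left_mono[of "norm x" R L] L_nonneg by (force intro: order_trans)

text \<open>Where \<open>u\<^sub>k\<close> and \<open>u\<^sub>l\<close> are uniformly \<open>\<eta>\<close>-close, the soft thresholds \<open>S (u\<^sub>k)\<close> and \<open>S (u\<^sub>l)\<close> at height \<open>\<eta>\<close>
  vanish at the zeros of either function, so that \<open>\<phi> (S (u\<^sub>l) - S (u\<^sub>k))\<close> is an admissible variation of both. The sum of
  the two first-order conditions bounds \<open>\<integral> \<phi> |\<nabla>u\<^sub>k - \<nabla>u\<^sub>l|\<^sup>2\<close>, up to the energy of \<open>u\<^sub>k - S (u\<^sub>k)\<close>, which is small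
  because this function is small and \<open>\<phi> (u\<^sub>k - S (u\<^sub>k))\<close> is an admissible variation too.\<close>

lemma gradients_cauchy_inside:
  assumes T: "0 \<le> T" "T < R" and e: "e > 0"
  shows "\<exists>k0. \<forall>k\<ge>k0. \<forall>l\<ge>k0. sqn (\<lambda>x. indicator (ball 0 T) x *\<^sub>R (Gk k i x - Gk l i x)) \<le> e"
proof -
  obtain \<phi> :: "'a \<Rightarrow> real" where \<phi>: "\<phi> \<in> C_c_inf (ball 0 R)" "\<And>x. 0 \<le> \<phi> x \<and> \<phi> x \<le> 1"
    "\<And>x. x \<in> cball 0 T \<Longrightarrow> \<phi> x = 1" "\<And>x. x \<notin> ball 0 R \<Longrightarrow> \<phi> x = 0" "\<And>x. x \<notin> ball 0 R \<Longrightarrow> grad \<phi> x = 0"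
    by (rule test_cutoff_ball[OF T]) blast
  have \<phi>': "\<phi> \<in> C_c_inf UNIV" using \<phi>(1) C_c_inf_mono by blast
  obtain C where C: "C > 0" "\<And>x. norm (grad \<phi> x) \<le> C" by (rule grad_bounded[OF \<phi>(1)]) blast
  define m where "m = measure lebesgue (ball (0::'a) R)"
  have m: "m \<ge> 0" by (simp add: m_def)
  define Kg where "Kg = real DIM('a) * L"
  note Gkb = Gk_bound_R[folded Kg_def]
  have Kg: "Kg \<ge> 0" using L_nonneg by (simp add: Kg_def)
  \<comment> \<open>The parameters are chosen in the order \<open>\<theta>\<close>, \<open>\<gamma>\<close>, \<open>\<eta>\<close>, each depending on the previous ones.\<close>
  obtain \<theta> where \<theta>: "\<theta> > 0" "(4 * Kg * m) * \<theta> \<le> e / 4"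
    using small_factor[of "4 * Kg * m" "e/4"] Kg m e by auto
  obtain \<gamma> where \<gamma>: "\<gamma> > 0" "(2 + 4 * Kg / \<theta>) * \<gamma> \<le> e / 4"
    using small_factor[of "2 + 4 * Kg / \<theta>" "e/4"] Kg \<theta>(1) e by auto
  obtain \<eta> where \<eta>: "\<eta> > 0" "\<eta> \<le> 1" "(8 * Kg * (Kg * C * m) / \<theta> + 2 * (Kg * C * m)) * \<eta> \<le> e / 4"
    using small_factor[of "8 * Kg * (Kg * C * m) / \<theta> + 2 * (Kg * C * m)" "e/4"] Kg m C(1) \<theta>(1) e by auto
  obtain S S' where S: "\<And>a. (S has_real_derivative S' a) (at a)" "continuous_on UNIV S'"
    "\<And>a. 0 \<le> S' a \<and> S' a \<le> 1" "\<And>a. \<bar>a\<bar> \<le> \<eta> \<Longrightarrow> S a = 0" "\<And>a. \<bar>S a - a\<bar> \<le> 2 * \<eta>"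
    by (rule soft_threshold[OF \<eta>(1)]) blast
  have S0: "S 0 = 0" using S(4)[of 0] \<eta> by simp
  have S'1: "\<bar>S' a\<bar> \<le> 1" for a using S(3)[of a] by simp
  have Slip: "\<bar>S a - S b\<bar> \<le> \<bar>a - b\<bar>" for a b
  proof -
    have "norm (S a - S b) \<le> 1 * norm (a - b)"
    proof (rule differentiable_bound[of UNIV S "\<lambda>a. (*) (S' a)"])
      show "onorm ((*) (S' x)) \<le> 1" for x
        by (rule onorm_le) (use S'1[of x] in \<open>auto simp: abs_mult mult_left_le_one_le\<close>)
    qed (use S(1) in \<open>auto simp: has_field_derivative_def\<close>)
    then show ?thesis by simp
  qed
  have mS: "(\<lambda>x. S (h x)) \<in> borel_measurable lebesgue" and mS': "(\<lambda>x. S' (h x)) \<in> borel_measurable lebesgue"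
    if "h \<in> borel_measurable lebesgue" for h :: "'a \<Rightarrow> real"
  proof -
    have "continuous_on UNIV S" using S(1) by (meson DERIV_continuous continuous_at_imp_continuous_on)
    then show "(\<lambda>x. S (h x)) \<in> borel_measurable lebesgue" "(\<lambda>x. S' (h x)) \<in> borel_measurable lebesgue"
      using measurable_compose[OF that borel_measurable_continuous_onI] S(2) by blast+
  qed
  define K where "K = ((2 * L * R + 2)\<^sup>2 + (2 * Kg + (2 * L * R + 2) * C)\<^sup>2) * m"
  have K: "K \<ge> 0" unfolding K_def using m by simp
  obtain k1 where k1: "\<And>k j h Q. k \<ge> k1 \<Longrightarrow> H1 h Q \<Longrightarrow>
    AE x in lebesgue. h x \<noteq> 0 \<longrightarrow> x \<in> ball 0 R \<and> uk k j x \<noteq> 0 \<Longrightarrow> sqn h \<le> K \<Longrightarrow> sqn Q \<le> K \<Longrightarrow>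
    - \<gamma> \<le> (LINT x|lebesgue. Gk k j x \<bullet> Q x)"
    by (rule euler_lagrange_inequality[of R K \<gamma>]) (use R_pos K \<gamma>(1) in auto)
  obtain k2 where k2': "\<forall>k\<ge>k2. \<forall>i. \<forall>x\<in>ball 0 R. \<bar>uk k i x - u_inf x $ i\<bar> < \<eta>/2"
    using uk_uniform_limit[of "\<eta>/2"] \<eta>(1) by auto
  have k2: "\<bar>uk k i x - u_inf x $ i\<bar> < \<eta>/2" if "k \<ge> k2" "x \<in> ball 0 R" for k x
    using k2' that by blast
  define k0 where "k0 = max k1 k2"
  have mU: "U k i \<in> borel_measurable lebesgue" "Gk k i \<in> borel_measurable lebesgue" for k
    using L2_UNIV_measurable[OF H1_D(1)[OF U_H1]] L2_UNIV_measurable[OF Gk_L2] by auto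
  note meas = mU mS[OF mU(1)] mS'[OF mU(1)]
  have LR: "L * R \<ge> 0" using L_nonneg R_pos by simp
  define EN where "EN = (\<lambda>k x. \<phi> x * (1 - S' (U k i x)) * (norm (Gk k i x))\<^sup>2)"
  have ENm: "EN k \<in> borel_measurable lebesgue" for k unfolding EN_def using meas[of k] C_c_inf_measurable[OF \<phi>(1)] by measurable
  have ENb: "AE x in lebesgue. norm (EN k x) \<le> Kg\<^sup>2 * indicat_real (ball 0 R) x" for k
    using Gkb[of k i]
  proof eventually_elim
    case (elim x)
    show ?case
    proof (cases "x \<in> ball 0 R")
      case True
      have "\<phi> x * (1 - S' (U k i x)) \<le> 1 * 1" using \<phi>(2)[of x] S(3)[of "U k i x"] by (intro mult_mono) auto
      moreover have "0 \<le> \<phi> x * (1 - S' (U k i x))" using \<phi>(2)[of x] S(3)[of "U k i x"] by simp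
      moreover have "(norm (Gk k i x))\<^sup>2 \<le> Kg\<^sup>2" using elim True by (intro power_mono) auto
      ultimately have "\<phi> x * (1 - S' (U k i x)) * (norm (Gk k i x))\<^sup>2 \<le> 1 * Kg\<^sup>2" by (intro mult_mono) auto
      moreover have "0 \<le> \<phi> x * (1 - S' (U k i x)) * (norm (Gk k i x))\<^sup>2"
        using \<open>0 \<le> \<phi> x * (1 - S' (U k i x))\<close> by simp
      ultimately show ?thesis using True by (simp add: EN_def abs_of_nonneg)
    qed (simp add: EN_def \<phi>(4))
  qed
  note ENi = bounded_ball_integrable[OF ENm ENb]
  have EN: "(LINT x|lebesgue. EN k x) \<le> \<gamma> + 2 * \<eta> * (Kg * C * m)" if k: "k \<ge> k0" for k
  proof -
    define Th where "Th = (\<lambda>a. a - S a)"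
    define h where "h = (\<lambda>x. -1 * (\<phi> x * Th (U k i x)))"
    define Q where "Q = (\<lambda>x. -1 *\<^sub>R (\<phi> x *\<^sub>R ((1 - S' (U k i x)) *\<^sub>R P k i x) + Th (U k i x) *\<^sub>R grad \<phi> x))"
    have ThH: "H1 (\<lambda>x. Th (U k i x)) (\<lambda>x. (1 - S' (U k i x)) *\<^sub>R P k i x)"
    proof (rule H1_chain_rule[OF U_H1])
      show "(Th has_real_derivative 1 - S' a) (at a)" for a unfolding Th_def by (intro derivative_intros S)
      show "continuous_on UNIV (\<lambda>a. 1 - S' a)" by (intro continuous_intros S)
      show "\<bar>1 - S' a\<bar> \<le> 1" for a using S(3)[of a] by simp
    qed (simp add: Th_def S0)
    have H: "H1 h Q" unfolding h_def Q_def by (rule H1_scale[OF H1_mult_test_UNIV[OF ThH \<phi>']])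
    have Thb: "\<bar>Th a\<bar> \<le> 2 * \<eta>" for a using S(5)[of a] by (simp add: Th_def abs_minus_commute)
    have Qb: "AE x in lebesgue. norm (Q x) \<le> (2 * Kg + (2 * L * R + 2) * C) * indicat_real (ball 0 R) x"
      using Gkb[of k i]
    proof eventually_elim
      case (elim x)
      show ?case
      proof (cases "x \<in> ball 0 R")
        case True
        have "norm (Q x) \<le> norm (\<phi> x *\<^sub>R ((1 - S' (U k i x)) *\<^sub>R Gk k i x)) + norm (Th (U k i x) *\<^sub>R grad \<phi> x)"
          using norm_triangle_ineq[of "\<phi> x *\<^sub>R ((1 - S' (U k i x)) *\<^sub>R Gk k i x)" "Th (U k i x) *\<^sub>R grad \<phi> x"]
          by (simp add: Q_def P_eq[OF True] norm_minus_commute norm_minus_cancel[of "_ + _"] del: minus_add_distrib)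
        also have "norm (\<phi> x *\<^sub>R ((1 - S' (U k i x)) *\<^sub>R Gk k i x)) \<le> 1 * (1 * Kg)"
          unfolding norm_scaleR using \<phi>(2)[of x] S(3)[of "U k i x"] elim True Kg by (intro mult_mono) auto
        also have "norm (Th (U k i x) *\<^sub>R grad \<phi> x) \<le> (2 * L * R + 2) * C"
          unfolding norm_scaleR using Thb[of "U k i x"] \<eta> LR C(2)[of x] by (intro mult_mono) auto
        finally show ?thesis using True Kg by simp
      qed (simp add: Q_def \<phi>(4,5))
    qed
    have hb: "AE x in lebesgue. norm (h x) \<le> (2 * L * R + 2) * indicat_real (ball 0 R) x"
    proof (rule AE_I2)
      fix x
      show "norm (h x) \<le> (2 * L * R + 2) * indicat_real (ball 0 R) x"
      proof (cases "x \<in> ball 0 R")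
        case True
        have "\<bar>\<phi> x\<bar> * \<bar>Th (U k i x)\<bar> \<le> 1 * (2 * L * R + 2)"
          using \<phi>(2)[of x] Thb[of "U k i x"] \<eta> LR by (intro mult_mono) auto
        then show ?thesis using True by (simp add: h_def abs_mult)
      qed (simp add: h_def \<phi>(4))
    qed
    have Qm: "Q \<in> borel_measurable lebesgue" "h \<in> borel_measurable lebesgue"
      using L2_UNIV_measurable[OF H1_D(1)[OF H]] L2_UNIV_measurable[OF H1_D(2)[OF H]] by auto
    have "- \<gamma> \<le> (LINT x|lebesgue. Gk k i x \<bullet> Q x)"
    proof (rule k1[OF _ H])
      show "AE x in lebesgue. h x \<noteq> 0 \<longrightarrow> x \<in> ball 0 R \<and> uk k i x \<noteq> 0"
      proof (intro AE_I2 impI conjI)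
        fix x assume hx: "h x \<noteq> 0"
        then show "x \<in> ball 0 R" using \<phi>(4)[of x] by (auto simp: h_def)
        then show "uk k i x \<noteq> 0" using hx S0 by (auto simp: h_def Th_def U_eq)
      qed
      have "sqn h \<le> (2 * L * R + 2)\<^sup>2 * m" unfolding m_def by (rule bounded_ball_sqn[OF Qm(2) hb])
      also have "\<dots> \<le> K" unfolding K_def using m by (intro mult_right_mono) auto
      finally show "sqn h \<le> K" .
      have "sqn Q \<le> (2 * Kg + (2 * L * R + 2) * C)\<^sup>2 * m" unfolding m_def by (rule bounded_ball_sqn[OF Qm(1) Qb])
      also have "\<dots> \<le> K" unfolding K_def using m by (intro mult_right_mono) auto
      finally show "sqn Q \<le> K" .
    qed (use k in \<open>simp add: k0_def\<close>)
    also have "(LINT x|lebesgue. Gk k i x \<bullet> Q x) \<le> (LINT x|lebesgue. 2 * \<eta> * (Kg * C) * indicat_real (ball 0 R) x - EN k x)"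
    proof (rule integral_mono_AE)
      show "integrable lebesgue (\<lambda>x. Gk k i x \<bullet> Q x)" by (rule integrable_inner_L2[OF Gk_L2 H1_D(2)[OF H]])
      show "integrable lebesgue (\<lambda>x. 2 * \<eta> * (Kg * C) * indicat_real (ball 0 R) x - EN k x)"
        by (intro Bochner_Integration.integrable_diff ball_indicator_integrable ENi)
      show "AE x in lebesgue. Gk k i x \<bullet> Q x \<le> 2 * \<eta> * (Kg * C) * indicat_real (ball 0 R) x - EN k x"
        using Gkb[of k i]
      proof eventually_elim
        case (elim x)
        show ?case
        proof (cases "x \<in> ball 0 R")
          case True
          have "Gk k i x \<bullet> Q x = - EN k x - Th (U k i x) * (Gk k i x \<bullet> grad \<phi> x)"
            by (simp add: Q_def P_eq[OF True] EN_def inner_add_right inner_diff_right power2_norm_eq_inner)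
          moreover have "\<bar>Th (U k i x) * (Gk k i x \<bullet> grad \<phi> x)\<bar> \<le> (2 * \<eta>) * (Kg * C)"
            unfolding abs_mult
          proof (intro mult_mono Thb)
            have "\<bar>Gk k i x \<bullet> grad \<phi> x\<bar> \<le> norm (Gk k i x) * norm (grad \<phi> x)" by (rule Cauchy_Schwarz_ineq2)
            also have "\<dots> \<le> Kg * C" using elim True C(2)[of x] Kg by (intro mult_mono) auto
            finally show "\<bar>Gk k i x \<bullet> grad \<phi> x\<bar> \<le> Kg * C" .
          qed (use \<eta> in auto)
          ultimately show ?thesis using True by (simp add: abs_le_iff) 
        qed (simp add: Q_def EN_def \<phi>(4,5))
      qed
    qed
    also have "\<dots> = 2 * \<eta> * (Kg * C) * m - (LINT x|lebesgue. EN k x)"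
      by (subst Bochner_Integration.integral_diff[OF ball_indicator_integrable ENi]) (simp add: m_def)
    finally show ?thesis by (simp add: mult_ac)
  qed
  have main: "sqn (\<lambda>x. indicator (ball 0 T) x *\<^sub>R (Gk k i x - Gk l i x)) \<le> e" if k: "k \<ge> k0" and l: "l \<ge> k0" for k l
  proof -
    define h where "h = (\<lambda>x. \<phi> x * (S (U l i x) - S (U k i x)))"
    define Q where "Q = (\<lambda>x. \<phi> x *\<^sub>R (S' (U l i x) *\<^sub>R P l i x - S' (U k i x) *\<^sub>R P k i x) + (S (U l i x) - S (U k i x)) *\<^sub>R grad \<phi> x)"
    have SH: "H1 (\<lambda>x. S (U k i x)) (\<lambda>x. S' (U k i x) *\<^sub>R P k i x)" for k
      by (rule H1_chain_rule[OF U_H1 S(1) S0 S(2) S'1])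
    have H: "H1 h Q" unfolding h_def Q_def by (rule H1_mult_test_UNIV[OF H1_diff[OF SH SH] \<phi>'])
    have close: "\<bar>U l i x - U k i x\<bar> < \<eta>" if "x \<in> ball 0 R" for x
    proof -
      have "\<bar>uk k i x - u_inf x $ i\<bar> < \<eta>/2" "\<bar>uk l i x - u_inf x $ i\<bar> < \<eta>/2"
        using k2[of k x] k2[of l x] that k l by (auto simp: k0_def)
      then show ?thesis unfolding U_eq[OF that] by linarith
    qed
    have Sclose: "\<bar>S (U l i x) - S (U k i x)\<bar> \<le> \<eta>" if "x \<in> ball 0 R" for x
      using Slip[of "U l i x" "U k i x"] close[OF that] by linarith
    have Qb: "AE x in lebesgue. norm (Q x) \<le> (2 * Kg + (2 * L * R + 2) * C) * indicat_real (ball 0 R) x"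
      using Gkb[of k i] Gkb[of l i]
    proof eventually_elim
      case (elim x)
      show ?case
      proof (cases "x \<in> ball 0 R")
        case True
        have "norm (Q x) \<le> norm (\<phi> x *\<^sub>R (S' (U l i x) *\<^sub>R Gk l i x - S' (U k i x) *\<^sub>R Gk k i x)) + norm ((S (U l i x) - S (U k i x)) *\<^sub>R grad \<phi> x)"
          unfolding Q_def P_eq[OF True] by (rule norm_triangle_ineq)
        also have "norm (\<phi> x *\<^sub>R (S' (U l i x) *\<^sub>R Gk l i x - S' (U k i x) *\<^sub>R Gk k i x)) \<le> 1 * (1 * Kg + 1 * Kg)"
          unfolding norm_scaleR
        proof (intro mult_mono)
          have "norm (S' (U l i x) *\<^sub>R Gk l i x - S' (U k i x) *\<^sub>R Gk k i x) \<le> norm (S' (U l i x) *\<^sub>R Gk l i x) + norm (S' (U k i x) *\<^sub>R Gk k i x)"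
            by (rule norm_triangle_ineq4)
          also have "\<dots> \<le> 1 * Kg + 1 * Kg" unfolding norm_scaleR using elim True S'1 by (intro add_mono mult_mono) auto
          finally show "norm (S' (U l i x) *\<^sub>R Gk l i x - S' (U k i x) *\<^sub>R Gk k i x) \<le> 1 * Kg + 1 * Kg" .
        qed (use \<phi>(2)[of x] Kg in auto)
        also have "norm ((S (U l i x) - S (U k i x)) *\<^sub>R grad \<phi> x) \<le> (2 * L * R + 2) * C"
          unfolding norm_scaleR using Sclose[OF True] \<eta> LR C(2)[of x] by (intro mult_mono) auto
        finally show ?thesis using True by simp
      qed (simp add: Q_def \<phi>(4,5))
    qed
    have hb: "AE x in lebesgue. norm (h x) \<le> (2 * L * R + 2) * indicat_real (ball 0 R) x"
    proof (rule AE_I2)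
      fix x
      show "norm (h x) \<le> (2 * L * R + 2) * indicat_real (ball 0 R) x"
      proof (cases "x \<in> ball 0 R")
        case True
        have "\<bar>\<phi> x\<bar> * \<bar>S (U l i x) - S (U k i x)\<bar> \<le> 1 * (2 * L * R + 2)"
          using \<phi>(2)[of x] Sclose[OF True] \<eta> LR by (intro mult_mono) auto
        then show ?thesis using True by (simp add: h_def abs_mult)
      qed (simp add: h_def \<phi>(4))
    qed
    have Qm: "Q \<in> borel_measurable lebesgue" "h \<in> borel_measurable lebesgue"
      using L2_UNIV_measurable[OF H1_D(1)[OF H]] L2_UNIV_measurable[OF H1_D(2)[OF H]] by auto
    have hK: "sqn h \<le> K"
    proof -
      have "sqn h \<le> (2 * L * R + 2)\<^sup>2 * m" unfolding m_def by (rule bounded_ball_sqn[OF Qm(2) hb])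
      also have "\<dots> \<le> K" unfolding K_def using m by (intro mult_right_mono) auto
      finally show ?thesis .
    qed
    have QK: "sqn Q \<le> K"
    proof -
      have "sqn Q \<le> (2 * Kg + (2 * L * R + 2) * C)\<^sup>2 * m" unfolding m_def by (rule bounded_ball_sqn[OF Qm(1) Qb])
      also have "\<dots> \<le> K" unfolding K_def using m by (intro mult_right_mono) auto
      finally show ?thesis .
    qed
    have supp: "x \<in> ball 0 R \<and> uk k i x \<noteq> 0 \<and> uk l i x \<noteq> 0" if hx: "h x \<noteq> 0" for x
    proof -
      have x: "x \<in> ball 0 R" using \<phi>(4)[of x] hx by (auto simp: h_def)
      have "\<bar>U l i x\<bar> > \<eta> \<or> \<bar>U k i x\<bar> > \<eta>" using hx S(4)[of "U l i x"] S(4)[of "U k i x"] by (force simp: h_def)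
      then have "U l i x \<noteq> 0 \<and> U k i x \<noteq> 0" using close[OF x] by auto
      then show ?thesis using x by (simp add: U_eq[OF x])
    qed
    have EL1: "- \<gamma> \<le> (LINT x|lebesgue. Gk k i x \<bullet> Q x)"
      by (rule k1[OF _ H _ hK QK]) (use k supp in \<open>auto simp: k0_def\<close>)
    have EL2: "- \<gamma> \<le> (LINT x|lebesgue. Gk l i x \<bullet> (-1 *\<^sub>R Q x))"
      by (rule k1[OF _ H1_scale[OF H, of "-1"]]) (use l supp hK QK in \<open>auto simp: k0_def\<close>)
    have i1: "integrable lebesgue (\<lambda>x. Gk j i x \<bullet> Q x)" for j by (rule integrable_inner_L2[OF Gk_L2 H1_D(2)[OF H]])
    let ?D = "\<lambda>x. Gk k i x - Gk l i x"
    define c1 where "c1 = 4 * Kg * \<theta> + 2 * \<eta> * (Kg * C)"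
    define c2 where "c2 = 2 * Kg / \<theta>"
    define RHS where "RHS = (\<lambda>x. c1 * indicat_real (ball 0 R) x + c2 * EN k x + c2 * EN l x + Gk l i x \<bullet> Q x - Gk k i x \<bullet> Q x)"
    have iR: "integrable lebesgue RHS" unfolding RHS_def
      by (intro Bochner_Integration.integrable_add Bochner_Integration.integrable_diff ball_indicator_integrable integrable_mult_right ENi i1)
    have le: "AE x in lebesgue. (norm (indicator (ball 0 T) x *\<^sub>R ?D x))\<^sup>2 \<le> RHS x"
    proof -
      show "AE x in lebesgue. (norm (indicator (ball 0 T) x *\<^sub>R ?D x))\<^sup>2 \<le> RHS x"
        using Gkb[of k i] Gkb[of l i]
      proof eventually_elim
        case (elim x)
        show ?case
        proof (cases "x \<in> ball 0 R")
          case True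
          let ?a = "1 - S' (U k i x)" and ?b = "1 - S' (U l i x)"
          let ?A = "Gk k i x" and ?B = "Gk l i x" and ?d = "S (U l i x) - S (U k i x)"
          have a: "0 \<le> ?a" "?a \<le> 1" "0 \<le> ?b" "?b \<le> 1" using S(3) by auto
          have n: "norm ?A \<le> Kg" "norm ?B \<le> Kg" using elim True by auto
          have nD: "norm (?A - ?B) \<le> 2 * Kg" using n norm_triangle_ineq4[of ?A ?B] by linarith
          have young: "c * norm v \<le> \<theta> + c * (norm v)\<^sup>2 / \<theta>" if "0 \<le> c" "c \<le> 1" for c and v :: 'a
          proof -
            have "norm v \<le> \<theta> + (norm v)\<^sup>2 / \<theta>"
            proof (cases "norm v \<le> \<theta>")
              case False
              then have "norm v * \<theta> \<le> norm v * norm v" by (intro mult_left_mono) auto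
              then have "norm v \<le> (norm v)\<^sup>2 / \<theta>" using \<theta>(1) by (simp add: le_divide_eq power2_eq_square)
              then show ?thesis using \<theta>(1) by linarith
            qed (use \<theta>(1) in \<open>simp add: add_increasing2\<close>)
            then have "c * norm v \<le> c * (\<theta> + (norm v)\<^sup>2 / \<theta>)" using that by (intro mult_left_mono)
            also have "\<dots> = c * \<theta> + c * (norm v)\<^sup>2 / \<theta>" by (simp add: distrib_left)
            also have "c * \<theta> \<le> 1 * \<theta>" using that \<theta>(1) by (intro mult_right_mono) auto
            finally show ?thesis by simp
          qed
          have "\<phi> x * (norm (?A - ?B))\<^sup>2 = ?B \<bullet> Q x - ?A \<bullet> Q x + \<phi> x * ((?A - ?B) \<bullet> (?a *\<^sub>R ?A - ?b *\<^sub>R ?B)) + ?d * ((?A - ?B) \<bullet> grad \<phi> x)"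
            by (simp add: Q_def P_eq[OF True] power2_norm_eq_inner algebra_simps inner_commute)
          also have "\<phi> x * ((?A - ?B) \<bullet> (?a *\<^sub>R ?A - ?b *\<^sub>R ?B)) \<le> 2 * Kg * (2 * \<theta> + (EN k x + EN l x) / \<theta>)"
          proof -
            have "(?A - ?B) \<bullet> (?a *\<^sub>R ?A - ?b *\<^sub>R ?B) \<le> norm (?A - ?B) * norm (?a *\<^sub>R ?A - ?b *\<^sub>R ?B)"
              by (rule norm_cauchy_schwarz)
            also have "\<dots> \<le> (2 * Kg) * (?a * norm ?A + ?b * norm ?B)"
            proof (intro mult_mono nD)
              show "norm (?a *\<^sub>R ?A - ?b *\<^sub>R ?B) \<le> ?a * norm ?A + ?b * norm ?B"
                using norm_triangle_ineq4[of "?a *\<^sub>R ?A" "?b *\<^sub>R ?B"] a by simp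
            qed (use Kg in auto)
            also have "\<dots> \<le> (2 * Kg) * ((\<theta> + ?a * (norm ?A)\<^sup>2 / \<theta>) + (\<theta> + ?b * (norm ?B)\<^sup>2 / \<theta>))"
              using Kg a by (intro mult_left_mono add_mono young) auto
            finally have "\<phi> x * ((?A - ?B) \<bullet> (?a *\<^sub>R ?A - ?b *\<^sub>R ?B)) \<le> \<phi> x * ((2 * Kg) * ((\<theta> + ?a * (norm ?A)\<^sup>2 / \<theta>) + (\<theta> + ?b * (norm ?B)\<^sup>2 / \<theta>)))"
              using \<phi>(2)[of x] by (intro mult_left_mono) auto
            also have "\<dots> = 2 * Kg * (\<phi> x * (2 * \<theta>) + (EN k x + EN l x) / \<theta>)"
              using \<theta>(1) by (simp add: EN_def field_simps)
            also have "\<dots> \<le> 2 * Kg * (1 * (2 * \<theta>) + (EN k x + EN l x) / \<theta>)"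
              using \<phi>(2)[of x] Kg \<theta>(1) by (intro mult_left_mono add_right_mono mult_right_mono) auto
            finally show ?thesis by simp
          qed
          also have "?d * ((?A - ?B) \<bullet> grad \<phi> x) \<le> \<eta> * ((2 * Kg) * C)"
          proof -
            have "?d * ((?A - ?B) \<bullet> grad \<phi> x) \<le> \<bar>?d\<bar> * \<bar>(?A - ?B) \<bullet> grad \<phi> x\<bar>" by (metis abs_ge_self abs_mult)
            also have "\<dots> \<le> \<eta> * ((2 * Kg) * C)"
            proof (intro mult_mono Sclose[OF True])
              have "\<bar>(?A - ?B) \<bullet> grad \<phi> x\<bar> \<le> norm (?A - ?B) * norm (grad \<phi> x)" by (rule Cauchy_Schwarz_ineq2)
              also have "\<dots> \<le> (2 * Kg) * C" using Kg by (intro mult_mono nD C(2)) auto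
              finally show "\<bar>(?A - ?B) \<bullet> grad \<phi> x\<bar> \<le> (2 * Kg) * C" .
            qed (use \<eta> in auto)
            finally show ?thesis .
          qed
          finally have "\<phi> x * (norm (?A - ?B))\<^sup>2 \<le> RHS x"
            using True \<theta>(1) by (simp add: RHS_def c1_def c2_def field_simps)
          moreover have "(norm (indicator (ball 0 T) x *\<^sub>R ?D x))\<^sup>2 \<le> \<phi> x * (norm (?A - ?B))\<^sup>2"
            using \<phi>(2)[of x] \<phi>(3)[of x] by (cases "x \<in> ball 0 T") auto
          ultimately show ?thesis by linarith
        next
          case False
          then have "x \<notin> ball 0 T" using T by auto
          then show ?thesis using False by (simp add: RHS_def Q_def EN_def \<phi>(4,5))
        qed
      qed
    qed
    have "sqn (\<lambda>x. indicator (ball 0 T) x *\<^sub>R ?D x) \<le> (LINT x|lebesgue. RHS x)"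
    proof (rule integral_mono_AE'[OF iR le])
      show "AE x in lebesgue. 0 \<le> RHS x"
        using le by eventually_elim (rule order_trans[OF zero_le_power2])
    qed
    also have "(LINT x|lebesgue. RHS x) = c1 * m + c2 * (LINT x|lebesgue. EN k x)
        + c2 * (LINT x|lebesgue. EN l x) + (LINT x|lebesgue. Gk l i x \<bullet> Q x) - (LINT x|lebesgue. Gk k i x \<bullet> Q x)"
    proof -
      have "integrable lebesgue (indicat_real (ball (0::'a) R))" using ball_indicator_integrable[of 1 R] by simp
      then show ?thesis unfolding RHS_def m_def using ENi[of k] ENi[of l] i1[of k] i1[of l] by simp
    qed
    also have "\<dots> \<le> c1 * m + c2 * (\<gamma> + 2 * \<eta> * (Kg * C * m)) + c2 * (\<gamma> + 2 * \<eta> * (Kg * C * m)) + \<gamma> + \<gamma>"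
    proof -
      have "c2 * (LINT x|lebesgue. EN j x) \<le> c2 * (\<gamma> + 2 * \<eta> * (Kg * C * m))" if "j \<ge> k0" for j
        using EN[OF that] Kg \<theta>(1) by (intro mult_left_mono) (auto simp: c2_def)
      from this[OF k] this[OF l] EL1 EL2 show ?thesis by simp
    qed
    also have "\<dots> = (4 * Kg * m) * \<theta> + (2 + 4 * Kg / \<theta>) * \<gamma> + (8 * Kg * (Kg * C * m) / \<theta> + 2 * (Kg * C * m)) * \<eta>"
      using \<theta>(1) by (simp add: c1_def c2_def field_simps)
    also have "\<dots> \<le> e/4 + e/4 + e/4" by (intro add_mono \<theta> \<gamma> \<eta>)
    finally show ?thesis using e by linarith
  qed
  then show ?thesis by blast
qed

end

lemma L2_inner_tendsto:
  assumes F: "\<And>k. F k \<in> L2 UNIV" and f: "f \<in> L2 UNIV" and h: "h \<in> L2 UNIV"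
    and lim: "(\<lambda>k. sqn (\<lambda>x. F k x - f x)) \<longlonglongrightarrow> 0"
  shows "(\<lambda>k. LINT x|lebesgue. F k x \<bullet> h x) \<longlonglongrightarrow> (LINT x|lebesgue. f x \<bullet> h x)"
proof (rule Lim_transform2[OF tendsto_const])
  show "(\<lambda>k. (LINT x|lebesgue. f x \<bullet> h x) - (LINT x|lebesgue. F k x \<bullet> h x)) \<longlonglongrightarrow> 0"
  proof (rule tendsto_0_le[where K = 1])
    show "(\<lambda>k. sqrt (sqn (\<lambda>x. F k x - f x)) * sqrt (sqn h)) \<longlonglongrightarrow> 0"
      using tendsto_mult_left_zero[OF tendsto_real_sqrt[OF lim, simplified]] by simp
    have "norm ((LINT x|lebesgue. f x \<bullet> h x) - (LINT x|lebesgue. F k x \<bullet> h x)) \<le> sqrt (sqn (\<lambda>x. F k x - f x)) * sqrt (sqn h)" for k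
    proof -
      have "(LINT x|lebesgue. F k x \<bullet> h x) - (LINT x|lebesgue. f x \<bullet> h x) = (LINT x|lebesgue. (F k x - f x) \<bullet> h x)"
        unfolding inner_diff_left by (rule Bochner_Integration.integral_diff[symmetric]) (rule integrable_inner_L2[OF F h] integrable_inner_L2[OF f h])+
      then show ?thesis using L2_cauchy_schwarz_inner[OF L2_UNIV_diff[OF F[of k] f] h] by (simp add: abs_minus_commute)
    qed
    then show "\<forall>\<^sub>F k in sequentially. norm ((LINT x|lebesgue. f x \<bullet> h x) - (LINT x|lebesgue. F k x \<bullet> h x))
        \<le> norm (sqrt (sqn (\<lambda>x. F k x - f x)) * sqrt (sqn h)) * 1"
      by (intro always_eventually allI) (simp only: mult_1_right real_norm_def order_trans[OF _ abs_ge_self])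
  qed
qed

lemma W12_scale:
  assumes "u \<in> W12 UNIV" "t > 0"
  shows "(\<lambda>x. inverse t * u (t *\<^sub>R x)) \<in> W12 UNIV"
proof -
  obtain G where G: "has_weak_gradient UNIV u G" "G \<in> L2 UNIV" using assms by (auto simp: W12_def)
  have "(\<lambda>x. G (t *\<^sub>R x)) \<in> L2 UNIV" using L2_UNIV_affine[OF G(2), of t 0] assms(2) by simp
  then show ?thesis
    using has_weak_gradient_scale[OF G(1) assms(2)] L2_loc_scale[of u t "inverse t"] assms by (auto simp: W12_def)
qed

lemma W12_subset:
  assumes "u \<in> W12 UNIV" "U \<in> sets lebesgue"
  shows "u \<in> W12 U"
  using assms has_weak_gradient_subset[of UNIV u _ U] L2_mono_set[of _ UNIV U] by (auto simp: W12_def L2_loc_def)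

lemma set_nn_integral_square:
  fixes H :: "'a::euclidean_space \<Rightarrow> 'b::euclidean_space"
  assumes "(\<lambda>x. indicator U x *\<^sub>R H x) \<in> L2 UNIV"
  shows "(\<integral>\<^sup>+x\<in>U. ennreal ((norm (H x))\<^sup>2) \<partial>lebesgue) = ennreal (sqn (\<lambda>x. indicator U x *\<^sub>R H x))"
proof -
  have "(\<integral>\<^sup>+x\<in>U. ennreal ((norm (H x))\<^sup>2) \<partial>lebesgue) = (\<integral>\<^sup>+x. ennreal ((norm (indicat_real U x *\<^sub>R H x))\<^sup>2) \<partial>lebesgue)"
    by (intro nn_integral_cong) (auto simp: indicator_def)
  then show ?thesis using nn_integral_eq_integral[OF L2_UNIV_integrable[OF assms]] by simp
qed

lemma weak_gradient_energy_eq: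
  assumes "has_weak_gradient U w H" "open U"
  shows "(\<integral>\<^sup>+x\<in>U. ennreal ((norm (weak_gradient U w x))\<^sup>2) \<partial>lebesgue) = (\<integral>\<^sup>+x\<in>U. ennreal ((norm (H x))\<^sup>2) \<partial>lebesgue)"
  by (rule nn_integral_cong_AE)
    (use weak_gradient_unique[OF weak_gradient_works[OF assms(1)] assms] in \<open>eventually_elim, auto simp: indicator_def\<close>)

lemma W12_norm_sq_eq:
  assumes "has_weak_gradient U w H" "open U" "(\<lambda>x. indicator U x *\<^sub>R w x) \<in> L2 UNIV" "(\<lambda>x. indicator U x *\<^sub>R H x) \<in> L2 UNIV"
  shows "W12_norm_sq U w = ennreal (sqn (\<lambda>x. indicator U x *\<^sub>R w x) + sqn (\<lambda>x. indicator U x *\<^sub>R H x))"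
  unfolding W12_norm_sq_def weak_gradient_energy_eq[OF assms(1,2)] set_nn_integral_square[OF assms(4)]
  using set_nn_integral_square[OF assms(3)] by (simp add: ennreal_plus integral_nonneg_AE)

context blowup_limit
begin

definition gk :: "nat \<Rightarrow> 'i \<Rightarrow> 'a \<Rightarrow> 'a" where
  "gk k i x = indicator (ball 0 R) x *\<^sub>R Gk k i x"

lemma gk_measurable: "gk k i \<in> borel_measurable lebesgue"
  unfolding gk_def[abs_def]
  by (intro borel_measurable_scaleR borel_measurable_indicator L2_UNIV_measurable[OF Gk_L2]) auto

lemma gk_bound: "AE x in lebesgue. norm (gk k i x) \<le> (real DIM('a) * L) * indicat_real (ball 0 R) x"
  using Gk_bound_R[of k i] by eventually_elim (auto simp: gk_def indicator_def)

lemmas gk_L2 = bounded_ball_L2[OF gk_measurable gk_bound]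

text \<open>In a thin shell at the boundary of the ball the bound on the gradients is enough.\<close>

lemma gk_cauchy:
  assumes e: "e > 0"
  shows "\<exists>k0. \<forall>k\<ge>k0. \<forall>l\<ge>k0. sqn (\<lambda>x. gk k i x - gk l i x) \<le> e"
proof -
  define Kg where "Kg = real DIM('a) * L"
  define vol where "vol = unit_ball_vol (real DIM('a))"
  have Kg: "Kg \<ge> 0" using L_nonneg by (simp add: Kg_def)
  have "((\<lambda>t. (2 * Kg)\<^sup>2 * (vol * R ^ DIM('a) - vol * t ^ DIM('a))) \<longlongrightarrow> (2 * Kg)\<^sup>2 * (vol * R ^ DIM('a) - vol * R ^ DIM('a))) (at_left R)"
    by (intro tendsto_intros)
  then have "\<forall>\<^sub>F t in at_left R. (2 * Kg)\<^sup>2 * (vol * R ^ DIM('a) - vol * t ^ DIM('a)) < e / 2"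
    by (rule order_tendstoD(2)) (use e in simp)
  moreover have "\<forall>\<^sub>F t in at_left R. t \<in> {0<..<R}" using R_pos by (rule eventually_at_left_real)
  ultimately have "\<forall>\<^sub>F t in at_left R. t \<in> {0<..<R} \<and> (2 * Kg)\<^sup>2 * (vol * R ^ DIM('a) - vol * t ^ DIM('a)) < e / 2"
    by eventually_elim simp
  then obtain T where T: "0 < T" "T < R" "(2 * Kg)\<^sup>2 * (vol * R ^ DIM('a) - vol * T ^ DIM('a)) < e / 2"
    using eventually_happens'[OF trivial_limit_at_left_real[of R]] by (metis (no_types, lifting) greaterThanLessThan_iff)
  obtain k0 where k0: "\<And>k l. k \<ge> k0 \<Longrightarrow> l \<ge> k0 \<Longrightarrow> sqn (\<lambda>x. indicator (ball 0 T) x *\<^sub>R (Gk k i x - Gk l i x)) \<le> e / 2"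
    using gradients_cauchy_inside[of T "e / 2" i] T e by auto
  have "sqn (\<lambda>x. gk k i x - gk l i x) \<le> e" if k: "k \<ge> k0" and l: "l \<ge> k0" for k l
  proof -
    let ?D = "\<lambda>x. indicat_real (ball 0 T) x *\<^sub>R (Gk k i x - Gk l i x)"
    have DL: "?D \<in> L2 UNIV"
    proof (rule L2_UNIV_mult_bounded[OF L2_UNIV_diff[OF Gk_L2 Gk_L2], of _ 1])
      show "indicat_real (ball (0::'a) T) \<in> borel_measurable lebesgue" by (intro borel_measurable_indicator) auto
    qed (auto simp: indicator_def)
    have iD: "integrable lebesgue (\<lambda>x. (norm (?D x))\<^sup>2)" by (rule L2_UNIV_integrable[OF DL])
    define B where "B = (\<lambda>x. (norm (?D x))\<^sup>2 + ((2 * Kg)\<^sup>2 * indicat_real (ball 0 R) x - (2 * Kg)\<^sup>2 * indicat_real (ball 0 T) x))"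
    have iB: "integrable lebesgue B" unfolding B_def
      by (intro Bochner_Integration.integrable_add Bochner_Integration.integrable_diff iD ball_indicator_integrable)
    have le: "AE x in lebesgue. (norm (gk k i x - gk l i x))\<^sup>2 \<le> B x"
      using gk_bound[of k i] gk_bound[of l i]
    proof eventually_elim
      case (elim x)
      show ?case
      proof (cases "x \<in> ball 0 T")
        case True
        then show ?thesis using T by (auto simp: B_def gk_def)
      next
        case False
        have "norm (gk k i x - gk l i x) \<le> 2 * Kg * indicat_real (ball 0 R) x"
          using norm_triangle_ineq4[of "gk k i x" "gk l i x"] elim unfolding Kg_def by linarith
        then have "(norm (gk k i x - gk l i x))\<^sup>2 \<le> (2 * Kg * indicat_real (ball 0 R) x)\<^sup>2" by (intro power_mono) auto
        then show ?thesis using False by (auto simp: B_def indicator_def)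
      qed
    qed
    have "sqn (\<lambda>x. gk k i x - gk l i x) \<le> (LINT x|lebesgue. B x)"
      by (rule integral_mono_AE[OF L2_UNIV_integrable[OF L2_UNIV_diff[OF gk_L2 gk_L2]] iB le])
    also have "\<dots> = sqn ?D + ((2 * Kg)\<^sup>2 * measure lebesgue (ball (0::'a) R) - (2 * Kg)\<^sup>2 * measure lebesgue (ball (0::'a) T))"
    proof -
      have "(LINT x|lebesgue. B x) = sqn ?D + (LINT x|lebesgue. (2 * Kg)\<^sup>2 * indicat_real (ball (0::'a) R) x - (2 * Kg)\<^sup>2 * indicat_real (ball 0 T) x)"
        unfolding B_def by (rule Bochner_Integration.integral_add[OF iD Bochner_Integration.integrable_diff]) (rule ball_indicator_integrable)+
      also have "(LINT x|lebesgue. (2 * Kg)\<^sup>2 * indicat_real (ball (0::'a) R) x - (2 * Kg)\<^sup>2 * indicat_real (ball 0 T) x)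
          = (2 * Kg)\<^sup>2 * measure lebesgue (ball (0::'a) R) - (2 * Kg)\<^sup>2 * measure lebesgue (ball (0::'a) T)"
        by (subst Bochner_Integration.integral_diff[OF ball_indicator_integrable ball_indicator_integrable]) simp
      finally show ?thesis .
    qed
    also have "\<dots> = sqn ?D + (2 * Kg)\<^sup>2 * (vol * R ^ DIM('a) - vol * T ^ DIM('a))"
      unfolding vol_def using T R_pos by (subst (1 2) lebesgue_measure_ball) (simp_all add: right_diff_distrib)
    also have "\<dots> \<le> e" using k0[OF k l] T(3) by linarith
    finally show ?thesis .
  qed
  then show ?thesis by blast
qed

text \<open>The limit of \<open>gk k i\<close> in \<open>L\<^sup>2\<close>. The bound forces it to vanish outside the ball, so that it is determined up to
  null sets on the whole space.\<close>

definition g_inf :: "'i \<Rightarrow> 'a \<Rightarrow> 'a" where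
  "g_inf i = (SOME h. h \<in> borel_measurable lebesgue \<and>
     (AE x in lebesgue. norm (h x) \<le> (real DIM('a) * L) * indicat_real (ball 0 R) x) \<and>
     (\<lambda>k. sqn (\<lambda>x. gk k i x - h x)) \<longlonglongrightarrow> 0)"

lemma g_inf:
  shows g_inf_measurable: "g_inf i \<in> borel_measurable lebesgue"
    and g_inf_bound: "AE x in lebesgue. norm (g_inf i x) \<le> (real DIM('a) * L) * indicat_real (ball 0 R) x"
    and gk_tendsto: "(\<lambda>k. sqn (\<lambda>x. gk k i x - g_inf i x)) \<longlonglongrightarrow> 0"
proof -
  obtain h where "h \<in> borel_measurable lebesgue" "AE x in lebesgue. norm (h x) \<le> (real DIM('a) * L) * indicat_real (ball 0 R) x"
    "(\<lambda>k. sqn (\<lambda>x. gk k i x - h x)) \<longlonglongrightarrow> 0"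
    by (rule L2_complete_bounded[OF gk_measurable gk_bound gk_cauchy])
  then have ex: "\<exists>h. h \<in> borel_measurable lebesgue \<and>
     (AE x in lebesgue. norm (h x) \<le> (real DIM('a) * L) * indicat_real (ball 0 R) x) \<and>
     (\<lambda>k. sqn (\<lambda>x. gk k i x - h x)) \<longlonglongrightarrow> 0" by blast
  from someI_ex[OF this] show "g_inf i \<in> borel_measurable lebesgue"
    "AE x in lebesgue. norm (g_inf i x) \<le> (real DIM('a) * L) * indicat_real (ball 0 R) x"
    "(\<lambda>k. sqn (\<lambda>x. gk k i x - g_inf i x)) \<longlonglongrightarrow> 0" unfolding g_inf_def by auto
qed

lemmas g_inf_L2 = bounded_ball_L2[OF g_inf_measurable g_inf_bound]

lemma uk_measurable: "uk k i \<in> borel_measurable lebesgue"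
proof -
  have "(\<lambda>x. indicat_real (cball 0 (real n)) x *\<^sub>R uk k i x) \<in> borel_measurable lebesgue" for n
    using uk_L2_loc[of k i] L2_indicator[of "cball (0::'a) (real n)" "uk k i"]
    by (intro L2_UNIV_measurable) (auto simp: L2_loc_def)
  then show ?thesis
  proof (rule borel_measurable_LIMSEQ_metric)
    fix x :: 'a
    obtain n0 where "norm x \<le> real n0" using real_arch_simple by blast
    then have "\<forall>\<^sub>F n in sequentially. indicat_real (cball 0 (real n)) x *\<^sub>R uk k i x = uk k i x"
      unfolding eventually_sequentially by (intro exI[of _ n0]) auto
    then show "(\<lambda>n. indicat_real (cball 0 (real n)) x *\<^sub>R uk k i x) \<longlonglongrightarrow> uk k i x" by (rule tendsto_eventually)
  qed
qed

definition vk :: "nat \<Rightarrow> 'i \<Rightarrow> 'a \<Rightarrow> real" where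
  "vk k i x = indicator (ball 0 R) x *\<^sub>R uk k i x"

definition v_inf :: "'i \<Rightarrow> 'a \<Rightarrow> real" where
  "v_inf i x = indicator (ball 0 R) x *\<^sub>R (u_inf x $ i)"

lemma vk_measurable: "vk k i \<in> borel_measurable lebesgue"
  unfolding vk_def[abs_def] by (intro borel_measurable_scaleR borel_measurable_indicator uk_measurable) auto

lemma vk_lim: "(\<lambda>k. vk k i x) \<longlonglongrightarrow> v_inf i x"
  using uk_lim[of x i] by (cases "x \<in> ball 0 R") (auto simp: vk_def v_inf_def)

lemma v_inf_measurable: "v_inf i \<in> borel_measurable lebesgue"
  by (rule borel_measurable_LIMSEQ_metric[OF vk_measurable vk_lim])

lemma vk_bound: "norm (vk k i x) \<le> (L * R) * indicat_real (ball 0 R) x"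
  using uk_bound_R[of x k i] by (cases "x \<in> ball 0 R") (auto simp: vk_def)

lemma v_inf_bound: "norm (v_inf i x) \<le> (L * R) * indicat_real (ball 0 R) x"
  by (rule LIMSEQ_le_const2[OF tendsto_norm[OF vk_lim]]) (use vk_bound in blast)

lemmas vk_L2 = bounded_ball_L2[OF vk_measurable AE_I2[OF vk_bound]]
lemmas v_inf_L2 = bounded_ball_L2[OF v_inf_measurable AE_I2[OF v_inf_bound]]

lemma vk_tendsto: "(\<lambda>k. sqn (\<lambda>x. vk k i x - v_inf i x)) \<longlonglongrightarrow> 0"
proof (rule sqn_tendsto_0_dominated[OF _ ball_indicator_L2[of "2 * (L * R)" R]])
  show "AE x in lebesgue. (\<lambda>k. vk k i x - v_inf i x) \<longlonglongrightarrow> 0" by (intro AE_I2 LIM_zero vk_lim)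
  show "AE x in lebesgue. norm (vk k i x - v_inf i x) \<le> norm (2 * (L * R) * indicat_real (ball 0 R) x)" for k
  proof (rule AE_I2)
    fix x
    show "norm (vk k i x - v_inf i x) \<le> norm (2 * (L * R) * indicat_real (ball 0 R) x)"
      using vk_bound[of k i x] v_inf_bound[of i x] norm_triangle_ineq4[of "vk k i x" "v_inf i x"]
      by (cases "x \<in> ball 0 R") auto
  qed
  show "(\<lambda>x. vk k i x - v_inf i x) \<in> borel_measurable lebesgue" for k
    by (intro borel_measurable_diff vk_measurable v_inf_measurable)
qed

text \<open>The defining identity of a weak gradient passes to \<open>L\<^sup>2\<close> limits.\<close>

lemma g_inf_gradient: "has_weak_gradient (ball 0 R) (\<lambda>x. u_inf x $ i) (g_inf i)"
  unfolding has_weak_gradient_iff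
proof (intro conjI ballI)
  show "(\<lambda>x. u_inf x $ i) \<in> L1_loc (ball 0 R)"
    by (rule L1_loc_AE_cong[OF L2_UNIV_imp_L1_loc[OF v_inf_L2[of i]]]) (auto simp: v_inf_def)
  show "g_inf i \<in> L1_loc (ball 0 R)" by (rule L2_UNIV_imp_L1_loc[OF g_inf_L2])
  fix \<phi> :: "'a \<Rightarrow> real" and b :: 'a assume \<phi>: "\<phi> \<in> C_c_inf (ball 0 R)" and b: "b \<in> Basis"
  obtain K where K: "compact K" "K \<subseteq> ball 0 R" "\<And>x. x \<notin> K \<Longrightarrow> \<phi> x = 0" using C_c_inf_support[OF \<phi>] by auto
  have out: "\<phi> x = 0" "pderivative b \<phi> x = 0" if "x \<notin> ball 0 R" for x
  proof -
    have "x \<notin> K" using that K(2) by blast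
    then show "\<phi> x = 0" "pderivative b \<phi> x = 0" using K pderivative_eq_0_outside[of K \<phi> x] by auto
  qed
  have \<phi>L: "\<phi> \<in> L2 UNIV" by (rule C_c_inf_L2[OF \<phi>])
  have dL: "pderivative b \<phi> \<in> L2 UNIV" by (rule C_c_inf_L2[OF C_c_inf_pderivative[OF \<phi> b]])
  have \<phi>bL: "(\<lambda>x. \<phi> x *\<^sub>R b) \<in> L2 UNIV"
    by (rule L2_UNIV_bound[OF \<phi>L]) (use b L2_UNIV_measurable[OF \<phi>L] in auto)
  have 1: "(\<lambda>k. LINT x|lebesgue. vk k i x \<bullet> pderivative b \<phi> x) \<longlonglongrightarrow> (LINT x|lebesgue. v_inf i x \<bullet> pderivative b \<phi> x)"
    by (rule L2_inner_tendsto[OF vk_L2 v_inf_L2 dL vk_tendsto])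
  have 2: "(\<lambda>k. LINT x|lebesgue. gk k i x \<bullet> (\<phi> x *\<^sub>R b)) \<longlonglongrightarrow> (LINT x|lebesgue. g_inf i x \<bullet> (\<phi> x *\<^sub>R b))"
    by (rule L2_inner_tendsto[OF gk_L2 g_inf_L2 \<phi>bL gk_tendsto])
  have eq: "(LINT x|lebesgue. vk k i x \<bullet> pderivative b \<phi> x) = - (LINT x|lebesgue. gk k i x \<bullet> (\<phi> x *\<^sub>R b))" for k
  proof -
    have "(LINT x|lebesgue. uk k i x * pderivative b \<phi> x) = - (LINT x|lebesgue. (Gk k i x \<bullet> b) * \<phi> x)"
      by (rule has_weak_gradientD[OF Gk_gradient _ b]) (use \<phi> C_c_inf_mono in blast)
    moreover have "vk k i x \<bullet> pderivative b \<phi> x = uk k i x * pderivative b \<phi> x"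
      "gk k i x \<bullet> (\<phi> x *\<^sub>R b) = (Gk k i x \<bullet> b) * \<phi> x" for x
      using out[of x] by (auto simp: vk_def gk_def indicator_def)
    ultimately show ?thesis by (simp only:)
  qed
  have "(LINT x|lebesgue. v_inf i x \<bullet> pderivative b \<phi> x) = - (LINT x|lebesgue. g_inf i x \<bullet> (\<phi> x *\<^sub>R b))"
    by (rule LIMSEQ_unique[OF 1]) (use tendsto_minus[OF 2] in \<open>simp only: eq\<close>)
  moreover have "v_inf i x \<bullet> pderivative b \<phi> x = (u_inf x $ i) * pderivative b \<phi> x"
    "g_inf i x \<bullet> (\<phi> x *\<^sub>R b) = (g_inf i x \<bullet> b) * \<phi> x" for x
    using out[of x] by (auto simp: v_inf_def indicator_def)
  ultimately show "(LINT x|lebesgue. (u_inf x $ i) * pderivative b \<phi> x) = - (LINT x|lebesgue. (g_inf i x \<bullet> b) * \<phi> x)" by (simp only:)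
qed

lemma u_inf_W12: "(\<lambda>x. u_inf x $ i) \<in> W12 (ball 0 R)"
  unfolding W12_def mem_Collect_eq
proof (intro conjI exI)
  have "(\<lambda>x. u_inf x $ i) \<in> L2 (ball 0 R)"
    using L2_indicator[of "ball (0::'a) R" "\<lambda>x. u_inf x $ i"] v_inf_L2[of i] by (simp add: v_inf_def[abs_def])
  then show "(\<lambda>x. u_inf x $ i) \<in> L2_loc (ball 0 R)" by (rule L2_imp_L2_loc) simp
  show "g_inf i \<in> L2 (ball 0 R)" by (rule L2_mono_set[OF g_inf_L2]) auto
qed (rule g_inf_gradient)

lemma blowup_tendsto_W12: "tendsto_W12 (ball 0 R) (\<lambda>k. uk k i) (\<lambda>x. u_inf x $ i)"
  unfolding tendsto_W12_def
proof (intro conjI allI u_inf_W12)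
  show "uk k i \<in> W12 (ball 0 R)" for k
    unfolding uk_def[abs_def] by (intro W12_subset[OF W12_scale[OF u_W12 r_pos]]) simp
  have eq: "W12_norm_sq (ball 0 R) (\<lambda>x. uk k i x - u_inf x $ i) = ennreal (sqn (\<lambda>x. vk k i x - v_inf i x) + sqn (\<lambda>x. gk k i x - g_inf i x))" for k
  proof -
    have D: "has_weak_gradient (ball 0 R) (\<lambda>x. uk k i x - u_inf x $ i) (\<lambda>x. Gk k i x - g_inf i x)"
      using has_weak_gradient_linear[OF has_weak_gradient_subset[OF Gk_gradient subset_UNIV] g_inf_gradient, where c = 1 and d = "-1"] by simp
    have e1: "indicat_real (ball 0 R) x *\<^sub>R (uk k i x - u_inf x $ i) = vk k i x - v_inf i x" for x
      by (simp add: vk_def v_inf_def right_diff_distrib)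
    have e2: "AE x in lebesgue. indicat_real (ball 0 R) x *\<^sub>R (Gk k i x - g_inf i x) = gk k i x - g_inf i x"
      using g_inf_bound[of i] by eventually_elim (auto simp: gk_def indicator_def)
    have L: "(\<lambda>x. gk k i x - g_inf i x) \<in> L2 UNIV" by (rule L2_UNIV_diff[OF gk_L2 g_inf_L2])
    have L': "(\<lambda>x. indicat_real (ball 0 R) x *\<^sub>R (Gk k i x - g_inf i x)) \<in> L2 UNIV"
      by (rule L2_UNIV_AE_cong[OF L]) (use e2 in \<open>eventually_elim, simp\<close>)
    have "sqn (\<lambda>x. indicat_real (ball 0 R) x *\<^sub>R (Gk k i x - g_inf i x)) = sqn (\<lambda>x. gk k i x - g_inf i x)"
    proof (rule integral_cong_AE)
      show "AE x in lebesgue. (norm (indicat_real (ball 0 R) x *\<^sub>R (Gk k i x - g_inf i x)))\<^sup>2 = (norm (gk k i x - g_inf i x))\<^sup>2"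
        using e2 by eventually_elim (simp only:)
    qed (rule borel_measurable_integrable[OF L2_UNIV_integrable[OF L']] borel_measurable_integrable[OF L2_UNIV_integrable[OF L]])+
    moreover have "(\<lambda>x. indicat_real (ball 0 R) x *\<^sub>R (uk k i x - u_inf x $ i)) \<in> L2 UNIV"
      unfolding e1 by (rule L2_UNIV_diff[OF vk_L2 v_inf_L2])
    ultimately show ?thesis using W12_norm_sq_eq[OF D open_ball _ L'] by (simp only: e1)
  qed
  show "(\<lambda>k. W12_norm_sq (ball 0 R) (\<lambda>x. uk k i x - u_inf x $ i)) \<longlonglongrightarrow> 0"
    unfolding eq using tendsto_ennrealI[OF tendsto_add[OF vk_tendsto[of i] gk_tendsto[of i]]] by simp
qed

end

section \<open>Passing to the limit in the comparison\<close>

lemma L2_inner_tendsto2: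
  assumes F: "\<And>k. F k \<in> L2 UNIV" "f \<in> L2 UNIV" "(\<lambda>k. sqn (\<lambda>x. F k x - f x)) \<longlonglongrightarrow> 0"
    and H: "\<And>k. H k \<in> L2 UNIV" "h \<in> L2 UNIV" "(\<lambda>k. sqn (\<lambda>x. H k x - h x)) \<longlonglongrightarrow> 0"
  shows "(\<lambda>k. LINT x|lebesgue. F k x \<bullet> H k x) \<longlonglongrightarrow> (LINT x|lebesgue. f x \<bullet> h x)"
proof -
  have dF: "(\<lambda>x. F k x - f x) \<in> L2 UNIV" and dH: "(\<lambda>x. H k x - h x) \<in> L2 UNIV" for k
    by (intro L2_UNIV_diff F H)+
  have 1: "(\<lambda>k. LINT x|lebesgue. (F k x - f x) \<bullet> (H k x - h x)) \<longlonglongrightarrow> 0"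
  proof (rule Lim_null_comparison)
    show "\<forall>\<^sub>F k in sequentially. norm (LINT x|lebesgue. (F k x - f x) \<bullet> (H k x - h x)) \<le> sqrt (sqn (\<lambda>x. F k x - f x)) * sqrt (sqn (\<lambda>x. H k x - h x))"
      using L2_cauchy_schwarz_inner[OF dF dH] by (intro always_eventually allI) simp
    show "(\<lambda>k. sqrt (sqn (\<lambda>x. F k x - f x)) * sqrt (sqn (\<lambda>x. H k x - h x))) \<longlonglongrightarrow> 0"
      using tendsto_mult[OF tendsto_real_sqrt[OF F(3)] tendsto_real_sqrt[OF H(3)]] by simp
  qed
  have 2: "(\<lambda>k. LINT x|lebesgue. F k x \<bullet> h x) \<longlonglongrightarrow> (LINT x|lebesgue. f x \<bullet> h x)"
    by (rule L2_inner_tendsto[OF F(1,2) H(2) F(3)])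
  have 3: "(\<lambda>k. LINT x|lebesgue. H k x \<bullet> f x) \<longlonglongrightarrow> (LINT x|lebesgue. h x \<bullet> f x)"
    by (rule L2_inner_tendsto[OF H(1,2) F(2) H(3)])
  have "(LINT x|lebesgue. F k x \<bullet> H k x) = (LINT x|lebesgue. (F k x - f x) \<bullet> (H k x - h x))
      + (LINT x|lebesgue. F k x \<bullet> h x) + (LINT x|lebesgue. H k x \<bullet> f x) - (LINT x|lebesgue. h x \<bullet> f x)" for k
  proof -
    note i = integrable_inner_L2
    have "(LINT x|lebesgue. F k x \<bullet> H k x) = (LINT x|lebesgue. ((F k x - f x) \<bullet> (H k x - h x) + F k x \<bullet> h x + H k x \<bullet> f x) - h x \<bullet> f x)"
      by (intro Bochner_Integration.integral_cong) (auto simp: inner_diff_left inner_diff_right inner_commute)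
    also have "\<dots> = (LINT x|lebesgue. (F k x - f x) \<bullet> (H k x - h x))
      + (LINT x|lebesgue. F k x \<bullet> h x) + (LINT x|lebesgue. H k x \<bullet> f x) - (LINT x|lebesgue. h x \<bullet> f x)"
      using i[OF dF dH] i[OF F(1) H(2)] i[OF H(1) F(2)] i[OF H(2) F(2)]
      by (simp add: Bochner_Integration.integral_diff Bochner_Integration.integral_add Bochner_Integration.integrable_add)
    finally show ?thesis .
  qed
  then show ?thesis using tendsto_diff[OF tendsto_add[OF tendsto_add[OF 1 2] 3] tendsto_const[of "LINT x|lebesgue. h x \<bullet> f x"]] by simp
qed

lemma sqn_tendsto:
  assumes F: "\<And>k. F k \<in> L2 UNIV" "f \<in> L2 UNIV" "(\<lambda>k. sqn (\<lambda>x. F k x - f x)) \<longlonglongrightarrow> 0"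
  shows "(\<lambda>k. sqn (F k)) \<longlonglongrightarrow> sqn f"
  using L2_inner_tendsto2[OF F F] by (simp add: power2_norm_eq_inner)

lemma sqn_tendsto_0_bound:
  assumes f: "\<And>k. f k \<in> L2 UNIV" "(\<lambda>k. sqn (f k)) \<longlonglongrightarrow> 0" and h: "\<And>k. h k \<in> L2 UNIV" "(\<lambda>k. sqn (h k)) \<longlonglongrightarrow> 0"
    and le: "\<And>k x. norm (F k x) \<le> A * norm (f k x) + B * norm (h k x)"
  shows "(\<lambda>k. sqn (F k)) \<longlonglongrightarrow> 0"
proof (rule Lim_null_comparison)
  show "(\<lambda>k. 2 * A\<^sup>2 * sqn (f k) + 2 * B\<^sup>2 * sqn (h k)) \<longlonglongrightarrow> 0"
    using tendsto_add[OF tendsto_mult_right_zero[OF f(2), of "2 * A\<^sup>2"] tendsto_mult_right_zero[OF h(2), of "2 * B\<^sup>2"]] by simp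
  show "\<forall>\<^sub>F k in sequentially. norm (sqn (F k)) \<le> 2 * A\<^sup>2 * sqn (f k) + 2 * B\<^sup>2 * sqn (h k)"
  proof (intro always_eventually allI)
    fix k
    have "sqn (F k) \<le> (LINT x|lebesgue. 2 * A\<^sup>2 * (norm (f k x))\<^sup>2 + 2 * B\<^sup>2 * (norm (h k x))\<^sup>2)"
    proof (rule integral_mono_AE')
      show "integrable lebesgue (\<lambda>x. 2 * A\<^sup>2 * (norm (f k x))\<^sup>2 + 2 * B\<^sup>2 * (norm (h k x))\<^sup>2)"
        by (intro Bochner_Integration.integrable_add integrable_mult_right L2_UNIV_integrable f h)
      have "(norm (F k x))\<^sup>2 \<le> 2 * A\<^sup>2 * (norm (f k x))\<^sup>2 + 2 * B\<^sup>2 * (norm (h k x))\<^sup>2" for x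
      proof -
        have "(norm (F k x))\<^sup>2 \<le> (A * norm (f k x) + B * norm (h k x))\<^sup>2" using le[of k x] by (intro power_mono) auto
        also have "\<dots> = (A * norm (f k x))\<^sup>2 + (B * norm (h k x))\<^sup>2 + 2 * (A * norm (f k x)) * (B * norm (h k x))"
          by (rule power2_sum)
        also have "\<dots> \<le> 2 * (A * norm (f k x))\<^sup>2 + 2 * (B * norm (h k x))\<^sup>2"
          using sum_squares_bound[of "A * norm (f k x)" "B * norm (h k x)"] by simp
        finally show ?thesis by (simp add: power_mult_distrib)
      qed
      then show "AE x in lebesgue. (norm (F k x))\<^sup>2 \<le> 2 * A\<^sup>2 * (norm (f k x))\<^sup>2 + 2 * B\<^sup>2 * (norm (h k x))\<^sup>2" by auto
    qed auto
    also have "\<dots> = 2 * A\<^sup>2 * sqn (f k) + 2 * B\<^sup>2 * sqn (h k)"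
      using L2_UNIV_integrable[OF f(1)[of k]] L2_UNIV_integrable[OF h(1)[of k]] by simp
    finally show "norm (sqn (F k)) \<le> 2 * A\<^sup>2 * sqn (f k) + 2 * B\<^sup>2 * sqn (h k)" by simp
  qed
qed

lemma borel_imp_lebesgue: "S \<in> sets borel \<Longrightarrow> S \<in> sets lebesgue"
  using sets_completionI_sets[of S lborel] by simp

lemma integrable_indicator_ball:
  assumes "S \<in> sets lebesgue" "S \<subseteq> ball (0::'a::euclidean_space) R"
  shows "integrable lebesgue (indicat_real S)"
  by (rule bounded_ball_integrable[OF _ AE_I2, where C = 1 and R = R])
    (use assms in \<open>auto intro!: borel_measurable_indicator simp: indicator_def\<close>)

lemma measure_split:
  fixes S :: "'a::euclidean_space set"
  assumes "S \<in> sets lebesgue" "A \<in> sets lebesgue" "bounded S"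
  shows "measure lebesgue S = measure lebesgue (S \<inter> A) + measure lebesgue (S - A)"
proof -
  have "S \<in> lmeasurable" using assms by (intro bounded_set_imp_lmeasurable)
  then have "S \<inter> A \<in> lmeasurable" "S - A \<in> lmeasurable" using assms by (auto intro: fmeasurable_Int_fmeasurable fmeasurable_Diff)
  moreover have "S \<inter> A \<inter> (S - A) = {}" by blast
  ultimately have "measure lebesgue ((S \<inter> A) \<union> (S - A)) = measure lebesgue (S \<inter> A) + measure lebesgue (S - A)"
    using measure_Un3[of "S \<inter> A" lebesgue "S - A"] by (simp only: measure_empty)
  then show ?thesis by (simp add: Int_Diff_Un)
qed

lemma sum_indicator_disjoint:
  fixes D :: "'i::finite \<Rightarrow> 'a set" and lam :: "'i \<Rightarrow> real"
  assumes "disjoint_family D" "x \<in> D i"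
  shows "(\<Sum>j\<in>UNIV. lam j * indicator (D j) x) = lam i"
proof -
  have "(\<Sum>j\<in>UNIV. lam j * indicator (D j) x) = lam i * indicator (D i) x"
    by (rule sum.mono_neutral_cong_right[of UNIV "{i}", simplified])
      (use assms in \<open>auto simp: disjoint_family_on_def indicator_def\<close>)
  then show ?thesis using assms by simp
qed

lemma sum_indicator_cases:
  fixes D :: "'i::finite \<Rightarrow> 'a set" and lam :: "'i \<Rightarrow> real"
  assumes "disjoint_family D"
  obtains i where "x \<in> D i" "(\<Sum>j\<in>UNIV. lam j * indicator (D j) x) = lam i"
  | "\<And>i. x \<notin> D i" "(\<Sum>j\<in>UNIV. lam j * indicator (D j) x) = 0"
  using sum_indicator_disjoint[OF assms, of x] by (cases "\<exists>i. x \<in> D i") auto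

locale blowup_limit_domain = blowup_limit \<Omega> f g F u W r R s0 M0 L lam \<epsilon> u_inf
  for \<Omega> :: "'a::euclidean_space set"
    and f g :: "'i::finite \<Rightarrow> 'a \<Rightarrow> real"
    and F :: "('i \<Rightarrow> 'a set) \<Rightarrow> real"
    and u :: "'a \<Rightarrow> real^'i"
    and W :: "'i \<Rightarrow> 'a set"
    and r :: "nat \<Rightarrow> real"
    and R s0 M0 L :: real
    and lam :: "'i \<Rightarrow> real"
    and \<epsilon> :: "real \<Rightarrow> real"
    and u_inf :: "'a \<Rightarrow> real^'i" +
  fixes \<Omega>_inf :: "'a set"
  assumes \<Omega>_borel: "\<Omega> \<in> sets borel"
    and \<Omega>_inf: "\<Omega>_inf \<in> sets lebesgue" "\<Omega>_inf \<subseteq> ball 0 R"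
    and \<Omega>_inf_lim: "(\<lambda>k. LINT x:ball 0 R|lebesgue.
        \<bar>indicator (ball 0 R \<inter> blowup_set (r k) \<Omega>) x - indicator \<Omega>_inf x :: real\<bar>) \<longlonglongrightarrow> 0"
    and \<Omega>_inf_density: "\<And>T. 0 < T \<Longrightarrow> T < R \<Longrightarrow>
        \<exists>r\<^sub>T>0. \<exists>c\<^sub>T>0. \<forall>x \<in> ball 0 T \<inter> frontier \<Omega>_inf. \<forall>s. 0 < s \<and> s \<le> r\<^sub>T \<longrightarrow>
          measure lebesgue (ball x s - \<Omega>_inf) \<ge> c\<^sub>T * s ^ DIM('a)"
    and \<Omega>_inf_dist: "\<And>T. 0 < T \<Longrightarrow> T < R \<Longrightarrow>
        (\<lambda>k. excess_dist R \<Omega>_inf (blowup_set (r k) \<Omega>) T) \<longlonglongrightarrow> 0"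
begin

lemma \<Omega>k_borel: "\<Omega>k k \<in> sets borel"
  unfolding \<Omega>k_def blowup_set_def by (rule borel_scale_image) (use \<Omega>_borel r_pos[of k] in auto)

definition dom_diff :: "nat \<Rightarrow> 'a \<Rightarrow> real" where
  "dom_diff k x = \<bar>indicator (ball 0 R \<inter> \<Omega>k k) x - indicator \<Omega>_inf x\<bar>"

lemma dom_diff_integrable: "integrable lebesgue (dom_diff k)"
  unfolding dom_diff_def[abs_def]
  by (intro integrable_abs Bochner_Integration.integrable_diff integrable_indicator_ball[of _ R] \<Omega>_inf sets.Int borel_imp_lebesgue \<Omega>k_borel) auto

lemma dom_diff_tendsto: "(\<lambda>k. LINT x|lebesgue. dom_diff k x) \<longlonglongrightarrow> 0"
proof -
  have "indicat_real (ball 0 R) x *\<^sub>R \<bar>indicat_real (ball 0 R \<inter> \<Omega>k k) x - indicat_real \<Omega>_inf x\<bar> = dom_diff k x" for k x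
    using \<Omega>_inf(2) by (auto simp: dom_diff_def indicator_def)
  then show ?thesis using \<Omega>_inf_lim unfolding set_lebesgue_integral_def \<Omega>k_def[symmetric] by simp
qed

lemma v_inf_eq: "x \<in> ball 0 R \<Longrightarrow> v_inf i x = u_inf x $ i"
  by (simp add: v_inf_def)

text \<open>Along a subsequence the indicator functions of \<open>\<Omega>\<^sub>k\<close> converge almost everywhere, so that a point outside
  \<open>\<Omega>_inf\<close> is eventually outside \<open>\<Omega>\<^sub>k\<close>, where \<open>u\<^sub>k\<close> vanishes.\<close>

lemma v_inf_zero: "AE x in lebesgue. x \<notin> \<Omega>_inf \<longrightarrow> v_inf i x = 0"
proof -
  obtain q where q: "strict_mono q" "AE x in lebesgue. (\<lambda>n. dom_diff (q n) x) \<longlonglongrightarrow> 0"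
    using tendsto_L1_AE_subseq[of lebesgue dom_diff, OF dom_diff_integrable] dom_diff_tendsto by (auto simp: dom_diff_def[abs_def])
  have "AE x in lebesgue. \<forall>k. x \<notin> Wk k i \<longrightarrow> uk k i x = 0" unfolding AE_all_countable using uk_zero by auto
  with q(2) show ?thesis
  proof eventually_elim
    case (elim x)
    show ?case
    proof (cases "x \<in> ball 0 R - \<Omega>_inf")
      case True
      have "\<forall>\<^sub>F n in sequentially. vk (q n) i x = 0"
        using order_tendstoD(2)[OF elim(1), of 1, simplified]
      proof eventually_elim
        case (elim n)
        then have "x \<notin> \<Omega>k (q n)" using True by (auto simp: dom_diff_def indicator_def split: if_splits)
        then show ?case using Wk_props(2)[of "q n" i] \<open>\<forall>k. x \<notin> Wk k i \<longrightarrow> uk k i x = 0\<close> by (auto simp: vk_def)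
      qed
      then have "(\<lambda>n. vk (q n) i x) \<longlonglongrightarrow> 0" by (rule tendsto_eventually)
      then show ?thesis using LIMSEQ_unique LIMSEQ_subseq_LIMSEQ[OF vk_lim q(1), of i x] by (auto simp: comp_def)
    qed (auto simp: v_inf_def)
  qed
qed

lemma v_inf_disjoint: "AE x in lebesgue. \<forall>i j. i \<noteq> j \<longrightarrow> v_inf i x = 0 \<or> v_inf j x = 0"
proof -
  have "AE x in lebesgue. \<forall>k. \<forall>i. x \<notin> Wk k i \<longrightarrow> uk k i x = 0"
    unfolding AE_all_countable using uk_zero by auto
  then show ?thesis
  proof eventually_elim
    case (elim x)
    have "v_inf i x = 0 \<or> v_inf j x = 0" if "i \<noteq> j" for i j
    proof -
      have "vk k i x * vk k j x = 0" for k
      proof -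
        have "x \<notin> Wk k i \<or> x \<notin> Wk k j" using disjoint_family_onD[OF Wk_props(3), of i j k] that by blast
        then show ?thesis using elim by (auto simp: vk_def)
      qed
      moreover have "(\<lambda>k. vk k i x * vk k j x) \<longlonglongrightarrow> v_inf i x * v_inf j x" by (intro tendsto_mult vk_lim)
      ultimately have "v_inf i x * v_inf j x = 0" by (simp only: LIMSEQ_const_iff)
      then show ?thesis by simp
    qed
    then show ?case by blast
  qed
qed

definition i0 :: 'i where
  "i0 = (SOME i. \<forall>j. lam i \<le> lam j)"

lemma i0: "lam i0 \<le> lam j"
proof -
  have "lam (arg_min_on lam UNIV) \<le> lam j" for j by (rule arg_min_least) auto
  then have "\<exists>i. \<forall>j. lam i \<le> lam j" by blast
  from someI_ex[OF this] show ?thesis unfolding i0_def by blast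
qed

text \<open>The sets \<open>W\<^sub>k\<^sub>,\<^sub>i\<close> need not converge on the zero set of \<open>u_inf\<close>. There the best choice is made: this part of
  \<open>\<Omega>_inf\<close> is given to an index with the smallest coefficient if this coefficient is negative, and to no index otherwise.
  The points where two components of \<open>u_inf\<close> do not vanish form a null set and are left out.\<close>

definition W_inf :: "'i \<Rightarrow> 'a set" where
  "W_inf i = {x \<in> \<Omega>_inf. v_inf i x \<noteq> 0 \<and> (\<forall>j. j \<noteq> i \<longrightarrow> v_inf j x = 0)}
     \<union> (if i = i0 \<and> lam i < 0 then {x \<in> \<Omega>_inf. \<forall>j. v_inf j x = 0} else {})"

lemma W_inf_subset: "W_inf i \<subseteq> \<Omega>_inf"
  by (auto simp: W_inf_def split: if_splits)

lemma W_inf_measurable: "W_inf i \<in> sets lebesgue"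
proof -
  have Z: "{x. v_inf j x = 0} \<in> sets lebesgue" for j
    using measurable_sets[OF v_inf_measurable[of j], of "{0}"] by (simp add: vimage_def)
  have "W_inf i = \<Omega>_inf \<inter> (- {x. v_inf i x = 0} \<inter> (\<Inter>j\<in>UNIV. if j = i then UNIV else {x. v_inf j x = 0}))
      \<union> (if i = i0 \<and> lam i < 0 then \<Omega>_inf \<inter> (\<Inter>j\<in>UNIV. {x. v_inf j x = 0}) else {})"
    by (auto simp: W_inf_def)
  also have "\<dots> \<in> sets lebesgue"
    using Z \<Omega>_inf(1) by (auto intro!: sets.Un sets.Int sets.finite_INT simp: Compl_eq_Diff_UNIV)
  finally show ?thesis .
qed

lemma W_inf_disjoint: "disjoint_family W_inf"
  by (auto simp: disjoint_family_on_def W_inf_def split: if_splits)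

lemma u_inf_F_class: "(u_inf, W_inf) \<in> F_class_ball R \<Omega>_inf"
  unfolding F_class_ball_def mem_Collect_eq prod.case
proof (intro conjI allI W_inf_measurable W_inf_subset W_inf_disjoint)
  fix i
  show "(\<lambda>x. u_inf x $ i) \<in> W12_loc (ball 0 R)"
    using u_inf_W12[of i] L2_imp_L2_loc[of _ "ball (0::'a) R"] by (auto simp: W12_def W12_loc_def)
  show "AE x in lebesgue. x \<in> ball 0 R - W_inf i \<longrightarrow> u_inf x $ i = 0"
    using v_inf_zero[of i] v_inf_disjoint
  proof eventually_elim
    case (elim x)
    then have "v_inf i x = 0 \<or> x \<in> W_inf i" unfolding W_inf_def by blast
    then show ?case using v_inf_eq[of x i] by auto
  qed
qed

text \<open>A point where \<open>u_inf\<close> has a nonzero component \<open>i\<close> belongs to \<open>W\<^sub>k\<^sub>,\<^sub>i\<close> for large \<open>k\<close>. At the other points of \<open>\<Omega>_inf\<close>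
  the density of the volume term of \<open>W_inf\<close> is the smallest possible one. The measure of \<open>\<Omega>\<^sub>k - \<Omega>_inf\<close> tends to \<open>0\<close>.\<close>

lemma volume_term_lower_semicontinuous:
  assumes s: "s \<le> R"
  obtains z where "z \<longlonglongrightarrow> 0" "\<And>k. (\<Sum>i\<in>UNIV. lam i * measure lebesgue (W_inf i \<inter> ball 0 s))
      \<le> (\<Sum>i\<in>UNIV. lam i * measure lebesgue (Wk k i \<inter> ball 0 s)) + z k"
proof -
  define \<Lambda> where "\<Lambda> = (\<Sum>i\<in>UNIV. \<bar>lam i\<bar>)"
  have \<Lambda>0: "\<Lambda> \<ge> 0" by (simp add: \<Lambda>_def sum_nonneg)
  have \<Lambda>: "\<bar>lam i\<bar> \<le> \<Lambda>" for i unfolding \<Lambda>_def by (rule member_le_sum) auto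
  define b where "b = (\<lambda>k x. if \<exists>i. v_inf i x \<noteq> 0 \<and> vk k i x = 0 then 1 else 0 :: real)"
  have bb: "\<bar>b k x\<bar> \<le> 1 * indicat_real (ball 0 R) x" for k x
    by (cases "x \<in> ball 0 R") (auto simp: b_def v_inf_def)
  have bm: "b k \<in> borel_measurable lebesgue" for k
    unfolding b_def using vk_measurable v_inf_measurable by measurable
  have bi: "integrable lebesgue (b k)" for k
    by (rule bounded_ball_integrable[OF bm AE_I2, where C = 1 and R = R]) (use bb in simp)
  have blim: "(\<lambda>k. LINT x|lebesgue. b k x) \<longlonglongrightarrow> (LINT x|(lebesgue :: 'a measure). 0)"
  proof (rule integral_dominated_convergence[OF _ bm ball_indicator_integrable[of 1 R]])
    show "AE x in lebesgue. (\<lambda>k. b k x) \<longlonglongrightarrow> 0"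
    proof (rule AE_I2)
      fix x
      have "\<forall>\<^sub>F k in sequentially. \<forall>i\<in>UNIV. v_inf i x \<noteq> 0 \<longrightarrow> vk k i x \<noteq> 0"
      proof (rule eventually_ball_finite, simp, intro ballI)
        fix i
        show "\<forall>\<^sub>F k in sequentially. v_inf i x \<noteq> 0 \<longrightarrow> vk k i x \<noteq> 0"
          using tendsto_imp_eventually_ne[OF vk_lim, of i x 0] by (cases "v_inf i x = 0") auto
      qed
      then have "\<forall>\<^sub>F k in sequentially. b k x = 0" by eventually_elim (auto simp: b_def)
      then show "(\<lambda>k. b k x) \<longlonglongrightarrow> 0" by (rule tendsto_eventually)
    qed
  qed (use bb in auto)
  define z where "z = (\<lambda>k. \<Lambda> * (LINT x|lebesgue. dom_diff k x) + 2 * \<Lambda> * (LINT x|lebesgue. b k x))"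
  have z: "z \<longlonglongrightarrow> 0"
    using tendsto_add[OF tendsto_mult_right_zero[OF dom_diff_tendsto, of \<Lambda>] tendsto_mult_right_zero[of _ _ "2 * \<Lambda>", OF blim[simplified]]]
    by (simp add: z_def)
  have vol: "integrable lebesgue (\<lambda>x. \<Sum>i\<in>UNIV. lam i * indicator (D i \<inter> ball 0 s) x)"
    "(LINT x|lebesgue. (\<Sum>i\<in>UNIV. lam i * indicator (D i \<inter> ball 0 s) x)) = (\<Sum>i\<in>UNIV. lam i * measure lebesgue (D i \<inter> ball 0 s))"
    if "\<And>i. D i \<in> sets lebesgue" for D :: "'i \<Rightarrow> 'a set"
  proof -
    have i: "integrable lebesgue (indicat_real (D i \<inter> ball 0 s))" for i
      by (rule integrable_indicator_ball[of _ R]) (use that s in auto)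
    show "integrable lebesgue (\<lambda>x. \<Sum>i\<in>UNIV. lam i * indicator (D i \<inter> ball 0 s) x)"
      by (intro Bochner_Integration.integrable_sum integrable_mult_right i)
    have "(LINT x|lebesgue. (\<Sum>i\<in>UNIV. lam i * indicator (D i \<inter> ball 0 s) x)) = (\<Sum>i\<in>UNIV. LINT x|lebesgue. lam i * indicator (D i \<inter> ball 0 s) x)"
      by (intro Bochner_Integration.integral_sum integrable_mult_right i)
    then show "(LINT x|lebesgue. (\<Sum>i\<in>UNIV. lam i * indicator (D i \<inter> ball 0 s) x)) = (\<Sum>i\<in>UNIV. lam i * measure lebesgue (D i \<inter> ball 0 s))"
      by simp
  qed
  have "(\<Sum>i\<in>UNIV. lam i * measure lebesgue (W_inf i \<inter> ball 0 s)) \<le> (\<Sum>i\<in>UNIV. lam i * measure lebesgue (Wk k i \<inter> ball 0 s)) + z k" for k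
  proof -
    let ?\<Phi> = "\<lambda>x. \<Sum>i\<in>UNIV. lam i * indicat_real (W_inf i \<inter> ball 0 s) x"
    let ?\<Phi>k = "\<lambda>x. \<Sum>i\<in>UNIV. lam i * indicat_real (Wk k i \<inter> ball 0 s) x"
    note vW = vol[of W_inf, OF W_inf_measurable] and vWk = vol[of "Wk k", OF borel_imp_lebesgue[OF Wk_props(1)]]
    have dW: "disjoint_family (\<lambda>i. W_inf i \<inter> ball 0 s)" using W_inf_disjoint by (auto simp: disjoint_family_on_def)
    have dWk: "disjoint_family (\<lambda>i. Wk k i \<inter> ball 0 s)" using Wk_props(3)[of k] by (fastforce simp: disjoint_family_on_def)
    have r: "integrable lebesgue (\<lambda>x. (?\<Phi>k x + \<Lambda> * dom_diff k x) + 2 * \<Lambda> * b k x)"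
      by (intro Bochner_Integration.integrable_add integrable_mult_right vWk(1) dom_diff_integrable bi)
    have "(LINT x|lebesgue. ?\<Phi> x) \<le> (LINT x|lebesgue. (?\<Phi>k x + \<Lambda> * dom_diff k x) + 2 * \<Lambda> * b k x)"
    proof (rule integral_mono_AE[OF vW(1) r])
      have "AE x in lebesgue. \<forall>i. x \<notin> \<Omega>_inf \<longrightarrow> v_inf i x = 0" "AE x in lebesgue. \<forall>i. x \<notin> Wk k i \<longrightarrow> uk k i x = 0"
        unfolding AE_all_countable using v_inf_zero uk_zero by auto
      then show "AE x in lebesgue. ?\<Phi> x \<le> (?\<Phi>k x + \<Lambda> * dom_diff k x) + 2 * \<Lambda> * b k x"
        using v_inf_disjoint
      proof eventually_elim
        case (elim x)
        have dd: "dom_diff k x \<ge> 0" "b k x \<ge> 0" by (auto simp: dom_diff_def b_def)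
        have nn: "\<Lambda> * dom_diff k x \<ge> 0" "2 * \<Lambda> * b k x \<ge> 0" using dd \<Lambda>0 by auto
        show ?case
        proof (cases "x \<in> ball 0 s")
          case False
          then show ?thesis using nn by simp
        next
          case xs: True
          then have xR: "x \<in> ball 0 R" using s by auto
          show ?thesis
          proof (cases "\<exists>i. v_inf i x \<noteq> 0")
            case True
            then obtain i where i: "v_inf i x \<noteq> 0" by blast
            show ?thesis
            proof (cases "vk k i x = 0")
              case True
              then have "b k x = 1" using i by (auto simp: b_def)
              moreover have "?\<Phi> x \<le> \<Lambda>"
                by (rule sum_indicator_cases[OF dW, of x lam]) (use \<Lambda> \<Lambda>0 in \<open>auto simp: abs_le_iff\<close>)
              moreover have "- \<Lambda> \<le> ?\<Phi>k x"
                by (rule sum_indicator_cases[OF dWk, of x lam]) (use \<Lambda> \<Lambda>0 in \<open>auto simp: abs_le_iff minus_le_iff\<close>)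
              ultimately show ?thesis using nn by simp
            next
              case False
              then have "x \<in> Wk k i" using elim(2) by (auto simp: vk_def)
              then have "?\<Phi>k x = lam i" using xs by (intro sum_indicator_disjoint[OF dWk]) auto
              moreover have "x \<in> W_inf i" using elim(1,3) i by (auto simp: W_inf_def)
              then have "?\<Phi> x = lam i" using xs by (intro sum_indicator_disjoint[OF dW]) auto
              ultimately show ?thesis using nn by simp
            qed
          next
            case zero: False
            show ?thesis
            proof (cases "x \<in> \<Omega>_inf")
              case True
              have "?\<Phi> x \<le> min (lam i0) 0"
              proof (cases "lam i0 < 0")
                case neg: True
                then have "x \<in> W_inf i0" using zero True by (auto simp: W_inf_def)
                then have "?\<Phi> x = lam i0" using xs by (intro sum_indicator_disjoint[OF dW]) auto
                then show ?thesis using neg by simp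
              next
                case False
                then have "x \<notin> W_inf i" for i using zero by (auto simp: W_inf_def)
                then show ?thesis using False by simp
              qed
              also have "\<dots> \<le> ?\<Phi>k x"
                by (rule sum_indicator_cases[OF dWk, of x lam]) (use i0 in \<open>auto simp: min_le_iff_disj\<close>)
              finally show ?thesis using nn by simp
            next
              case False
              then have "x \<notin> W_inf i" for i using W_inf_subset by blast
              then have \<Phi>0: "?\<Phi> x = 0" by simp
              show ?thesis
              proof (rule sum_indicator_cases[OF dWk, of x lam])
                fix i assume xi: "x \<in> Wk k i \<inter> ball 0 s" and eq: "?\<Phi>k x = lam i"
                then have "x \<in> \<Omega>k k" using Wk_props(2) by blast
                then have "dom_diff k x = 1" using xR False by (simp add: dom_diff_def)
                then show ?thesis using \<Phi>0 eq \<Lambda>[of i] nn by (simp add: abs_le_iff)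
              qed (use \<Phi>0 nn in simp)
            qed
          qed
        qed
      qed
    qed
    also have "\<dots> = (LINT x|lebesgue. ?\<Phi>k x) + \<Lambda> * (LINT x|lebesgue. dom_diff k x) + 2 * \<Lambda> * (LINT x|lebesgue. b k x)"
      by (subst Bochner_Integration.integral_add, intro Bochner_Integration.integrable_add integrable_mult_right vWk(1) dom_diff_integrable,
          intro integrable_mult_right bi, subst Bochner_Integration.integral_add[OF vWk(1)], intro integrable_mult_right dom_diff_integrable) simp
    finally show ?thesis unfolding vW(2) vWk(2) by (simp add: z_def)
  qed
  then show ?thesis using that z by blast
qed

text \<open>The components \<open>y\<^sub>i\<close> of the competitor are glued to those of the blow-up by \<open>\<psi>\<close>. For the sets no gluing is necessary:
  outside the smaller ball the sets of the blow-up are kept, which is admissible since \<open>y\<^sub>i\<close> vanishes there at the zeros of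
  \<open>u\<^sub>k\<^sub>,\<^sub>i\<close>. All gradients converge strongly in \<open>L\<^sup>2\<close>, so the quadratic terms pass to the limit.\<close>

lemma comparison_limit:
  assumes r0: "0 < r0" "r0 < \<rho>" "\<rho> < R"
    and \<psi>: "\<psi> \<in> C_c_inf (ball 0 \<rho>)" "\<And>x. 0 \<le> \<psi> x \<and> \<psi> x \<le> 1" "\<And>x. x \<in> cball 0 r0 \<Longrightarrow> \<psi> x = 1"
      "\<And>x. x \<notin> ball 0 \<rho> \<Longrightarrow> \<psi> x = 0" "\<And>x. x \<notin> ball 0 \<rho> \<Longrightarrow> grad \<psi> x = 0"
    and y: "\<And>i. H1 (y i) (yG i)"
    and Z: "\<And>i. Z i \<in> sets borel" "disjoint_family Z"
    and y_Z: "\<And>i. AE x in lebesgue. x \<in> ball 0 r0 \<longrightarrow> x \<notin> Z i \<longrightarrow> y i x = 0"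
    and y_\<Omega>: "\<forall>\<^sub>F k in sequentially. \<forall>i. AE x in lebesgue. x \<in> ball 0 r0 \<longrightarrow> x \<notin> \<Omega>k k \<longrightarrow> y i x = 0"
    and y_uk: "\<forall>\<^sub>F k in sequentially. \<forall>i. AE x in lebesgue. x \<in> ball 0 \<rho> - ball 0 r0 \<longrightarrow> uk k i x = 0 \<longrightarrow> y i x = 0"
    and Q_def: "\<And>i x. Q i x = \<psi> x *\<^sub>R (yG i x - g_inf i x) + (y i x - v_inf i x) *\<^sub>R grad \<psi> x"
  shows "Q i \<in> L2 UNIV"
    and "0 \<le> (\<Sum>i\<in>UNIV. 2 * (LINT x|lebesgue. g_inf i x \<bullet> Q i x) + sqn (Q i))
      + (\<Sum>i\<in>UNIV. lam i * (measure lebesgue (Z i \<inter> \<Omega>_inf \<inter> ball 0 r0) - measure lebesgue (W_inf i \<inter> ball 0 r0)))"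
proof -
  define q where "q = (\<lambda>k i x. \<psi> x *\<^sub>R (yG i x - gk k i x) + (y i x - vk k i x) *\<^sub>R grad \<psi> x)"
  define h where "h = (\<lambda>k i x. \<psi> x * (y i x - vk k i x))"
  have \<psi>U: "\<psi> \<in> C_c_inf UNIV" using \<psi>(1) C_c_inf_mono by blast
  obtain C where C: "C > 0" "\<And>x. norm (grad \<psi> x) \<le> C" by (rule grad_bounded[OF \<psi>(1)]) blast
  have out: "\<psi> x = 0 \<and> grad \<psi> x = 0" if "x \<notin> ball 0 R" for x using \<psi>(4,5)[of x] that r0 by auto
  have hq: "H1 (h k i) (q k i)" for k i
  proof -
    have "h k i = (\<lambda>x. \<psi> x * (y i x - U k i x))"
      using out U_eq[of _ k i] by (fastforce simp: h_def vk_def fun_eq_iff indicator_def)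
    moreover have "q k i = (\<lambda>x. \<psi> x *\<^sub>R (yG i x - P k i x) + (y i x - U k i x) *\<^sub>R grad \<psi> x)"
    proof
      fix x show "q k i x = \<psi> x *\<^sub>R (yG i x - P k i x) + (y i x - U k i x) *\<^sub>R grad \<psi> x"
        by (cases "x \<in> ball 0 R") (simp_all add: q_def gk_def vk_def U_eq P_eq out)
    qed
    ultimately show ?thesis using H1_mult_test_UNIV[OF H1_diff[OF y[of i] U_H1[of k i]] \<psi>U] by simp
  qed
  note qL = H1_D(2)[OF hq] and hL = H1_D(1)[OF hq]
  have \<psi>m: "\<psi> \<in> borel_measurable lebesgue" "grad \<psi> \<in> borel_measurable lebesgue"
    by (rule C_c_inf_measurable[OF \<psi>(1)] grad_measurable[OF \<psi>(1)])+
  have dg: "(\<lambda>x. gk k i x - g_inf i x) \<in> L2 UNIV" and dv: "(\<lambda>x. vk k i x - v_inf i x) \<in> L2 UNIV" for k i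
    by (intro L2_UNIV_diff gk_L2 g_inf_L2 vk_L2 v_inf_L2)+
  have QL: "Q i \<in> L2 UNIV" for i
  proof -
    have 1: "(\<lambda>x. \<psi> x *\<^sub>R (yG i x - g_inf i x)) \<in> L2 UNIV"
      by (rule L2_UNIV_mult_bounded[OF L2_UNIV_diff[OF H1_D(2)[OF y] g_inf_L2] \<psi>m(1), where B = 1]) (use \<psi>(2) in auto)
    have 2: "(\<lambda>x. (y i x - v_inf i x) *\<^sub>R grad \<psi> x) \<in> L2 UNIV"
    proof (rule L2_UNIV_bound[OF L2_UNIV_scale[OF L2_UNIV_diff[OF H1_D(1)[OF y[of i]] v_inf_L2[of i]], of C]])
      show "(\<lambda>x. (y i x - v_inf i x) *\<^sub>R grad \<psi> x) \<in> borel_measurable lebesgue"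
        by (intro borel_measurable_scaleR borel_measurable_diff \<psi>m v_inf_measurable L2_UNIV_measurable[OF H1_D(1)[OF y]])
      show "AE x in lebesgue. norm ((y i x - v_inf i x) *\<^sub>R grad \<psi> x) \<le> norm (C *\<^sub>R (y i x - v_inf i x))"
        using C by (intro AE_I2) (auto simp: mult.commute[of C] abs_mult intro!: mult_left_mono)
    qed
    show ?thesis unfolding Q_def[abs_def] by (rule L2_UNIV_add[OF 1 2])
  qed
  then show "Q i \<in> L2 UNIV" .
  have qlim: "(\<lambda>k. sqn (\<lambda>x. q k i x - Q i x)) \<longlonglongrightarrow> 0" for i
  proof (rule sqn_tendsto_0_bound[OF dg gk_tendsto dv vk_tendsto])
    fix k x
    have "q k i x - Q i x = - (\<psi> x *\<^sub>R (gk k i x - g_inf i x)) - (vk k i x - v_inf i x) *\<^sub>R grad \<psi> x"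
      by (simp add: q_def Q_def algebra_simps)
    then have "norm (q k i x - Q i x) \<le> norm (\<psi> x *\<^sub>R (gk k i x - g_inf i x)) + norm ((vk k i x - v_inf i x) *\<^sub>R grad \<psi> x)"
      by (metis norm_minus_cancel norm_triangle_ineq4)
    also have "\<dots> \<le> 1 * norm (gk k i x - g_inf i x) + C * norm (vk k i x - v_inf i x)"
      using mult_right_mono[of "\<psi> x" 1 "norm (gk k i x - g_inf i x)"] mult_left_mono[OF C(2)[of x] norm_ge_zero[of "vk k i x - v_inf i x"]] \<psi>(2)[of x]
      by (simp add: mult.commute)
    finally show "norm (q k i x - Q i x) \<le> 1 * norm (gk k i x - g_inf i x) + C * norm (vk k i x - v_inf i x)" .
  qed
  have hlim: "(\<lambda>k. sqn (\<lambda>x. h k i x - \<psi> x * (y i x - v_inf i x))) \<longlonglongrightarrow> 0" for i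
  proof (rule sqn_tendsto_0_bound[OF dv vk_tendsto dv vk_tendsto])
    fix k x
    have "h k i x - \<psi> x * (y i x - v_inf i x) = - (\<psi> x * (vk k i x - v_inf i x))" by (simp add: h_def algebra_simps)
    then have "norm (h k i x - \<psi> x * (y i x - v_inf i x)) = \<psi> x * norm (vk k i x - v_inf i x)"
      using \<psi>(2)[of x] by (simp add: abs_mult)
    also have "\<dots> \<le> 1 * norm (vk k i x - v_inf i x)" using \<psi>(2)[of x] by (intro mult_right_mono) auto
    finally show "norm (h k i x - \<psi> x * (y i x - v_inf i x)) \<le> 1 * norm (vk k i x - v_inf i x) + 0 * norm (vk k i x - v_inf i x)" by simp
  qed
  have h_L2: "(\<lambda>x. \<psi> x * (y i x - v_inf i x)) \<in> L2 UNIV" for i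
    using L2_UNIV_mult_bounded[OF L2_UNIV_diff[OF H1_D(1)[OF y[of i]] v_inf_L2[of i]] \<psi>m(1), of 1] \<psi>(2) by auto
  define m where "m = measure lebesgue (ball (0::'a) \<rho>)"
  obtain z where z: "z \<longlonglongrightarrow> 0" "\<And>k. (\<Sum>i\<in>UNIV. lam i * measure lebesgue (W_inf i \<inter> ball 0 r0))
      \<le> (\<Sum>i\<in>UNIV. lam i * measure lebesgue (Wk k i \<inter> ball 0 r0)) + z k"
    by (rule volume_term_lower_semicontinuous[of r0]) (use r0 in auto)
  have Zlim: "(\<lambda>k. measure lebesgue (Z i \<inter> \<Omega>k k \<inter> ball 0 r0)) \<longlonglongrightarrow> measure lebesgue (Z i \<inter> \<Omega>_inf \<inter> ball 0 r0)" for i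
  proof (rule Lim_transform2[OF tendsto_const Lim_null_comparison[OF always_eventually dom_diff_tendsto]], intro allI)
    fix k
    have i1: "integrable lebesgue (indicat_real (Z i \<inter> \<Omega>k k \<inter> ball 0 r0))" "integrable lebesgue (indicat_real (Z i \<inter> \<Omega>_inf \<inter> ball 0 r0))"
      using borel_imp_lebesgue[OF Z(1)] borel_imp_lebesgue[OF \<Omega>k_borel] \<Omega>_inf(1) r0 by (auto intro!: integrable_indicator_ball[of _ r0])
    have "measure lebesgue (Z i \<inter> \<Omega>_inf \<inter> ball 0 r0) - measure lebesgue (Z i \<inter> \<Omega>k k \<inter> ball 0 r0)
        = (LINT x|lebesgue. indicator (Z i \<inter> \<Omega>_inf \<inter> ball 0 r0) x - indicator (Z i \<inter> \<Omega>k k \<inter> ball 0 r0) x)"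
      by (subst Bochner_Integration.integral_diff[OF i1(2,1)]) simp
    also have "norm \<dots> \<le> (LINT x|lebesgue. dom_diff k x)"
    proof (rule Bochner_Integration.integral_norm_bound_integral[OF Bochner_Integration.integrable_diff[OF i1(2,1)] dom_diff_integrable])
      fix x show "norm (indicat_real (Z i \<inter> \<Omega>_inf \<inter> ball 0 r0) x - indicator (Z i \<inter> \<Omega>k k \<inter> ball 0 r0) x) \<le> dom_diff k x"
        using r0 by (auto simp: dom_diff_def indicator_def)
    qed
    finally show "norm (measure lebesgue (Z i \<inter> \<Omega>_inf \<inter> ball 0 r0) - measure lebesgue (Z i \<inter> \<Omega>k k \<inter> ball 0 r0)) \<le> (LINT x|lebesgue. dom_diff k x)" .
  qed
  define B where "B = (\<lambda>k. (\<Sum>i\<in>UNIV. 2 * (LINT x|lebesgue. gk k i x \<bullet> q k i x) + sqn (q k i))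
      + ((\<Sum>i\<in>UNIV. lam i * measure lebesgue (Z i \<inter> \<Omega>k k \<inter> ball 0 r0))
         - (\<Sum>i\<in>UNIV. lam i * measure lebesgue (W_inf i \<inter> ball 0 r0)) + z k)
      + \<rho> ^ DIM('a) * \<epsilon> (r k * \<rho>) + r k * M0 * (\<Sum>i\<in>UNIV. (L\<^sup>2 * \<rho>\<^sup>2 + 1) * m + 3 * sqn (h k i)))"
  have Blim: "B \<longlonglongrightarrow> (\<Sum>i\<in>UNIV. 2 * (LINT x|lebesgue. g_inf i x \<bullet> Q i x) + sqn (Q i))
      + ((\<Sum>i\<in>UNIV. lam i * measure lebesgue (Z i \<inter> \<Omega>_inf \<inter> ball 0 r0))
         - (\<Sum>i\<in>UNIV. lam i * measure lebesgue (W_inf i \<inter> ball 0 r0)) + 0)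
      + \<rho> ^ DIM('a) * 0 + 0 * M0 * (\<Sum>i\<in>UNIV. (L\<^sup>2 * \<rho>\<^sup>2 + 1) * m + 3 * sqn (\<lambda>x. \<psi> x * (y i x - v_inf i x)))"
    unfolding B_def
    by (intro tendsto_intros L2_inner_tendsto2[OF gk_L2 g_inf_L2 gk_tendsto qL QL qlim] sqn_tendsto[OF qL QL qlim]
        sqn_tendsto[OF hL h_L2 hlim] Zlim z(1) \<epsilon>_scaled_lim r_lim) (use r0 in simp)
  have "0 \<le> B k" if \<Omega>: "\<forall>i. AE x in lebesgue. x \<in> ball 0 r0 \<longrightarrow> x \<notin> \<Omega>k k \<longrightarrow> y i x = 0"
    and uk: "\<forall>i. AE x in lebesgue. x \<in> ball 0 \<rho> - ball 0 r0 \<longrightarrow> uk k i x = 0 \<longrightarrow> y i x = 0" for k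
  proof -
    define X where "X = (\<lambda>i. (Z i \<inter> \<Omega>k k \<inter> ball 0 r0) \<union> (Wk k i - ball 0 r0))"
    have XB: "X i \<in> sets borel" for i unfolding X_def using Z(1)[of i] \<Omega>k_borel[of k] Wk_props(1)[of k i] by auto
    have main: "0 \<le> (\<Sum>i\<in>UNIV. LINT x|lebesgue. 2 * (Gk k i x \<bullet> q k i x) + (norm (q k i x))\<^sup>2)
      + (\<Sum>i\<in>UNIV. lam i * (measure lebesgue (X i \<inter> ball 0 \<rho>) - measure lebesgue (Wk k i \<inter> ball 0 \<rho>)))
      + \<rho> ^ DIM('a) * \<epsilon> (r k * \<rho>)
      + r k * M0 * (\<Sum>i\<in>UNIV. (L\<^sup>2 * \<rho>\<^sup>2 + 1) * measure lebesgue (ball (0::'a) \<rho>) + 3 * sqn (h k i))"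
    proof (rule scaled_minimality[OF _ _ hq _ XB])
      show "AE x in lebesgue. x \<notin> ball 0 \<rho> \<longrightarrow> h k i x = 0" for i using \<psi>(4) by (auto simp: h_def)
      show "X i \<subseteq> \<Omega>k k" for i using Wk_props(2)[of k i] by (auto simp: X_def)
      show "disjoint_family X"
        using Z(2) Wk_props(3)[of k] by (fastforce simp: disjoint_family_on_def X_def)
      show "X i - ball 0 \<rho> = Wk k i - ball 0 \<rho>" for i using r0 by (auto simp: X_def)
      fix i
      have "AE x in lebesgue. x \<in> ball 0 r0 \<longrightarrow> x \<notin> \<Omega>k k \<longrightarrow> y i x = 0"
        "AE x in lebesgue. x \<in> ball 0 \<rho> - ball 0 r0 \<longrightarrow> uk k i x = 0 \<longrightarrow> y i x = 0" using \<Omega> uk by blast+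
      then show "AE x in lebesgue. x \<notin> X i \<longrightarrow> uk k i x + h k i x = 0"
        using y_Z[of i] uk_zero[of k i]
      proof eventually_elim
        case (elim x)
        show ?case
        proof
          assume xX: "x \<notin> X i"
          show "uk k i x + h k i x = 0"
          proof (cases "x \<in> ball 0 r0")
            case True
            then have "\<psi> x = 1" "vk k i x = uk k i x" using \<psi>(3) r0 by (auto simp: vk_def)
            moreover have "y i x = 0" using True elim xX by (auto simp: X_def)
            ultimately show ?thesis by (simp add: h_def)
          next
            case False
            then have u0: "uk k i x = 0" using elim xX by (auto simp: X_def)
            show ?thesis
            proof (cases "x \<in> ball 0 \<rho>")
              case True
              then have "y i x = 0" using elim u0 False by auto
              then show ?thesis using u0 by (simp add: h_def vk_def)
            qed (simp add: h_def \<psi>(4) u0)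
          qed
        qed
      qed
    qed (use r0 in auto)
    have E: "(LINT x|lebesgue. 2 * (Gk k i x \<bullet> q k i x) + (norm (q k i x))\<^sup>2) = 2 * (LINT x|lebesgue. gk k i x \<bullet> q k i x) + sqn (q k i)" for i
    proof -
      have "Gk k i x \<bullet> q k i x = gk k i x \<bullet> q k i x" for x
        using out[of x] by (cases "x \<in> ball 0 R") (auto simp: gk_def q_def)
      then show ?thesis using integrable_inner_L2[OF gk_L2[of k i] qL[of k i]] L2_UNIV_integrable[OF qL[of k i]] by simp
    qed
    have Mm: "measure lebesgue (X i \<inter> ball 0 \<rho>) - measure lebesgue (Wk k i \<inter> ball 0 \<rho>)
        = measure lebesgue (Z i \<inter> \<Omega>k k \<inter> ball 0 r0) - measure lebesgue (Wk k i \<inter> ball 0 r0)" for i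
    proof -
      have s: "measure lebesgue (D \<inter> ball 0 \<rho>) = measure lebesgue (D \<inter> ball 0 r0) + measure lebesgue (D \<inter> ball 0 \<rho> - ball 0 r0)"
        if "D \<in> sets borel" for D :: "'a set"
      proof -
        have "D \<inter> ball 0 \<rho> \<inter> ball 0 r0 = D \<inter> ball 0 r0" using r0 by auto
        then show ?thesis using measure_split[of "D \<inter> ball 0 \<rho>" "ball 0 r0", OF sets.Int[OF borel_imp_lebesgue[OF that]]] by (simp add: bounded_Int)
      qed
      have "X i \<inter> ball 0 r0 = Z i \<inter> \<Omega>k k \<inter> ball 0 r0" "X i \<inter> ball 0 \<rho> - ball 0 r0 = Wk k i \<inter> ball 0 \<rho> - ball 0 r0"
        by (auto simp: X_def)
      then show ?thesis using s[OF XB, of i] s[OF Wk_props(1), of k i] by simp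
    qed
    have "(\<Sum>i\<in>UNIV. lam i * (measure lebesgue (X i \<inter> ball 0 \<rho>) - measure lebesgue (Wk k i \<inter> ball 0 \<rho>)))
        \<le> (\<Sum>i\<in>UNIV. lam i * measure lebesgue (Z i \<inter> \<Omega>k k \<inter> ball 0 r0))
         - (\<Sum>i\<in>UNIV. lam i * measure lebesgue (W_inf i \<inter> ball 0 r0)) + z k"
      using z(2)[of k] by (simp add: Mm right_diff_distrib sum_subtractf)
    then show ?thesis using main unfolding B_def E m_def by linarith
  qed
  then have "\<forall>\<^sub>F k in sequentially. 0 \<le> B k"
    using eventually_conj[OF y_\<Omega> y_uk] by (auto elim!: eventually_mono)
  from tendsto_lowerbound[OF Blim this]
  show "0 \<le> (\<Sum>i\<in>UNIV. 2 * (LINT x|lebesgue. g_inf i x \<bullet> Q i x) + sqn (Q i))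
      + (\<Sum>i\<in>UNIV. lam i * (measure lebesgue (Z i \<inter> \<Omega>_inf \<inter> ball 0 r0) - measure lebesgue (W_inf i \<inter> ball 0 r0)))"
    by (simp add: right_diff_distrib sum_subtractf)
qed

end

section \<open>Local minimality of the limit\<close>

lemma lebesgue_inner_borel:
  fixes A :: "'a::euclidean_space set"
  assumes "A \<in> sets lebesgue"
  obtains B where "B \<in> sets borel" "B \<subseteq> A" "AE x in lebesgue. x \<in> A \<longrightarrow> x \<in> B"
proof -
  obtain S N N' where *: "A = S \<union> N" "N \<subseteq> N'" "N' \<in> null_sets lborel" "S \<in> sets lborel"
    using assms by (rule sets_completionE)
  have "AE x in lebesgue. x \<notin> N'" using *(3) by (intro AE_not_in null_sets_completionI)
  then have "AE x in lebesgue. x \<in> A \<longrightarrow> x \<in> S" by eventually_elim (use * in auto)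
  then show ?thesis using that[of S] * by auto
qed

lemma J_inf_eq:
  fixes v :: "'a::euclidean_space \<Rightarrow> real^'i::finite"
  assumes "\<And>i. has_weak_gradient (ball 0 R) (\<lambda>x. v x $ i) (H i)" "\<And>i. (\<lambda>x. indicator (ball 0 R) x *\<^sub>R H i x) \<in> L2 UNIV"
  shows "J_inf R lam v Z = ereal ((\<Sum>i\<in>UNIV. sqn (\<lambda>x. indicator (ball 0 R) x *\<^sub>R H i x)) + (\<Sum>i\<in>UNIV. lam i * measure lebesgue (Z i)))"
proof -
  have "(\<integral>\<^sup>+x\<in>ball 0 R. ennreal ((norm (weak_gradient (ball 0 R) (\<lambda>y. v y $ i) x))\<^sup>2) \<partial>lebesgue)
      = ennreal (sqn (\<lambda>x. indicator (ball 0 R) x *\<^sub>R H i x))" for i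
    unfolding weak_gradient_energy_eq[OF assms(1) open_ball] by (rule set_nn_integral_square[OF assms(2)])
  then have "J_inf R lam v Z = enn2ereal (ennreal (\<Sum>i\<in>UNIV. sqn (\<lambda>x. indicator (ball 0 R) x *\<^sub>R H i x)))
      + ereal (\<Sum>i\<in>UNIV. lam i * measure lebesgue (Z i))"
    unfolding J_inf_def by (simp add: sum_ennreal integral_nonneg_AE)
  then show ?thesis by (simp add: enn2ereal_ennreal sum_nonneg integral_nonneg_AE)
qed

lemma sqn_disjoint_sum:
  fixes H :: "'a::euclidean_space \<Rightarrow> 'b::euclidean_space"
  assumes "(\<lambda>x. indicat_real A x *\<^sub>R H x) \<in> L2 UNIV" "(\<lambda>x. indicat_real B x *\<^sub>R H x) \<in> L2 UNIV" "A \<inter> B = {}"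
  shows "(\<lambda>x. indicat_real (A \<union> B) x *\<^sub>R H x) \<in> L2 UNIV"
    and "sqn (\<lambda>x. indicat_real (A \<union> B) x *\<^sub>R H x) = sqn (\<lambda>x. indicat_real A x *\<^sub>R H x) + sqn (\<lambda>x. indicat_real B x *\<^sub>R H x)"
proof -
  have "indicat_real (A \<union> B) x *\<^sub>R H x = indicat_real A x *\<^sub>R H x + indicat_real B x *\<^sub>R H x" for x
    using assms(3) by (auto simp: indicator_def)
  then show "(\<lambda>x. indicat_real (A \<union> B) x *\<^sub>R H x) \<in> L2 UNIV" using L2_UNIV_add[OF assms(1,2)] by simp
  have "(norm (indicat_real (A \<union> B) x *\<^sub>R H x))\<^sup>2 = (norm (indicat_real A x *\<^sub>R H x))\<^sup>2 + (norm (indicat_real B x *\<^sub>R H x))\<^sup>2" for x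
    using assms(3) by (auto simp: indicator_def)
  then show "sqn (\<lambda>x. indicat_real (A \<union> B) x *\<^sub>R H x) = sqn (\<lambda>x. indicat_real A x *\<^sub>R H x) + sqn (\<lambda>x. indicat_real B x *\<^sub>R H x)"
    using Bochner_Integration.integral_add[OF L2_UNIV_integrable[OF assms(1)] L2_UNIV_integrable[OF assms(2)]] by simp
qed

context blowup_limit_domain
begin

text \<open>The density hypothesis is about boundary points of \<open>\<Omega>_inf\<close>; a segment from a point of \<open>\<Omega>_inf\<close> to a point of
  the complement meets the boundary.\<close>

lemma complement_density:
  assumes T: "0 < T" "T < R"
  obtains c \<delta>0 where "c > 0" "\<delta>0 > 0"
    "\<And>\<delta> x. 0 < \<delta> \<Longrightarrow> \<delta> \<le> \<delta>0 \<Longrightarrow> x \<in> \<Omega>_inf \<Longrightarrow> \<exists>a\<in>ball 0 T - \<Omega>_inf. dist x a < \<delta> \<Longrightarrow>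
      c * \<delta> ^ DIM('a) \<le> measure lebesgue (ball x (2 * \<delta>) - \<Omega>_inf)"
proof -
  define T' where "T' = (T + R) / 2"
  have T': "T < T'" "T' < R" using T by (auto simp: T'_def)
  obtain r1 c where rc: "r1 > 0" "c > 0"
    "\<And>x s. x \<in> ball 0 T' \<inter> frontier \<Omega>_inf \<Longrightarrow> 0 < s \<Longrightarrow> s \<le> r1 \<Longrightarrow> c * s ^ DIM('a) \<le> measure lebesgue (ball x s - \<Omega>_inf)"
    using \<Omega>_inf_density[of T'] T T' by (metis order_less_trans)
  show ?thesis
  proof (rule that[OF rc(2)])
    show "min r1 (T' - T) > 0" using rc T' by simp
    fix \<delta> x assume \<delta>: "0 < \<delta>" "\<delta> \<le> min r1 (T' - T)" and x: "x \<in> \<Omega>_inf" and ex: "\<exists>a\<in>ball 0 T - \<Omega>_inf. dist x a < \<delta>"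
    then obtain a where a: "a \<in> ball 0 T" "a \<notin> \<Omega>_inf" "dist x a < \<delta>" by blast
    have "closed_segment x a \<inter> \<Omega>_inf \<noteq> {}" "closed_segment x a - \<Omega>_inf \<noteq> {}" using x a by auto
    then obtain z where z: "z \<in> closed_segment x a" "z \<in> frontier \<Omega>_inf"
      using connected_Int_frontier[OF connected_segment(1)[of x a]] by blast
    have dz: "dist z x < \<delta>" "dist z a < \<delta>" using dist_in_closed_segment[OF z(1)] a(3) by auto
    have "norm z \<le> norm a + dist z a" by (metis add.commute dist_norm norm_triangle_sub)
    then have "z \<in> ball 0 T' \<inter> frontier \<Omega>_inf" using a(1) dz \<delta> z(2) by auto
    then have "c * \<delta> ^ DIM('a) \<le> measure lebesgue (ball z \<delta> - \<Omega>_inf)" using rc(3) \<delta> by auto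
    also have "\<dots> \<le> measure lebesgue (ball x (2 * \<delta>) - \<Omega>_inf)"
    proof (rule measure_mono_fmeasurable)
      show "ball z \<delta> - \<Omega>_inf \<subseteq> ball x (2 * \<delta>) - \<Omega>_inf"
      proof
        fix w assume w: "w \<in> ball z \<delta> - \<Omega>_inf"
        have "dist x w \<le> dist z x + dist z w" by (metis dist_commute dist_triangle)
        then show "w \<in> ball x (2 * \<delta>) - \<Omega>_inf" using w dz by auto
      qed
      show "ball x (2 * \<delta>) - \<Omega>_inf \<in> lmeasurable" by (intro fmeasurable_Diff lmeasurable_ball \<Omega>_inf(1))
    qed (use \<Omega>_inf(1) in auto)
    finally show "c * \<delta> ^ DIM('a) \<le> measure lebesgue (ball x (2 * \<delta>) - \<Omega>_inf)" .
  qed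
qed

lemma near_complement:
  assumes T: "0 < T" "T < R" and d: "d > 0"
  shows "\<forall>\<^sub>F k in sequentially. \<forall>x\<in>ball 0 T - \<Omega>k k. \<exists>a\<in>ball 0 R - \<Omega>_inf. dist x a < d"
proof -
  have "\<forall>\<^sub>F k in sequentially. excess_dist R \<Omega>_inf (\<Omega>k k) T < ennreal d"
    using order_tendstoD(2)[OF \<Omega>_inf_dist[OF T], of "ennreal d"] d by (simp add: \<Omega>k_def)
  then show ?thesis
  proof (eventually_elim, intro ballI)
    fix k x assume k: "excess_dist R \<Omega>_inf (\<Omega>k k) T < ennreal d" and x: "x \<in> ball 0 T - \<Omega>k k"
    have "(INF y\<in>ball 0 R - \<Omega>_inf. ennreal (dist x y)) \<le> excess_dist R \<Omega>_inf (\<Omega>k k) T"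
      unfolding excess_dist_def by (rule SUP_upper[OF x])
    then have "(INF y\<in>ball 0 R - \<Omega>_inf. ennreal (dist x y)) < ennreal d" using k by (rule order.strict_trans1)
    then obtain a where "a \<in> ball 0 R - \<Omega>_inf" "ennreal (dist x a) < ennreal d" unfolding INF_less_iff by blast
    then show "\<exists>a\<in>ball 0 R - \<Omega>_inf. dist x a < d" using d by (auto simp: ennreal_less_iff)
  qed
qed

text \<open>A competitor \<open>v\<close> of the limit problem need not vanish outside \<open>\<Omega>\<^sub>k\<close>, nor at the zeros of \<open>u\<^sub>k\<close> in the annulus
  where it agrees with \<open>u_inf\<close>. Both are repaired at a small cost in energy: the cut-off near the complement of \<open>\<Omega>_inf\<close> takes care
  of the first, because the points outside \<open>\<Omega>\<^sub>k\<close> are close to this complement, and the soft threshold of the second, because \<open>u\<^sub>k\<close>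
  is uniformly close to \<open>u_inf\<close>.\<close>

lemma approximate_energy_comparison:
  assumes r0: "0 < r0" "r0 < \<rho>" "\<rho> < R"
    and vZ: "(v, Z) \<in> F_class_ball R \<Omega>_inf"
    and eq: "AE x in lebesgue. x \<in> ball 0 R - ball 0 r0 \<longrightarrow> v x = u_inf x"
    and Gv: "\<And>i. has_weak_gradient (ball 0 R) (\<lambda>x. v x $ i) (Gv i)" "\<And>i. Gv i \<in> L2_loc (ball 0 R)"
    and \<omega>: "\<omega> > 0"
  shows "(\<Sum>i\<in>UNIV. sqn (\<lambda>x. indicator (ball 0 \<rho>) x *\<^sub>R g_inf i x)) + (\<Sum>i\<in>UNIV. lam i * measure lebesgue (W_inf i \<inter> ball 0 r0))
    \<le> (\<Sum>i\<in>UNIV. (sqrt (sqn (\<lambda>x. indicator (ball 0 \<rho>) x *\<^sub>R Gv i x)) + \<omega>)\<^sup>2) + (\<Sum>i\<in>UNIV. lam i * measure lebesgue (Z i \<inter> ball 0 r0))"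
proof -
  have Z: "\<And>i. Z i \<in> sets lebesgue" "\<And>i. Z i \<subseteq> \<Omega>_inf" "disjoint_family Z"
    and vL: "\<And>i. (\<lambda>x. v x $ i) \<in> L2_loc (ball 0 R)"
    and vz: "\<And>i. AE x in lebesgue. x \<in> ball 0 R - Z i \<longrightarrow> v x $ i = 0"
    using vZ by (auto simp: F_class_ball_def W12_loc_def)
  obtain \<psi> :: "'a \<Rightarrow> real" where \<psi>: "\<psi> \<in> C_c_inf (ball 0 \<rho>)" "\<And>x. 0 \<le> \<psi> x \<and> \<psi> x \<le> 1" "\<And>x. x \<in> cball 0 r0 \<Longrightarrow> \<psi> x = 1"
      "\<And>x. x \<notin> ball 0 \<rho> \<Longrightarrow> \<psi> x = 0" "\<And>x. x \<notin> ball 0 \<rho> \<Longrightarrow> grad \<psi> x = 0"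
    by (rule test_cutoff_ball[of r0 \<rho>]) (use r0 in auto)
  obtain C where C: "C > 0" "\<And>x. norm (grad \<psi> x) \<le> C" by (rule grad_bounded[OF \<psi>(1)]) blast
  obtain \<xi> :: "'a \<Rightarrow> real" where \<xi>: "\<xi> \<in> C_c_inf (ball 0 R)" "\<And>x. x \<in> cball 0 \<rho> \<Longrightarrow> \<xi> x = 1" "\<And>x. x \<notin> ball 0 R \<Longrightarrow> \<xi> x = 0"
    by (rule test_cutoff_ball[of \<rho> R]) (use r0 in auto)
  define V where "V = (\<lambda>i x. \<xi> x * v x $ i)"
  define VG where "VG = (\<lambda>i x. \<xi> x *\<^sub>R Gv i x + v x $ i *\<^sub>R grad \<xi> x)"
  have VH: "H1 (V i) (VG i)" for i unfolding V_def VG_def by (rule H1_mult_test[OF Gv(1) vL Gv(2) \<xi>(1)])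
  have V_eq: "V i x = v x $ i" "VG i x = Gv i x" if "x \<in> ball 0 \<rho>" for i x
    using \<xi>(2)[of x] grad_eq_0_const[OF open_ball that, of \<xi> 1] \<xi>(2) that by (auto simp: V_def VG_def)
  have V0: "AE x in lebesgue. x \<notin> Z i \<longrightarrow> V i x = 0" for i
    using vz[of i] by eventually_elim (use \<xi>(3) in \<open>auto simp: V_def\<close>)
  have V\<Omega>: "AE x in lebesgue. x \<notin> \<Omega>_inf \<longrightarrow> V i x = 0" for i
    using V0[of i] by eventually_elim (use Z(2)[of i] in auto)

  \<comment> \<open>The cost of the cut-offs is controlled by \<open>e\<close> and that of the threshold by \<open>\<eta>\<close>; each is at most \<open>\<omega> / 2\<close>.\<close>
  define mb where "mb = measure lebesgue (ball (0::'a) \<rho>)"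
  have mb: "mb \<ge> 0" by (simp add: mb_def)
  define e where "e = (\<omega> / (2 * (1 + C)))\<^sup>2"
  have e: "e > 0" using \<omega> C(1) by (simp add: e_def)
  have e': "(1 + C) * sqrt e = \<omega> / 2"
  proof -
    have "sqrt e = \<omega> / (2 * (1 + C))" unfolding e_def using \<omega> C(1) by (subst real_sqrt_abs) simp
    then show ?thesis using C(1) by (simp add: field_simps)
  qed
  define \<eta> where "\<eta> = \<omega> / (4 * (C * sqrt mb + 1))"
  have Cs: "C * sqrt mb + 1 > 0" using C(1) mb by (simp add: add_nonneg_pos)
  have \<eta>: "\<eta> > 0" and \<eta>': "2 * \<eta> * C * sqrt mb \<le> \<omega> / 2"
  proof -
    show "\<eta> > 0" using \<omega> Cs by (simp add: \<eta>_def)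
    then have "2 * \<eta> * (C * sqrt mb) \<le> 2 * \<eta> * (C * sqrt mb + 1)" by (intro mult_left_mono) auto
    also have "\<dots> = \<omega> / 2"
    proof -
      have "2 * (\<omega> / (4 * t)) * t = \<omega> / 2" if "t > 0" for t using that by simp
      from this[OF Cs] show ?thesis by (simp only: \<eta>_def)
    qed
    finally show "2 * \<eta> * C * sqrt mb \<le> \<omega> / 2" by (simp add: mult.assoc)
  qed

  define T where "T = (r0 + R) / 2"
  have T: "0 < T" "T < R" "r0 < T" using r0 by (auto simp: T_def)
  obtain c \<delta>0 where c: "c > 0" "\<delta>0 > 0"
    "\<And>\<delta> x. 0 < \<delta> \<Longrightarrow> \<delta> \<le> \<delta>0 \<Longrightarrow> x \<in> \<Omega>_inf \<Longrightarrow> \<exists>a\<in>ball 0 T - \<Omega>_inf. dist x a < \<delta> \<Longrightarrow>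
      c * \<delta> ^ DIM('a) \<le> measure lebesgue (ball x (2 * \<delta>) - \<Omega>_inf)"
    by (rule complement_density[OF T(1,2)]) blast
  have bd: "bounded \<Omega>_inf" "bounded (ball 0 T - \<Omega>_inf)" using \<Omega>_inf(2) bounded_subset[OF bounded_ball] by auto
  have "\<exists>p. fst p \<in> C_c_inf UNIV \<and> (\<forall>x. 0 \<le> fst p x \<and> fst p x \<le> 1) \<and> snd p > 0 \<and>
    (\<forall>x. (\<exists>a\<in>ball 0 T - \<Omega>_inf. dist x a < snd p) \<longrightarrow> fst p x = 1) \<and>
    sqn (\<lambda>x. fst p x * V i x) \<le> e \<and> sqn (\<lambda>x. V i x *\<^sub>R grad (fst p) x) \<le> e" for i
  proof (rule cutoff_near_thick_complement[OF VH[of i] \<Omega>_inf(1) bd(1) V\<Omega> bd(2) c(1,2) c(3) e])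
    fix m d assume "m \<in> C_c_inf UNIV" "\<And>x. 0 \<le> m x \<and> m x \<le> 1" "d > 0" "\<And>x. \<exists>a\<in>ball 0 T - \<Omega>_inf. dist x a < d \<Longrightarrow> m x = 1"
      "sqn (\<lambda>x. m x * V i x) \<le> e" "sqn (\<lambda>x. V i x *\<^sub>R grad m x) \<le> e"
    then show ?thesis by (intro exI[of _ "(m, d)"]) simp
  qed
  from choice[OF allI[OF this]] obtain p where p: "\<forall>i. fst (p i) \<in> C_c_inf UNIV \<and> (\<forall>x. 0 \<le> fst (p i) x \<and> fst (p i) x \<le> 1) \<and> snd (p i) > 0 \<and>
    (\<forall>x. (\<exists>a\<in>ball 0 T - \<Omega>_inf. dist x a < snd (p i)) \<longrightarrow> fst (p i) x = 1) \<and>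
    sqn (\<lambda>x. fst (p i) x * V i x) \<le> e \<and> sqn (\<lambda>x. V i x *\<^sub>R grad (fst (p i)) x) \<le> e" ..
  define m where "m = (\<lambda>i. fst (p i))"
  define d where "d = (\<lambda>i. snd (p i))"
  have m: "\<And>i. m i \<in> C_c_inf UNIV" "\<And>i x. 0 \<le> m i x \<and> m i x \<le> 1" and d: "\<And>i. d i > 0"
    "\<And>i x. \<exists>a\<in>ball 0 T - \<Omega>_inf. dist x a < d i \<Longrightarrow> m i x = 1"
    and mV: "\<And>i. sqn (\<lambda>x. m i x * V i x) \<le> e" "\<And>i. sqn (\<lambda>x. V i x *\<^sub>R grad (m i) x) \<le> e"
    using p unfolding m_def d_def by blast+
  obtain S S' where S: "\<And>a. (S has_real_derivative S' a) (at a)" "continuous_on UNIV S'"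
    "\<And>a. 0 \<le> S' a \<and> S' a \<le> 1" "\<And>a. \<bar>a\<bar> \<le> \<eta> \<Longrightarrow> S a = 0" "\<And>a. \<bar>S a - a\<bar> \<le> 2 * \<eta>"
    by (rule soft_threshold[OF \<eta>]) blast
  have S0: "S 0 = 0" using S(4) \<eta> by simp
  define Y where "Y = (\<lambda>i x. V i x - m i x * V i x)"
  define YG where "YG = (\<lambda>i x. VG i x - (m i x *\<^sub>R VG i x + V i x *\<^sub>R grad (m i) x))"
  have mVH: "H1 (\<lambda>x. m i x * V i x) (\<lambda>x. m i x *\<^sub>R VG i x + V i x *\<^sub>R grad (m i) x)" for i
    by (rule H1_mult_test_UNIV[OF VH m(1)])
  have YH: "H1 (Y i) (YG i)" for i unfolding Y_def YG_def by (rule H1_diff[OF VH mVH])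
  have SH: "H1 (\<lambda>x. S (Y i x)) (\<lambda>x. S' (Y i x) *\<^sub>R YG i x)" for i
    by (rule H1_chain_rule[OF YH S(1) S0 S(2)]) (use S(3) in auto)
  have Y_le: "\<bar>Y i x\<bar> \<le> \<bar>V i x\<bar>" for i x
  proof -
    have "Y i x = (1 - m i x) * V i x" by (simp add: Y_def left_diff_distrib)
    then have "\<bar>Y i x\<bar> = (1 - m i x) * \<bar>V i x\<bar>" using m(2)[of i x] by (simp add: abs_mult)
    also have "\<dots> \<le> 1 * \<bar>V i x\<bar>" using m(2)[of i x] by (intro mult_right_mono) auto
    finally show ?thesis by simp
  qed
  have "\<exists>B. B \<in> sets borel \<and> B \<subseteq> Z i \<and> (AE x in lebesgue. x \<in> Z i \<longrightarrow> x \<in> B)" for i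
    by (rule lebesgue_inner_borel[OF Z(1)[of i]]) blast
  from choice[OF allI[OF this]] obtain Z0 where "\<forall>i. Z0 i \<in> sets borel \<and> Z0 i \<subseteq> Z i \<and> (AE x in lebesgue. x \<in> Z i \<longrightarrow> x \<in> Z0 i)" ..
  then have Z0: "\<And>i. Z0 i \<in> sets borel" "\<And>i. Z0 i \<subseteq> Z i" "\<And>i. AE x in lebesgue. x \<in> Z i \<longrightarrow> x \<in> Z0 i" by auto
  define Q where "Q = (\<lambda>i x. \<psi> x *\<^sub>R (S' (Y i x) *\<^sub>R YG i x - g_inf i x) + (S (Y i x) - v_inf i x) *\<^sub>R grad \<psi> x)"
  have y_Z: "AE x in lebesgue. x \<in> ball 0 r0 \<longrightarrow> x \<notin> Z0 i \<longrightarrow> S (Y i x) = 0" for i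
    using V0[of i] Z0(3)[of i] by eventually_elim (auto simp: Y_def S0)
  have y_\<Omega>: "\<forall>\<^sub>F k in sequentially. \<forall>i. AE x in lebesgue. x \<in> ball 0 r0 \<longrightarrow> x \<notin> \<Omega>k k \<longrightarrow> S (Y i x) = 0"
  proof -
    define d0 where "d0 = min (T - r0) (Min (range d))"
    have d0: "d0 > 0" "d0 \<le> T - r0" "\<And>i. d0 \<le> d i" using d(1) T by (auto simp: d0_def min_le_iff_disj)
    have "\<forall>\<^sub>F k in sequentially. \<forall>x\<in>ball 0 r0 - \<Omega>k k. \<exists>a\<in>ball 0 R - \<Omega>_inf. dist x a < d0"
      by (rule near_complement) (use r0 d0 in auto)
    then show ?thesis
    proof (eventually_elim, intro allI AE_I2 impI)
      fix k i x assume k: "\<forall>x\<in>ball 0 r0 - \<Omega>k k. \<exists>a\<in>ball 0 R - \<Omega>_inf. dist x a < d0" and x: "x \<in> ball 0 r0" "x \<notin> \<Omega>k k"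
      then obtain a where a: "a \<in> ball 0 R - \<Omega>_inf" "dist x a < d0" by blast
      have "norm a \<le> norm x + dist x a" by (metis dist_commute dist_norm norm_triangle_sub)
      then have "a \<in> ball 0 T - \<Omega>_inf" using a x d0(2) by auto
      moreover have "dist x a < d i" using a(2) d0(3)[of i] by linarith
      ultimately have "m i x = 1" using d(2) by blast
      then show "S (Y i x) = 0" by (simp add: Y_def S0)
    qed
  qed
  have y_uk: "\<forall>\<^sub>F k in sequentially. \<forall>i. AE x in lebesgue. x \<in> ball 0 \<rho> - ball 0 r0 \<longrightarrow> uk k i x = 0 \<longrightarrow> S (Y i x) = 0"
  proof -
    obtain k0 where k0: "\<forall>k\<ge>k0. \<forall>i. \<forall>x\<in>ball 0 R. \<bar>uk k i x - u_inf x $ i\<bar> < \<eta>" using uk_uniform_limit[OF \<eta>] by blast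
    show ?thesis unfolding eventually_sequentially
    proof (intro exI allI impI)
      fix k i assume k: "k \<ge> k0"
      show "AE x in lebesgue. x \<in> ball 0 \<rho> - ball 0 r0 \<longrightarrow> uk k i x = 0 \<longrightarrow> S (Y i x) = 0"
        using eq
      proof (eventually_elim, intro impI)
        fix x assume vx: "x \<in> ball 0 R - ball 0 r0 \<longrightarrow> v x = u_inf x" and x: "x \<in> ball 0 \<rho> - ball 0 r0" and u0: "uk k i x = 0"
        have xR: "x \<in> ball 0 R" using x r0 by auto
        then have "\<bar>u_inf x $ i\<bar> < \<eta>" using k0[rule_format, OF k xR, of i] u0 by simp
        then have "\<bar>V i x\<bar> < \<eta>" using V_eq(1)[of x i] vx x xR by auto
        then show "S (Y i x) = 0" using S(4)[of "Y i x"] Y_le[of i x] by simp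
      qed
    qed
  qed
  have dZ0: "disjoint_family Z0" using Z(3) Z0(2) by (rule disjoint_family_subset)
  have Q_eq: "Q i x = \<psi> x *\<^sub>R (S' (Y i x) *\<^sub>R YG i x - g_inf i x) + (S (Y i x) - v_inf i x) *\<^sub>R grad \<psi> x" for i x
    by (simp add: Q_def)
  note cl = comparison_limit[OF r0 \<psi> SH Z0(1) dZ0 y_Z y_\<Omega> y_uk Q_eq]
  have Q0: "Q i x = 0" if "x \<notin> ball 0 \<rho>" for i x using \<psi>(4,5)[OF that] by (simp add: Q_def)
  define X where "X = (\<lambda>i x. indicat_real (ball 0 \<rho>) x *\<^sub>R (g_inf i x + Q i x))"
  have ind: "(\<lambda>x. indicat_real (ball 0 \<rho>) x *\<^sub>R H x) \<in> L2 UNIV" if "H \<in> L2 UNIV" for H :: "'a \<Rightarrow> 'a"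
    by (rule L2_UNIV_mult_bounded[OF that borel_measurable_indicator, where B = 1]) (auto intro!: AE_I2 simp: indicator_def)
  have XL: "X i \<in> L2 UNIV" for i unfolding X_def by (rule ind[OF L2_UNIV_add[OF g_inf_L2 cl(1)]])
  have E: "2 * (LINT x|lebesgue. g_inf i x \<bullet> Q i x) + sqn (Q i) = sqn (X i) - sqn (\<lambda>x. indicator (ball 0 \<rho>) x *\<^sub>R g_inf i x)" for i
  proof -
    have "2 * (LINT x|lebesgue. g_inf i x \<bullet> Q i x) + sqn (Q i) = (LINT x|lebesgue. 2 * (g_inf i x \<bullet> Q i x) + (norm (Q i x))\<^sup>2)"
      using integrable_inner_L2[OF g_inf_L2[of i] cl(1)[of i]] L2_UNIV_integrable[OF cl(1)[of i]] by simp
    also have "\<dots> = (LINT x|lebesgue. (norm (X i x))\<^sup>2 - (norm (indicat_real (ball 0 \<rho>) x *\<^sub>R g_inf i x))\<^sup>2)"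
    proof (intro Bochner_Integration.integral_cong refl)
      fix x show "2 * (g_inf i x \<bullet> Q i x) + (norm (Q i x))\<^sup>2 = (norm (X i x))\<^sup>2 - (norm (indicat_real (ball 0 \<rho>) x *\<^sub>R g_inf i x))\<^sup>2"
        by (cases "x \<in> ball 0 \<rho>") (simp_all add: X_def Q0 power2_norm_eq_inner inner_add_left inner_add_right inner_commute)
    qed
    also have "\<dots> = sqn (X i) - sqn (\<lambda>x. indicator (ball 0 \<rho>) x *\<^sub>R g_inf i x)"
      by (rule Bochner_Integration.integral_diff[OF L2_UNIV_integrable[OF XL] L2_UNIV_integrable[OF ind[OF g_inf_L2]]])
    finally show ?thesis .
  qed

  have X_le: "sqrt (sqn (X i)) \<le> sqrt (sqn (\<lambda>x. indicator (ball 0 \<rho>) x *\<^sub>R Gv i x)) + \<omega>" for i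
  proof -
    have GvV: "(\<lambda>x. indicat_real (ball 0 \<rho>) x *\<^sub>R Gv i x) = (\<lambda>x. indicat_real (ball 0 \<rho>) x *\<^sub>R VG i x)"
    proof
      fix x show "indicat_real (ball 0 \<rho>) x *\<^sub>R Gv i x = indicat_real (ball 0 \<rho>) x *\<^sub>R VG i x"
        using V_eq(2)[of x i] by (cases "x \<in> ball 0 \<rho>") auto
    qed
    define n1 where "n1 = (\<lambda>x. norm (indicat_real (ball 0 \<rho>) x *\<^sub>R Gv i x))"
    define n2 where "n2 = (\<lambda>x. norm (V i x *\<^sub>R grad (m i) x))"
    define n3 where "n3 = (\<lambda>x. C *\<^sub>R \<bar>m i x * V i x\<bar>)"
    define n4 where "n4 = (\<lambda>x :: 'a. 2 * \<eta> * C * indicat_real (ball 0 \<rho>) x)"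
    have norm_L2: "(\<lambda>x. norm (H x)) \<in> L2 UNIV" if "H \<in> L2 UNIV" for H :: "'a \<Rightarrow> 'c::euclidean_space"
      by (rule L2_UNIV_bound[OF that]) (use L2_UNIV_measurable[OF that] in auto)
    have VgL: "(\<lambda>x. V i x *\<^sub>R grad (m i) x) \<in> L2 UNIV"
    proof -
      obtain B where B: "\<And>x. norm (grad (m i) x) \<le> B" by (rule grad_bounded[OF m(1)[of i]]) blast
      show ?thesis
      proof (rule L2_UNIV_bound[OF L2_UNIV_scale[OF H1_D(1)[OF VH[of i]], of B]])
        show "(\<lambda>x. V i x *\<^sub>R grad (m i) x) \<in> borel_measurable lebesgue"
          by (intro borel_measurable_scaleR grad_measurable[OF m(1)] L2_UNIV_measurable[OF H1_D(1)[OF VH]])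
        have "norm (V i x *\<^sub>R grad (m i) x) \<le> norm (B *\<^sub>R V i x)" for x
        proof -
          have "norm (grad (m i) x) \<le> \<bar>B\<bar>" using B[of x] by linarith
          from mult_left_mono[OF this, of "\<bar>V i x\<bar>"] show ?thesis by (simp add: mult.commute abs_mult)
        qed
        then show "AE x in lebesgue. norm (V i x *\<^sub>R grad (m i) x) \<le> norm (B *\<^sub>R V i x)" by auto
      qed
    qed
    have nL: "n1 \<in> L2 UNIV" "n2 \<in> L2 UNIV" "n3 \<in> L2 UNIV" "n4 \<in> L2 UNIV"
    proof -
      have "(\<lambda>x. indicat_real (ball 0 \<rho>) x *\<^sub>R Gv i x) \<in> L2 UNIV" unfolding GvV by (intro ind H1_D(2)[OF VH])
      then show "n1 \<in> L2 UNIV" unfolding n1_def by (rule norm_L2)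
      show "n2 \<in> L2 UNIV" unfolding n2_def by (rule norm_L2[OF VgL])
      show "n3 \<in> L2 UNIV" unfolding n3_def using L2_UNIV_scale[OF norm_L2[OF H1_D(1)[OF mVH[of i]]], of C] by simp
      show "n4 \<in> L2 UNIV" unfolding n4_def by (rule ball_indicator_L2)
    qed
    have "AE x in lebesgue. x \<in> ball 0 R - cball 0 r0 \<longrightarrow> Gv i x = g_inf i x"
    proof (rule weak_gradient_unique)
      have "has_weak_gradient (ball 0 R) (\<lambda>x. v x $ i) (Gv i)" by (rule Gv(1))
      then have g: "has_weak_gradient (ball 0 R - cball 0 r0) (\<lambda>x. v x $ i) (Gv i)" by (rule has_weak_gradient_subset) auto
      show "has_weak_gradient (ball 0 R - cball 0 r0) (\<lambda>x. u_inf x $ i) (Gv i)"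
        by (rule has_weak_gradient_AE_cong[OF g]) (use eq in \<open>eventually_elim, auto\<close>)
      show "has_weak_gradient (ball 0 R - cball 0 r0) (\<lambda>x. u_inf x $ i) (g_inf i)"
        by (rule has_weak_gradient_subset[OF g_inf_gradient]) auto
    qed (intro open_Diff open_ball closed_cball)
    then have le: "AE x in lebesgue. norm (X i x) \<le> norm (n1 x + (n2 x + (n3 x + n4 x)))"
      using eq
    proof eventually_elim
      case (elim x)
      show ?case
      proof (cases "x \<in> ball 0 \<rho>")
        case True
        have xR: "x \<in> ball 0 R" using True r0 by auto
        let ?s = "S' (Y i x)"
        have s: "0 \<le> ?s" "?s \<le> 1" using S(3) by auto
        have mm: "0 \<le> m i x" "m i x \<le> 1" using m(2) by auto
        have p: "0 \<le> \<psi> x" "\<psi> x \<le> 1" using \<psi>(2) by auto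
        have k01: "0 \<le> ?s * (1 - m i x)" "?s * (1 - m i x) \<le> 1" using s mm by (auto intro: mult_le_one)
        have eqX: "X i x = ((\<psi> x * (?s * (1 - m i x))) *\<^sub>R Gv i x + (1 - \<psi> x) *\<^sub>R g_inf i x)
            + (- (\<psi> x * ?s) *\<^sub>R (V i x *\<^sub>R grad (m i) x) + (S (Y i x) - v_inf i x) *\<^sub>R grad \<psi> x)"
          using True by (simp add: X_def Q_def YG_def V_eq algebra_simps)
        have 1: "norm ((\<psi> x * (?s * (1 - m i x))) *\<^sub>R Gv i x + (1 - \<psi> x) *\<^sub>R g_inf i x) \<le> n1 x"
        proof (cases "x \<in> cball 0 r0")
          case True2: True
          then have "\<psi> x = 1" by (rule \<psi>(3))
          moreover have "?s * (1 - m i x) * norm (Gv i x) \<le> 1 * norm (Gv i x)" using k01 by (intro mult_right_mono) auto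
          ultimately show ?thesis using True k01 by (simp add: n1_def abs_of_nonneg)
        next
          case False
          define t where "t = \<psi> x * (?s * (1 - m i x)) + (1 - \<psi> x)"
          have t: "0 \<le> t" "t \<le> 1"
          proof -
            show "0 \<le> t" unfolding t_def using p mult_nonneg_nonneg[OF p(1) k01(1)] by (intro add_nonneg_nonneg) auto
            have "\<psi> x * (?s * (1 - m i x)) \<le> \<psi> x * 1" using p k01 by (intro mult_left_mono) auto
            then show "t \<le> 1" by (simp add: t_def)
          qed
          have "Gv i x = g_inf i x" using elim(1) False xR by auto
          then have "(\<psi> x * (?s * (1 - m i x))) *\<^sub>R Gv i x + (1 - \<psi> x) *\<^sub>R g_inf i x = t *\<^sub>R Gv i x"
            by (simp add: t_def scaleR_add_left)
          moreover have "t * norm (Gv i x) \<le> 1 * norm (Gv i x)" using t by (intro mult_right_mono) auto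
          ultimately show ?thesis using True t by (simp add: n1_def)
        qed
        have 2: "norm (- (\<psi> x * ?s) *\<^sub>R (V i x *\<^sub>R grad (m i) x)) \<le> n2 x"
        proof -
          have "(\<psi> x * ?s) * n2 x \<le> 1 * n2 x" using p s by (intro mult_right_mono mult_le_one) (auto simp: n2_def)
          then show ?thesis using p s by (simp add: n2_def abs_mult)
        qed
        have 3: "norm ((S (Y i x) - v_inf i x) *\<^sub>R grad \<psi> x) \<le> n3 x + n4 x"
        proof (cases "x \<in> ball 0 r0")
          case in0: True
          have "grad \<psi> x = 0" by (rule grad_eq_0_const[OF open_ball in0, of \<psi> 1]) (use \<psi>(3) in auto)
          then show ?thesis using C(1) \<eta> by (simp add: n3_def n4_def)
        next
          case False
          then have "v_inf i x = V i x" using elim(2) xR V_eq(1)[OF True] v_inf_eq[OF xR] by auto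
          moreover have "\<bar>S (Y i x) - V i x\<bar> \<le> 2 * \<eta> + \<bar>m i x * V i x\<bar>"
            using S(5)[of "Y i x"] by (simp add: Y_def)
          ultimately have "norm ((S (Y i x) - v_inf i x) *\<^sub>R grad \<psi> x) \<le> (2 * \<eta> + \<bar>m i x * V i x\<bar>) * C"
            unfolding norm_scaleR using C by (intro mult_mono) auto
          then show ?thesis using True by (simp add: n3_def n4_def algebra_simps)
        qed
        have "norm (X i x) \<le> n1 x + (n2 x + (n3 x + n4 x))"
          unfolding eqX by (intro norm_triangle_le add_mono 1 order_trans[OF norm_triangle_ineq add_mono[OF 2 3]])
        then show ?thesis by simp
      qed (simp add: X_def)
    qed
    have "sqrt (sqn (X i)) \<le> sqrt (sqn (\<lambda>x. n1 x + (n2 x + (n3 x + n4 x))))"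
      by (intro real_sqrt_le_mono sqn_mono[OF _ le] L2_UNIV_add nL)
    also have "\<dots> \<le> sqrt (sqn n1) + (sqrt (sqn n2) + (sqrt (sqn n3) + sqrt (sqn n4)))"
      by (intro order_trans[OF L2_triangle] add_left_mono L2_UNIV_add nL order_refl)
    also have "\<dots> \<le> sqrt (sqn n1) + (sqrt e + (C * sqrt e + 2 * \<eta> * C * sqrt mb))"
    proof (intro add_mono order_refl)
      show "sqrt (sqn n2) \<le> sqrt e" using mV(2)[of i] by (simp add: n2_def)
      have "sqn n3 = C\<^sup>2 * sqn (\<lambda>x. m i x * V i x)" unfolding n3_def by (subst sqn_scale) simp
      also have "sqrt \<dots> = C * sqrt (sqn (\<lambda>x. m i x * V i x))" using C(1) by (simp add: real_sqrt_mult)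
      also have "\<dots> \<le> C * sqrt e" using mV(1)[of i] C(1) by (intro mult_left_mono real_sqrt_le_mono) auto
      finally show "sqrt (sqn n3) \<le> C * sqrt e" .
      have "sqn n4 \<le> (2 * \<eta> * C)\<^sup>2 * mb" unfolding mb_def
        by (rule bounded_ball_sqn[OF L2_UNIV_measurable[OF nL(4)]]) (use \<eta> C(1) in \<open>auto simp: n4_def indicator_def intro!: AE_I2\<close>)
      then have "sqrt (sqn n4) \<le> sqrt ((2 * \<eta> * C)\<^sup>2 * mb)" by (rule real_sqrt_le_mono)
      also have "\<dots> = 2 * \<eta> * C * sqrt mb" using \<eta> C(1) by (simp add: real_sqrt_mult)
      finally show "sqrt (sqn n4) \<le> 2 * \<eta> * C * sqrt mb" .
    qed
    also have "\<dots> \<le> sqrt (sqn n1) + \<omega>" using e' \<eta>' by (simp add: distrib_right)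
    also have "sqn n1 = sqn (\<lambda>x. indicator (ball 0 \<rho>) x *\<^sub>R Gv i x)" by (simp add: n1_def)
    finally show ?thesis .
  qed
  have "(\<Sum>i\<in>UNIV. sqn (X i)) \<le> (\<Sum>i\<in>UNIV. (sqrt (sqn (\<lambda>x. indicator (ball 0 \<rho>) x *\<^sub>R Gv i x)) + \<omega>)\<^sup>2)"
  proof (rule sum_mono)
    fix i
    have "sqn (X i) = (sqrt (sqn (X i)))\<^sup>2" by (simp add: integral_nonneg_AE)
    also have "\<dots> \<le> (sqrt (sqn (\<lambda>x. indicator (ball 0 \<rho>) x *\<^sub>R Gv i x)) + \<omega>)\<^sup>2"
      by (rule power_mono[OF X_le]) (simp add: integral_nonneg_AE)
    finally show "sqn (X i) \<le> (sqrt (sqn (\<lambda>x. indicator (ball 0 \<rho>) x *\<^sub>R Gv i x)) + \<omega>)\<^sup>2" .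
  qed
  moreover have "measure lebesgue (Z0 i \<inter> \<Omega>_inf \<inter> ball 0 r0) = measure lebesgue (Z i \<inter> ball 0 r0)" for i
  proof (rule measure_eq_AE)
    show "AE x in lebesgue. (x \<in> Z0 i \<inter> \<Omega>_inf \<inter> ball 0 r0) = (x \<in> Z i \<inter> ball 0 r0)"
      using Z0(3)[of i] by eventually_elim (use Z0(2)[of i] Z(2)[of i] in auto)
  qed (use Z(1) \<Omega>_inf(1) borel_imp_lebesgue[OF Z0(1)] in auto)
  ultimately show ?thesis
    using cl(2) unfolding E by (simp add: sum_subtractf right_diff_distrib)
qed

lemma energy_comparison:
  assumes r0: "0 < r0" "r0 < \<rho>" "\<rho> < R"
    and vZ: "(v, Z) \<in> F_class_ball R \<Omega>_inf"
    and eq: "AE x in lebesgue. x \<in> ball 0 R - ball 0 r0 \<longrightarrow> v x = u_inf x"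
    and Gv: "\<And>i. has_weak_gradient (ball 0 R) (\<lambda>x. v x $ i) (Gv i)" "\<And>i. Gv i \<in> L2_loc (ball 0 R)"
  shows "(\<Sum>i\<in>UNIV. sqn (\<lambda>x. indicator (ball 0 \<rho>) x *\<^sub>R g_inf i x)) + (\<Sum>i\<in>UNIV. lam i * measure lebesgue (W_inf i \<inter> ball 0 r0))
    \<le> (\<Sum>i\<in>UNIV. sqn (\<lambda>x. indicator (ball 0 \<rho>) x *\<^sub>R Gv i x)) + (\<Sum>i\<in>UNIV. lam i * measure lebesgue (Z i \<inter> ball 0 r0))"
proof -
  let ?a = "\<lambda>i. sqn (\<lambda>x. indicator (ball 0 \<rho>) x *\<^sub>R Gv i x)"
  have "((\<lambda>\<omega>. (\<Sum>i\<in>UNIV. (sqrt (?a i) + \<omega>)\<^sup>2) + (\<Sum>i\<in>UNIV. lam i * measure lebesgue (Z i \<inter> ball 0 r0)))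
      \<longlongrightarrow> (\<Sum>i\<in>UNIV. (sqrt (?a i) + 0)\<^sup>2) + (\<Sum>i\<in>UNIV. lam i * measure lebesgue (Z i \<inter> ball 0 r0))) (at_right 0)"
    by (intro tendsto_intros)
  moreover have "\<forall>\<^sub>F \<omega> in at_right 0. (\<Sum>i\<in>UNIV. sqn (\<lambda>x. indicator (ball 0 \<rho>) x *\<^sub>R g_inf i x)) + (\<Sum>i\<in>UNIV. lam i * measure lebesgue (W_inf i \<inter> ball 0 r0))
    \<le> (\<Sum>i\<in>UNIV. (sqrt (?a i) + \<omega>)\<^sup>2) + (\<Sum>i\<in>UNIV. lam i * measure lebesgue (Z i \<inter> ball 0 r0))"
    using eventually_at_right_less[of "0::real"]
    by eventually_elim (rule approximate_energy_comparison[OF r0 vZ eq Gv])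
  ultimately have "(\<Sum>i\<in>UNIV. sqn (\<lambda>x. indicator (ball 0 \<rho>) x *\<^sub>R g_inf i x)) + (\<Sum>i\<in>UNIV. lam i * measure lebesgue (W_inf i \<inter> ball 0 r0))
    \<le> (\<Sum>i\<in>UNIV. (sqrt (?a i) + 0)\<^sup>2) + (\<Sum>i\<in>UNIV. lam i * measure lebesgue (Z i \<inter> ball 0 r0))"
    by (rule tendsto_lowerbound) simp
  then show ?thesis by (simp add: integral_nonneg_AE)
qed

text \<open>Outside the ball of radius \<open>\<rho>\<close> the gradients of \<open>v\<close> and \<open>u_inf\<close> agree almost everywhere. So both energies are
  finite there, and adding the common part to the comparison in the ball gives the inequality for \<open>J_inf\<close>.\<close>

lemma limit_local_minimizer: "local_minimizer R \<Omega>_inf lam u_inf W_inf"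
  unfolding local_minimizer_def
proof (intro ballI, unfold split_paired_all prod.case, intro impI)
  fix v :: "'a \<Rightarrow> real^'i" and Z
  assume vZ: "(v, Z) \<in> F_class_ball R \<Omega>_inf"
    and "\<exists>s<R. (AE x in lebesgue. x \<in> ball 0 R - ball 0 s \<longrightarrow> v x = u_inf x) \<and> (\<forall>i. Z i - ball 0 s = W_inf i - ball 0 s)"
  then obtain s where s: "s < R" "AE x in lebesgue. x \<in> ball 0 R - ball 0 s \<longrightarrow> v x = u_inf x" "\<And>i. Z i - ball 0 s = W_inf i - ball 0 s"
    by blast
  define r0 where "r0 = max s (R / 2)"
  define \<rho> where "\<rho> = (r0 + R) / 2"
  have r0: "0 < r0" "r0 < \<rho>" "\<rho> < R" and sr: "s \<le> r0" using s(1) R_pos by (auto simp: r0_def \<rho>_def max_def)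
  have eq: "AE x in lebesgue. x \<in> ball 0 R - ball 0 r0 \<longrightarrow> v x = u_inf x"
    using s(2) by eventually_elim (use sr in auto)
  have ZW: "Z i - ball 0 r0 = W_inf i - ball 0 r0" for i
  proof -
    have "Z i - ball 0 r0 = (Z i - ball 0 s) - ball 0 r0" "W_inf i - ball 0 r0 = (W_inf i - ball 0 s) - ball 0 r0"
      using sr by auto
    then show ?thesis using s(3)[of i] by simp
  qed
  have Z: "\<And>i. Z i \<in> sets lebesgue" "\<And>i. Z i \<subseteq> \<Omega>_inf" using vZ by (auto simp: F_class_ball_def)
  have "\<exists>H. has_weak_gradient (ball 0 R) (\<lambda>x. v x $ i) H \<and> H \<in> L2_loc (ball 0 R)" for i
    using vZ by (auto simp: F_class_ball_def W12_loc_def)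
  then obtain Gv where Gv: "\<And>i. has_weak_gradient (ball 0 R) (\<lambda>x. v x $ i) (Gv i)" "\<And>i. Gv i \<in> L2_loc (ball 0 R)" by metis
  have mm: "A \<in> sets lebesgue \<Longrightarrow> indicat_real A \<in> borel_measurable lebesgue" for A :: "'a set" by (intro borel_measurable_indicator) auto
  have gi: "(\<lambda>x. indicat_real A x *\<^sub>R g_inf i x) \<in> L2 UNIV" if "A \<in> sets lebesgue" for A i
    by (rule L2_UNIV_mult_bounded[OF g_inf_L2 mm[OF that], where B = 1]) (auto simp: indicator_def intro!: AE_I2)
  have "cball 0 \<rho> \<subseteq> ball (0::'a) R" using r0 by auto
  then have "Gv i \<in> L2 (cball 0 \<rho>)" for i using Gv(2)[of i] by (auto simp: L2_loc_def)
  then have Gb: "(\<lambda>x. indicat_real (ball 0 \<rho>) x *\<^sub>R Gv i x) \<in> L2 UNIV" for i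
    using L2_indicator[of "ball (0::'a) \<rho>" "Gv i"] L2_mono_set[of "Gv i" "cball 0 \<rho>" "ball 0 \<rho>"] by auto
  let ?N = "ball (0::'a) R - ball 0 \<rho>"
  have out: "AE x in lebesgue. indicat_real ?N x *\<^sub>R g_inf i x = indicat_real ?N x *\<^sub>R Gv i x" for i
  proof -
    have "AE x in lebesgue. x \<in> ball 0 R - cball 0 r0 \<longrightarrow> Gv i x = g_inf i x"
    proof (rule weak_gradient_unique)
      have g: "has_weak_gradient (ball 0 R - cball 0 r0) (\<lambda>x. v x $ i) (Gv i)" by (rule has_weak_gradient_subset[OF Gv(1)]) auto
      show "has_weak_gradient (ball 0 R - cball 0 r0) (\<lambda>x. u_inf x $ i) (Gv i)"
        by (rule has_weak_gradient_AE_cong[OF g]) (use eq in \<open>eventually_elim, auto\<close>)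
      show "has_weak_gradient (ball 0 R - cball 0 r0) (\<lambda>x. u_inf x $ i) (g_inf i)"
        by (rule has_weak_gradient_subset[OF g_inf_gradient]) auto
    qed (intro open_Diff open_ball closed_cball)
    then show ?thesis by eventually_elim (use r0 in \<open>auto simp: indicator_def\<close>)
  qed
  have GN: "(\<lambda>x. indicat_real ?N x *\<^sub>R Gv i x) \<in> L2 UNIV" for i
    by (rule L2_UNIV_AE_cong[OF gi out]) auto
  have GNe: "sqn (\<lambda>x. indicat_real ?N x *\<^sub>R g_inf i x) = sqn (\<lambda>x. indicat_real ?N x *\<^sub>R Gv i x)" for i
  proof (rule integral_cong_AE)
    show "AE x in lebesgue. (norm (indicat_real ?N x *\<^sub>R g_inf i x))\<^sup>2 = (norm (indicat_real ?N x *\<^sub>R Gv i x))\<^sup>2"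
      using out[of i] by eventually_elim (simp only:)
    show "(\<lambda>x. (norm (indicat_real ?N x *\<^sub>R g_inf i x))\<^sup>2) \<in> borel_measurable lebesgue"
      by (rule borel_measurable_integrable[OF L2_UNIV_integrable[OF gi]]) auto
  qed (rule borel_measurable_integrable[OF L2_UNIV_integrable[OF GN]])
  have BN: "ball 0 \<rho> \<union> ?N = ball 0 R" "ball 0 \<rho> \<inter> ?N = {}" using r0 by auto
  have gS: "sqn (\<lambda>x. indicat_real (ball 0 R) x *\<^sub>R g_inf i x) = sqn (\<lambda>x. indicat_real (ball 0 \<rho>) x *\<^sub>R g_inf i x) + sqn (\<lambda>x. indicat_real ?N x *\<^sub>R g_inf i x)" for i
    using sqn_disjoint_sum(2)[OF gi[of "ball 0 \<rho>" i] gi[of ?N i] BN(2)] unfolding BN(1) by simp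
  have vS: "(\<lambda>x. indicat_real (ball 0 R) x *\<^sub>R Gv i x) \<in> L2 UNIV"
    "sqn (\<lambda>x. indicat_real (ball 0 R) x *\<^sub>R Gv i x) = sqn (\<lambda>x. indicat_real (ball 0 \<rho>) x *\<^sub>R Gv i x) + sqn (\<lambda>x. indicat_real ?N x *\<^sub>R Gv i x)" for i
    using sqn_disjoint_sum[OF Gb[of i] GN[of i] BN(2)] unfolding BN(1) by auto
  have ms: "measure lebesgue A = measure lebesgue (A \<inter> ball 0 r0) + measure lebesgue (A - ball 0 r0)" if "A \<in> sets lebesgue" "A \<subseteq> \<Omega>_inf" for A
    using measure_split[OF that(1), of "ball 0 r0"] that(2) \<Omega>_inf(2) bounded_subset[OF bounded_ball, of A 0 R] by auto
  have "(\<Sum>i\<in>UNIV. sqn (\<lambda>x. indicat_real (ball 0 R) x *\<^sub>R g_inf i x)) + (\<Sum>i\<in>UNIV. lam i * measure lebesgue (W_inf i))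
      \<le> (\<Sum>i\<in>UNIV. sqn (\<lambda>x. indicat_real (ball 0 R) x *\<^sub>R Gv i x)) + (\<Sum>i\<in>UNIV. lam i * measure lebesgue (Z i))"
    using energy_comparison[OF r0 vZ eq Gv]
    unfolding gS vS(2) GNe ms[OF Z] ms[OF W_inf_measurable W_inf_subset] ZW
    by (simp add: sum.distrib distrib_left)
  then show "J_inf R lam u_inf W_inf \<le> J_inf R lam v Z"
    using J_inf_eq[OF g_inf_gradient gi, of lam W_inf] J_inf_eq[OF Gv(1) vS(1), of lam Z] by simp
qed

end

section \<open>The blow-up theorem\<close>

lemma Linf_norm_bound:
  assumes "A \<in> sets lebesgue" "Linf_norm A h < \<infinity>"
  shows "\<exists>M. AE x in lebesgue. x \<in> A \<longrightarrow> \<bar>h x\<bar> \<le> M"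
proof -
  obtain n :: nat where n: "Linf_norm A h < ereal (real n)" using assms(2) by (auto simp: less_PInf_Ex_of_nat)
  have "AE x in lebesgue_on A. ereal \<bar>h x\<bar> \<le> Linf_norm A h" unfolding Linf_norm_def by (rule esssup_AE)
  then have "AE x in lebesgue. x \<in> A \<longrightarrow> ereal \<bar>h x\<bar> \<le> Linf_norm A h"
    using assms(1) by (subst (asm) AE_restrict_space_iff) auto
  then have "AE x in lebesgue. x \<in> A \<longrightarrow> \<bar>h x\<bar> \<le> real n"
  proof eventually_elim
    case (elim x)
    then show ?case using n by (metis ereal_less_eq(3) less_imp_le order_trans)
  qed
  then show ?thesis by blast
qed

theorem theorem18p1:
  fixes \<Omega> \<Omega>_inf :: "(real^'n::finite) set"
    and f g :: "'i::finite \<Rightarrow> real^'n \<Rightarrow> real"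
    and F :: "('i \<Rightarrow> (real^'n) set) \<Rightarrow> real"
    and u u_inf :: "real^'n \<Rightarrow> real^'i"
    and W :: "'i \<Rightarrow> (real^'n) set"
    and r :: "nat \<Rightarrow> real"
    and \<rho>\<^sub>0 R :: real
    and lam :: "'i \<Rightarrow> real"
    and \<epsilon> :: "real \<Rightarrow> real"
  assumes dim: "CARD('n) \<ge> 2"
    and \<Omega>: "\<Omega> \<in> sets borel" "emeasure lebesgue \<Omega> < \<infinity>"
    and fg_measurable: "\<And>i. f i \<in> borel_measurable (lebesgue_on \<Omega>)"
      "\<And>i. g i \<in> borel_measurable (lebesgue_on \<Omega>)"
    and fg_converge: "J_integrals_converge f g \<Omega>"
    and minimizer: "J_minimizer f g F \<Omega> u W"
    and r_pos: "\<And>k. r k > 0"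
    and r_lim: "r \<longlonglongrightarrow> 0"
    and u_0: "u 0 = 0"
    and \<rho>\<^sub>0_pos: "\<rho>\<^sub>0 > 0"
    and f_nonneg: "\<And>i. AE x in lebesgue_on (ball 0 \<rho>\<^sub>0 \<inter> \<Omega>). f i x \<ge> 0"
    and fg_bounded: "\<And>i. Linf_norm (ball 0 \<rho>\<^sub>0 \<inter> \<Omega>) (f i) + Linf_norm (ball 0 \<rho>\<^sub>0 \<inter> \<Omega>) (g i) < \<infinity>"
    and u_lipschitz: "\<exists>L. L-lipschitz_on (ball 0 \<rho>\<^sub>0) u"
    and R_pos: "R > 0"
    and u_inf_lipschitz: "\<exists>L. L-lipschitz_on (ball 0 R) u_inf"
    and u_inf_lim: "\<And>x. x \<in> ball 0 R \<Longrightarrow> (\<lambda>k. blowup_fun (r k) u x) \<longlonglongrightarrow> u_inf x"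
    and \<Omega>_inf_set: "\<Omega>_inf \<in> sets lebesgue" "\<Omega>_inf \<subseteq> ball 0 R"
    and \<Omega>_inf_lim: "(\<lambda>k. LINT x:ball 0 R|lebesgue.
        \<bar>indicator (ball 0 R \<inter> blowup_set (r k) \<Omega>) x - indicator \<Omega>_inf x :: real\<bar>) \<longlonglongrightarrow> 0"
    and \<Omega>_inf_density: "\<And>T. 0 < T \<Longrightarrow> T < R \<Longrightarrow>
        \<exists>r\<^sub>T>0. \<exists>c\<^sub>T>0. \<forall>x \<in> ball 0 T \<inter> frontier \<Omega>_inf. \<forall>s. 0 < s \<and> s \<le> r\<^sub>T \<longrightarrow>
          measure lebesgue (ball x s - \<Omega>_inf) \<ge> c\<^sub>T * s ^ CARD('n)"
    and \<Omega>_inf_dist: "\<And>T. 0 < T \<Longrightarrow> T < R \<Longrightarrow>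
        (\<lambda>k. excess_dist R \<Omega>_inf (blowup_set (r k) \<Omega>) T) \<longlonglongrightarrow> 0"
    and \<epsilon>_lim: "(\<epsilon> \<longlongrightarrow> 0) (at_right 0)"
    and F_diff: "\<forall>\<^sub>F s in at_right 0. \<forall>W' \<in> W_class \<Omega>.
        (\<forall>i. W i - ball 0 s = W' i - ball 0 s) \<longrightarrow>
        \<bar>F W - F W' - (\<Sum>i\<in>UNIV. lam i * (measure lebesgue (W i \<inter> ball 0 s)
            - measure lebesgue (W' i \<inter> ball 0 s)))\<bar> \<le> s ^ CARD('n) * \<epsilon> s"
  shows "(\<exists>W_inf. (u_inf, W_inf) \<in> F_class_ball R \<Omega>_inf \<and> local_minimizer R \<Omega>_inf lam u_inf W_inf)
    \<and> (\<forall>i. tendsto_W12 (ball 0 R) (\<lambda>k x. blowup_fun (r k) u x $ i) (\<lambda>x. u_inf x $ i))"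
proof -
  obtain L where L: "L-lipschitz_on (ball 0 \<rho>\<^sub>0) u" using u_lipschitz by blast
  obtain s1 where s1: "s1 > 0" "\<And>s W'. 0 < s \<Longrightarrow> s < s1 \<Longrightarrow> W' \<in> W_class \<Omega> \<Longrightarrow> (\<And>i. W i - ball 0 s = W' i - ball 0 s) \<Longrightarrow>
        \<bar>F W - F W' - (\<Sum>i\<in>UNIV. lam i * (measure lebesgue (W i \<inter> ball 0 s)
            - measure lebesgue (W' i \<inter> ball 0 s)))\<bar> \<le> s ^ CARD('n) * \<epsilon> s"
    using F_diff unfolding eventually_at_right_field by blast
  define s0 where "s0 = min \<rho>\<^sub>0 s1"
  have s0: "s0 > 0" "s0 \<le> \<rho>\<^sub>0" "s0 \<le> s1" using s1(1) \<rho>\<^sub>0_pos by (auto simp: s0_def)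
  have A: "ball 0 \<rho>\<^sub>0 \<inter> \<Omega> \<in> sets lebesgue" using borel_imp_lebesgue[OF \<Omega>(1)] by auto
  have "Linf_norm (ball 0 \<rho>\<^sub>0 \<inter> \<Omega>) (f i) < \<infinity>" "Linf_norm (ball 0 \<rho>\<^sub>0 \<inter> \<Omega>) (g i) < \<infinity>" for i
    using fg_bounded[of i] by auto
  note this[THEN Linf_norm_bound[OF A]]
  then have "\<forall>i. \<exists>M. AE x in lebesgue. x \<in> ball 0 \<rho>\<^sub>0 \<inter> \<Omega> \<longrightarrow> \<bar>f i x\<bar> \<le> M"
    "\<forall>i. \<exists>M. AE x in lebesgue. x \<in> ball 0 \<rho>\<^sub>0 \<inter> \<Omega> \<longrightarrow> \<bar>g i x\<bar> \<le> M" by blast+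
  from choice[OF this(1)] choice[OF this(2)] obtain Mf Mg
    where M: "\<forall>i. AE x in lebesgue. x \<in> ball 0 \<rho>\<^sub>0 \<inter> \<Omega> \<longrightarrow> \<bar>f i x\<bar> \<le> Mf i"
      "\<forall>i. AE x in lebesgue. x \<in> ball 0 \<rho>\<^sub>0 \<inter> \<Omega> \<longrightarrow> \<bar>g i x\<bar> \<le> Mg i" by blast
  define M0 where "M0 = (\<Sum>i\<in>UNIV. \<bar>Mf i\<bar> + \<bar>Mg i\<bar>)"
  have M0: "\<bar>Mf i\<bar> + \<bar>Mg i\<bar> \<le> M0" for i unfolding M0_def by (rule member_le_sum) auto
  have "\<forall>\<^sub>F k in sequentially. r k < min 1 (s0 / (2 * R))"
    by (rule order_tendstoD(2)[OF r_lim]) (use s0 R_pos in simp)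
  then obtain k1 where k1: "\<And>k. k \<ge> k1 \<Longrightarrow> r k < min 1 (s0 / (2 * R))" by (auto simp: eventually_sequentially)
  define r' where "r' = (\<lambda>k. r (k + k1))"
  have r': "r' k > 0" "r' k \<le> 1" "2 * R * r' k < s0" for k
    using r_pos[of "k + k1"] k1[of "k + k1"] R_pos by (auto simp: r'_def field_simps)
  have shift: "X \<longlonglongrightarrow> l \<Longrightarrow> (\<lambda>k. X (k + k1)) \<longlonglongrightarrow> l" for X :: "nat \<Rightarrow> 'b::topological_space" and l
    by (rule LIMSEQ_ignore_initial_segment)
  interpret B: blowup_limit_domain \<Omega> f g F u W r' R s0 M0 L lam \<epsilon> u_inf \<Omega>_inf
  proof
    fix i
    show "AE x in lebesgue. x \<in> ball 0 s0 \<inter> \<Omega> \<longrightarrow> \<bar>f i x\<bar> \<le> M0 \<and> \<bar>g i x\<bar> \<le> M0"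
      using M(1)[rule_format, of i] M(2)[rule_format, of i] by eventually_elim (use M0[of i] s0(2) in auto)
  next
    show "L-lipschitz_on (ball 0 s0) u" by (rule lipschitz_on_subset[OF L]) (use s0 in auto)
    show "M0 \<ge> 0" unfolding M0_def by (intro sum_nonneg) auto
  next
    fix s W' assume "0 < s" "s < s0" "W' \<in> W_class \<Omega>" "\<And>i. W i - ball 0 s = W' i - ball 0 s"
    then show "\<bar>F W - F W' - (\<Sum>i\<in>UNIV. lam i * (measure lebesgue (W i \<inter> ball 0 s)
            - measure lebesgue (W' i \<inter> ball 0 s)))\<bar> \<le> s ^ DIM(real^'n) * \<epsilon> s"
      using s1(2)[of s W'] s0(3) by simp
  next
    show "r' \<longlonglongrightarrow> 0" unfolding r'_def by (rule shift[OF r_lim])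
    show "(\<lambda>k. LINT x:ball 0 R|lebesgue.
        \<bar>indicator (ball 0 R \<inter> blowup_set (r' k) \<Omega>) x - indicator \<Omega>_inf x :: real\<bar>) \<longlonglongrightarrow> 0"
      unfolding r'_def by (rule shift[OF \<Omega>_inf_lim])
  next
    fix x :: "real^'n" assume "x \<in> ball 0 R"
    then show "(\<lambda>k. blowup_fun (r' k) u x) \<longlonglongrightarrow> u_inf x" unfolding r'_def by (rule shift[OF u_inf_lim])
  next
    fix T assume T: "0 < T" "T < R"
    show "(\<lambda>k. excess_dist R \<Omega>_inf (blowup_set (r' k) \<Omega>) T) \<longlonglongrightarrow> 0" unfolding r'_def by (rule shift[OF \<Omega>_inf_dist[OF T]])
    show "\<exists>r\<^sub>T>0. \<exists>c\<^sub>T>0. \<forall>x \<in> ball 0 T \<inter> frontier \<Omega>_inf. \<forall>s. 0 < s \<and> s \<le> r\<^sub>T \<longrightarrow>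
          measure lebesgue (ball x s - \<Omega>_inf) \<ge> c\<^sub>T * s ^ DIM(real^'n)"
      using \<Omega>_inf_density[OF T] by simp
  qed (fact fg_converge minimizer r' R_pos u_0 \<epsilon>_lim \<Omega>(1) \<Omega>_inf_set)+
  have "tendsto_W12 (ball 0 R) (\<lambda>k x. blowup_fun (r k) u x $ i) (\<lambda>x. u_inf x $ i)" for i
    unfolding tendsto_W12_def
  proof (intro conjI allI)
    show "(\<lambda>x. blowup_fun (r k) u x $ i) \<in> W12 (ball 0 R)" for k
      using W12_subset[OF W12_scale[OF B.u_W12[of i] r_pos[of k]], of "ball 0 R"] by (simp add: blowup_fun_def)
    show "(\<lambda>x. u_inf x $ i) \<in> W12 (ball 0 R)" by (rule B.u_inf_W12)
    have eq: "B.uk k i x = blowup_fun (r (k + k1)) u x $ i" for k x unfolding B.uk_def by (simp add: blowup_fun_def r'_def)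
    have "(\<lambda>k. W12_norm_sq (ball 0 R) (\<lambda>x. blowup_fun (r (k + k1)) u x $ i - u_inf x $ i)) \<longlonglongrightarrow> 0"
      using B.blowup_tendsto_W12[of i] by (simp add: tendsto_W12_def eq)
    then show "(\<lambda>k. W12_norm_sq (ball 0 R) (\<lambda>x. blowup_fun (r k) u x $ i - u_inf x $ i)) \<longlonglongrightarrow> 0"
      by (rule LIMSEQ_offset)
  qed
  then show ?thesis using B.u_inf_F_class B.limit_local_minimizer by blast
qed

end
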